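(* Let $(S,d,\mu)$ be a space of homogeneous type and let $X$ and $Y$ be Banach spaces. Let $p_0\in[1,\infty)$ and suppose $T$ is a bounded linear operator from $L^{p_0}(S;X)$ to $L^{p_0,\infty}(S;Y)$ with Dini kernel $K$. Set $$C_T:=\|T\|_{L^{p_0}(S;X)\to L^{p_0,\infty}(S;Y)}+\|K\|_{\mathrm{Dini}}.$$ Then there is an $\eta\in(0,1)$ such that for every boundedly supported $f\in L^1(S;X)$ there exists an $\eta$-sparse collection of cubes $\mathcal{S}$ with $$\|Tf(s)\|_Y\leq C\,C_T\sum_{Q\in\mathcal{S}}\bigl\langle\|f\|_X\bigr\rangle_{1,Q}\,\mathbf{1}_Q(s),\qquad s\in S,$$ where $C>0$ depends only on $S$ and $p_0$. Moreover, for all $p\in(1,\infty)$ and $w\in A_p$, $$\|T\|_{L^p(S,w;X)\to L^p(S,w;Y)}\leq C'\,C_T\,[w]_{A_p}^{\max\{\frac{1}{p-1},1\}},$$ where $C'>0$ depends only on $S$, $p$ and $p_0$.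
   Context: Space of homogeneous type: a set $S$ with a quasi-metric $d$ (a metric except that the triangle inequality is replaced by $d(s,t)\leq c_d(d(s,u)+d(u,t))$ for some $c_d\geq1$) and a Borel measure $\mu$ with $\mu(B(s,2\rho))\leq c_\mu\,\mu(B(s,\rho))$ for all $s\in S$, $\rho>0$ and some $c_\mu\ge 1$, where $B(s,\rho)=\{t\in S:d(s,t)<\rho\}$. All balls are assumed to be Borel sets with $0<\mu(B)<\infty$. "Depending on $S$" means depending on $c_d$ and $c_\mu$. Dini kernel: a map $K:(S\times S)\setminus\{(s,s):s\in S\}\to\mathcal{L}(X,Y)$, strongly measurable in the strong operator topology, for which there is $c_K\geq2$ such that $$\|K(s,t)-K(s,t')\|\leq\omega\Bigl(\frac{d(t,t')}{d(s,t)}\Bigr)\frac{1}{\mu(B(s,d(s,t)))},\quad 0<d(t,t')\leq\tfrac{1}{c_K}d(s,t),$$ $$\|K(s,t)-K(s',t)\|\leq\omega\Bigl(\frac{d(s,s')}{d(s,t)}\Bigr)\frac{1}{\mu(B(s,d(s,t)))},\quad 0<d(s,s')\leq\tfrac{1}{c_K}d(s,t),$$ where $\omega:[0,1]\to[0,\infty)$ is increasing, subadditive, $\omega(0)=0$ and $\|K\|_{\mathrm{Dini}}:=\int_0^1\omega(t)\frac{dt}{t}<\infty$. A bounded linear operator $T:L^{p_0}(S;X)\to L^{p_0,\infty}(S;Y)$ has Dini kernel $K$ if for every boundedly supported $f\in L^{p_0}(S;X)$ and a.e. $s\in S\setminus\overline{\operatorname{supp}f}$ one has $Tf(s)=\int_SK(s,t)f(t)\,d\mu(t)$.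 Such a $T$ extends (from $L^1\cap L^{p_0}$) to a bounded operator from $L^1(S;X)$ to $L^{1,\infty}(S;Y)$, by the classical Calderón–Zygmund argument, and $Tf$ for $f\in L^1(S;X)$ refers to this extension. Dyadic system with parameters $0<c_0\leq C_0<\infty$, $\delta\in(0,1)$: $\mathscr{D}=\bigcup_{k\in\mathbb{Z}}\mathscr{D}_k$, where each $\mathscr{D}_k=\{Q_j^k\}_{j\in J_k}$ is a pairwise disjoint collection of measurable sets, with points $\{z_j^k\}_{j\in J_k}$, such that (i) $S=\bigcup_{j\in J_k}Q_j^k$ for all $k$; (ii) for $k\geq l$, $Q\in\mathscr{D}_k$, $Q'\in\mathscr{D}_l$ either $Q\cap Q'=\varnothing$ or $Q\subseteq Q'$; (iii) $B(z_j^k,c_0\delta^k)\subseteq Q_j^k\subseteq B(z_j^k,C_0\delta^k)$. It is known that there are $0<c_0\leq C_0<\infty$, $\gamma\geq1$, $\delta\in(0,1)$, $m\in\mathbb{N}$ (depending only on $S$) and dyadic systems $\mathscr{D}^1,\ldots,\mathscr{D}^m$ with parameters $c_0,C_0,\delta$ such that every ball $B(s,\rho)$ is contained in some $Q\in\bigcup_j\mathscr{D}^j$ with $\operatorname{diam}(Q)\leq\gamma\rho$. Such a choice is fixed, and "cube" means an element of $\bigcup_j\mathscr{D}^j$. A collection of cubes $\mathcal{S}$ is $\eta$-sparse if for every $Q\in\mathcal{S}$ there is a measurable $E_Q\subseteq Q$ with $\mu(E_Q)\geq\eta\mu(Q)$, the $E_Q$ being pairwise disjoint. $\langle g\rangle_{1,Q}:=\frac{1}{\mu(Q)}\int_Qg\,d\mu$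 for $g\geq0$. A weight is a locally integrable $w:S\to(0,\infty)$; $\|f\|_{L^p(S,w;X)}=(\int_S\|f\|_X^pw\,d\mu)^{1/p}$; $w\in A_p$ iff $[w]_{A_p}:=\sup_B\bigl(\frac1{\mu(B)}\int_Bw\,d\mu\bigr)\bigl(\frac1{\mu(B)}\int_Bw^{-1/(p-1)}d\mu\bigr)^{p-1}<\infty$ (supremum over balls). Weak norms: $\|g\|_{L^{p,\infty}}=\sup_{\lambda>0}\lambda\,\mu(\{\|g\|_Y>\lambda\})^{1/p}$. Pointwise inequalities hold a.e.; the weighted operator norm is tested on boundedly supported $f\in L^p(S,w;X)$ (which lie in $L^1(S;X)$) and $T$ is extended by density.
   Formalization: C and C' may also depend on the constant c_K of the Dini condition (with c_K unrestricted the claim is false); formally they are obtained for each choice of X, Y and ambient set of S, and uniformity in these follows by passing to direct sums and disjoint unions. *)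

theory Defs
  imports "HOL-Analysis.Analysis"
begin

section \<open>Spaces of homogeneous type\<close>

text \<open>The underlying set is \<open>S = space M\<close>; the quasi-metric is only constrained there.\<close>

definition qball :: "'a measure \<Rightarrow> ('a \<Rightarrow> 'a \<Rightarrow> real) \<Rightarrow> 'a \<Rightarrow> real \<Rightarrow> 'a set" where
  "qball M d s \<rho> = {t \<in> space M. d s t < \<rho>}"

definition qtopology :: "'a measure \<Rightarrow> ('a \<Rightarrow> 'a \<Rightarrow> real) \<Rightarrow> 'a topology" where
  "qtopology M d = topology (\<lambda>U. U \<subseteq> space M \<and> (\<forall>s\<in>U. \<exists>\<rho>>0. qball M d s \<rho> \<subseteq> U))"

lemma openin_qtopology:
  "openin (qtopology M d) U \<longleftrightarrow> U \<subseteq> space M \<and> (\<forall>s\<in>U. \<exists>\<rho>>0. qball M d s \<rho> \<subseteq> U)"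
proof -
  have "istopology (\<lambda>U. U \<subseteq> space M \<and> (\<forall>s\<in>U. \<exists>\<rho>>0. qball M d s \<rho> \<subseteq> U))"
    unfolding istopology_def
  proof (intro conjI allI impI)
    fix A B
    assume A: "A \<subseteq> space M \<and> (\<forall>s\<in>A. \<exists>\<rho>>0. qball M d s \<rho> \<subseteq> A)"
      and B: "B \<subseteq> space M \<and> (\<forall>s\<in>B. \<exists>\<rho>>0. qball M d s \<rho> \<subseteq> B)"
    show "A \<inter> B \<subseteq> space M" using A by blast
    show "\<forall>s\<in>A \<inter> B. \<exists>\<rho>>0. qball M d s \<rho> \<subseteq> A \<inter> B"
    proof
      fix s assume "s \<in> A \<inter> B"
      then obtain r r' where "r > 0" "r' > 0" "qball M d s r \<subseteq> A" "qball M d s r' \<subseteq> B"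
        using A B by blast
      then show "\<exists>\<rho>>0. qball M d s \<rho> \<subseteq> A \<inter> B"
        by (intro exI[of _ "min r r'"]) (auto simp: qball_def)
    qed
  next
    fix \<K>
    assume K: "\<forall>U\<in>\<K>. U \<subseteq> space M \<and> (\<forall>s\<in>U. \<exists>\<rho>>0. qball M d s \<rho> \<subseteq> U)"
    show "\<Union>\<K> \<subseteq> space M" using K by blast
    show "\<forall>s\<in>\<Union>\<K>. \<exists>\<rho>>0. qball M d s \<rho> \<subseteq> \<Union>\<K>"
      using K by (meson Union_iff Union_upper subset_trans)
  qed
  then show ?thesis by (simp add: qtopology_def)
qed

locale homogeneous_type =
  fixes M :: "'a measure" and d :: "'a \<Rightarrow> 'a \<Rightarrow> real" and c_d c_mu :: real
  assumes c_d: "c_d \<ge> 1" and c_mu: "c_mu \<ge> 1"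
    and nonneg: "\<And>s t. s \<in> space M \<Longrightarrow> t \<in> space M \<Longrightarrow> d s t \<ge> 0"
    and zero_iff: "\<And>s t. s \<in> space M \<Longrightarrow> t \<in> space M \<Longrightarrow> d s t = 0 \<longleftrightarrow> s = t"
    and sym: "\<And>s t. s \<in> space M \<Longrightarrow> t \<in> space M \<Longrightarrow> d s t = d t s"
    and quasi_triangle: "\<And>s t u. s \<in> space M \<Longrightarrow> t \<in> space M \<Longrightarrow> u \<in> space M \<Longrightarrow>
          d s t \<le> c_d * (d s u + d u t)"
    and borel: "sets M = sigma_sets (space M) {U. openin (qtopology M d) U}"
    and ball_measurable: "\<And>s \<rho>. s \<in> space M \<Longrightarrow> \<rho> > 0 \<Longrightarrow> qball M d s \<rho> \<in> sets M"
    and ball_pos: "\<And>s \<rho>. s \<in> space M \<Longrightarrow> \<rho> > 0 \<Longrightarrow> emeasure M (qball M d s \<rho>) > 0"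
    and ball_finite: "\<And>s \<rho>. s \<in> space M \<Longrightarrow> \<rho> > 0 \<Longrightarrow> emeasure M (qball M d s \<rho>) < \<infinity>"
    and doubling: "\<And>s \<rho>. s \<in> space M \<Longrightarrow> \<rho> > 0 \<Longrightarrow>
          emeasure M (qball M d s (2 * \<rho>)) \<le> ennreal c_mu * emeasure M (qball M d s \<rho>)"

section \<open>Vector-valued functions\<close>

text \<open>The library's Bochner integral is restricted to second countable target spaces.  The next
  two definitions are the same notions for arbitrary (possibly non-separable) Banach spaces:
  Borel measurability is replaced by strong measurability, which is equivalent to it in the
  second countable case.\<close>

definition strongly_measurable :: "'a measure \<Rightarrow> ('a \<Rightarrow> 'b::metric_space) \<Rightarrow> bool" where
  "strongly_measurable M f \<longleftrightarrow>
     (\<exists>F. (\<forall>n. simple_function M (F n)) \<and> (\<forall>x\<in>space M. (\<lambda>n. F n x) \<longlonglongrightarrow> f x))"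

definition has_strong_bochner_integral ::
    "'a measure \<Rightarrow> ('a \<Rightarrow> 'b::real_normed_vector) \<Rightarrow> 'b \<Rightarrow> bool" where
  "has_strong_bochner_integral M f I \<longleftrightarrow> strongly_measurable M f \<and>
     (\<exists>F. (\<forall>n. Bochner_Integration.simple_bochner_integrable M (F n)) \<and>
        (\<lambda>n. \<integral>\<^sup>+x. ennreal (norm (f x - F n x)) \<partial>M) \<longlonglongrightarrow> 0 \<and>
        (\<lambda>n. Bochner_Integration.simple_bochner_integral M (F n)) \<longlonglongrightarrow> I)"

text \<open>Real powers on the extended half-line; only used for exponents \<open>a > 0\<close>.\<close>

definition enn_powr :: "ennreal \<Rightarrow> real \<Rightarrow> ennreal" where
  "enn_powr x a = (if x = \<infinity> then \<infinity> else ennreal (enn2real x powr a))"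

definition Lp_norm :: "'a measure \<Rightarrow> real \<Rightarrow> ('a \<Rightarrow> 'b::real_normed_vector) \<Rightarrow> ennreal" where
  "Lp_norm M p f = enn_powr (\<integral>\<^sup>+x. ennreal (norm (f x) powr p) \<partial>M) (1 / p)"

definition weak_Lp_norm :: "'a measure \<Rightarrow> real \<Rightarrow> ('a \<Rightarrow> 'b::real_normed_vector) \<Rightarrow> ennreal" where
  "weak_Lp_norm M p g =
     (SUP l\<in>{0<..}. ennreal l * enn_powr (emeasure M {x \<in> space M. norm (g x) > l}) (1 / p))"

text \<open>Functions instead of almost-everywhere classes.\<close>

definition Lp_space :: "'a measure \<Rightarrow> real \<Rightarrow> ('a \<Rightarrow> 'b::real_normed_vector) set" where
  "Lp_space M p = {f. strongly_measurable M f \<and> Lp_norm M p f < \<infinity>}"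

definition boundedly_supported ::
    "'a measure \<Rightarrow> ('a \<Rightarrow> 'a \<Rightarrow> real) \<Rightarrow> ('a \<Rightarrow> 'b::zero) \<Rightarrow> bool" where
  "boundedly_supported M d f \<longleftrightarrow>
     (\<exists>s\<in>space M. \<exists>\<rho>>0. {t \<in> space M. f t \<noteq> 0} \<subseteq> qball M d s \<rho>)"

section \<open>Operators\<close>

text \<open>Linearity holds almost everywhere.  Together with the bound it implies that \<open>T\<close> respects
  equality almost everywhere: if \<open>f = g\<close> a.e. then \<open>T (f - g)\<close> has norm zero.\<close>

definition bounded_linear_operator ::
    "'a measure \<Rightarrow> ('a \<Rightarrow> 'b::real_normed_vector) set \<Rightarrow> (('a \<Rightarrow> 'b) \<Rightarrow> ennreal) \<Rightarrow>
     (('a \<Rightarrow> 'c::real_normed_vector) \<Rightarrow> ennreal) \<Rightarrow> (('a \<Rightarrow> 'b) \<Rightarrow> ('a \<Rightarrow> 'c)) \<Rightarrow> bool" where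
  "bounded_linear_operator M V N N' T \<longleftrightarrow>
     (\<forall>f\<in>V. strongly_measurable M (T f)) \<and>
     (\<forall>f\<in>V. \<forall>g\<in>V. AE s in M. T (\<lambda>x. f x + g x) s = T f s + T g s) \<and>
     (\<forall>c. \<forall>f\<in>V. AE s in M. T (\<lambda>x. c *\<^sub>R f x) s = c *\<^sub>R T f s) \<and>
     (\<exists>B. \<forall>f\<in>V. N' (T f) \<le> ennreal B * N f)"

definition op_norm ::
    "'f set \<Rightarrow> ('f \<Rightarrow> ennreal) \<Rightarrow> ('g \<Rightarrow> ennreal) \<Rightarrow> ('f \<Rightarrow> 'g) \<Rightarrow> ennreal" where
  "op_norm V N N' T = (SUP f\<in>{f \<in> V. N f \<le> 1}. N' (T f))"

definition dini_norm :: "(real \<Rightarrow> real) \<Rightarrow> ennreal" where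
  "dini_norm \<omega> = (\<integral>\<^sup>+t\<in>{0<..1}. ennreal (\<omega> t / t) \<partial>lborel)"

text \<open>The values of \<open>K\<close> on the diagonal are irrelevant.  Strong measurability is taken off the
  diagonal, with respect to the product sigma-algebra.\<close>

locale dini_kernel =
  fixes M :: "'a measure" and d :: "'a \<Rightarrow> 'a \<Rightarrow> real"
    and K :: "'a \<Rightarrow> 'a \<Rightarrow> 'b::banach \<Rightarrow>\<^sub>L 'c::banach" and \<omega> :: "real \<Rightarrow> real" and c_K :: real
  assumes c_K: "c_K \<ge> 2"
    and kernel_measurable: "\<And>x. strongly_measurable
          (restrict_space (M \<Otimes>\<^sub>M M) {z. fst z \<noteq> snd z}) (\<lambda>(s, t). blinfun_apply (K s t) x)"
    and omega_nonneg: "\<And>u. u \<in> {0..1} \<Longrightarrow> \<omega> u \<ge> 0"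
    and omega_mono: "mono_on {0..1} \<omega>"
    and omega_subadditive:
          "\<And>u v. u \<ge> 0 \<Longrightarrow> v \<ge> 0 \<Longrightarrow> u + v \<le> 1 \<Longrightarrow> \<omega> (u + v) \<le> \<omega> u + \<omega> v"
    and omega_zero: "\<omega> 0 = 0"
    and dini_finite: "dini_norm \<omega> < \<infinity>"
    and smooth_right: "\<And>s t t'. s \<in> space M \<Longrightarrow> t \<in> space M \<Longrightarrow> t' \<in> space M \<Longrightarrow>
          0 < d t t' \<Longrightarrow> d t t' \<le> 1 / c_K * d s t \<Longrightarrow>
          norm (K s t - K s t') \<le> \<omega> (d t t' / d s t) * (1 / measure M (qball M d s (d s t)))"
    and smooth_left: "\<And>s s' t. s \<in> space M \<Longrightarrow> s' \<in> space M \<Longrightarrow> t \<in> space M \<Longrightarrow>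
          0 < d s s' \<Longrightarrow> d s s' \<le> 1 / c_K * d s t \<Longrightarrow>
          norm (K s t - K s' t) \<le> \<omega> (d s s' / d s t) * (1 / measure M (qball M d s (d s t)))"

definition has_kernel ::
    "'a measure \<Rightarrow> ('a \<Rightarrow> 'a \<Rightarrow> real) \<Rightarrow> real \<Rightarrow> (('a \<Rightarrow> 'b::banach) \<Rightarrow> ('a \<Rightarrow> 'c::banach)) \<Rightarrow>
     ('a \<Rightarrow> 'a \<Rightarrow> 'b \<Rightarrow>\<^sub>L 'c) \<Rightarrow> bool" where
  "has_kernel M d p0 T K \<longleftrightarrow>
     (\<forall>f\<in>Lp_space M p0. boundedly_supported M d f \<longrightarrow>
        (AE s in M. s \<notin> qtopology M d closure_of {t \<in> space M. f t \<noteq> 0} \<longrightarrow>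
           has_strong_bochner_integral M (\<lambda>t. blinfun_apply (K s t) (f t)) (T f s)))"

definition dini_operator ::
    "'a measure \<Rightarrow> ('a \<Rightarrow> 'a \<Rightarrow> real) \<Rightarrow> real \<Rightarrow> (('a \<Rightarrow> 'b::banach) \<Rightarrow> ('a \<Rightarrow> 'c::banach)) \<Rightarrow>
     ('a \<Rightarrow> 'a \<Rightarrow> 'b \<Rightarrow>\<^sub>L 'c) \<Rightarrow> (real \<Rightarrow> real) \<Rightarrow> real \<Rightarrow> bool" where
  "dini_operator M d p0 T K \<omega> c_K \<longleftrightarrow>
     bounded_linear_operator M (Lp_space M p0) (Lp_norm M p0) (weak_Lp_norm M p0) T \<and>
     dini_kernel M d K \<omega> c_K \<and> has_kernel M d p0 T K"

definition C_T ::
    "'a measure \<Rightarrow> real \<Rightarrow> (('a \<Rightarrow> 'b::banach) \<Rightarrow> ('a \<Rightarrow> 'c::banach)) \<Rightarrow> (real \<Rightarrow> real) \<Rightarrow> ennreal" where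
  "C_T M p0 T \<omega> =
     op_norm (Lp_space M p0) (Lp_norm M p0) (weak_Lp_norm M p0) T + dini_norm \<omega>"

text \<open>Unique up to equality almost everywhere, since \<open>L\<^sup>1 \<inter> L\<^bsup>p0\<^esup>\<close> is dense in \<open>L\<^sup>1\<close>.\<close>

definition is_L1_extension ::
    "'a measure \<Rightarrow> real \<Rightarrow> (('a \<Rightarrow> 'b::banach) \<Rightarrow> ('a \<Rightarrow> 'c::banach)) \<Rightarrow>
     (('a \<Rightarrow> 'b) \<Rightarrow> ('a \<Rightarrow> 'c)) \<Rightarrow> bool" where
  "is_L1_extension M p0 T T1 \<longleftrightarrow>
     bounded_linear_operator M (Lp_space M 1) (Lp_norm M 1) (weak_Lp_norm M 1) T1 \<and>
     (\<forall>f \<in> Lp_space M 1 \<inter> Lp_space M p0. AE s in M. T1 f s = T f s)"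

section \<open>Dyadic cubes and sparse collections\<close>

text \<open>Cubes of one generation are non-empty and pairwise disjoint, so the index sets \<open>J\<^sub>k\<close> can be
  taken to be the generations \<open>D k\<close> themselves.\<close>

definition dyadic_system ::
    "'a measure \<Rightarrow> ('a \<Rightarrow> 'a \<Rightarrow> real) \<Rightarrow> real \<Rightarrow> real \<Rightarrow> real \<Rightarrow> (int \<Rightarrow> 'a set set) \<Rightarrow> bool" where
  "dyadic_system M d c0 C0 \<delta> D \<longleftrightarrow>
     (\<forall>k. D k \<subseteq> sets M \<and> disjoint (D k) \<and> \<Union>(D k) = space M) \<and>
     (\<forall>k l. k \<ge> l \<longrightarrow> (\<forall>Q\<in>D k. \<forall>Q'\<in>D l. Q \<inter> Q' = {} \<or> Q \<subseteq> Q')) \<and>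
     (\<forall>k. \<forall>Q\<in>D k. \<exists>z\<in>space M.
        qball M d z (c0 * \<delta> powi k) \<subseteq> Q \<and> Q \<subseteq> qball M d z (C0 * \<delta> powi k))"

definition cubes :: "nat \<Rightarrow> (nat \<Rightarrow> int \<Rightarrow> 'a set set) \<Rightarrow> 'a set set" where
  "cubes m D = (\<Union>i<m. \<Union>k. D i k)"

definition adjacent_dyadic_systems ::
    "'a measure \<Rightarrow> ('a \<Rightarrow> 'a \<Rightarrow> real) \<Rightarrow> real \<Rightarrow> real \<Rightarrow> real \<Rightarrow> real \<Rightarrow> nat \<Rightarrow>
     (nat \<Rightarrow> int \<Rightarrow> 'a set set) \<Rightarrow> bool" where
  "adjacent_dyadic_systems M d c0 C0 \<gamma> \<delta> m D \<longleftrightarrow>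
     0 < c0 \<and> c0 \<le> C0 \<and> \<gamma> \<ge> 1 \<and> 0 < \<delta> \<and> \<delta> < 1 \<and>
     (\<forall>i<m. dyadic_system M d c0 C0 \<delta> (D i)) \<and>
     (\<forall>s\<in>space M. \<forall>\<rho>>0. \<exists>Q\<in>cubes m D.
        qball M d s \<rho> \<subseteq> Q \<and> (\<forall>x\<in>Q. \<forall>y\<in>Q. d x y \<le> \<gamma> * \<rho>))"

definition is_sparse :: "'a measure \<Rightarrow> real \<Rightarrow> 'a set set \<Rightarrow> bool" where
  "is_sparse M \<eta> \<S> \<longleftrightarrow>
     (\<exists>E. (\<forall>Q\<in>\<S>. E Q \<in> sets M \<and> E Q \<subseteq> Q \<and> emeasure M (E Q) \<ge> ennreal \<eta> * emeasure M Q) \<and>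
          disjoint_family_on E \<S>)"

definition average :: "'a measure \<Rightarrow> ('a \<Rightarrow> ennreal) \<Rightarrow> 'a set \<Rightarrow> ennreal" where
  "average M g Q = (\<integral>\<^sup>+x\<in>Q. g x \<partial>M) / emeasure M Q"

definition sparse_operator ::
    "'a measure \<Rightarrow> 'a set set \<Rightarrow> ('a \<Rightarrow> 'b::real_normed_vector) \<Rightarrow> 'a \<Rightarrow> ennreal" where
  "sparse_operator M \<S> f s =
     (\<Sum>\<^sub>\<infinity>Q\<in>\<S>. average M (\<lambda>x. ennreal (norm (f x))) Q * indicator Q s)"

section \<open>Weights\<close>

text \<open>Local integrability means integrability on every ball.\<close>

definition is_weight :: "'a measure \<Rightarrow> ('a \<Rightarrow> 'a \<Rightarrow> real) \<Rightarrow> ('a \<Rightarrow> real) \<Rightarrow> bool" where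
  "is_weight M d w \<longleftrightarrow> w \<in> borel_measurable M \<and> (\<forall>s\<in>space M. w s > 0) \<and>
     (\<forall>s\<in>space M. \<forall>\<rho>>0. (\<integral>\<^sup>+x\<in>qball M d s \<rho>. ennreal (w x) \<partial>M) < \<infinity>)"

definition Ap_constant ::
    "'a measure \<Rightarrow> ('a \<Rightarrow> 'a \<Rightarrow> real) \<Rightarrow> real \<Rightarrow> ('a \<Rightarrow> real) \<Rightarrow> ennreal" where
  "Ap_constant M d p w =
     (SUP (s, \<rho>)\<in>space M \<times> {0<..}.
        average M (\<lambda>x. ennreal (w x)) (qball M d s \<rho>) *
        enn_powr (average M (\<lambda>x. ennreal (w x powr (- 1 / (p - 1)))) (qball M d s \<rho>)) (p - 1))"

definition Ap_weight :: "'a measure \<Rightarrow> ('a \<Rightarrow> 'a \<Rightarrow> real) \<Rightarrow> real \<Rightarrow> ('a \<Rightarrow> real) \<Rightarrow> bool" where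
  "Ap_weight M d p w \<longleftrightarrow> is_weight M d w \<and> Ap_constant M d p w < \<infinity>"

definition weighted_measure :: "'a measure \<Rightarrow> ('a \<Rightarrow> real) \<Rightarrow> 'a measure" where
  "weighted_measure M w = density M (\<lambda>x. ennreal (w x))"

text \<open>The norm is tested on boundedly supported functions.  These are dense in
  \<open>L\<^sup>p(S, w; X)\<close>, so it is the norm of the extension by density.\<close>

definition weighted_op_norm ::
    "'a measure \<Rightarrow> ('a \<Rightarrow> 'a \<Rightarrow> real) \<Rightarrow> ('a \<Rightarrow> real) \<Rightarrow> real \<Rightarrow>
     (('a \<Rightarrow> 'b::banach) \<Rightarrow> ('a \<Rightarrow> 'c::banach)) \<Rightarrow> ennreal" where
  "weighted_op_norm M d w p T =
     op_norm {f \<in> Lp_space (weighted_measure M w) p. boundedly_supported M d f}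
       (Lp_norm (weighted_measure M w) p) (Lp_norm (weighted_measure M w) p) T"

end

theory Submission imports Defs begin

text \<open>Calderon-Zygmund decomposition gives the weak type (1,1) of \<open>T\<close>, hence the extension to
 \<open>L\<^sup>1\<close>.  Sparse domination comes from a stopping argument that runs over Whitney balls of decreasing open
 sets instead of dyadic cubes.  In a ball, the points where \<open>T f\<close> or the maximal function of \<open>f\<close> is large
 compared with the average of \<open>f\<close> form a small set; it is thickened to an open set, and on each Whitney ball
 of that set one continues with \<open>f\<close> truncated to the ball.  The Dini condition bounds the oscillation of \<open>T\<close>
 applied to the part cut off, so consecutive truncations differ by a multiple of an average.  The balls carry
 disjoint sets of comparable measure and can be enlarged to cubes.

 For the weighted bound let \<open>D\<close> be a sparse sum over balls and \<open>X\<close> the integral of \<open>D\<^sup>p w\<close>.  The balls are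
 enlarged to boundedly many laminar families, for which the maximal functions with respect to \<open>w\<close> and to the
 dual weight are bounded with constants independent of \<open>w\<close>.  Moen's testing estimate and Hoelder's
 inequality then bound \<open>X\<close> by its own power \<open>X\<^bsup>1-1/p\<^esup>\<close> times the right constant.\<close>

section \<open>Strongly measurable functions\<close>

text \<open>Two truncations of \<open>f\<close> can be compared on a small ball only through a point
  where both are under control. This is why the exceptional set is thickened: a Whitney ball of the
  new set lies close to a point left outside, around which the old exceptional sets have density at
  most \<tau>, so the ball keeps points that are good for its parent. The constants must be fixed in
  the order a, \<tau>, \<epsilon>, A: the ratio of radii by the geometry and \<open>c_K\<close>, the
  density by a, the size of the exceptional sets by \<tau> and a, the stopping height by \<epsilon>.
  The kernel formula is available only for \<open>T\<close> itself, so the oscillation bound is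
  proved for simple functions of bounded support and passed to the extension by a pointwise limit.
  In the weighted bound a weight must not contribute a doubling constant of its own, which would
  spoil the power of the \<open>A_p\<close> constant; nested or disjoint sets have maximal functions
  bounded for every measure. Finite partial sums are treated first, since a power of X is cancelled
  and X has to be finite.\<close>

abbreviation enorm :: "'b::real_normed_vector \<Rightarrow> ennreal" where
 "enorm x \<equiv> ennreal (norm x)"

abbreviation L1_mass :: "'a measure \<Rightarrow> ('a \<Rightarrow> 'b::real_normed_vector) \<Rightarrow> ennreal" where
 "L1_mass M f \<equiv> \<integral>\<^sup>+x. enorm (f x) \<partial>M"

abbreviation L1_dist :: "'a measure \<Rightarrow> ('a \<Rightarrow> 'b::real_normed_vector) \<Rightarrow> ('a \<Rightarrow> 'b) \<Rightarrow> ennreal" where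
 "L1_dist M f g \<equiv> \<integral>\<^sup>+x. enorm (f x - g x) \<partial>M"

abbreviation superlevel :: "'a measure \<Rightarrow> ('a \<Rightarrow> 'b::real_normed_vector) \<Rightarrow> real \<Rightarrow> 'a set" where
 "superlevel M g l \<equiv> {s \<in> space M. norm (g s) > l}"

abbreviation "sintegrable \<equiv> Bochner_Integration.simple_bochner_integrable"

abbreviation "sintegral \<equiv> Bochner_Integration.simple_bochner_integral"

lemma strongly_measurable_borel:
 "strongly_measurable M f \<Longrightarrow> f \<in> borel_measurable M"
 unfolding strongly_measurable_def
 by (metis borel_measurable_LIMSEQ_metric borel_measurable_simple_function)

lemma strongly_measurable_norm:
 fixes f :: "'a \<Rightarrow> 'b::real_normed_vector"
 assumes "strongly_measurable M f"
 shows "(\<lambda>x. norm (f x)) \<in> borel_measurable M"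
 using strongly_measurable_borel[OF assms] by measurable

lemma strongly_measurable_norm_le:
 fixes f :: "'a \<Rightarrow> 'b::real_normed_vector"
 assumes "strongly_measurable M f"
 shows "superlevel M f l \<in> sets M"
 using strongly_measurable_norm[OF assms] by measurable

lemma strongly_measurable_simple: "simple_function M f \<Longrightarrow> strongly_measurable M f"
 unfolding strongly_measurable_def by (intro exI[of _ "\<lambda>n. f"]) auto

lemma strongly_measurable_compose2:
 assumes "strongly_measurable M f" "strongly_measurable M g"
  and "\<And>F G l m. F \<longlonglongrightarrow> l \<Longrightarrow> G \<longlonglongrightarrow> m \<Longrightarrow> (\<lambda>n. h (F n) (G n)) \<longlonglongrightarrow> h l m"
 shows "strongly_measurable M (\<lambda>x. h (f x) (g x))"
proof -
 obtain F G where "\<forall>n. simple_function M (F n)" "\<forall>x\<in>space M. (\<lambda>n. F n x) \<longlonglongrightarrow> f x"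
  "\<forall>n. simple_function M (G n)" "\<forall>x\<in>space M. (\<lambda>n. G n x) \<longlonglongrightarrow> g x"
  using assms(1,2) unfolding strongly_measurable_def by blast
 then show ?thesis
  unfolding strongly_measurable_def
  by (intro exI[of _ "\<lambda>n x. h (F n x) (G n x)"]) (auto intro: simple_function_compose2 assms(3))
qed

lemma strongly_measurable_add:
 fixes f :: "'a \<Rightarrow> 'b::real_normed_vector"
 assumes "strongly_measurable M f" "strongly_measurable M g"
 shows "strongly_measurable M (\<lambda>x. f x + g x)"
 by (rule strongly_measurable_compose2[OF assms]) (rule tendsto_add)

lemma strongly_measurable_diff:
 fixes f :: "'a \<Rightarrow> 'b::real_normed_vector"
 assumes "strongly_measurable M f" "strongly_measurable M g"
 shows "strongly_measurable M (\<lambda>x. f x - g x)"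
 by (rule strongly_measurable_compose2[OF assms]) (rule tendsto_diff)

lemma strongly_measurable_scaleR:
 fixes f :: "'a \<Rightarrow> 'b::real_normed_vector"
 assumes "strongly_measurable M f"
 shows "strongly_measurable M (\<lambda>x. c *\<^sub>R f x)"
 by (rule strongly_measurable_compose2[OF assms assms]) (rule tendsto_scaleR[OF tendsto_const])

definition cut :: "'a set \<Rightarrow> ('a \<Rightarrow> 'b::real_vector) \<Rightarrow> 'a \<Rightarrow> 'b" where
 "cut A f x = (if x \<in> A then f x else 0)"

lemma simple_function_cut:
 "simple_function M f \<Longrightarrow> A \<in> sets M \<Longrightarrow> simple_function M (cut A f)"
 unfolding cut_def[abs_def] by (rule simple_function_If_set) auto

lemma strongly_measurable_cut:
 fixes f :: "'a \<Rightarrow> 'b::real_normed_vector"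
 assumes "strongly_measurable M f" "A \<in> sets M"
 shows "strongly_measurable M (cut A f)"
proof -
 obtain F where F: "\<forall>n. simple_function M (F n)" "\<forall>x\<in>space M. (\<lambda>n. F n x) \<longlonglongrightarrow> f x"
  using assms(1) unfolding strongly_measurable_def by blast
 then show ?thesis
  unfolding strongly_measurable_def
  by (intro exI[of _ "\<lambda>n. cut A (F n)"]) (auto simp: simple_function_cut assms(2) cut_def)
qed

text \<open>A diagonal choice among simple approximants of the \<open>F n\<close> has no rate that
  is uniform in the point. But all their values form a countable set whose closure contains the
  range of \<open>f\<close>; picking the nearest among the first points of this set gives simple
  functions.\<close>

lemma strongly_measurable_LIMSEQ:
 fixes f :: "'a \<Rightarrow> 'b::metric_space"
 assumes F: "\<And>n. strongly_measurable M (F n)"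
  and lim: "\<And>x. x \<in> space M \<Longrightarrow> (\<lambda>n. F n x) \<longlonglongrightarrow> f x"
 shows "strongly_measurable M f"
proof (cases "space M = {}")
 case True
 then show ?thesis
  unfolding strongly_measurable_def by (intro exI[of _ "\<lambda>n. f"]) (auto simp: simple_function_def)
next
 case False
 have fb[measurable]: "f \<in> borel_measurable M"
  using borel_measurable_LIMSEQ_metric[OF strongly_measurable_borel[OF F] lim] by blast
 obtain S where S: "\<And>n k. simple_function M (S n k)"
  "\<And>n x. x \<in> space M \<Longrightarrow> (\<lambda>k. S n k x) \<longlonglongrightarrow> F n x"
  using F unfolding strongly_measurable_def by metis
 define C where "C = (\<Union>n k. S n k ` space M)"
 have "countable (S n k ` space M)" for n k
  using S(1)[of n k] by (intro countable_finite) (auto simp: simple_function_def)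
 then have C: "countable C" "C \<noteq> {}"
  unfolding C_def using False by auto
 define e where "e = from_nat_into C"
 have dense: "\<exists>i. dist (f x) (e i) < r" if x: "x \<in> space M" and r: "r > 0" for x r
 proof -
  obtain n where n: "dist (F n x) (f x) < r/2"
   using lim[OF x] r unfolding lim_sequentially by (metis half_gt_zero order_refl)
  obtain k where k: "dist (S n k x) (F n x) < r/2"
   using S(2)[OF x, of n] r unfolding lim_sequentially by (metis half_gt_zero order_refl)
  have "S n k x \<in> C" using x by (auto simp: C_def)
  then obtain i where "e i = S n k x"
   unfolding e_def using C by (metis from_nat_into_surj)
  moreover have "dist (f x) (S n k x) < r"
   using n k dist_triangle_half_r[of "F n x" "f x" r "S n k x"]
   by (simp add: dist_commute)
  ultimately show ?thesis by metis
 qed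
 \<comment> \<open>\<open>G n x\<close> is a point of e 0, ..., e n nearest to \<open>f x\<close>; a
   tie keeps the earlier one.\<close>
 define G where "G = rec_nat (\<lambda>x. e 0)
   (\<lambda>n g x. if dist (f x) (e (Suc n)) < dist (f x) (g x) then e (Suc n) else g x)"
 have G0: "G 0 = (\<lambda>x. e 0)" and GS: "G (Suc n) =
   (\<lambda>x. if dist (f x) (e (Suc n)) < dist (f x) (G n x) then e (Suc n) else G n x)" for n
  unfolding G_def by simp_all
 have de: "(\<lambda>x. dist (f x) c) \<in> borel_measurable M" for c
  by (rule borel_measurable_continuous_on[OF _ fb]) (intro continuous_intros)
 have "simple_function M (G n) \<and> (\<lambda>x. dist (f x) (G n x)) \<in> borel_measurable M" for n
 proof (induction n)
  case 0
  then show ?case by (simp add: G0 de)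
 next
  case (Suc n)
  then have [measurable]: "(\<lambda>x. dist (f x) (G n x)) \<in> borel_measurable M" by simp
  note [measurable] = de
  have "(\<lambda>x. dist (f x) (G (Suc n) x)) = (\<lambda>x. min (dist (f x) (e (Suc n))) (dist (f x) (G n x)))"
   by (auto simp: GS)
  moreover have "simple_function M (G (Suc n))"
   unfolding GS using Suc by (intro simple_function_If) auto
  ultimately show ?case by simp
 qed
 moreover have "(\<lambda>n. G n x) \<longlonglongrightarrow> f x" if x: "x \<in> space M" for x
 proof -
  have le: "dist (f x) (G n x) \<le> dist (f x) (e i)" if "i \<le> n" for i n
   using that
  proof (induction n)
   case 0
   then show ?case by (simp add: G0)
  next
   case (Suc n)
   show ?case
   proof (cases "i = Suc n")
    case True
    then show ?thesis by (simp add: GS)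
   next
    case False
    then have "dist (f x) (G n x) \<le> dist (f x) (e i)" using Suc by simp
    then show ?thesis by (auto simp: GS)
   qed
  qed
  show ?thesis
   unfolding lim_sequentially
  proof (intro allI impI)
   fix r :: real assume "r > 0"
   then obtain i where "dist (f x) (e i) < r" using dense[OF x] by blast
   then show "\<exists>no. \<forall>n\<ge>no. dist (G n x) (f x) < r"
    using le by (intro exI[of _ i]) (metis dist_commute le_less_trans)
  qed
 qed
 ultimately show ?thesis unfolding strongly_measurable_def by blast
qed

text \<open>Rescaling simple approximants keeps them below twice the function they approximate.\<close>

lemma strongly_measurable_approx:
 fixes f :: "'a \<Rightarrow> 'b::real_normed_vector"
 assumes "strongly_measurable M f"
 obtains G where "\<And>n. simple_function M (G n)"
  "\<And>x. x \<in> space M \<Longrightarrow> (\<lambda>n. G n x) \<longlonglongrightarrow> f x"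
  "\<And>n x. x \<in> space M \<Longrightarrow> norm (G n x) \<le> 2 * norm (f x)"
proof -
 obtain F where F: "\<And>n. simple_function M (F n)" "\<And>x. x \<in> space M \<Longrightarrow> (\<lambda>n. F n x) \<longlonglongrightarrow> f x"
  using assms unfolding strongly_measurable_def by metis
 obtain P where P: "\<And>n. simple_function M (P n)"
  "\<And>x. x \<in> space M \<Longrightarrow> (\<lambda>n. P n x) \<longlonglongrightarrow> norm (f x)"
  "\<And>n x. x \<in> space M \<Longrightarrow> dist (P n x) 0 \<le> 2 * dist (norm (f x)) 0"
  using borel_measurable_implies_sequence_metric[OF strongly_measurable_norm[OF assms], of 0]
  by metis
 \<comment> \<open>Shortens v to a length of at most the scalar. At \<open>v = 0\<close> the
   quotient is 0 by convention, and the value is 0 anyway.\<close>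
 define h where "h a v = min 1 (\<bar>a\<bar> / norm v) *\<^sub>R v" for a and v :: 'b
 have hn: "norm (h a v) \<le> \<bar>a\<bar>" for a v
  by (cases "v = 0") (auto simp: h_def min_def field_simps)
 show ?thesis
 proof (rule that[of "\<lambda>n x. h (P n x) (F n x)"])
  show "simple_function M (\<lambda>x. h (P n x) (F n x))" for n
   by (rule simple_function_compose2[OF P(1) F(1)])
  show "norm (h (P n x) (F n x)) \<le> 2 * norm (f x)" if "x \<in> space M" for n x
   using hn[of "P n x" "F n x"] P(3)[OF that, of n] by simp
  show "(\<lambda>n. h (P n x) (F n x)) \<longlonglongrightarrow> f x" if x: "x \<in> space M" for x
  \<comment> \<open>The scaling factor is discontinuous at the origin. There the bound by
    \<open>P n x\<close>, which tends to 0, replaces continuity.\<close>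
  proof (cases "f x = 0")
   case True
   have "(\<lambda>n. norm (P n x)) \<longlonglongrightarrow> 0" using tendsto_norm[OF P(2)[OF x]] True by simp
   then have "(\<lambda>n. h (P n x) (F n x)) \<longlonglongrightarrow> 0"
    by (rule Lim_null_comparison[rotated]) (simp add: hn)
   then show ?thesis using True by simp
  next
   case False
   have "(\<lambda>n. h (P n x) (F n x)) \<longlonglongrightarrow> min 1 (\<bar>norm (f x)\<bar> / norm (f x)) *\<^sub>R f x"
    unfolding h_def using False x by (intro tendsto_intros P F) auto
   then show ?thesis using False by simp
  qed
 qed
qed

text \<open>Subtracting the approximating simple functions avoids an integral of
  \<open>f - g\<close>. It is applied to the kernel with one argument changed, where the right-hand
  side is a kernel difference; the case \<open>f = g\<close> is uniqueness of the integral.\<close>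

lemma has_strong_bochner_integral_diff_le:
 fixes f g :: "'a \<Rightarrow> 'b::real_normed_vector"
 assumes f: "has_strong_bochner_integral M f I" and g: "has_strong_bochner_integral M g J"
 shows "enorm (I - J) \<le> L1_dist M f g"
proof -
 obtain F G where F: "\<And>n. sintegrable M (F n)"
   "(\<lambda>n. \<integral>\<^sup>+x. enorm (f x - F n x) \<partial>M) \<longlonglongrightarrow> 0"
   "(\<lambda>n. sintegral M (F n)) \<longlonglongrightarrow> I"
  and G: "\<And>n. sintegrable M (G n)"
   "(\<lambda>n. \<integral>\<^sup>+x. enorm (g x - G n x) \<partial>M) \<longlonglongrightarrow> 0"
   "(\<lambda>n. sintegral M (G n)) \<longlonglongrightarrow> J"
  using f g unfolding has_strong_bochner_integral_def by blast
 have sm: "strongly_measurable M f" "strongly_measurable M g"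
  using f g by (auto simp: has_strong_bochner_integral_def)
 let ?e = "\<integral>\<^sup>+x. enorm (f x - g x) \<partial>M"
 have "enorm (sintegral M (F n)
    - sintegral M (G n))
   \<le> L1_dist M f (F n) + ?e + L1_dist M g (G n)" for n
 proof -
  have FG: "sintegrable M (\<lambda>x. F n x - G n x)"
   by (rule simple_bochner_integrable_compose2[OF _ F(1) G(1)]) simp
  have FGn: "sintegrable M (\<lambda>x. norm (F n x - G n x))"
   by (rule simple_bochner_integrable_compose2[OF _ F(1) G(1)]) simp
  have sF: "simple_function M (F n)" "simple_function M (G n)"
   using F(1)[of n] G(1)[of n] by (auto elim: simple_bochner_integrable.cases)
  have [measurable]: "(\<lambda>x. norm (f x - F n x)) \<in> borel_measurable M"
   "(\<lambda>x. norm (f x - g x)) \<in> borel_measurable M" "(\<lambda>x. norm (g x - G n x)) \<in> borel_measurable M"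
   by (intro strongly_measurable_norm strongly_measurable_diff sm strongly_measurable_simple sF)+
  have "enorm (sintegral M (F n)
     - sintegral M (G n))
   \<le> ennreal (sintegral M (\<lambda>x. norm (F n x - G n x)))"
   using simple_bochner_integral_norm_bound[OF FG]
   by (simp add: simple_bochner_integral_diff[OF F(1) G(1)] ennreal_leI)
  also have "... = L1_dist M (F n) (G n)"
   by (rule simple_bochner_integral_eq_nn_integral[OF FGn]) simp
  also have "... \<le> (\<integral>\<^sup>+x. enorm (f x - F n x) + enorm (f x - g x)
     + enorm (g x - G n x) \<partial>M)"
  proof (rule nn_integral_mono)
   fix x
   have "norm (F n x - G n x) \<le> norm (f x - F n x) + norm (f x - g x) + norm (g x - G n x)"
    by norm
   then have "enorm (F n x - G n x)
     \<le> ennreal (norm (f x - F n x) + norm (f x - g x) + norm (g x - G n x))"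
    by (rule ennreal_leI)
   then show "enorm (F n x - G n x) \<le> enorm (f x - F n x)
     + enorm (f x - g x) + enorm (g x - G n x)"
    by (simp add: ennreal_plus)
  qed
  also have "... = L1_dist M f (F n) + ?e
    + L1_dist M g (G n)"
   by (simp add: nn_integral_add)
  finally show ?thesis .
 qed
 moreover have "(\<lambda>n. enorm (sintegral M (F n)
    - sintegral M (G n))) \<longlonglongrightarrow> enorm (I - J)"
  by (intro tendsto_ennrealI tendsto_norm tendsto_diff F G)
 moreover have "(\<lambda>n. (L1_dist M f (F n)) + ?e
   + L1_dist M g (G n)) \<longlonglongrightarrow> 0 + ?e + 0"
  by (intro tendsto_add F G tendsto_const)
 ultimately show ?thesis
  by (auto intro: LIMSEQ_le)
qed

lemma AE_zero_levels:
 fixes \<phi> :: "'a \<Rightarrow> 'b::real_normed_vector"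
 assumes "strongly_measurable M \<phi>" "\<And>l. l > 0 \<Longrightarrow> emeasure M {s\<in>space M. norm (\<phi> s) > l} = 0"
 shows "AE s in M. \<phi> s = 0"
proof -
 have "{s\<in>space M. norm (\<phi> s) > 1 / real (Suc n)} \<in> null_sets M" for n
  using strongly_measurable_norm_le[OF assms(1)] assms(2)[of "1 / real (Suc n)"] by (auto simp: null_sets_def)
 then have "AE s in M. \<forall>n. s \<notin> {s\<in>space M. norm (\<phi> s) > 1 / real (Suc n)}"
  unfolding AE_all_countable by (intro allI AE_not_in)
 then show ?thesis
  using AE_space
 proof eventually_elim
  case (elim s)
  show ?case
  proof (rule ccontr)
   assume "\<not> ?thesis"
   then have "0 < norm (\<phi> s)" by simp
   then obtain n where "1 / real (Suc n) < norm (\<phi> s)" by (rule nat_approx_posE)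
   then show False using elim by auto
  qed
 qed
qed

section \<open>Balls and coverings in spaces of homogeneous type\<close>

text \<open>Countable subadditivity on the left and additivity on the right, after an enumeration of
  the index set. The two measures may differ, as in the maximal inequality.\<close>

lemma emeasure_UN_le_disjoint:
 assumes "countable I" and A: "\<And>i. i \<in> I \<Longrightarrow> A i \<in> sets M" and b: "\<And>i. i \<in> I \<Longrightarrow> b i \<in> sets N"
  and le: "\<And>i. i \<in> I \<Longrightarrow> emeasure M (A i) \<le> K * emeasure N (b i)"
  and dis: "disjoint_family_on b I"
 shows "emeasure M (\<Union>i\<in>I. A i) \<le> K * emeasure N (\<Union>i\<in>I. b i)"
proof -
 \<comment> \<open>At most one index for each natural number; numbers outside the enumeration get
   the empty set.\<close>
 define J where "J n = {i\<in>I. to_nat_on I i = n}" for n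
 have J: "J n = {} \<or> (\<exists>i\<in>I. J n = {i})" for n
  using inj_on_to_nat_on[OF assms(1)] unfolding J_def inj_on_def by blast
 have J_sub: "i \<in> I" if "i \<in> J n" for i n using that by (simp add: J_def)
 define A' where "A' n = (\<Union>i\<in>J n. A i)" for n
 define b' where "b' n = (\<Union>i\<in>J n. b i)" for n
 have A': "A' n \<in> sets M" "b' n \<in> sets N" "emeasure M (A' n) \<le> K * emeasure N (b' n)" for n
  using J[of n] A b le by (auto simp: A'_def b'_def)
 have dis': "disjoint_family b'"
  unfolding disjoint_family_on_def
 proof (intro ballI impI)
  fix m n :: nat assume "m \<noteq> n"
  have "b i \<inter> b j = {}" if "i \<in> J m" "j \<in> J n" for i j
   using that \<open>m \<noteq> n\<close> by (intro disjoint_family_onD[OF dis]) (auto simp: J_def)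
  then show "b' m \<inter> b' n = {}" by (auto simp: b'_def)
 qed
 have "(\<Union>i\<in>I. A i) = (\<Union>n. A' n)" "(\<Union>i\<in>I. b i) = (\<Union>n. b' n)"
  by (auto simp: A'_def b'_def J_def)
 then have "emeasure M (\<Union>i\<in>I. A i) \<le> (\<Sum>n. emeasure M (A' n))"
  using emeasure_subadditive_countably[of A' M] A'(1) by (simp add: image_subset_iff)
 also have "... \<le> (\<Sum>n. K * emeasure N (b' n))"
  by (intro suminf_le A') auto
 also have "... = K * (\<Sum>n. emeasure N (b' n))"
  by simp
 also have "(\<Sum>n. emeasure N (b' n)) = emeasure N (\<Union>n. b' n)"
  using A' dis' by (intro suminf_emeasure) auto
 finally show ?thesis using \<open>(\<Union>i\<in>I. b i) = (\<Union>n. b' n)\<close> by simp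
qed

lemma disjoint_family_on_chain:
 assumes "\<And>X. X \<in> C \<Longrightarrow> disjoint_family_on b X" "\<And>X Y. X \<in> C \<Longrightarrow> Y \<in> C \<Longrightarrow> X \<subseteq> Y \<or> Y \<subseteq> X"
 shows "disjoint_family_on b (\<Union>C)"
 unfolding disjoint_family_on_def
proof (intro ballI impI)
 fix i j assume "i \<in> \<Union>C" "j \<in> \<Union>C" and ne: "i \<noteq> j"
 then obtain X where X: "X \<in> C" "i \<in> X" "j \<in> X" using assms(2) by blast
 then show "b i \<inter> b j = {}" using assms(1)[OF X(1)] ne by (simp add: disjoint_family_on_def)
qed

text \<open>Volume growth under dilation by \<open>a\<close>: the exponent is the number of
  doublings that reach \<open>a\<close>, and \<open>nat\<close> makes it 0 for
  \<open>0 < a \<le> 1\<close>.\<close>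

definition dbl :: "real \<Rightarrow> real \<Rightarrow> real" where
 "dbl cm a = cm ^ nat \<lceil>log 2 a\<rceil>"

section \<open>Geometry and volume of quasi-metric balls\<close>

context homogeneous_type
begin

abbreviation "B \<equiv> qball M d"

definition V :: "'a \<Rightarrow> real \<Rightarrow> real" where
 "V x r = measure M (B x r)"

text \<open>Balls of a quasi-metric need not be open. This is the interior of \<open>B x r\<close>;
  it still contains the centre, and the open sets below are unions of such interiors.\<close>

definition U :: "'a \<Rightarrow> real \<Rightarrow> 'a set" where
 "U x r = {y \<in> space M. \<exists>e>0. B y e \<subseteq> B x r}"

abbreviation "qopen \<equiv> openin (qtopology M d)"

lemma mem_B: "y \<in> B x r \<longleftrightarrow> y \<in> space M \<and> d x y < r"
 by (simp add: qball_def)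

lemma B_space: "B x r \<subseteq> space M"
 by (auto simp: mem_B)

lemma B_mono: "r \<le> s \<Longrightarrow> B x r \<subseteq> B x s"
 by (auto simp: mem_B)

lemma B_empty: "x \<in> space M \<Longrightarrow> r \<le> 0 \<Longrightarrow> B x r = {}"
 using nonneg by (force simp: mem_B)

lemma d_self [simp]: "x \<in> space M \<Longrightarrow> d x x = 0"
 using zero_iff by simp

lemma B_center: "x \<in> space M \<Longrightarrow> r > 0 \<Longrightarrow> x \<in> B x r"
 by (simp add: mem_B)

lemma B_sets [measurable, simp]: "x \<in> space M \<Longrightarrow> B x r \<in> sets M"
 using ball_measurable B_empty by (cases "r > 0") auto

lemma emeasure_B: "x \<in> space M \<Longrightarrow> emeasure M (B x r) = ennreal (V x r)"
 unfolding V_def using ball_finite[of x r] B_empty[of x r]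
 by (cases "r > 0") (auto intro!: emeasure_eq_ennreal_measure)

lemma emeasure_B_finite: "x \<in> space M \<Longrightarrow> emeasure M (B x r) < \<infinity>"
 by (simp add: emeasure_B)

lemma emeasure_subset_B_finite:
 "x \<in> space M \<Longrightarrow> A \<subseteq> B x r \<Longrightarrow> emeasure M A < \<infinity>"
 using emeasure_mono[of A "B x r" M] emeasure_B_finite[of x r] by (auto intro: le_less_trans)

lemma emeasure_eq_measure_subset_B:
 "x \<in> space M \<Longrightarrow> A \<subseteq> B x r \<Longrightarrow> emeasure M A = ennreal (measure M A)"
 using emeasure_subset_B_finite by (intro emeasure_eq_ennreal_measure) (metis infinity_ennreal_def less_irrefl)

lemma V_pos: "x \<in> space M \<Longrightarrow> r > 0 \<Longrightarrow> V x r > 0"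
 using ball_pos[of x r] by (simp add: emeasure_B)

lemma V_nonneg: "V x r \<ge> 0"
 by (simp add: V_def)

lemma measure_mono_B:
 "x \<in> space M \<Longrightarrow> A \<subseteq> A' \<Longrightarrow> A' \<subseteq> B x r \<Longrightarrow> A' \<in> sets M \<Longrightarrow> measure M A \<le> measure M A'"
 using emeasure_mono[of A A' M] emeasure_eq_measure_subset_B[of x A r] emeasure_eq_measure_subset_B[of x A' r]
 by (simp add: ennreal_le_iff)

lemma V_mono_subset: "x \<in> space M \<Longrightarrow> y \<in> space M \<Longrightarrow> B y s \<subseteq> B x r \<Longrightarrow> V y s \<le> V x r"
 unfolding V_def by (rule measure_mono_B[of x _ _ r]) auto

text \<open>Two uses of the quasi-triangle inequality, as in most comparisons of balls, produce a
  multiple of \<open>c_d\<^sup>2\<close>.\<close>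

abbreviation dq :: "real \<Rightarrow> real" where
 "dq n \<equiv> dbl c_mu (n * c_d\<^sup>2)"

lemma dbl_ge_1: "dbl c_mu a \<ge> 1"
 unfolding dbl_def using c_mu by (simp add: one_le_power)

lemma dbl_pos: "dbl c_mu a > 0"
 using dbl_ge_1[of a] by linarith

lemma V_pow2: "x \<in> space M \<Longrightarrow> r > 0 \<Longrightarrow> V x (2 ^ n * r) \<le> c_mu ^ n * V x r"
proof (induction n)
 case (Suc n)
 have "ennreal (V x (2 * (2 ^ n * r))) \<le> ennreal c_mu * ennreal (V x (2 ^ n * r))"
  using doubling[of x "2 ^ n * r"] Suc.prems by (simp add: emeasure_B)
 then have "V x (2 * (2 ^ n * r)) \<le> c_mu * V x (2 ^ n * r)"
  using c_mu V_nonneg by (simp flip: ennreal_mult add: ennreal_le_iff)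
 also have "... \<le> c_mu * (c_mu ^ n * V x r)"
  using Suc c_mu by (intro mult_left_mono) auto
 finally show ?case by (simp add: mult_ac)
qed simp

lemma V_dbl:
 assumes "x \<in> space M" "r > 0" "a > 0"
 shows "V x (a * r) \<le> dbl c_mu a * V x r"
proof -
 have "a \<le> 2 ^ nat \<lceil>log 2 a\<rceil>"
 proof -
  have "a = 2 powr (log 2 a)" using assms by simp
  also have "... \<le> 2 powr (real (nat \<lceil>log 2 a\<rceil>))"
   by (intro powr_mono) linarith+
  finally show ?thesis by (simp add: powr_realpow)
 qed
 then have "V x (a * r) \<le> V x (2 ^ nat \<lceil>log 2 a\<rceil> * r)"
  using assms by (intro V_mono_subset B_mono) auto
 then show ?thesis
  using V_pow2[OF assms(1,2), of "nat \<lceil>log 2 a\<rceil>"] by (simp add: dbl_def)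
qed

lemma B_subset:
 assumes "x \<in> space M" "y \<in> space M" "d x y \<le> s" "c_d * (s + r) \<le> R"
 shows "B y r \<subseteq> B x R"
proof
 fix z assume z: "z \<in> B y r"
 have "d x z \<le> c_d * (d x y + d y z)" using z assms by (intro quasi_triangle) (auto simp: mem_B)
 also have "... < c_d * (s + r)"
  using z assms c_d by (intro mult_strict_left_mono) (auto simp: mem_B)
 finally show "z \<in> B x R" using z assms by (auto simp: mem_B)
qed

text \<open>Changing the centre and the radius at once costs a single dilation, because the ball
  around \<open>y\<close> lies in one around \<open>x\<close> of radius at most
  \<open>K * r'\<close>.\<close>

lemma V_compare:
 assumes "x \<in> space M" "y \<in> space M" "d x y \<le> s" "c_d * (s + r) \<le> K * r'" "r' > 0" "K > 0"
 shows "V y r \<le> dbl c_mu K * V x r'"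
 using V_mono_subset[OF assms(1,2) B_subset[OF assms(1-4)]] V_dbl[OF assms(1,5,6)] by linarith

lemma d_lt_triangle:
 assumes "x \<in> space M" "y \<in> space M" "z \<in> space M" "d x y < s" "d y z < t"
 shows "d x z < c_d * (s + t)"
proof -
 have "d x z \<le> c_d * (d x y + d y z)" using assms by (intro quasi_triangle) auto
 also have "... < c_d * (s + t)" using assms c_d by (intro mult_strict_left_mono) auto
 finally show ?thesis .
qed

lemma qopenD: "qopen A \<Longrightarrow> x \<in> A \<Longrightarrow> \<exists>r>0. B x r \<subseteq> A"
 by (auto simp: openin_qtopology)

lemma qopen_subset: "qopen A \<Longrightarrow> A \<subseteq> space M"
 by (auto simp: openin_qtopology)

lemma qopen_sets: "qopen A \<Longrightarrow> A \<in> sets M"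
 unfolding borel by (intro sigma_sets.Basic) simp

lemma U_subset: "U x r \<subseteq> B x r"
 unfolding U_def by (auto dest!: subsetD[OF _ B_center])

lemma U_open: "qopen (U x r)"
 unfolding openin_qtopology
proof (intro conjI ballI)
 show "U x r \<subseteq> space M" by (auto simp: U_def)
 fix y assume "y \<in> U x r"
 then obtain e where y: "y \<in> space M" and e: "e > 0" "B y e \<subseteq> B x r" by (auto simp: U_def)
 have "z \<in> U x r" if "z \<in> B y (e / (2 * c_d))" for z
 proof -
  have "B z (e / (2 * c_d)) \<subseteq> B y e"
   using that y c_d by (intro B_subset[where s="e / (2 * c_d)"]) (auto simp: mem_B field_simps)
  then show ?thesis
   using e that c_d unfolding U_def by (auto simp: mem_B intro!: exI[of _ "e / (2 * c_d)"])
 qed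
 then show "\<exists>\<rho>>0. B y \<rho> \<subseteq> U x r"
  using e c_d by (intro exI[of _ "e / (2 * c_d)"]) auto
qed

lemma U_center: "x \<in> space M \<Longrightarrow> r > 0 \<Longrightarrow> x \<in> U x r"
 unfolding U_def by auto

section \<open>Disjoint families, the covering lemma and the maximal inequality\<close>

lemma space_eq_UN_B:
 assumes "x \<in> space M" shows "space M = (\<Union>n. B x (real n))"
proof -
 have "\<exists>n. d x y < real n" for y by (rule reals_Archimedean2)
 then show ?thesis by (auto simp: mem_B)
qed

text \<open>Inside \<open>B x0 (real n)\<close> the masses of disjoint sets sum to at most
  \<open>V x0 (real n)\<close>, so only countably many are positive, and every \<open>b i\<close>
  has positive mass in one of these balls.\<close>

lemma countable_disjoint:
 assumes I: "\<And>i. i \<in> I \<Longrightarrow> b i \<in> sets M \<and> emeasure M (b i) > 0" and "disjoint_family_on b I"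
 shows "countable I"
proof (cases "space M = {}")
 case True
 then have "I = {}" using I sets.sets_into_space[of _ M] by fastforce
 then show ?thesis by simp
next
 case False
 then obtain x0 where x0: "x0 \<in> space M" by auto
 define J where "J n = {i\<in>I. measure M (b i \<inter> B x0 (real n)) \<noteq> 0}" for n
 have "countable (J n)" for n
  unfolding J_def
 proof (rule summable_countable_real, rule nonneg_bdd_above_summable_on)
  show "bdd_above (sum (\<lambda>i. measure M (b i \<inter> B x0 (real n))) ` {F. F \<subseteq> I \<and> finite F})"
  proof (rule bdd_aboveI2)
   fix F assume F: "F \<in> {F. F \<subseteq> I \<and> finite F}"
   have "(\<Sum>i\<in>F. measure M (b i \<inter> B x0 (real n))) = measure M (\<Union>i\<in>F. b i \<inter> B x0 (real n))"
   proof (rule measure_finite_Union[symmetric])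
    show "disjoint_family_on (\<lambda>i. b i \<inter> B x0 (real n)) F"
     unfolding disjoint_family_on_def
    proof (intro ballI impI)
     fix i j assume "i \<in> F" "j \<in> F" "i \<noteq> j"
     then have "b i \<inter> b j = {}" using F by (intro disjoint_family_onD[OF assms(2)]) auto
     then show "b i \<inter> B x0 (real n) \<inter> (b j \<inter> B x0 (real n)) = {}" by blast
    qed
    show "emeasure M (b i \<inter> B x0 (real n)) \<noteq> \<infinity>" for i
     using emeasure_subset_B_finite[OF x0, of "b i \<inter> B x0 (real n)" "real n"] by auto
    have "b i \<inter> B x0 (real n) \<in> sets M" if "i \<in> F" for i
     using that F I x0 by (intro sets.Int B_sets) auto
    then show "(\<lambda>i. b i \<inter> B x0 (real n)) ` F \<subseteq> sets M" by blast
   qed (use F in auto)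
   also have "... \<le> V x0 (real n)"
    unfolding V_def using F I x0 by (intro measure_mono_B[of x0 _ _ "real n"]) auto
   finally show "(\<Sum>i\<in>F. measure M (b i \<inter> B x0 (real n))) \<le> V x0 (real n)" .
  qed
 qed simp
 moreover have "I \<subseteq> (\<Union>n. J n)"
 proof
  fix i assume i: "i \<in> I"
  have "b i = (\<Union>n. b i \<inter> B x0 (real n))"
   using I[OF i] sets.sets_into_space[of "b i" M] space_eq_UN_B[OF x0] by blast
  moreover have "emeasure M (\<Union>n. b i \<inter> B x0 (real n)) = 0" if "\<And>n. emeasure M (b i \<inter> B x0 (real n)) = 0"
   using that I[OF i] x0 by (intro emeasure_UN_eq_0) auto
  ultimately obtain n where "emeasure M (b i \<inter> B x0 (real n)) \<noteq> 0"
   using I[OF i] by force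
  then have "measure M (b i \<inter> B x0 (real n)) \<noteq> 0"
   using emeasure_eq_measure_subset_B[OF x0, of "b i \<inter> B x0 (real n)" "real n"] by auto
  then show "i \<in> (\<Union>n. J n)" using i by (auto simp: J_def)
 qed
 ultimately show ?thesis by (meson countable_UN countable_subset countableI_type)
qed

text \<open>Zorn's lemma without regard to size. It serves where sets that meet have comparable
  radii, namely for Whitney balls and for nets.\<close>

lemma maximal_disjoint:
 obtains I where "I \<subseteq> A" "disjoint_family_on b I" "\<And>x. x \<in> A \<Longrightarrow> b x \<noteq> {} \<Longrightarrow> \<exists>i\<in>I. b x \<inter> b i \<noteq> {}"
proof -
 let ?\<Phi> = "{I. I \<subseteq> A \<and> disjoint_family_on b I}"
 have "\<exists>X\<in>?\<Phi>. \<forall>Y\<in>?\<Phi>. X \<subseteq> Y \<longrightarrow> Y = X"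
 proof (rule subset_Zorn')
  fix C assume C: "subset.chain ?\<Phi> C"
  have C': "X \<in> ?\<Phi>" if "X \<in> C" for X
   using C that unfolding subset_chain_def by (meson subsetD)
  have "X \<subseteq> Y \<or> Y \<subseteq> X" if "X \<in> C" "Y \<in> C" for X Y
   using C that unfolding subset_chain_def by (meson subsetD)
  then have "disjoint_family_on b (\<Union>C)"
   using C' by (intro disjoint_family_on_chain) auto
  moreover have "\<Union>C \<subseteq> A"
   using C' by (intro Union_least) simp
  ultimately have "disjoint_family_on b (\<Union>C) \<and> \<Union>C \<subseteq> A" by blast
  then show "\<Union>C \<in> ?\<Phi>" by blast
 qed
 then obtain I where "I \<in> ?\<Phi>" and max: "\<forall>Y\<in>?\<Phi>. I \<subseteq> Y \<longrightarrow> Y = I" ..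
 then have I: "I \<subseteq> A" "disjoint_family_on b I"
  "\<And>Y. Y \<subseteq> A \<Longrightarrow> disjoint_family_on b Y \<Longrightarrow> I \<subseteq> Y \<Longrightarrow> Y = I"
  by simp_all
 show ?thesis
 proof (rule that[OF I(1,2)])
  fix x assume x: "x \<in> A" "b x \<noteq> {}"
  show "\<exists>i\<in>I. b x \<inter> b i \<noteq> {}"
  proof (rule ccontr)
   assume n: "\<not> ?thesis"
   then have "disjoint_family_on b (insert x I)"
    using I(2) by (auto simp: disjoint_family_on_def)
   then have "insert x I = I" using I(1,3) x by blast
   then show False using n x by blast
  qed
 qed
qed

text \<open>Zorn's lemma is applied to families with the property \<open>good\<close>: a ball of
  \<open>F\<close> that meets the family meets a member with at least half its radius. A maximal
  such family meets every ball, since otherwise a missed ball with radius above half the supremum of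
  the missed radii could be added.\<close>

lemma vitali:
 assumes F: "F \<subseteq> space M \<times> {0<..R0}"
 obtains G where "G \<subseteq> F" "countable G" "disjoint_family_on (\<lambda>e. B (fst e) (snd e)) G"
  "\<And>x r. (x, r) \<in> F \<Longrightarrow> \<exists>e\<in>G. B x r \<subseteq> B (fst e) (5 * c_d\<^sup>2 * snd e)"
proof -
 define b where "b = (\<lambda>e. B (fst e) (snd e))"
 define good where "good G \<longleftrightarrow> (\<forall>e\<in>F. (\<exists>g\<in>G. b e \<inter> b g \<noteq> {}) \<longrightarrow> (\<exists>g\<in>G. b e \<inter> b g \<noteq> {} \<and> snd e \<le> 2 * snd g))" for G
 let ?\<Phi> = "{G. G \<subseteq> F \<and> disjoint_family_on b G \<and> good G}"
 have "\<exists>X\<in>?\<Phi>. \<forall>Y\<in>?\<Phi>. X \<subseteq> Y \<longrightarrow> Y = X"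
 proof (rule subset_Zorn')
  fix C assume C: "subset.chain ?\<Phi> C"
  have C': "X \<in> ?\<Phi>" if "X \<in> C" for X
   using C that unfolding subset_chain_def by (meson subsetD)
  have "X \<subseteq> Y \<or> Y \<subseteq> X" if "X \<in> C" "Y \<in> C" for X Y
   using C that unfolding subset_chain_def by (meson subsetD)
  then have "disjoint_family_on b (\<Union>C)"
   using C' by (intro disjoint_family_on_chain) auto
  moreover have "\<Union>C \<subseteq> F"
   using C' by (intro Union_least) simp
  ultimately have "disjoint_family_on b (\<Union>C) \<and> \<Union>C \<subseteq> F" by blast
  moreover have "good (\<Union>C)"
   unfolding good_def
  proof (intro ballI impI)
   fix e assume e: "e \<in> F" "\<exists>g\<in>\<Union>C. b e \<inter> b g \<noteq> {}"
   then obtain X g where X: "X \<in> C" "g \<in> X" "b e \<inter> b g \<noteq> {}" by blast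
   then have "good X" using C' by simp
   then show "\<exists>g\<in>\<Union>C. b e \<inter> b g \<noteq> {} \<and> snd e \<le> 2 * snd g"
    using e(1) X unfolding good_def by blast
  qed
  ultimately show "\<Union>C \<in> ?\<Phi>" by blast
 qed
 then obtain G where "G \<in> ?\<Phi>" and max: "\<forall>Y\<in>?\<Phi>. G \<subseteq> Y \<longrightarrow> Y = G" ..
 then have G: "G \<subseteq> F" "disjoint_family_on b G" "good G"
  "\<And>Y. Y \<subseteq> F \<Longrightarrow> disjoint_family_on b Y \<Longrightarrow> good Y \<Longrightarrow> G \<subseteq> Y \<Longrightarrow> Y = G"
  by simp_all
 have bself: "b e \<inter> b e \<noteq> {}" if "e \<in> F" for e
 proof -
  have "fst e \<in> b e" using that F unfolding b_def by (intro B_center) auto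
  then show ?thesis by blast
 qed
 have meets: "\<exists>g\<in>G. b e \<inter> b g \<noteq> {}" if e: "e \<in> F" for e
 proof (rule ccontr)
  assume n: "\<not> ?thesis"
  define T where "T = {e\<in>F. \<forall>g\<in>G. b e \<inter> b g = {}}"
  have T: "e \<in> T" using n e by (auto simp: T_def)
  have bd: "bdd_above (snd ` T)" using F by (intro bdd_aboveI[of _ R0]) (auto simp: T_def)
  define s where "s = Sup (snd ` T)"
  have "snd e \<le> s" unfolding s_def using T bd by (intro cSup_upper) auto
  moreover have "snd e > 0" using e F by auto
  ultimately have "s / 2 < s" by simp
  then obtain e0 where e0: "e0 \<in> T" "s / 2 < snd e0"
   unfolding s_def using T bd by (subst (asm) less_cSup_iff) auto
  have "disjoint_family_on b (insert e0 G)"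
   using G(2) e0(1) unfolding T_def disjoint_family_on_def by blast
  moreover have "good (insert e0 G)"
   unfolding good_def
  proof (intro ballI impI)
   fix f assume f: "f \<in> F" "\<exists>g\<in>insert e0 G. b f \<inter> b g \<noteq> {}"
   show "\<exists>g\<in>insert e0 G. b f \<inter> b g \<noteq> {} \<and> snd f \<le> 2 * snd g"
   proof (cases "\<exists>g\<in>G. b f \<inter> b g \<noteq> {}")
    case True
    then show ?thesis using G(3) f(1) unfolding good_def by blast
   next
    case False
    then have "f \<in> T" using f by (auto simp: T_def)
    then have "snd f \<le> s" unfolding s_def using bd by (intro cSup_upper) auto
    then show ?thesis using f False e0 by auto
   qed
  qed
  ultimately have "insert e0 G = G"
   using G(1) e0 by (intro G(4)) (auto simp: T_def)
  then show False using e0(1) bself unfolding T_def by blast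
 qed
 show ?thesis
 proof (rule that[OF G(1)])
  show "disjoint_family_on (\<lambda>e. B (fst e) (snd e)) G" using G(2) by (simp add: b_def)
  have "b g \<in> sets M \<and> emeasure M (b g) > 0" if "g \<in> G" for g
   using that G(1) F ball_pos by (auto simp: b_def)
  then show "countable G" using G(2) countable_disjoint[of G b] by blast
  fix x r assume xr: "(x, r) \<in> F"
  then have "\<exists>g\<in>G. b (x, r) \<inter> b g \<noteq> {} \<and> r \<le> 2 * snd g"
   using G(3) meets unfolding good_def by fastforce
  then obtain g where g': "g \<in> G" "b (x, r) \<inter> b g \<noteq> {}" "r \<le> 2 * snd g" by blast
  obtain y s where "g = (y, s)" by (cases g)
  then have g: "(y, s) \<in> G" "b (x, r) \<inter> b (y, s) \<noteq> {}" "r \<le> 2 * s"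
   using g' by simp_all
  then obtain z where z: "z \<in> B x r" "z \<in> B y s" by (auto simp: b_def)
  have S: "x \<in> space M" "y \<in> space M" "z \<in> space M" "s > 0"
   using xr g G(1) F z by (auto simp: mem_B)
  have "d y x < c_d * (s + r)"
   using z S by (intro d_lt_triangle[of y z x]) (auto simp: mem_B sym[of z x])
  then have "B x r \<subseteq> B y (c_d * (c_d * (s + r) + r))"
   using S by (intro B_subset[where s="c_d * (s + r)"]) auto
  also have "... \<subseteq> B y (5 * c_d\<^sup>2 * s)"
  proof (rule B_mono)
   \<comment> \<open>With \<open>r \<le> 2 * s\<close> the radii add up to 3 + 2 = 5, and
     \<open>c_d \<ge> 1\<close> evens out the powers.\<close>
   have "c_d * (s + r) + r \<le> c_d * (s + 2 * s) + c_d * (2 * s)"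
   proof (intro add_mono mult_left_mono)
    have "1 * (2 * s) \<le> c_d * (2 * s)" using c_d S by (intro mult_right_mono) auto
    then show "r \<le> c_d * (2 * s)" using g(3) by linarith
   qed (use c_d g in auto)
   then have "c_d * (c_d * (s + r) + r) \<le> c_d * (5 * c_d * s)"
    using c_d by (intro mult_left_mono) (auto simp: algebra_simps)
   then show "c_d * (c_d * (s + r) + r) \<le> 5 * c_d\<^sup>2 * s"
    by (simp add: power2_eq_square mult_ac)
  qed
  finally show "\<exists>e\<in>G. B x r \<subseteq> B (fst e) (5 * c_d\<^sup>2 * snd e)"
   using g(1) by force
 qed
qed

text \<open>The set \<open>A\<close> is a countable union of dilated Vitali balls, hence measurable,
  and it contains the centre of every ball on which the ratio of \<open>N\<close> to
  \<open>M\<close> exceeds \<open>l\<close>. The bound \<open>R0\<close> on the radii is there for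
  the covering lemma and does not enter the constant.\<close>

lemma weak_maximal:
 assumes N: "sets N = sets M" and l: "l > 0"
 obtains A where "A \<in> sets M"
  "emeasure M A \<le> ennreal (dq 5 / l) * emeasure N (space M)"
  "\<And>v r. v \<in> space M \<Longrightarrow> v \<notin> A \<Longrightarrow> 0 < r \<Longrightarrow> r \<le> R0 \<Longrightarrow> emeasure N (B v r) \<le> ennreal l * emeasure M (B v r)"
proof -
 define F where "F = {(v, r). v \<in> space M \<and> 0 < r \<and> r \<le> R0 \<and> emeasure N (B v r) > ennreal l * emeasure M (B v r)}"
 have "F \<subseteq> space M \<times> {0<..R0}" by (auto simp: F_def)
 then obtain G where G: "G \<subseteq> F" "countable G" "disjoint_family_on (\<lambda>e. B (fst e) (snd e)) G"
  "\<And>x r. (x, r) \<in> F \<Longrightarrow> \<exists>e\<in>G. B x r \<subseteq> B (fst e) (5 * c_d\<^sup>2 * snd e)"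
  using vitali[of F R0] by blast
 define A where "A = (\<Union>e\<in>G. B (fst e) (5 * c_d\<^sup>2 * snd e))"
 have Gs: "fst e \<in> space M \<and> 0 < snd e \<and> ennreal l * emeasure M (B (fst e) (snd e)) < emeasure N (B (fst e) (snd e))"
  if "e \<in> G" for e
  using that G(1) by (auto simp: F_def)
 have cd: "5 * c_d\<^sup>2 > 0" using c_d by simp
 show ?thesis
 proof (rule that[of A])
  show "A \<in> sets M" unfolding A_def using G(2) Gs by (intro sets.countable_UN'') auto
  have "emeasure M A \<le> ennreal (dq 5 / l) * emeasure N (\<Union>e\<in>G. B (fst e) (snd e))"
   unfolding A_def
  proof (rule emeasure_UN_le_disjoint[OF G(2) _ _ _ G(3)])
   fix e assume e: "e \<in> G"
   let ?D = "dq 5"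
   have "emeasure M (B (fst e) (5 * c_d\<^sup>2 * snd e)) \<le> ennreal (?D * V (fst e) (snd e))"
    using V_dbl[of "fst e" "snd e" "5 * c_d\<^sup>2"] Gs[OF e] cd by (simp add: emeasure_B ennreal_leI)
   also have "... = ennreal (?D / l) * (ennreal l * emeasure M (B (fst e) (snd e)))"
    using l dbl_pos[of "5 * c_d\<^sup>2"] Gs[OF e] V_nonneg by (simp add: emeasure_B flip: ennreal_mult)
   also have "... \<le> ennreal (?D / l) * emeasure N (B (fst e) (snd e))"
    using Gs[OF e] by (intro mult_left_mono) auto
   finally show "emeasure M (B (fst e) (5 * c_d\<^sup>2 * snd e)) \<le> ennreal (?D / l) * emeasure N (B (fst e) (snd e))" .
  qed (use Gs N in auto)
  also have "... \<le> ennreal (dq 5 / l) * emeasure N (space M)"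
   using N B_space by (intro mult_left_mono emeasure_mono UN_least) auto
  finally show "emeasure M A \<le> ennreal (dq 5 / l) * emeasure N (space M)" .
  fix v r assume v: "v \<in> space M" "v \<notin> A" "0 < r" "r \<le> R0"
  show "emeasure N (B v r) \<le> ennreal l * emeasure M (B v r)"
  proof (rule ccontr)
   assume "\<not> ?thesis"
   then have "(v, r) \<in> F" using v by (auto simp: F_def)
   then have "v \<in> A" using G(4)[of v r] B_center[of v r] v by (auto simp: A_def)
   then show False using v by simp
  qed
 qed
qed


section \<open>Regularity and density points\<close>

text \<open>Closed sets inside and open sets outside are carried together, so that taking
  complements merely exchanges them. The ball makes the measures finite, as continuity from above
  requires.\<close>

lemma regular:
 assumes "A \<in> sets M" and x0: "x0 \<in> space M" and "e > (0::real)"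
 shows "\<exists>G C. qopen G \<and> qopen (space M - C) \<and> C \<subseteq> A \<and> A \<subseteq> G \<and>
  emeasure M ((G - C) \<inter> B x0 R) < ennreal e"
proof -
 have "A \<in> sigma_sets (space M) {U. qopen U}" using assms(1) borel by simp
 then show ?thesis using \<open>e > 0\<close>
 proof (induction A arbitrary: e)
  case (Basic a)
  then have a: "qopen a" by simp
  \<comment> \<open>Shrinking open neighbourhoods of the complement of \<open>a\<close>. A point of
    \<open>a\<close> has a ball inside \<open>a\<close>, so it leaves them eventually.\<close>
  define W where "W k = (\<Union>y\<in>space M - a. U y (1 / real (Suc k)))" for k
  have W: "qopen (W k)" for k
   unfolding W_def by (intro openin_Union) (auto simp: U_open)
  have sub: "space M - W k \<subseteq> a" for k
  proof
   fix x assume x: "x \<in> space M - W k"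
   then have "x \<in> U x (1 / real (Suc k))" by (intro U_center) auto
   then show "x \<in> a" using x by (auto simp: W_def)
  qed
  have "(\<lambda>k. emeasure M (a \<inter> W k \<inter> B x0 R)) \<longlonglongrightarrow> emeasure M (\<Inter>k. a \<inter> W k \<inter> B x0 R)"
  proof (rule Lim_emeasure_decseq)
   show "range (\<lambda>k. a \<inter> W k \<inter> B x0 R) \<subseteq> sets M"
    using qopen_sets[OF W] qopen_sets[OF a] x0 by auto
   have "U y (1 / real (Suc n)) \<subseteq> U y (1 / real (Suc m))" if "m \<le> n" for y m n
   proof -
    have "B y (1 / real (Suc n)) \<subseteq> B y (1 / real (Suc m))"
     using that by (intro B_mono) (auto simp: field_simps)
    then show ?thesis unfolding U_def by blast
   qed
   then show "decseq (\<lambda>k. a \<inter> W k \<inter> B x0 R)"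
    unfolding decseq_def W_def by blast
   show "emeasure M (a \<inter> W i \<inter> B x0 R) \<noteq> \<infinity>" for i
    using emeasure_subset_B_finite[OF x0, of "a \<inter> W i \<inter> B x0 R" R] by auto
  qed
  moreover have "(\<Inter>k. a \<inter> W k \<inter> B x0 R) = {}"
  proof (rule ccontr)
   assume "\<not> ?thesis"
   then obtain x where x: "x \<in> a" "\<And>k. x \<in> W k" by blast
   obtain \<delta> where \<delta>: "\<delta> > 0" "B x \<delta> \<subseteq> a" using qopenD[OF a x(1)] by blast
   obtain k where k: "1 / real (Suc k) < \<delta>" using nat_approx_posE[OF \<delta>(1)] by blast
   obtain y where y: "y \<in> space M" "y \<notin> a" "x \<in> U y (1 / real (Suc k))"
    using x(2)[of k] unfolding W_def by blast
   then have "x \<in> B y (1 / real (Suc k))" using U_subset by blast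
   then have "y \<in> B x \<delta>" using y k by (auto simp: mem_B sym)
   then show False using \<delta> y by blast
  qed
  ultimately have "(\<lambda>k. emeasure M (a \<inter> W k \<inter> B x0 R)) \<longlonglongrightarrow> 0" by simp
  then have "\<forall>\<^sub>F k in sequentially. emeasure M (a \<inter> W k \<inter> B x0 R) < ennreal e"
   using Basic by (intro order_tendstoD(2)) (auto)
  then obtain k where k: "emeasure M (a \<inter> W k \<inter> B x0 R) < ennreal e"
   by (auto simp: eventually_sequentially)
  have "(a - (space M - W k)) = a \<inter> W k" "space M - (space M - W k) = W k"
   using qopen_subset[OF a] qopen_subset[OF W] by auto
  then show ?case
   using a W[of k] sub[of k] k by (intro exI[of _ a] exI[of _ "space M - W k"]) auto
 next
  case Empty
  have "qopen (space M)"
   unfolding openin_qtopology using B_space by (auto intro: exI[of _ 1])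
  then show ?case using Empty by (intro exI[of _ "{}"]) auto
 next
  case (Compl a)
  obtain G C where GC: "qopen G" "qopen (space M - C)" "C \<subseteq> a" "a \<subseteq> G"
   "emeasure M ((G - C) \<inter> B x0 R) < ennreal e"
   using Compl by blast
  have "space M - (space M - G) = G" "space M - C - (space M - G) = G - C"
   using qopen_subset[OF GC(1)] by auto
  then show ?case
   using GC by (intro exI[of _ "space M - C"] exI[of _ "space M - G"]) auto
 next
  case (Union a)
  \<comment> \<open>These errors sum to \<open>e / 2\<close>. The other half pays for cutting the
    union of the \<open>C i\<close>, which need not be closed, down to finitely many.\<close>
  have "\<exists>G C. qopen G \<and> qopen (space M - C) \<and> C \<subseteq> a i \<and> a i \<subseteq> G \<and>
    emeasure M ((G - C) \<inter> B x0 R) < ennreal (e / 4 * (1/2)^i)" for i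
   using Union by auto
  then obtain G C where GC: "\<And>i. qopen (G i)" "\<And>i. qopen (space M - C i)" "\<And>i. C i \<subseteq> a i"
   "\<And>i. a i \<subseteq> G i" "\<And>i. emeasure M ((G i - C i) \<inter> B x0 R) < ennreal (e / 4 * (1/2)^i)"
   by metis
  have Ca: "C i \<subseteq> space M" for i
   using GC(3,4)[of i] qopen_subset[OF GC(1)[of i]] by blast
  have Cs: "C i \<in> sets M" for i
  proof -
   have "space M - (space M - C i) \<in> sets M" using GC(2)[of i] qopen_sets by blast
   then show ?thesis using Ca by (simp add: double_diff)
  qed
  have Gs: "G i \<in> sets M" for i using GC(1) qopen_sets by blast
  have 1: "emeasure M (\<Union>i. (G i - C i) \<inter> B x0 R) \<le> ennreal (e/2)"
  proof -
   have "emeasure M (\<Union>i. (G i - C i) \<inter> B x0 R) \<le> (\<Sum>i. emeasure M ((G i - C i) \<inter> B x0 R))"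
    using Cs Gs x0 by (intro emeasure_subadditive_countably) auto
   also have "... \<le> (\<Sum>i. ennreal (e / 4 * (1/2)^i))"
    using GC(5) by (intro suminf_le) (auto intro: less_imp_le)
   also have "... = ennreal (\<Sum>i. e / 4 * (1/2)^i)"
    using Union.prems by (intro suminf_ennreal2) (auto intro!: summable_mult summable_geometric)
   also have "(\<Sum>i. e / 4 * (1/2::real)^i) = e/2"
    by (subst suminf_mult) (auto intro!: summable_geometric simp: suminf_geometric)
   finally show ?thesis .
  qed
  have "(\<lambda>n. emeasure M (((\<Union>i. C i) - (\<Union>i\<le>n. C i)) \<inter> B x0 R))
    \<longlonglongrightarrow> emeasure M (\<Inter>n. ((\<Union>i. C i) - (\<Union>i\<le>n. C i)) \<inter> B x0 R)"
  proof (rule Lim_emeasure_decseq)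
   show "range (\<lambda>n. ((\<Union>i. C i) - (\<Union>i\<le>n. C i)) \<inter> B x0 R) \<subseteq> sets M"
    using Cs x0 by auto
   have "(\<Union>i\<le>m. C i) \<subseteq> (\<Union>i\<le>n. C i)" if "m \<le> n" for m n
    using that by (intro UN_mono) auto
   then show "decseq (\<lambda>n. ((\<Union>i. C i) - (\<Union>i\<le>n. C i)) \<inter> B x0 R)"
    unfolding decseq_def by blast
   show "emeasure M (((\<Union>i. C i) - (\<Union>i\<le>n. C i)) \<inter> B x0 R) \<noteq> \<infinity>" for n
    using emeasure_subset_B_finite[OF x0, of "((\<Union>i. C i) - (\<Union>i\<le>n. C i)) \<inter> B x0 R" R] by auto
  qed
  moreover have "(\<Inter>n. ((\<Union>i. C i) - (\<Union>i\<le>n. C i)) \<inter> B x0 R) = {}" by blast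
  ultimately have "(\<lambda>n. emeasure M (((\<Union>i. C i) - (\<Union>i\<le>n. C i)) \<inter> B x0 R)) \<longlonglongrightarrow> 0" by simp
  then have "\<forall>\<^sub>F n in sequentially. emeasure M (((\<Union>i. C i) - (\<Union>i\<le>n. C i)) \<inter> B x0 R) < ennreal (e/2)"
   using Union.prems by (intro order_tendstoD(2)) (auto)
  then obtain n where n: "emeasure M (((\<Union>i. C i) - (\<Union>i\<le>n. C i)) \<inter> B x0 R) < ennreal (e/2)"
   by (auto simp: eventually_sequentially)
  have "((\<Union>i. G i) - (\<Union>i\<le>n. C i)) \<inter> B x0 R
    \<subseteq> (\<Union>i. (G i - C i) \<inter> B x0 R) \<union> ((\<Union>i. C i) - (\<Union>i\<le>n. C i)) \<inter> B x0 R" by blast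
  then have "emeasure M (((\<Union>i. G i) - (\<Union>i\<le>n. C i)) \<inter> B x0 R)
    \<le> emeasure M ((\<Union>i. (G i - C i) \<inter> B x0 R) \<union> ((\<Union>i. C i) - (\<Union>i\<le>n. C i)) \<inter> B x0 R)"
   using Cs Gs x0 by (intro emeasure_mono sets.Un sets.countable_UN) auto
  also have "... \<le> emeasure M (\<Union>i. (G i - C i) \<inter> B x0 R) + emeasure M (((\<Union>i. C i) - (\<Union>i\<le>n. C i)) \<inter> B x0 R)"
   using Cs Gs x0 by (intro emeasure_subadditive) auto
  also have "... \<le> ennreal (e/2) + emeasure M (((\<Union>i. C i) - (\<Union>i\<le>n. C i)) \<inter> B x0 R)"
   using 1 by (rule add_right_mono)
  also have "... < ennreal (e/2) + ennreal (e/2)"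
   using n by (simp only: ennreal_add_left_cancel_less) simp
  also have "... = ennreal e" using Union.prems by (simp flip: ennreal_plus)
  finally have *: "emeasure M (((\<Union>i. G i) - (\<Union>i\<le>n. C i)) \<inter> B x0 R) < ennreal e" .
  have "qopen (\<Inter>i\<in>{..n}. space M - C i)"
   using GC(2) by (intro openin_Inter) auto
  moreover have "(\<Inter>i\<in>{..n}. space M - C i) = space M - (\<Union>i\<le>n. C i)" by auto
  ultimately have "qopen (space M - (\<Union>i\<le>n. C i))" by simp
  moreover have "qopen (\<Union>i. G i)" using GC(1) by blast
  ultimately show ?case
   using * GC(3,4) by (intro exI[of _ "\<Union>i. G i"] exI[of _ "\<Union>i\<le>n. C i"]) blast
 qed
qed

text \<open>Around a point of \<open>A\<close> small balls lie in an open \<open>G\<close>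
  containing \<open>A\<close>, so what they miss of \<open>A\<close> lies in \<open>G - A\<close>.
  The maximal inequality for the indicator of this small set makes the exceptional points a set of
  arbitrarily small measure.\<close>

lemma density_points:
 assumes A: "A \<in> sets M" and eta: "\<eta> > 0"
 shows "AE x in M. x \<in> A \<longrightarrow> (\<exists>r0>0. \<forall>r. 0 < r \<longrightarrow> r < r0 \<longrightarrow> measure M (B x r - A) \<le> \<eta> * V x r)"
proof (cases "space M = {}")
 case True
 then show ?thesis by (simp add: AE_iff_null null_sets_def)
next
 case False
 then obtain x0 where x0: "x0 \<in> space M" by blast
 define bad where "bad = {x\<in>space M. \<not> (x \<in> A \<longrightarrow>
   (\<exists>r0>0. \<forall>r. 0 < r \<longrightarrow> r < r0 \<longrightarrow> measure M (B x r - A) \<le> \<eta> * V x r))}"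
 let ?D = "dq 5"
 have step: "\<exists>N\<in>sets M. emeasure M N \<le> ennreal (?D / \<eta> * (1 / real (Suc k))) \<and> bad \<inter> B x0 (real n) \<subseteq> N" for n k
 proof -
  \<comment> \<open>Balls of radius at most 1 with centre in \<open>B x0 (real n)\<close> lie in
    \<open>B x0 R\<close>.\<close>
  define R where "R = c_d * (real n + 1)"
  obtain G C where G: "qopen G" "qopen (space M - C)" "C \<subseteq> A" "A \<subseteq> G" "emeasure M ((G - C) \<inter> B x0 R) < ennreal (1 / real (Suc k))"
   using regular[OF A x0, of "1 / real (Suc k)" R] by auto
  have Gs: "G \<in> sets M" using G qopen_sets by blast
  define H where "H = (G - A) \<inter> B x0 R"
  have H: "H \<in> sets M" using Gs A x0 by (simp add: H_def)
  have "emeasure M H \<le> ennreal (1 / real (Suc k))"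
  proof -
   have "C = space M - (space M - C)" using G(3,4) sets.sets_into_space[OF A] by auto
   then have "C \<in> sets M" using qopen_sets[OF G(2)] by (metis sets.compl_sets)
   then have "emeasure M H \<le> emeasure M ((G - C) \<inter> B x0 R)"
    using G(3) Gs x0 by (intro emeasure_mono) (auto simp: H_def)
   then show ?thesis using G(5) by simp
  qed
  obtain N where N: "N \<in> sets M" "emeasure M N \<le> ennreal (?D / \<eta>) * emeasure (density M (indicator H)) (space M)"
   "\<And>v r. v \<in> space M \<Longrightarrow> v \<notin> N \<Longrightarrow> 0 < r \<Longrightarrow> r \<le> 1 \<Longrightarrow> emeasure (density M (indicator H)) (B v r) \<le> ennreal \<eta> * emeasure M (B v r)"
   using weak_maximal[of "density M (indicator H)" \<eta> 1] eta by auto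
  have "emeasure M N \<le> ennreal (?D / \<eta>) * ennreal (1 / real (Suc k))"
  proof -
   have "emeasure (density M (indicator H)) (space M) = emeasure M H"
    using H sets.sets_into_space[OF H] by (simp add: emeasure_restricted Int_absorb2)
   then show ?thesis
    using N(2) mult_left_mono[OF \<open>emeasure M H \<le> _\<close>, of "ennreal (?D / \<eta>)"] by auto
  qed
  also have "... = ennreal (?D / \<eta> * (1 / real (Suc k)))"
   using dbl_pos[of "5 * c_d\<^sup>2"] eta by (intro ennreal_mult[symmetric]) auto
  finally have "emeasure M N \<le> ennreal (?D / \<eta> * (1 / real (Suc k)))" .
  moreover have "bad \<inter> B x0 (real n) \<subseteq> N"
  proof (rule subsetI, rule ccontr)
   fix x assume x: "x \<in> bad \<inter> B x0 (real n)" and xN: "x \<notin> N"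
   have xM: "x \<in> space M" "x \<in> A" using x by (auto simp: bad_def)
   obtain \<delta> where \<delta>: "\<delta> > 0" "B x \<delta> \<subseteq> G" using qopenD[OF G(1)] G(4) xM by blast
   have "measure M (B x r - A) \<le> \<eta> * V x r" if r: "0 < r" "r < min \<delta> 1" for r
   proof -
    have "B x r \<subseteq> G" using \<delta> r B_mono[of r \<delta> x] by auto
    moreover have "B x r \<subseteq> B x0 R"
     using x r xM x0 c_d unfolding R_def
     by (intro B_subset[where s="real n"] mult_left_mono) (auto simp: mem_B)
    ultimately have "B x r - A = H \<inter> B x r" by (auto simp: H_def)
    moreover have "emeasure M (H \<inter> B x r) \<le> ennreal \<eta> * emeasure M (B x r)"
     using N(3)[of x r] xM xN r H by (simp add: emeasure_restricted)
    ultimately have "ennreal (measure M (B x r - A)) \<le> ennreal (\<eta> * V x r)"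
     using xM eta V_nonneg emeasure_eq_measure_subset_B[of x "B x r - A" r]
     by (simp add: emeasure_B ennreal_mult)
    then show ?thesis using eta V_nonneg by (simp add: ennreal_le_iff)
   qed
   then have "\<exists>r0>0. \<forall>r. 0 < r \<longrightarrow> r < r0 \<longrightarrow> measure M (B x r - A) \<le> \<eta> * V x r"
    using \<delta> by (intro exI[of _ "min \<delta> 1"]) auto
   then show False using x by (auto simp: bad_def)
  qed
  ultimately show ?thesis using N(1) by blast
 qed
 then have "\<forall>n. \<forall>k. \<exists>N. N \<in> sets M \<and> emeasure M N \<le> ennreal (?D / \<eta> * (1 / real (Suc k))) \<and>
   bad \<inter> B x0 (real n) \<subseteq> N" by blast
 then obtain N where N: "\<And>n k. N n k \<in> sets M" "\<And>n k. emeasure M (N n k) \<le> ennreal (?D / \<eta> * (1 / real (Suc k)))"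
  "\<And>n k. bad \<inter> B x0 (real n) \<subseteq> N n k" by metis
 have "emeasure M (\<Inter>k. N n k) = 0" for n
 proof -
  have "emeasure M (\<Inter>k. N n k) \<le> ennreal (?D / \<eta> * (1 / real (Suc k)))" for k
   using N(2)[of n k] emeasure_mono[of "\<Inter>k. N n k" "N n k" M] N(1) by (auto intro: order_trans)
  moreover have "(\<lambda>k. ennreal (?D / \<eta> * (1 / real (Suc k)))) \<longlonglongrightarrow> ennreal (?D / \<eta> * 0)"
   by (intro tendsto_ennrealI tendsto_mult tendsto_const LIMSEQ_inverse_real_of_nat[unfolded inverse_eq_divide])
  ultimately have "emeasure M (\<Inter>k. N n k) \<le> ennreal (?D / \<eta> * 0)"
   by (intro LIMSEQ_le_const) auto
  then show ?thesis by simp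
 qed
 then have "(\<Inter>k. N n k) \<in> null_sets M" for n
  using N(1) by (intro null_setsI sets.countable_INT) auto
 then have null: "(\<Union>n. \<Inter>k. N n k) \<in> null_sets M"
  by (rule null_sets_UN)
 have "bad \<subseteq> (\<Union>n. \<Inter>k. N n k)"
 proof
  fix x assume x: "x \<in> bad"
  then have "x \<in> (\<Union>n. B x0 (real n))" using space_eq_UN_B[OF x0] by (auto simp: bad_def)
  then obtain n where "x \<in> B x0 (real n)" by blast
  then have "x \<in> N n k" for k using N(3)[of n k] x by blast
  then show "x \<in> (\<Union>n. \<Inter>k. N n k)" by blast
 qed
 then show ?thesis
  using null by (intro AE_I'[OF null]) (auto simp: bad_def)
qed


section \<open>Whitney coverings\<close>

lemma V_split:
 assumes x: "x \<in> space M" and A: "A \<in> sets M"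
 shows "V x r = measure M (B x r - A) + measure M (A \<inter> B x r)"
proof -
 have "emeasure M (B x r) = emeasure M (B x r - A) + emeasure M (A \<inter> B x r)"
  using x A by (subst plus_emeasure) (auto intro!: arg_cong[where f="emeasure M"])
 then have "ennreal (V x r) = ennreal (measure M (B x r - A)) + ennreal (measure M (A \<inter> B x r))"
  using emeasure_eq_measure_subset_B[OF x, of "B x r - A" r] emeasure_eq_measure_subset_B[OF x, of "A \<inter> B x r" r] x
  by (simp add: emeasure_B)
 then show ?thesis using V_nonneg by (simp flip: ennreal_plus)
qed

text \<open>A Whitney radius behaves like the distance to the complement of an open set, but is also
 allowed to be \<open>c_d * (d x s0 + r0)\<close> on the whole space.\<close>

definition whitney :: "'a set \<Rightarrow> ('a \<Rightarrow> real) \<Rightarrow> bool" where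
 "whitney \<Omega> \<rho> \<longleftrightarrow> qopen \<Omega> \<and> (\<forall>x\<in>\<Omega>. 0 < \<rho> x \<and> B x (\<rho> x) \<subseteq> \<Omega>) \<and>
   (\<forall>x\<in>\<Omega>. \<forall>y\<in>\<Omega>. \<rho> x \<le> c_d\<^sup>2 * (d x y + \<rho> y))"

lemma cd2: "c_d \<le> c_d\<^sup>2" "1 \<le> c_d\<^sup>2"
 using c_d by (auto simp: power2_eq_square mult_le_cancel_left1 intro: order_trans)

text \<open>All smallness asked of \<open>a\<close> by the Whitney geometry has the form
  \<open>n * (c_d\<^sup>2)^k * a \<le> 1\<close> with moderate \<open>n\<close> and
  \<open>k\<close>; one generous inequality covers every case.\<close>

lemma small_power:
 assumes "a > 0" "1000 * (c_d\<^sup>2)^8 * a \<le> 1" "n \<le> 1000" "k \<le> 8" "0 \<le> n"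
 shows "n * (c_d\<^sup>2)^k * a \<le> 1"
proof -
 have "n * (c_d\<^sup>2)^k * a \<le> 1000 * (c_d\<^sup>2)^8 * a"
  using assms cd2 by (intro mult_right_mono mult_mono power_increasing) auto
 then show ?thesis using assms(2) by linarith
qed

lemma whitneyD:
 assumes "whitney \<Omega> \<rho>"
 shows "qopen \<Omega>" "\<And>x. x \<in> \<Omega> \<Longrightarrow> x \<in> space M" "\<And>x. x \<in> \<Omega> \<Longrightarrow> 0 < \<rho> x"
  "\<And>x. x \<in> \<Omega> \<Longrightarrow> B x (\<rho> x) \<subseteq> \<Omega>" "\<And>x y. x \<in> \<Omega> \<Longrightarrow> y \<in> \<Omega> \<Longrightarrow> \<rho> x \<le> c_d\<^sup>2 * (d x y + \<rho> y)"
 using assms qopen_subset unfolding whitney_def by blast+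

text \<open>The term \<open>c_d\<^sup>2 * d x y\<close> is at most half of \<open>\<rho> x\<close>
  and can be absorbed.\<close>

lemma whitney_compare:
 assumes w: "whitney \<Omega> \<rho>" and x: "x \<in> \<Omega>" and y: "y \<in> \<Omega>" and le: "d x y * (2 * c_d\<^sup>2) \<le> \<rho> x"
 shows "\<rho> x \<le> 2 * c_d\<^sup>2 * \<rho> y" "\<rho> y \<le> 2 * c_d\<^sup>2 * \<rho> x"
proof -
 have "\<rho> x \<le> c_d\<^sup>2 * (d x y + \<rho> y)" using whitneyD(5)[OF w x y] .
 then show "\<rho> x \<le> 2 * c_d\<^sup>2 * \<rho> y" using le by (simp add: algebra_simps)
 have "\<rho> y \<le> c_d\<^sup>2 * (d y x + \<rho> x)" using whitneyD(5)[OF w y x] .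
 also have "d y x = d x y" using whitneyD(2)[OF w] x y by (intro sym) auto
 finally have 1: "\<rho> y \<le> c_d\<^sup>2 * d x y + c_d\<^sup>2 * \<rho> x" by (simp add: algebra_simps)
 have "1 * \<rho> x \<le> c_d\<^sup>2 * \<rho> x" using cd2 whitneyD(3)[OF w x] by (intro mult_right_mono) auto
 show "\<rho> y \<le> 2 * c_d\<^sup>2 * \<rho> x"
 proof -
  have "2 * c_d\<^sup>2 * \<rho> x = 2 * (c_d\<^sup>2 * \<rho> x)" "d x y * (2 * c_d\<^sup>2) = 2 * (c_d\<^sup>2 * d x y)" by simp_all
  then show ?thesis using 1 le \<open>1 * \<rho> x \<le> c_d\<^sup>2 * \<rho> x\<close> whitneyD(3)[OF w x] by linarith
 qed
qed

text \<open>The version for a point not yet known to lie in \<Omega>: its distance from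
  \<open>x\<close> is below \<open>\<rho> x\<close>, which places it there before the radii are
  compared.\<close>

lemma whitney_compare':
 assumes w: "whitney \<Omega> \<rho>" and x: "x \<in> \<Omega>" and y: "y \<in> space M" and le: "d x y < a * \<rho> x"
  and a: "a * (2 * c_d\<^sup>2) \<le> 1"
 shows "y \<in> \<Omega>" "\<rho> x \<le> 2 * c_d\<^sup>2 * \<rho> y" "\<rho> y \<le> 2 * c_d\<^sup>2 * \<rho> x"
proof -
 have px: "\<rho> x > 0" using whitneyD(3)[OF w x] .
 have "d x y * (2 * c_d\<^sup>2) \<le> (a * \<rho> x) * (2 * c_d\<^sup>2)" using le by (intro mult_right_mono) auto
 also have "... = (a * (2 * c_d\<^sup>2)) * \<rho> x" by simp
 also have "... \<le> 1 * \<rho> x" using a px by (intro mult_right_mono) auto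
 finally have 1: "d x y * (2 * c_d\<^sup>2) \<le> \<rho> x" by simp
 have "d x y * 1 \<le> d x y * (2 * c_d\<^sup>2)"
  using nonneg[of x y] whitneyD(2)[OF w x] y cd2 by (intro mult_left_mono) auto
 moreover have "d x y = 0 \<or> d x y < d x y * (2 * c_d\<^sup>2)"
 proof (cases "d x y = 0")
  case False
  then have "d x y > 0" using nonneg[of x y] whitneyD(2)[OF w x] y by auto
  then have "d x y * 1 < d x y * (2 * c_d\<^sup>2)" using cd2 by (intro mult_strict_left_mono) auto
  then show ?thesis by simp
 qed simp
 ultimately have "d x y < \<rho> x" using 1 px by auto
 then show "y \<in> \<Omega>" using whitneyD(4)[OF w x] y by (auto simp: mem_B)
 then show "\<rho> x \<le> 2 * c_d\<^sup>2 * \<rho> y" "\<rho> y \<le> 2 * c_d\<^sup>2 * \<rho> x"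
  using whitney_compare[OF w x _ 1] by auto
qed

text \<open>Any maximal disjoint family will do: balls that meet have comparable radii, by two
  comparisons through a common point, each with the factor \<open>2 * c_d\<^sup>2\<close>. With
  \<open>q = c_d\<^sup>2\<close> this gives \<open>1 + 4 * q\<^sup>2 \<le> 5 * q\<^sup>2\<close>,
  and the triangle inequality adds one more q.\<close>

lemma whitney_cover:
 assumes w: "whitney \<Omega> \<rho>" and a: "a > 0" "a * (2 * c_d\<^sup>2) \<le> 1"
 obtains I where "I \<subseteq> \<Omega>" "countable I" "disjoint_family_on (\<lambda>i. B i (a * \<rho> i)) I"
  "\<And>x. x \<in> \<Omega> \<Longrightarrow> \<exists>i\<in>I. x \<in> B i (5 * (c_d\<^sup>2)^3 * a * \<rho> i)"
proof -
 let ?q = "c_d\<^sup>2"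
 obtain I where I: "I \<subseteq> \<Omega>" "disjoint_family_on (\<lambda>i. B i (a * \<rho> i)) I"
  "\<And>x. x \<in> \<Omega> \<Longrightarrow> B x (a * \<rho> x) \<noteq> {} \<Longrightarrow> \<exists>i\<in>I. B x (a * \<rho> x) \<inter> B i (a * \<rho> i) \<noteq> {}"
  by (rule maximal_disjoint[of \<Omega> "\<lambda>i. B i (a * \<rho> i)"]) blast
 show ?thesis
 proof (rule that[OF I(1) _ I(2)])
  have "B i (a * \<rho> i) \<in> sets M \<and> emeasure M (B i (a * \<rho> i)) > 0" if "i \<in> I" for i
   using that I(1) whitneyD(2,3)[OF w] a ball_pos[of i "a * \<rho> i"] by auto
  then show "countable I" using countable_disjoint[OF _ I(2)] by blast
  fix x assume x: "x \<in> \<Omega>"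
  have xM: "x \<in> space M" and px: "\<rho> x > 0" using whitneyD(2,3)[OF w x] by auto
  have "x \<in> B x (a * \<rho> x)" using xM px a by (intro B_center) auto
  then obtain i y where i: "i \<in> I" and y: "y \<in> B x (a * \<rho> x)" "y \<in> B i (a * \<rho> i)"
   using I(3)[OF x] by blast
  have i\<Omega>: "i \<in> \<Omega>" and iM: "i \<in> space M" and pi: "\<rho> i > 0" using i I(1) whitneyD(2,3)[OF w] by auto
  have yM: "y \<in> space M" "d x y < a * \<rho> x" "d i y < a * \<rho> i" using y by (auto simp: mem_B)
  have "\<rho> x \<le> 2 * ?q * \<rho> y" using whitney_compare'[OF w x yM(1,2) a(2)] by simp
  also have "... \<le> 2 * ?q * (2 * ?q * \<rho> i)"
   using whitney_compare'(3)[OF w i\<Omega> yM(1,3) a(2)] cd2 by (intro mult_left_mono) auto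
  finally have r: "\<rho> x \<le> 4 * ?q^2 * \<rho> i" by (simp add: power2_eq_square)
  have "d i x < c_d * (a * \<rho> i + a * \<rho> x)"
   using yM iM xM by (intro d_lt_triangle[of i y x]) (auto simp: sym[of y x])
  also have "... \<le> c_d * (a * \<rho> i + a * (4 * ?q^2 * \<rho> i))"
   using r a c_d by (intro mult_left_mono add_left_mono) auto
  also have "... = (c_d * (1 + 4 * ?q^2)) * (a * \<rho> i)" by (simp add: algebra_simps)
  also have "... \<le> (?q * (5 * ?q^2)) * (a * \<rho> i)"
  proof (intro mult_right_mono mult_mono)
   show "1 + 4 * ?q^2 \<le> 5 * ?q^2" using cd2 one_le_power[of ?q 2] by simp
  qed (use cd2 a pi c_d in auto)
  finally show "\<exists>i\<in>I. x \<in> B i (5 * ?q^3 * a * \<rho> i)"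
   using i xM by (auto simp: mem_B power2_eq_square power3_eq_cube mult_ac)
 qed
qed

text \<open>The distance to the complement, written as the largest radius of a ball inside. The
  supremum is meaningful once the complement has a point, such as the \<open>z\<close> of the
  following context.\<close>

definition wrad :: "'a set \<Rightarrow> 'a \<Rightarrow> real" where
 "wrad \<Omega> x = Sup {r. 0 < r \<and> B x r \<subseteq> \<Omega>}"

context
 fixes \<Omega> :: "'a set" and z :: 'a
 assumes \<Omega>: "qopen \<Omega>" and z: "z \<in> space M" "z \<notin> \<Omega>"
begin

lemma wrad_bdd: "x \<in> \<Omega> \<Longrightarrow> bdd_above {r. 0 < r \<and> B x r \<subseteq> \<Omega>}"
proof (rule bdd_aboveI[of _ "d x z"])
 fix r assume "r \<in> {r. 0 < r \<and> B x r \<subseteq> \<Omega>}"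
 then have "z \<notin> B x r" using z by blast
 then show "r \<le> d x z" using z by (simp add: mem_B)
qed

lemma wrad_ge: "x \<in> \<Omega> \<Longrightarrow> 0 < r \<Longrightarrow> B x r \<subseteq> \<Omega> \<Longrightarrow> r \<le> wrad \<Omega> x"
 unfolding wrad_def using wrad_bdd by (intro cSup_upper) auto

lemma wrad_pos: "x \<in> \<Omega> \<Longrightarrow> wrad \<Omega> x > 0"
 using qopenD[OF \<Omega>] wrad_ge by (meson less_le_trans)

lemma wrad_subset:
 assumes "x \<in> \<Omega>" shows "B x (wrad \<Omega> x) \<subseteq> \<Omega>"
proof
 fix y assume y: "y \<in> B x (wrad \<Omega> x)"
 then have "d x y < Sup {r. 0 < r \<and> B x r \<subseteq> \<Omega>}" by (simp add: mem_B wrad_def)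
 moreover have "{r. 0 < r \<and> B x r \<subseteq> \<Omega>} \<noteq> {}" using qopenD[OF \<Omega> assms] by auto
 ultimately obtain r where "B x r \<subseteq> \<Omega>" "d x y < r"
  using wrad_bdd[OF assms] by (auto simp: less_cSup_iff)
 then show "y \<in> \<Omega>" using y by (auto simp: mem_B)
qed

lemma wrad_exit:
 assumes "x \<in> \<Omega>" "wrad \<Omega> x < r"
 obtains y where "y \<in> space M" "y \<notin> \<Omega>" "d x y < r"
proof -
 have "\<not> B x r \<subseteq> \<Omega>" using assms wrad_ge[of x r] wrad_pos[of x] by auto
 then obtain y where "y \<in> B x r" "y \<notin> \<Omega>" by blast
 then show ?thesis using that[of y] by (simp add: mem_B)
qed

lemma whitney_wrad: "whitney \<Omega> (wrad \<Omega>)"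
 unfolding whitney_def
proof (intro conjI ballI)
 fix x y assume x: "x \<in> \<Omega>" and y: "y \<in> \<Omega>"
 have xy: "x \<in> space M" "y \<in> space M" using x y qopen_subset[OF \<Omega>] by auto
 have "wrad \<Omega> x \<le> c_d * (d x y + wrad \<Omega> y)"
 proof (rule ccontr)
  assume "\<not> ?thesis"
  then have 1: "c_d * (d x y + wrad \<Omega> y) < wrad \<Omega> x" by simp
  \<comment> \<open>The distance from \<open>y\<close> below which a point outside \<Omega> would be
    closer to \<open>x\<close> than \<open>wrad \<Omega> x\<close>.\<close>
  define s where "s = wrad \<Omega> x / c_d - d x y"
  have "wrad \<Omega> y < s" using 1 c_d by (simp add: s_def field_simps)
  then obtain w where w: "w \<in> space M" "w \<notin> \<Omega>" "d y w < s" using wrad_exit[OF y] by blast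
  have "d x w \<le> c_d * (d x y + d y w)" using w xy by (intro quasi_triangle) auto
  also have "... < c_d * (d x y + s)" using w c_d by (intro mult_strict_left_mono) auto
  also have "... = wrad \<Omega> x" using c_d by (simp add: s_def)
  finally have "w \<in> B x (wrad \<Omega> x)" using w by (simp add: mem_B)
  then show False using wrad_subset[OF x] w by blast
 qed
 \<comment> \<open>The distance function satisfies the bound already with \<open>c_d\<close>; the
   square accommodates the radius chosen on the whole space.\<close>
 also have "... \<le> c_d\<^sup>2 * (d x y + wrad \<Omega> y)"
  using cd2 nonneg[OF xy] wrad_pos[OF y] by (intro mult_right_mono) auto
 finally show "wrad \<Omega> x \<le> c_d\<^sup>2 * (d x y + wrad \<Omega> y)" .
qed (use \<Omega> wrad_pos wrad_subset in auto)

end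

text \<open>The new open set consists of the points around which \<open>\<Union>i\<in>I. bad i\<close> has density above \<open>\<tau>\<close> at
 some small scale.\<close>

lemma whitney_step:
 assumes w: "whitney \<Omega> \<rho>" and a: "a > 0" "1000 * (c_d\<^sup>2)^8 * a \<le> 1"
  and I: "I \<subseteq> \<Omega>" "countable I" "disjoint_family_on (\<lambda>i. B i (a * \<rho> i)) I"
  and bad: "\<And>i. i \<in> I \<Longrightarrow> bad i \<in> sets M" "\<And>i. i \<in> I \<Longrightarrow> bad i \<subseteq> B i (13 * (c_d\<^sup>2)^4 * a * \<rho> i)"
   "\<And>i. i \<in> I \<Longrightarrow> measure M (bad i) \<le> \<epsilon> * V i (a * \<rho> i)"
  and \<tau>: "0 < \<tau>" "\<tau> < 1" and \<epsilon>: "\<epsilon> > 0"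
   "dq 5 * dq 3 / \<tau> * \<epsilon> * dbl c_mu (1 / a) \<le> 1/2"
 obtains \<Omega>' where "qopen \<Omega>'" "\<Omega>' \<subseteq> \<Omega>"
  "\<And>y. y \<in> \<Omega> \<Longrightarrow> measure M (\<Omega>' \<inter> B y (a * \<rho> y)) \<le> V y (a * \<rho> y) / 2"
  "AE x in M. x \<in> (\<Union>i\<in>I. bad i) \<longrightarrow> x \<in> \<Omega>'"
  "\<And>x r. x \<in> \<Omega> \<Longrightarrow> x \<notin> \<Omega>' \<Longrightarrow> 0 < r \<Longrightarrow> r \<le> 6 * (c_d\<^sup>2)^2 * a * \<rho> x \<Longrightarrow>
    measure M ((\<Union>i\<in>I. bad i) \<inter> B x r) \<le> \<tau> * V x r"
proof -
 define q where "q = c_d\<^sup>2"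
 have q1: "q \<ge> 1" and cq: "c_d \<le> q" using cd2 by (auto simp: q_def)
 have small: "n * q^k * a \<le> 1" if "n \<le> 1000" "k \<le> 8" "0 \<le> n" for n k
  using small_power[OF a(1,2) that] by (simp only: q_def)
 define G where "G = (\<Union>i\<in>I. bad i)"
 have Gs: "G \<in> sets M" unfolding G_def using I(2) bad(1) by (intro sets.countable_UN'') auto
 have \<rho>pos: "\<And>x. x \<in> \<Omega> \<Longrightarrow> 0 < \<rho> x" and \<Omega>M: "\<And>x. x \<in> \<Omega> \<Longrightarrow> x \<in> space M"
  using whitneyD[OF w] by auto
 \<comment> \<open>The scales reach as far as the next generation asks: \<open>3 * q\<close> times a
   new Whitney radius, measured at a nearby point that stays outside, is at most this bound.\<close>
 define \<Omega>' where "\<Omega>' = (\<Union>(x, r)\<in>{(x, r). x \<in> \<Omega> \<and> 0 < r \<and> r \<le> 6 * q^2 * a * \<rho> x \<and>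
   measure M (G \<inter> B x r) > \<tau> * V x r}. U x r)"
 have in\<Omega>': "U x r \<subseteq> \<Omega>'" if "x \<in> \<Omega>" "0 < r" "r \<le> 6 * q^2 * a * \<rho> x" "measure M (G \<inter> B x r) > \<tau> * V x r" for x r
  using that unfolding \<Omega>'_def by blast
 \<comment> \<open>The exceptional sets meeting this ball are charged to the disjoint balls
   \<open>B i (a * \<rho> i)\<close>, all of which lie in \<open>B y (\<rho> y)\<close>. The radius
   with \<open>49 * q^6\<close> is the reach of the balls used for the maximal function
   below.\<close>
 have G_thin: "emeasure M (G \<inter> B y (49 * q^6 * a * \<rho> y)) \<le> ennreal \<epsilon> * emeasure M (B y (\<rho> y))"
  if y: "y \<in> \<Omega>" for y
 proof -
  define \<beta> where "\<beta> = 49 * q^6 * a"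
  have yM: "y \<in> space M" and py: "\<rho> y > 0" using y \<rho>pos \<Omega>M by auto
  define J where "J = {i\<in>I. bad i \<inter> B y (\<beta> * \<rho> y) \<noteq> {}}"
  have "G \<inter> B y (\<beta> * \<rho> y) = (\<Union>i\<in>J. bad i \<inter> B y (\<beta> * \<rho> y))"
   by (auto simp: G_def J_def)
  also have "emeasure M ... \<le> ennreal \<epsilon> * emeasure M (\<Union>i\<in>J. B i (a * \<rho> i))"
  proof (rule emeasure_UN_le_disjoint)
   show "countable J" using I(2) by (rule countable_subset[rotated]) (auto simp: J_def)
   show "disjoint_family_on (\<lambda>i. B i (a * \<rho> i)) J"
    using I(3) by (rule disjoint_family_on_mono[rotated]) (auto simp: J_def)
   fix i assume "i \<in> J"
   then have i: "i \<in> I" "i \<in> \<Omega>" "i \<in> space M" using I(1) \<Omega>M by (auto simp: J_def)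
   show "bad i \<inter> B y (\<beta> * \<rho> y) \<in> sets M" "B i (a * \<rho> i) \<in> sets M"
    using bad(1)[OF i(1)] yM i by auto
   have "emeasure M (bad i \<inter> B y (\<beta> * \<rho> y)) \<le> emeasure M (bad i)"
    using bad(1)[OF i(1)] by (intro emeasure_mono) auto
   also have "... = ennreal (measure M (bad i))"
    using emeasure_eq_measure_subset_B[OF i(3) bad(2)[OF i(1)]] .
   also have "... \<le> ennreal (\<epsilon> * V i (a * \<rho> i))"
    using bad(3)[OF i(1)] by (rule ennreal_leI)
   finally show "emeasure M (bad i \<inter> B y (\<beta> * \<rho> y)) \<le> ennreal \<epsilon> * emeasure M (B i (a * \<rho> i))"
    using i \<epsilon> V_nonneg by (simp add: emeasure_B ennreal_mult)
  qed
  also have "... \<le> ennreal \<epsilon> * emeasure M (B y (\<rho> y))"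
  proof (intro mult_left_mono emeasure_mono UN_least)
   fix i assume "i \<in> J"
   then have i: "i \<in> I" "i \<in> \<Omega>" "i \<in> space M" using I(1) \<Omega>M by (auto simp: J_def)
   have pi: "\<rho> i > 0" using \<rho>pos i by auto
   obtain z where z: "z \<in> bad i" "z \<in> B y (\<beta> * \<rho> y)" using \<open>i \<in> J\<close> by (auto simp: J_def)
   have zi: "z \<in> space M" "d i z < 13 * q^4 * a * \<rho> i" "d y z < \<beta> * \<rho> y"
    using z bad(2)[OF i(1)] by (auto simp: mem_B q_def)
   have \<beta>1: "\<beta> * (2 * c_d\<^sup>2) \<le> 1" and a21: "13 * q^4 * a * (2 * c_d\<^sup>2) \<le> 1"
    unfolding \<beta>_def q_def[symmetric] using small[of 98 7] small[of 26 5]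
    by (simp_all add: power_numeral_reduce mult_ac)
   have "\<rho> i \<le> 2 * q * \<rho> z"
    using whitney_compare'(2)[OF w i(2) zi(1) _ a21] zi(2) by (simp add: q_def)
   also have "... \<le> 2 * q * (2 * q * \<rho> y)"
    using whitney_compare'(3)[OF w y zi(1) zi(3) \<beta>1] q1 by (intro mult_left_mono) (auto simp: q_def)
   finally have r: "\<rho> i \<le> 4 * q^2 * \<rho> y" by (simp add: power2_eq_square)
   have "B i (a * \<rho> i) \<subseteq> B z (c_d * (13 * q^4 * a * \<rho> i + a * \<rho> i))"
    using zi i by (intro B_subset[where s="13 * q^4 * a * \<rho> i"]) (auto simp: sym[of z i])
   also have "... \<subseteq> B y (\<rho> y)"
   proof (rule B_subset[where s="\<beta> * \<rho> y"])
    have "13 * q^4 * a * \<rho> i + a * \<rho> i = (13 * q^4 + 1) * a * \<rho> i" by (simp add: algebra_simps)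
    also have "... \<le> (14 * q^4) * a * (4 * q^2 * \<rho> y)"
     using one_le_power[OF q1, of 4] a r pi by (intro mult_mono) auto
    also have "... = 56 * q^6 * a * \<rho> y" by (simp add: power_numeral_reduce)
    finally have "c_d * (13 * q^4 * a * \<rho> i + a * \<rho> i) \<le> q * (56 * q^6 * a * \<rho> y)"
     using cq c_d q1 py a pi by (intro mult_mono) auto
    then have "c_d * (\<beta> * \<rho> y + c_d * (13 * q^4 * a * \<rho> i + a * \<rho> i))
      \<le> q * (\<beta> * \<rho> y + q * (56 * q^6 * a * \<rho> y))"
     using cq c_d q1 py a pi by (intro mult_mono[OF cq add_left_mono]) (auto simp: \<beta>_def)
    also have "... = (49 * q^7 * a + 56 * q^8 * a) * \<rho> y"
     by (simp add: \<beta>_def algebra_simps power_numeral_reduce)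
    also have "... \<le> 1 * \<rho> y"
    proof (rule mult_right_mono)
     have "49 * q^7 * a \<le> 49 * q^8 * a" using q1 a by (intro mult_right_mono mult_left_mono power_increasing) auto
     then show "49 * q^7 * a + 56 * q^8 * a \<le> 1" using small[of 105 8] by linarith
    qed (use py in auto)
    finally show "c_d * (\<beta> * \<rho> y + c_d * (13 * q^4 * a * \<rho> i + a * \<rho> i)) \<le> \<rho> y" by simp
   qed (use zi yM in auto)
   finally show "B i (a * \<rho> i) \<subseteq> B y (\<rho> y)" .
  qed (use yM in auto)
  finally show ?thesis by (simp add: \<beta>_def)
 qed
 show ?thesis
 proof (rule that[of \<Omega>'])
  show op: "qopen \<Omega>'" unfolding \<Omega>'_def by (intro openin_Union) (auto simp: U_open)
  show "\<Omega>' \<subseteq> \<Omega>"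
  proof
   fix v assume "v \<in> \<Omega>'"
   then obtain x r where xr: "x \<in> \<Omega>" "r \<le> 6 * q^2 * a * \<rho> x" "v \<in> U x r" by (auto simp: \<Omega>'_def)
   have "6 * q^2 * a * \<rho> x \<le> 1 * \<rho> x" using small[of 6 2] \<rho>pos[OF xr(1)] by (intro mult_right_mono) auto
   then have "v \<in> B x (\<rho> x)" using xr U_subset B_mono[of r "\<rho> x" x] by auto
   then show "v \<in> \<Omega>" using whitneyD(4)[OF w xr(1)] by blast
  qed
  show "measure M (\<Omega>' \<inter> B y (a * \<rho> y)) \<le> V y (a * \<rho> y) / 2" if y: "y \<in> \<Omega>" for y
  proof -
   have yM: "y \<in> space M" and py: "\<rho> y > 0" using y \<rho>pos \<Omega>M by auto
   define H where "H = G \<inter> B y (49 * q^6 * a * \<rho> y)"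
   have H: "H \<in> sets M" using Gs yM by (simp add: H_def)
   let ?N = "density M (indicator H)"
   \<comment> \<open>The maximal inequality is centred, so a ball of high density around
     \<open>x\<close> has to be recentred at the given point \<open>v\<close>; this costs the factor
     \<open>dq 3\<close>.\<close>
   define l where "l = \<tau> / dq 3"
   have l: "l > 0" using \<tau> dbl_pos by (simp add: l_def)
   obtain A where A: "A \<in> sets M" "emeasure M A \<le> ennreal (dq 5 / l) * emeasure ?N (space M)"
    "\<And>v r. v \<in> space M \<Longrightarrow> v \<notin> A \<Longrightarrow> 0 < r \<Longrightarrow> r \<le> 2 * c_d * (24 * q^4 * a * \<rho> y) \<Longrightarrow>
     emeasure ?N (B v r) \<le> ennreal l * emeasure M (B v r)"
    using weak_maximal[of ?N l "2 * c_d * (24 * q^4 * a * \<rho> y)"] l by auto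
   have "\<Omega>' \<inter> B y (a * \<rho> y) \<subseteq> A"
   proof (rule subsetI, rule ccontr)
    fix v assume v: "v \<in> \<Omega>' \<inter> B y (a * \<rho> y)" and vA: "v \<notin> A"
    then obtain x r where x: "x \<in> \<Omega>" and r: "0 < r" "r \<le> 6 * q^2 * a * \<rho> x"
     and vU: "v \<in> U x r" and G: "measure M (G \<inter> B x r) > \<tau> * V x r" by (auto simp: \<Omega>'_def)
    have xM: "x \<in> space M" and px: "\<rho> x > 0" using x \<rho>pos \<Omega>M by auto
    have "v \<in> B x r" using vU U_subset by blast
    then have vM: "v \<in> space M" "d x v < r" "d y v < a * \<rho> y" using v by (auto simp: mem_B)
    have "\<rho> x \<le> 2 * q * \<rho> v"
     using whitney_compare'(2)[OF w x vM(1), of "6 * q^2 * a"] vM(2) r small[of 12 3]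
     unfolding q_def[symmetric] by (simp add: power_numeral_reduce mult_ac)
    also have "... \<le> 2 * q * (2 * q * \<rho> y)"
     using whitney_compare'(3)[OF w y vM(1,3)] small[of 2 1] q1
     unfolding q_def[symmetric] by (intro mult_left_mono) (auto simp: mult_ac)
    finally have r1: "\<rho> x \<le> 4 * q^2 * \<rho> y" by (simp add: power2_eq_square)
    have "r \<le> 6 * q^2 * a * (4 * q^2 * \<rho> y)"
     by (rule order_trans[OF r(2) mult_left_mono[OF r1]]) (use a q1 in auto)
    then have r2: "r \<le> 24 * q^4 * a * \<rho> y" by (simp add: power_numeral_reduce mult_ac)
    have dvx: "d v x \<le> r" using vM xM sym[of v x] by simp
    have s1: "B x r \<subseteq> B v (2 * c_d * r)"
     using dvx xM vM by (intro B_subset[where s=r]) auto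
    have s2: "B v (2 * c_d * r) \<subseteq> B y (49 * q^6 * a * \<rho> y)"
    proof (rule B_subset[where s="a * \<rho> y"])
     have "2 * c_d * r \<le> 2 * q * (24 * q^4 * a * \<rho> y)"
      using cq c_d r2 q1 r by (intro mult_mono) auto
     then have "c_d * (a * \<rho> y + 2 * c_d * r) \<le> q * (a * \<rho> y + 2 * q * (24 * q^4 * a * \<rho> y))"
      using q1 py a r c_d by (intro mult_mono[OF cq add_left_mono]) auto
     also have "... = (q^1 + 48 * q^6) * (a * \<rho> y)" by (simp add: algebra_simps power_numeral_reduce)
     also have "... \<le> (q^6 + 48 * q^6) * (a * \<rho> y)"
      using q1 a py power_increasing[of 1 6 q] by (intro mult_right_mono add_right_mono) auto
     finally show "c_d * (a * \<rho> y + 2 * c_d * r) \<le> 49 * q^6 * a * \<rho> y" by (simp add: mult_ac)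
    qed (use vM yM in auto)
    have "V v (2 * c_d * r) \<le> dq 3 * V x r"
    proof (rule V_compare[where s=r])
     have "c_d * (r + 2 * c_d * r) = (c_d + 2 * c_d\<^sup>2) * r" by (simp add: algebra_simps power2_eq_square)
     also have "... \<le> (3 * c_d\<^sup>2) * r" using cd2 r by (intro mult_right_mono) auto
     finally show "c_d * (r + 2 * c_d * r) \<le> 3 * c_d\<^sup>2 * r" .
    qed (use vM xM r c_d in auto)
    then have "l * V v (2 * c_d * r) \<le> l * (dq 3 * V x r)"
     using l by (intro mult_left_mono) auto
    also have "... = \<tau> * V x r" using dbl_pos[of "3 * c_d\<^sup>2"] by (simp add: l_def)
    also have "... < measure M (G \<inter> B x r)" by fact
    finally have "ennreal (l * V v (2 * c_d * r)) < emeasure M (G \<inter> B x r)"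
     using emeasure_eq_measure_subset_B[OF xM, of "G \<inter> B x r" r] l V_nonneg
     by (simp add: ennreal_less_iff)
    also have "... \<le> emeasure M (H \<inter> B v (2 * c_d * r))"
     using s1 s2 H vM by (intro emeasure_mono) (auto simp: H_def)
    also have "... = emeasure ?N (B v (2 * c_d * r))"
     using H vM by (simp add: emeasure_restricted)
    also have "... \<le> ennreal l * emeasure M (B v (2 * c_d * r))"
     using vM vA r r2 c_d by (intro A(3) mult_left_mono) auto
    finally show False using vM l V_nonneg by (simp add: emeasure_B ennreal_mult)
   qed
   then have "emeasure M (\<Omega>' \<inter> B y (a * \<rho> y)) \<le> emeasure M A"
    using A(1) by (intro emeasure_mono)
   also have "... \<le> ennreal (dq 5 / l) * (ennreal \<epsilon> * emeasure M (B y (\<rho> y)))"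
   proof (rule order_trans[OF A(2)], rule mult_left_mono)
    have "emeasure ?N (space M) = emeasure M H"
     using H sets.sets_into_space[OF H] by (simp add: emeasure_restricted Int_absorb2)
    then show "emeasure ?N (space M) \<le> ennreal \<epsilon> * emeasure M (B y (\<rho> y))"
     using G_thin[OF y] by (simp add: H_def)
   qed simp
   also have "... = ennreal (dq 5 / l * (\<epsilon> * V y (\<rho> y)))"
    using yM \<epsilon> l dbl_pos[of "5 * c_d\<^sup>2"] V_nonneg by (simp add: emeasure_B flip: ennreal_mult)
   also have "... \<le> ennreal (V y (a * \<rho> y) / 2)"
   proof (rule ennreal_leI)
    have "V y (\<rho> y) \<le> dbl c_mu (1 / a) * V y (a * \<rho> y)"
     using V_dbl[of y "a * \<rho> y" "1 / a"] yM a py by simp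
    then have "dq 5 / l * (\<epsilon> * V y (\<rho> y))
      \<le> dq 5 / l * (\<epsilon> * (dbl c_mu (1 / a) * V y (a * \<rho> y)))"
     using l \<epsilon> dbl_pos[of "5 * c_d\<^sup>2"] by (intro mult_left_mono) auto
    also have "... = (dq 5 * dq 3 / \<tau> * \<epsilon> * dbl c_mu (1 / a)) * V y (a * \<rho> y)"
     by (simp add: l_def)
    also have "... \<le> (1/2) * V y (a * \<rho> y)"
     using \<epsilon> V_nonneg by (intro mult_right_mono) auto
    finally show "dq 5 / l * (\<epsilon> * V y (\<rho> y)) \<le> V y (a * \<rho> y) / 2" by simp
   qed
   finally show ?thesis
    using emeasure_eq_measure_subset_B[OF yM, of "\<Omega>' \<inter> B y (a * \<rho> y)" "a * \<rho> y"] V_nonneg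
    by (simp add: ennreal_le_iff)
  qed
  have "(1 - \<tau>) / 2 > 0" using \<tau> by simp
  from density_points[OF Gs this] AE_space
  show "AE x in M. x \<in> (\<Union>i\<in>I. bad i) \<longrightarrow> x \<in> \<Omega>'"
  proof eventually_elim
   case (elim x)
   show ?case
   proof
    assume "x \<in> (\<Union>i\<in>I. bad i)"
    then have xG: "x \<in> G" by (simp add: G_def)
    then obtain i where i: "i \<in> I" "x \<in> bad i" by (auto simp: G_def)
    then have i': "i \<in> \<Omega>" "x \<in> B i (13 * q^4 * a * \<rho> i)" using I(1) bad(2)[OF i(1)] by (auto simp: q_def)
    then have x\<Omega>: "x \<in> \<Omega>"
     using whitney_compare'(1)[OF w i'(1) elim(2), of "13 * q^4 * a"] small[of 26 5]
     unfolding q_def[symmetric] by (auto simp: mem_B power_numeral_reduce mult_ac)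
    obtain r0 where r0: "r0 > 0" "\<And>r. 0 < r \<Longrightarrow> r < r0 \<Longrightarrow> measure M (B x r - G) \<le> (1 - \<tau>) / 2 * V x r"
     using elim(1) xG \<tau> by auto
    define r where "r = min (r0 / 2) (6 * q^2 * a * \<rho> x)"
    have r: "0 < r" "r < r0" "r \<le> 6 * q^2 * a * \<rho> x"
     using r0 a q1 \<rho>pos[OF x\<Omega>] by (auto simp: r_def min_def)
    have "V x r = measure M (B x r - G) + measure M (G \<inter> B x r)"
     using V_split[OF elim(2) Gs] .
    moreover have "V x r > 0" using V_pos[OF elim(2) r(1)] .
    moreover have "(1 - \<tau>) / 2 * V x r < (1 - \<tau>) * V x r"
     using \<tau> \<open>V x r > 0\<close> by simp
    ultimately have "measure M (G \<inter> B x r) > \<tau> * V x r"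
     using r0(2)[OF r(1,2)] by (simp add: algebra_simps)
    then show "x \<in> \<Omega>'" using in\<Omega>'[OF x\<Omega> r(1,3)] U_center[OF elim(2) r(1)] by blast
   qed
  qed
  fix x r assume x: "x \<in> \<Omega>" "x \<notin> \<Omega>'" "0 < r" "r \<le> 6 * (c_d\<^sup>2)^2 * a * \<rho> x"
  show "measure M ((\<Union>i\<in>I. bad i) \<inter> B x r) \<le> \<tau> * V x r"
  proof (rule ccontr)
   assume "\<not> ?thesis"
   then have "U x r \<subseteq> \<Omega>'" using x by (intro in\<Omega>') (auto simp: G_def q_def)
   then show False using U_center[OF \<Omega>M[OF x(1)] x(3)] x(2) by blast
  qed
 qed
qed


section \<open>Stopping generations\<close>

text \<open>The whole space has no boundary, hence this substitute for the distance to it. The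
  radius is so large that the ball around any \<open>x\<close> contains \<open>B s0 r0\<close>, so
  the truncations of the zeroth generation do not change a function supported there.\<close>

lemma whitney_initial:
 assumes "s0 \<in> space M" "r0 > 0"
 shows "whitney (space M) (\<lambda>x. c_d * (d x s0 + r0))"
 unfolding whitney_def
proof (intro conjI ballI)
 show "qopen (space M)" unfolding openin_qtopology using B_space by (auto intro: exI[of _ 1])
 fix x y assume x: "x \<in> space M" and y: "y \<in> space M"
 show "0 < c_d * (d x s0 + r0)" using c_d nonneg[OF x assms(1)] assms(2) by (simp add: add_nonneg_pos)
 show "B x (c_d * (d x s0 + r0)) \<subseteq> space M" by (rule B_space)
 have "d x s0 \<le> c_d * (d x y + d y s0)" using x y assms by (intro quasi_triangle) auto
 then have "d x s0 + r0 \<le> c_d * (d x y + d y s0) + c_d * r0"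
  using c_d assms(2) by (intro add_mono) (auto simp: mult_le_cancel_right1)
 then have "c_d * (d x s0 + r0) \<le> c_d * (c_d * (d x y + d y s0) + c_d * r0)"
  using c_d by (intro mult_left_mono) auto
 also have "... = c_d\<^sup>2 * (d x y + (d y s0 + r0))" by (simp add: algebra_simps power2_eq_square)
 also have "... \<le> c_d\<^sup>2 * (d x y + c_d * (d y s0 + r0))"
  using c_d assms(2) nonneg[OF y assms(1)]
  by (intro mult_left_mono add_left_mono) (auto simp: mult_le_cancel_right1)
 finally show "c_d * (d x s0 + r0) \<le> c_d\<^sup>2 * (d x y + c_d * (d y s0 + r0))" .
qed

text \<open>Covering balls of one generation are not nested in those of the previous one. But the
  radii shrink by \<open>a\<close>, so a child whose covering ball shares a point with that of its
  parent stays deep inside the parent. The constant is 13 = 5 + 4 + 4.\<close>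

lemma whitney_descendant_subset:
 assumes w: "whitney \<Omega> \<rho>" and a: "a > 0" "1000 * (c_d\<^sup>2)^8 * a \<le> 1"
  and i: "i \<in> \<Omega>" and j: "j \<in> \<Omega>" "0 < \<rho>'" "\<rho>' \<le> a * \<rho> j"
  and x: "x \<in> B i (5 * (c_d\<^sup>2)^3 * a * \<rho> i)" "x \<in> B j (5 * (c_d\<^sup>2)^3 * a * \<rho>')"
 shows "B j \<rho>' \<subseteq> B i (13 * (c_d\<^sup>2)^4 * a * \<rho> i)"
proof -
 define q where "q = c_d\<^sup>2"
 have q1: "q \<ge> 1" and cq: "c_d \<le> q" using cd2 by (auto simp: q_def)
 have small: "n * q^k * a \<le> 1" if "n \<le> 1000" "k \<le> 8" "0 \<le> n" for n k
  using small_power[OF a(1,2) that] by (simp only: q_def)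
 have M: "i \<in> space M" "j \<in> space M" "x \<in> space M" and p: "\<rho> i > 0" "\<rho> j > 0"
  using i j x whitneyD(2,3)[OF w] by (auto simp: mem_B)
 have dix: "d i x < 5 * q^3 * a * \<rho> i" and djx: "d j x < 5 * q^3 * a * \<rho>'"
  using x by (auto simp: mem_B q_def)
 have "5 * q^3 * a * \<rho>' \<le> 1 * \<rho>'" using small[of 5 3] j by (intro mult_right_mono) auto
 then have djx': "d j x < \<rho>'" using djx by simp
 then have "d j x < a * \<rho> j" using j by simp
 then have "\<rho> j \<le> 2 * q * \<rho> x"
  using whitney_compare'(2)[OF w j(1) M(3), of a] small[of 2 1]
  unfolding q_def[symmetric] by (simp add: mult_ac)
 also have "... \<le> 2 * q * (2 * q * \<rho> i)"
  using whitney_compare'(3)[OF w i M(3), of "5 * q^3 * a"] small[of 10 4] dix q1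
  unfolding q_def[symmetric] by (intro mult_left_mono) (auto simp: power_numeral_reduce mult_ac)
 finally have "a * \<rho> j \<le> a * (4 * q^2 * \<rho> i)"
  using a by (intro mult_left_mono) (auto simp: power2_eq_square)
 then have r': "\<rho>' \<le> 4 * q^2 * a * \<rho> i" using j by (simp add: mult_ac)
 have "B j \<rho>' \<subseteq> B x (c_d * (\<rho>' + \<rho>'))"
  using M djx' by (intro B_subset[where s=\<rho>']) (auto simp: sym[of x j])
 also have "... \<subseteq> B i (13 * q^4 * a * \<rho> i)"
 proof (rule B_subset[where s="5 * q^3 * a * \<rho> i"])
  have "c_d * (\<rho>' + \<rho>') \<le> q * (4 * q^2 * a * \<rho> i + 4 * q^2 * a * \<rho> i)"
   using cq r' q1 j by (intro mult_mono add_mono) auto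
  then have "c_d * (5 * q^3 * a * \<rho> i + c_d * (\<rho>' + \<rho>'))
    \<le> q * (5 * q^3 * a * \<rho> i + q * (4 * q^2 * a * \<rho> i + 4 * q^2 * a * \<rho> i))"
   using q1 a p c_d j by (intro mult_mono[OF cq add_left_mono]) auto
  also have "... = 13 * q^4 * a * \<rho> i" by (simp add: power_numeral_reduce)
  finally show "c_d * (5 * q^3 * a * \<rho> i + c_d * (\<rho>' + \<rho>')) \<le> 13 * q^4 * a * \<rho> i" .
 qed (use M dix in auto)
 finally show ?thesis by (simp add: q_def)
qed

text \<open>As \<open>\<Omega> (Suc k)\<close> fills at most half of each
  \<open>B y (a * \<rho> k y)\<close>, it contains none of them. This fact yields the point of the
  complement that \<open>wrad\<close> asks for, the decay of the radii by \<open>a\<close> and,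
  through density points, the null intersection of all generations.\<close>

lemma stopping_generations:
 assumes a: "a > 0" "1000 * (c_d\<^sup>2)^8 * a \<le> 1"
  and \<tau>: "\<tau> > 0" "\<tau> < 1" "\<tau> * dbl c_mu (1 / (c_d\<^sup>2 * a)) \<le> 1/4"
  and \<epsilon>: "\<epsilon> > 0" "dq 5 * dq 3 / \<tau> * \<epsilon> * dbl c_mu (1 / a) \<le> 1/2"
  and bad: "\<And>x r. x \<in> space M \<Longrightarrow> r > 0 \<Longrightarrow> bad x r \<in> sets M"
   "\<And>x r. x \<in> space M \<Longrightarrow> r > 0 \<Longrightarrow> bad x r \<subseteq> B x (13 * (c_d\<^sup>2)^4 * a * r)"
   "\<And>x r. x \<in> space M \<Longrightarrow> r > 0 \<Longrightarrow> measure M (bad x r) \<le> \<epsilon> * V x (a * r)"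
  and s0: "s0 \<in> space M" "r0 > 0"
 obtains \<Omega> :: "nat \<Rightarrow> 'a set" and \<rho> :: "nat \<Rightarrow> 'a \<Rightarrow> real" and I :: "nat \<Rightarrow> 'a set" where
  "\<Omega> 0 = space M" "\<rho> 0 = (\<lambda>x. c_d * (d x s0 + r0))"
  "\<And>k. whitney (\<Omega> k) (\<rho> k)" "\<And>k. I k \<subseteq> \<Omega> k" "\<And>k. countable (I k)"
  "\<And>k. disjoint_family_on (\<lambda>i. B i (a * \<rho> k i)) (I k)"
  "\<And>k x. x \<in> \<Omega> k \<Longrightarrow> \<exists>i\<in>I k. x \<in> B i (5 * (c_d\<^sup>2)^3 * a * \<rho> k i)"
  "\<And>k. \<Omega> (Suc k) \<subseteq> \<Omega> k"
  "\<And>k y. y \<in> \<Omega> k \<Longrightarrow> measure M (\<Omega> (Suc k) \<inter> B y (a * \<rho> k y)) \<le> V y (a * \<rho> k y) / 2"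
  "\<And>k. AE x in M. x \<in> (\<Union>i\<in>I k. bad i (\<rho> k i)) \<longrightarrow> x \<in> \<Omega> (Suc k)"
  "\<And>k x. x \<in> \<Omega> (Suc k) \<Longrightarrow> \<rho> (Suc k) x \<le> a * \<rho> k x"
  "\<And>k i j. j \<in> \<Omega> (Suc k) \<Longrightarrow> i \<in> I k \<Longrightarrow>
    measure M (bad i (\<rho> k i) \<inter> B j (5 * (c_d\<^sup>2)^3 * a * \<rho> (Suc k) j))
     \<le> V j (5 * (c_d\<^sup>2)^3 * a * \<rho> (Suc k) j) / 4"
  "AE x in M. \<exists>k. x \<notin> \<Omega> k"
proof -
 define q where "q = c_d\<^sup>2"
 have q1: "q \<ge> 1" and cq: "c_d \<le> q" using cd2 by (auto simp: q_def)
 have small: "n * q^k * a \<le> 1" if "n \<le> 1000" "k \<le> 8" "0 \<le> n" for n k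
  using small_power[OF a(1,2) that] by (simp only: q_def)
 have a2: "a * (2 * c_d\<^sup>2) \<le> 1" using small[of 2 1] by (simp add: q_def mult_ac)
 define P where "P = (\<lambda>(n::nat) (\<Omega>, \<rho>, I). whitney \<Omega> \<rho> \<and> I \<subseteq> \<Omega> \<and> countable I \<and>
   disjoint_family_on (\<lambda>i. B i (a * \<rho> i)) I \<and> (\<forall>x\<in>\<Omega>. \<exists>i\<in>I. x \<in> B i (5 * (c_d\<^sup>2)^3 * a * \<rho> i)) \<and>
   (n = 0 \<longrightarrow> \<Omega> = space M \<and> \<rho> = (\<lambda>x. c_d * (d x s0 + r0))))"
 define Q where "Q = (\<lambda>(n::nat) (\<Omega>, \<rho>, I) (\<Omega>', \<rho>', I'::'a set). \<Omega>' \<subseteq> \<Omega> \<and>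
   (\<forall>y\<in>\<Omega>. measure M (\<Omega>' \<inter> B y (a * \<rho> y)) \<le> V y (a * \<rho> y) / 2) \<and>
   (AE x in M. x \<in> (\<Union>i\<in>I. bad i (\<rho> i)) \<longrightarrow> x \<in> \<Omega>') \<and> (\<forall>x\<in>\<Omega>'. \<rho>' x \<le> a * \<rho> x) \<and>
   (\<forall>j\<in>\<Omega>'. \<forall>i\<in>I. measure M (bad i (\<rho> i) \<inter> B j (5 * (c_d\<^sup>2)^3 * a * \<rho>' j))
     \<le> V j (5 * (c_d\<^sup>2)^3 * a * \<rho>' j) / 4))"
 have "\<exists>s. \<forall>n. P n (s n) \<and> Q n (s n) (s (Suc n))"
 proof (rule dependent_nat_choice)
  obtain I where "I \<subseteq> space M" "countable I"
   "disjoint_family_on (\<lambda>i. B i (a * (c_d * (d i s0 + r0)))) I"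
   "\<And>x. x \<in> space M \<Longrightarrow> \<exists>i\<in>I. x \<in> B i (5 * (c_d\<^sup>2)^3 * a * (c_d * (d i s0 + r0)))"
   using whitney_cover[OF whitney_initial[OF s0] a(1) a2] by blast
  then have "P 0 (space M, (\<lambda>x. c_d * (d x s0 + r0)), I)"
   using whitney_initial[OF s0] by (auto simp: P_def)
  then show "\<exists>x. P 0 x" by blast
 next
  fix s n assume Ps: "P n s"
  obtain \<Omega> \<rho> I where s: "s = (\<Omega>, \<rho>, I)" by (cases s)
  have w: "whitney \<Omega> \<rho>" and I: "I \<subseteq> \<Omega>" "countable I" "disjoint_family_on (\<lambda>i. B i (a * \<rho> i)) I"
   using Ps by (auto simp: P_def s)
  note \<Omega>M = whitneyD(2)[OF w] and \<rho>pos = whitneyD(3)[OF w]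
  have b: "bad i (\<rho> i) \<in> sets M" "bad i (\<rho> i) \<subseteq> B i (13 * (c_d\<^sup>2)^4 * a * \<rho> i)"
   "measure M (bad i (\<rho> i)) \<le> \<epsilon> * V i (a * \<rho> i)" if "i \<in> I" for i
   using bad[OF \<Omega>M \<rho>pos] that I(1) by blast+
  obtain \<Omega>' where \<Omega>': "qopen \<Omega>'" "\<Omega>' \<subseteq> \<Omega>"
   "\<And>y. y \<in> \<Omega> \<Longrightarrow> measure M (\<Omega>' \<inter> B y (a * \<rho> y)) \<le> V y (a * \<rho> y) / 2"
   "AE x in M. x \<in> (\<Union>i\<in>I. bad i (\<rho> i)) \<longrightarrow> x \<in> \<Omega>'"
   "\<And>x r. x \<in> \<Omega> \<Longrightarrow> x \<notin> \<Omega>' \<Longrightarrow> 0 < r \<Longrightarrow> r \<le> 6 * (c_d\<^sup>2)^2 * a * \<rho> x \<Longrightarrow>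
     measure M ((\<Union>i\<in>I. bad i (\<rho> i)) \<inter> B x r) \<le> \<tau> * V x r"
   using whitney_step[OF w a I b \<tau>(1,2) \<epsilon>] by blast
  have no_sub: "\<not> B y (a * \<rho> y) \<subseteq> \<Omega>'" if "y \<in> \<Omega>" for y
  proof
   assume "B y (a * \<rho> y) \<subseteq> \<Omega>'"
   then have "\<Omega>' \<inter> B y (a * \<rho> y) = B y (a * \<rho> y)" by blast
   then have "V y (a * \<rho> y) \<le> V y (a * \<rho> y) / 2" using \<Omega>'(3)[OF that] by (simp add: V_def)
   moreover have "V y (a * \<rho> y) > 0" using that a \<Omega>M \<rho>pos by (intro V_pos) auto
   ultimately show False by simp
  qed
  have "\<exists>z. z \<in> space M \<and> z \<notin> \<Omega>'"
  proof (cases "s0 \<in> \<Omega>'")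
   case True
   then have "\<not> B s0 (a * \<rho> s0) \<subseteq> \<Omega>'" using no_sub[of s0] \<Omega>'(2) by blast
   then show ?thesis using B_space by blast
  qed (use s0 in auto)
  then obtain z where z: "z \<in> space M" "z \<notin> \<Omega>'" by blast
  define \<rho>' where "\<rho>' = wrad \<Omega>'"
  note w' = whitney_wrad[OF \<Omega>'(1) z, folded \<rho>'_def]
  have rad: "\<rho>' x \<le> a * \<rho> x" if "x \<in> \<Omega>'" for x
  proof (rule ccontr)
   assume "\<not> ?thesis"
   then have "B x (a * \<rho> x) \<subseteq> \<Omega>'"
    using whitneyD(4)[OF w' that] B_mono[of "a * \<rho> x" "\<rho>' x" x] by auto
   then show False using no_sub[of x] that \<Omega>'(2) by blast
  qed
  have good: "measure M (bad i (\<rho> i) \<inter> B j (5 * (c_d\<^sup>2)^3 * a * \<rho>' j)) \<le> V j (5 * (c_d\<^sup>2)^3 * a * \<rho>' j) / 4"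
   if j: "j \<in> \<Omega>'" and i: "i \<in> I" for i j
  proof -
   have j': "j \<in> \<Omega>" "j \<in> space M" "0 < \<rho>' j" "0 < \<rho> j"
    using j \<Omega>'(2) \<Omega>M \<rho>pos whitneyD(3)[OF w'] by auto
   \<comment> \<open>Densities of the exceptional sets are bounded only at points outside \<Omega>',
     so the estimate is made at an exit point \<open>v\<close>. Passing from the ball around
     \<open>v\<close> to the smaller one around \<open>j\<close> costs
     \<open>dbl c_mu (1 / (q * a))\<close>, which the choice of \<tau> pays for.\<close>
   have "wrad \<Omega>' j < 2 * \<rho>' j" using j' by (simp add: \<rho>'_def)
   then obtain v where v: "v \<in> space M" "v \<notin> \<Omega>'" "d j v < 2 * \<rho>' j"
    using wrad_exit[OF \<Omega>'(1) z j] by blast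
   have "d j v < (2 * a) * \<rho> j" using v(3) rad[OF j] by simp
   then have v\<Omega>: "v \<in> \<Omega>" and jv: "\<rho> j \<le> 2 * q * \<rho> v"
    using whitney_compare'[OF w j'(1) v(1), of "2 * a"] small[of 4 1]
    unfolding q_def[symmetric] by (auto simp: mult_ac)
   \<comment> \<open>Large enough to contain the ball around \<open>j\<close>: that ball has radius
     at most \<open>\<rho>' j\<close> and its centre is within \<open>2 * \<rho>' j\<close> of
     \<open>v\<close>.\<close>
   define r where "r = 3 * q * \<rho>' j"
   have "r \<le> 3 * q * (a * (2 * q * \<rho> v))"
    unfolding r_def using rad[OF j] jv a q1 j' by (intro mult_left_mono order_trans[OF rad[OF j]]) auto
   then have "r \<le> 6 * (c_d\<^sup>2)^2 * a * \<rho> v"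
    unfolding q_def[symmetric] by (simp add: power2_eq_square mult_ac)
   moreover have "r > 0" using q1 j' by (simp add: r_def)
   ultimately have r: "r > 0" "r \<le> 6 * (c_d\<^sup>2)^2 * a * \<rho> v" by simp_all
   define s where "s = 5 * q^3 * a * \<rho>' j"
   have spos: "s > 0" using q1 a j' by (simp add: s_def)
   have s_le: "s \<le> \<rho>' j" using mult_right_mono[OF small[of 5 3], of "\<rho>' j"] j' by (simp add: s_def)
   have "B j s \<subseteq> B v r"
   proof (rule B_subset[where s="2 * \<rho>' j"])
    have "c_d * (2 * \<rho>' j + s) \<le> q * (2 * \<rho>' j + \<rho>' j)"
     using cq s_le q1 j' spos by (intro mult_mono add_left_mono) auto
    then show "c_d * (2 * \<rho>' j + s) \<le> r" by (simp add: r_def)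
   qed (use v j' in \<open>auto simp: sym[of v j]\<close>)
   then have "measure M (bad i (\<rho> i) \<inter> B j s) \<le> measure M ((\<Union>i\<in>I. bad i (\<rho> i)) \<inter> B v r)"
    using v i I(2) b(1) by (intro measure_mono_B[OF v(1), of _ _ r] sets.Int sets.countable_UN'') auto
   also have "... \<le> \<tau> * V v r" by (rule \<Omega>'(5)[OF v\<Omega> v(2) r])
   also have "... \<le> \<tau> * (dbl c_mu (1 / (q * a)) * V j s)"
   proof (intro mult_left_mono V_compare[where s="2 * \<rho>' j"])
    have "c_d * (2 * \<rho>' j + r) \<le> q * (2 * q * \<rho>' j + r)"
     using cq q1 j' r by (intro mult_mono add_right_mono) (auto simp: mult_le_cancel_right1)
    also have "... = 1 / (q * a) * s"
     using q1 a by (simp add: r_def s_def field_simps power_numeral_reduce)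
    finally show "c_d * (2 * \<rho>' j + r) \<le> 1 / (q * a) * s" .
   qed (use v j' q1 a spos \<tau> in auto)
   also have "... = (\<tau> * dbl c_mu (1 / (q * a))) * V j s" by simp
   also have "... \<le> 1/4 * V j s" using \<tau>(3) V_nonneg by (intro mult_right_mono) (auto simp: q_def)
   finally show ?thesis by (simp add: s_def q_def)
  qed
  obtain I' where "I' \<subseteq> \<Omega>'" "countable I'" "disjoint_family_on (\<lambda>i. B i (a * \<rho>' i)) I'"
   "\<And>x. x \<in> \<Omega>' \<Longrightarrow> \<exists>i\<in>I'. x \<in> B i (5 * (c_d\<^sup>2)^3 * a * \<rho>' i)"
   using whitney_cover[OF w' a(1) a2] by blast
  then have "P (Suc n) (\<Omega>', \<rho>', I') \<and> Q n s (\<Omega>', \<rho>', I')"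
   using w' \<Omega>'(2,3,4) rad good by (simp add: P_def Q_def s)
  then show "\<exists>y. P (Suc n) y \<and> Q n s y" by blast
 qed
 then obtain s where s: "\<And>n. P n (s n)" "\<And>n. Q n (s n) (s (Suc n))" by blast
 define \<Omega> where "\<Omega> n = fst (s n)" for n
 define \<rho> where "\<rho> n = fst (snd (s n))" for n
 define I where "I n = snd (snd (s n))" for n
 have seq: "s n = (\<Omega> n, \<rho> n, I n)" for n by (simp add: \<Omega>_def \<rho>_def I_def)
 have P': "whitney (\<Omega> k) (\<rho> k)" "I k \<subseteq> \<Omega> k" "countable (I k)"
  "disjoint_family_on (\<lambda>i. B i (a * \<rho> k i)) (I k)"
  "\<And>x. x \<in> \<Omega> k \<Longrightarrow> \<exists>i\<in>I k. x \<in> B i (5 * (c_d\<^sup>2)^3 * a * \<rho> k i)" for k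
  using s(1)[of k] by (auto simp: P_def seq)
 have P0: "\<Omega> 0 = space M" "\<rho> 0 = (\<lambda>x. c_d * (d x s0 + r0))"
  using s(1)[of 0] by (auto simp: P_def seq)
 have Q': "\<Omega> (Suc k) \<subseteq> \<Omega> k"
  "\<And>y. y \<in> \<Omega> k \<Longrightarrow> measure M (\<Omega> (Suc k) \<inter> B y (a * \<rho> k y)) \<le> V y (a * \<rho> k y) / 2"
  "AE x in M. x \<in> (\<Union>i\<in>I k. bad i (\<rho> k i)) \<longrightarrow> x \<in> \<Omega> (Suc k)"
  "\<And>x. x \<in> \<Omega> (Suc k) \<Longrightarrow> \<rho> (Suc k) x \<le> a * \<rho> k x"
  "\<And>i j. j \<in> \<Omega> (Suc k) \<Longrightarrow> i \<in> I k \<Longrightarrow>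
    measure M (bad i (\<rho> k i) \<inter> B j (5 * (c_d\<^sup>2)^3 * a * \<rho> (Suc k) j))
     \<le> V j (5 * (c_d\<^sup>2)^3 * a * \<rho> (Suc k) j) / 4" for k
  using s(2)[of k] by (simp_all add: Q_def seq)
 \<comment> \<open>At a density point of the intersection the ball of radius
   \<open>a * \<rho> k x\<close> would be filled to three quarters for large \<open>k\<close>,
   whereas the next open set fills at most half of it.\<close>
 have "AE x in M. \<exists>k. x \<notin> \<Omega> k"
 proof -
  define F where "F = (\<Inter>k. \<Omega> k)"
  have Fs: "F \<in> sets M" unfolding F_def using whitneyD(1)[OF P'(1)] qopen_sets by (intro sets.countable_INT) auto
  have a1: "a < 1" using small[of 2 0] a by simp
  have "(1/4 :: real) > 0" by simp
  from density_points[OF Fs this] AE_space show ?thesis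
  proof eventually_elim
   case (elim x)
   show ?case
   proof (rule ccontr)
    assume "\<nexists>k. x \<notin> \<Omega> k"
    then have xk: "\<And>k. x \<in> \<Omega> k" and xF: "x \<in> F" by (auto simp: F_def)
    obtain e where e: "e > 0" "\<And>r. 0 < r \<Longrightarrow> r < e \<Longrightarrow> measure M (B x r - F) \<le> 1/4 * V x r"
     using elim(1) xF by auto
    have dec: "\<rho> k x \<le> a^k * \<rho> 0 x" for k
    proof (induction k)
     case (Suc k)
     have "\<rho> (Suc k) x \<le> a * \<rho> k x" using Q'(4) xk by blast
     also have "... \<le> a * (a^k * \<rho> 0 x)" using Suc a by (intro mult_left_mono) auto
     finally show ?case by simp
    qed simp
    have "(\<lambda>k. a^k * \<rho> 0 x) \<longlonglongrightarrow> 0 * \<rho> 0 x"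
     using a a1 by (intro tendsto_mult LIMSEQ_realpow_zero tendsto_const) auto
    then have "\<forall>\<^sub>F k in sequentially. a^k * \<rho> 0 x < e"
     using e by (intro order_tendstoD(2)) auto
    then obtain k where k: "a^k * \<rho> 0 x < e" by (auto simp: eventually_sequentially)
    define r where "r = a * \<rho> k x"
    have \<rho>k: "\<rho> k x > 0" using whitneyD(3)[OF P'(1) xk] .
    have "r \<le> 1 * \<rho> k x" unfolding r_def using a1 \<rho>k by (intro mult_right_mono) auto
    then have "r < e" using dec[of k] k by linarith
    then have r: "0 < r" "r < e" using \<rho>k a by (auto simp: r_def)
    have "measure M (F \<inter> B x r) \<le> measure M (\<Omega> (Suc k) \<inter> B x r)"
     using elim(2) qopen_sets[OF whitneyD(1)[OF P'(1)]]
     by (intro measure_mono_B[OF elim(2), of _ _ r]) (auto simp: F_def)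
    also have "... \<le> V x r / 2" unfolding r_def by (rule Q'(2)[OF xk])
    finally have "V x r \<le> 1/4 * V x r + V x r / 2"
     using V_split[OF elim(2) Fs, of r] e(2)[OF r] by simp
    then show False using V_pos[OF elim(2) r(1)] by simp
   qed
  qed
 qed
 then show ?thesis
  using that[OF P0 P' Q'] by blast
qed

end

section \<open>Integrable functions\<close>

lemma enn_powr_one [simp]: "enn_powr x 1 = x"
 by (cases x) (auto simp: enn_powr_def)

lemma Lp_norm_1: "Lp_norm M 1 f = L1_mass M f"
 by (simp add: Lp_norm_def)

lemma L1_iff: "f \<in> Lp_space M 1 \<longleftrightarrow> strongly_measurable M f \<and> (L1_mass M f) < \<infinity>"
 by (simp add: Lp_space_def Lp_norm_1)

text \<open>The measure with density \<open>norm f\<close>. It turns masses of \<open>f\<close> on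
  balls into measures, to which \<open>weak_maximal\<close> applies directly.\<close>

definition nu :: "'a measure \<Rightarrow> ('a \<Rightarrow> 'b::real_normed_vector) \<Rightarrow> 'a measure" where
 "nu M f = density M (\<lambda>x. enorm (f x))"

lemma sets_nu [simp, measurable_cong]: "sets (nu M f) = sets M"
 by (simp add: nu_def)

lemma space_nu [simp]: "space (nu M f) = space M"
 by (simp add: nu_def)

lemma emeasure_nu:
 assumes "strongly_measurable M f" "A \<in> sets M"
 shows "emeasure (nu M f) A = (\<integral>\<^sup>+x\<in>A. enorm (f x) \<partial>M)"
 using strongly_measurable_norm[OF assms(1)] assms(2) unfolding nu_def by (subst emeasure_density) auto

lemma emeasure_nu_space:
 assumes "strongly_measurable M f"
 shows "emeasure (nu M f) (space M) = L1_mass M f"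
 using emeasure_nu[OF assms sets.top] by (auto intro!: nn_integral_cong simp: indicator_def)

lemma finite_measure_nu: "f \<in> Lp_space M 1 \<Longrightarrow> finite_measure (nu M f)"
 by (rule finite_measureI) (auto simp: L1_iff emeasure_nu_space)

lemma emeasure_nu_cut:
 assumes "strongly_measurable M f" "A \<in> sets M" "X \<in> sets M"
 shows "emeasure (nu M (cut A f)) X = emeasure (nu M f) (A \<inter> X)"
 using assms by (auto simp: emeasure_nu strongly_measurable_cut intro!: nn_integral_cong)
   (auto simp: cut_def indicator_def)

lemma L1_cut:
 assumes "f \<in> Lp_space M 1" "A \<in> sets M"
 shows "cut A f \<in> Lp_space M 1"
proof -
 have "L1_mass M (cut A f) \<le> L1_mass M f"
  by (intro nn_integral_mono) (auto simp: cut_def)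
 then show ?thesis using assms by (auto simp: L1_iff strongly_measurable_cut intro: le_less_trans)
qed

lemma L1_add:
 assumes "f \<in> Lp_space M 1" "g \<in> Lp_space M 1"
 shows "(\<lambda>x. f x + g x) \<in> Lp_space M 1"
proof -
 have [measurable]: "(\<lambda>x. norm (f x)) \<in> borel_measurable M" "(\<lambda>x. norm (g x)) \<in> borel_measurable M"
  using assms by (auto simp: L1_iff strongly_measurable_norm)
 have "(\<integral>\<^sup>+x. enorm (f x + g x) \<partial>M) \<le> (\<integral>\<^sup>+x. enorm (f x) + enorm (g x) \<partial>M)"
  by (intro nn_integral_mono) (auto simp flip: ennreal_plus intro: ennreal_leI norm_triangle_ineq)
 also have "... = L1_mass M f + L1_mass M g"
  by (rule nn_integral_add) auto
 also have "... < \<infinity>" using assms by (auto simp: L1_iff)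
 finally show ?thesis using assms by (auto simp: L1_iff strongly_measurable_add)
qed

lemma L1_scaleR:
 assumes "f \<in> Lp_space M 1"
 shows "(\<lambda>x. c *\<^sub>R f x) \<in> Lp_space M 1"
proof -
 have [measurable]: "(\<lambda>x. norm (f x)) \<in> borel_measurable M"
  using assms by (auto simp: L1_iff strongly_measurable_norm)
 have "(\<integral>\<^sup>+x. enorm (c *\<^sub>R f x) \<partial>M) = (\<integral>\<^sup>+x. ennreal \<bar>c\<bar> * enorm (f x) \<partial>M)"
  by (intro nn_integral_cong) (auto simp: ennreal_mult)
 also have "... = ennreal \<bar>c\<bar> * L1_mass M f"
  by (rule nn_integral_cmult) auto
 also have "... < \<infinity>" using assms by (auto simp: L1_iff ennreal_mult_less_top)
 finally show ?thesis using assms by (auto simp: L1_iff strongly_measurable_scaleR)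
qed

lemma L1_diff:
 assumes "f \<in> Lp_space M 1" "g \<in> Lp_space M 1"
 shows "(\<lambda>x. f x - g x) \<in> Lp_space M 1"
 using L1_add[OF assms(1) L1_scaleR[OF assms(2), of "-1"]] by simp

section \<open>Sparse domination by balls\<close>

context homogeneous_type
begin

definition avg :: "('a \<Rightarrow> 'b::real_normed_vector) \<Rightarrow> 'a \<Rightarrow> real \<Rightarrow> real" where
 "avg f x r = measure (nu M f) (B x r) / V x r"

lemma avg_nonneg: "avg f x r \<ge> 0"
 by (simp add: avg_def V_nonneg)

lemma measure_nu_B: "x \<in> space M \<Longrightarrow> r > 0 \<Longrightarrow> measure (nu M f) (B x r) = avg f x r * V x r"
 using V_pos[of x r] by (simp add: avg_def)

section \<open>Domination for operators given by weak type and oscillation bounds\<close>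

context
 fixes T1 :: "('a \<Rightarrow> 'b::banach) \<Rightarrow> ('a \<Rightarrow> 'c::banach)" and \<kappa> C1 C2 a :: real
 assumes a: "a > 0" "1000 * (c_d\<^sup>2)^8 * a \<le> 1"
  and \<kappa>: "\<kappa> > 0" and C1: "C1 \<ge> 0" and C2: "C2 \<ge> 0"
  and T_meas: "\<And>f. f \<in> Lp_space M 1 \<Longrightarrow> strongly_measurable M (T1 f)"
  and T_add: "\<And>f g. f \<in> Lp_space M 1 \<Longrightarrow> g \<in> Lp_space M 1 \<Longrightarrow> AE s in M. T1 (\<lambda>x. f x + g x) s = T1 f s + T1 g s"
  and T_weak: "\<And>f l. f \<in> Lp_space M 1 \<Longrightarrow> l > 0 \<Longrightarrow>
    emeasure M (superlevel M (T1 f) l) \<le> ennreal (C1 * \<kappa> / l) * emeasure (nu M f) (space M)"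
  and T_osc: "\<And>f z r A. f \<in> Lp_space M 1 \<Longrightarrow> z \<in> space M \<Longrightarrow> r > 0 \<Longrightarrow> (\<forall>x\<in>B z r. f x = 0) \<Longrightarrow>
    A \<ge> 0 \<Longrightarrow> (\<forall>R\<ge>r. measure (nu M f) (B z R) \<le> A * V z R) \<Longrightarrow>
    \<exists>N\<in>null_sets M. \<forall>y\<in>B z (5 * (c_d\<^sup>2)^3 * a * r) - N. \<forall>y'\<in>B z (5 * (c_d\<^sup>2)^3 * a * r) - N.
     norm (T1 f y - T1 f y') \<le> C2 * \<kappa> * A"
begin

text \<open>At a height of \<open>A\<close> times the average, the weak type of the operator and
  that of the maximal function leave at most the fraction \<open>(C1 + dq 5) / A\<close> of the
  volume of \<open>B x r\<close>; the condition on \<open>A\<close> turns this into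
  \<open>\<epsilon> * V x (a * r)\<close>.\<close>

lemma bad_set:
 assumes f: "f \<in> Lp_space M 1" and x: "x \<in> space M" and r: "r > 0" and b: "b > 0"
  and A: "A > 0" "(C1 + dq 5) * dbl c_mu (1 / a) \<le> A * \<epsilon>"
 shows "\<exists>E\<in>sets M. E \<subseteq> B x b \<and> measure M E \<le> \<epsilon> * V x (a * r) \<and>
   (\<forall>y\<in>B x b - E. norm (T1 (cut (B x r) f) y) \<le> A * \<kappa> * avg f x r) \<and>
   (\<forall>y\<in>B x b - E. \<forall>R. 0 < R \<longrightarrow> R \<le> r \<longrightarrow> measure (nu M f) (B x r \<inter> B y R) \<le> A * avg f x r * V y R)"
proof -
 interpret nuf: finite_measure "nu M f" by (rule finite_measure_nu[OF f])
 let ?f = "cut (B x r) f"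
 have fx: "?f \<in> Lp_space M 1" using f x by (intro L1_cut) auto
 have sm: "strongly_measurable M f" using f by (simp add: L1_iff)
 have Ts: "{s\<in>space M. norm (T1 ?f s) > l} \<in> sets M" for l
  using strongly_measurable_norm_le[OF T_meas[OF fx]] .
 let ?D = "dq 5"
 have nux: "emeasure (nu M ?f) (space M) = ennreal (avg f x r * V x r)"
  using emeasure_nu_cut[OF sm B_sets[OF x] sets.top, of r] sets.sets_into_space[OF B_sets[OF x, of r]]
   measure_nu_B[OF x r, of f]
  by (simp add: Int_absorb2 nuf.emeasure_eq_measure)
 have \<epsilon>V: "\<epsilon> * V x (a * r) \<ge> 0"
 proof -
  have "0 \<le> (C1 + ?D) * dbl c_mu (1 / a)" using C1 dbl_pos by (simp add: less_imp_le)
  then have "0 \<le> A * \<epsilon>" using A(2) by linarith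
  then show ?thesis using A(1) V_nonneg by (simp add: zero_le_mult_iff)
 qed
 show ?thesis
 \<comment> \<open>Weak type bounds need a positive level. If the average vanishes, the truncation
   is null and so is its image.\<close>
 proof (cases "avg f x r = 0")
  case True
  define E where "E = B x b \<inter> (\<Union>n. {s\<in>space M. norm (T1 ?f s) > 1 / real (Suc n)})"
  have "emeasure M (\<Union>n. {s\<in>space M. norm (T1 ?f s) > 1 / real (Suc n)}) = 0"
  proof (rule emeasure_UN_eq_0)
   show "emeasure M {s\<in>space M. norm (T1 ?f s) > 1 / real (Suc n)} = 0" for n
    using T_weak[OF fx, of "1 / real (Suc n)"] nux True by simp
  qed (use Ts in auto)
  then have "emeasure M E = 0"
   unfolding E_def using Ts by (intro emeasure_eq_0[OF _ _ Int_lower2]) auto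
  then have "measure M E = 0" by (simp add: measure_def)
  moreover have "norm (T1 ?f y) \<le> A * \<kappa> * avg f x r" if y: "y \<in> B x b - E" for y
  proof (rule ccontr)
   assume "\<not> ?thesis"
   then have "norm (T1 ?f y) > 0" using True by simp
   then obtain n where "1 / real (Suc n) < norm (T1 ?f y)" by (rule nat_approx_posE)
   then show False using y by (auto simp: E_def mem_B)
  qed
  moreover have "measure (nu M f) (B x r \<inter> B y R) \<le> A * avg f x r * V y R" for y R
  proof -
   have "measure (nu M f) (B x r \<inter> B y R) \<le> measure (nu M f) (B x r)"
    using x by (intro nuf.finite_measure_mono) auto
   then show ?thesis using measure_nu_B[OF x r, of f] True by simp
  qed
  ultimately show ?thesis
   using \<epsilon>V Ts x by (intro bexI[of _ E]) (auto simp: E_def)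
 next
  case False
  define m where "m = avg f x r"
  have m: "m > 0" using False avg_nonneg[of f x r] by (simp add: m_def)
  obtain N where N: "N \<in> sets M" "emeasure M N \<le> ennreal (?D / (A * m)) * emeasure (nu M ?f) (space M)"
   "\<And>v R. v \<in> space M \<Longrightarrow> v \<notin> N \<Longrightarrow> 0 < R \<Longrightarrow> R \<le> r \<Longrightarrow> emeasure (nu M ?f) (B v R) \<le> ennreal (A * m) * emeasure M (B v R)"
   using weak_maximal[of "nu M ?f" "A * m" r] A m by auto
  define L where "L = {s\<in>space M. norm (T1 ?f s) > A * \<kappa> * m}"
  define E where "E = B x b \<inter> (L \<union> N)"
  have LN: "L \<in> sets M" "N \<in> sets M" using Ts N by (auto simp: L_def)
  have "emeasure M E \<le> emeasure M (L \<union> N)" using LN by (intro emeasure_mono) (auto simp: E_def)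
  also have "... \<le> emeasure M L + emeasure M N" using LN by (intro emeasure_subadditive)
  also have "... \<le> ennreal (C1 * \<kappa> / (A * \<kappa> * m)) * ennreal (m * V x r) + ennreal (?D / (A * m)) * ennreal (m * V x r)"
   using T_weak[OF fx, of "A * \<kappa> * m"] N(2) A m \<kappa> nux by (intro add_mono) (auto simp: L_def m_def)
  also have "... = ennreal ((C1 + ?D) / A * V x r)"
  proof -
   have "C1 * \<kappa> / (A * \<kappa> * m) * (m * V x r) + ?D / (A * m) * (m * V x r) = (C1 + ?D) / A * V x r"
    using A m \<kappa> by (simp add: field_simps)
   moreover have nn: "0 \<le> C1 * \<kappa> / (A * \<kappa> * m)" "0 \<le> ?D / (A * m)" "0 \<le> m * V x r"
    using A m \<kappa> C1 dbl_pos[of "5 * c_d\<^sup>2"] V_nonneg by simp_all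
   ultimately show ?thesis
    unfolding ennreal_mult[OF nn(1,3), symmetric] ennreal_mult[OF nn(2,3), symmetric]
    by (subst ennreal_plus[symmetric]) (use mult_nonneg_nonneg[OF nn(1,3)] mult_nonneg_nonneg[OF nn(2,3)] in auto)
  qed
  also have "... \<le> ennreal (\<epsilon> * V x (a * r))"
  proof (rule ennreal_leI)
   have "V x r \<le> dbl c_mu (1 / a) * V x (a * r)" using V_dbl[of x "a * r" "1 / a"] x r a by simp
   then have "(C1 + ?D) / A * V x r \<le> (C1 + ?D) / A * (dbl c_mu (1 / a) * V x (a * r))"
    using A C1 dbl_pos[of "5 * c_d\<^sup>2"] by (intro mult_left_mono) auto
   also have "... = ((C1 + ?D) * dbl c_mu (1 / a)) / A * V x (a * r)" by simp
   also have "... \<le> \<epsilon> * V x (a * r)"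
    using A V_nonneg by (intro mult_right_mono) (auto simp: pos_divide_le_eq mult.commute)
   finally show "(C1 + ?D) / A * V x r \<le> \<epsilon> * V x (a * r)" .
  qed
  finally have "measure M E \<le> \<epsilon> * V x (a * r)"
   using \<epsilon>V by (simp add: measure_def enn2real_leI)
  moreover have "norm (T1 ?f y) \<le> A * \<kappa> * avg f x r" if "y \<in> B x b - E" for y
   using that by (auto simp: E_def L_def m_def mem_B not_less)
  moreover have "measure (nu M f) (B x r \<inter> B y R) \<le> A * avg f x r * V y R"
   if y: "y \<in> B x b - E" and R: "0 < R" "R \<le> r" for y R
  proof -
   have yM: "y \<in> space M" "y \<notin> N" using y by (auto simp: E_def mem_B)
   have "ennreal (measure (nu M f) (B x r \<inter> B y R)) = emeasure (nu M ?f) (B y R)"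
    using x yM sm by (simp add: emeasure_nu_cut nuf.emeasure_eq_measure)
   also have "... \<le> ennreal (A * m) * emeasure M (B y R)" using N(3)[OF yM R] .
   also have "... = ennreal (A * m * V y R)"
    using A m V_nonneg yM by (simp add: emeasure_B ennreal_mult)
   finally show ?thesis using A m V_nonneg by (simp add: m_def ennreal_le_iff)
  qed
  ultimately show ?thesis
   using LN x by (intro bexI[of _ E]) (auto simp: E_def)
 qed
qed

text \<open>The hypotheses on \<open>E\<close> and \<open>E'\<close> provide a point of the smaller ball which is good for both
 truncations; oscillation is controlled from there.\<close>

lemma consecutive_truncations:
 assumes f: "f \<in> Lp_space M 1" and A: "A \<ge> 1"
  and i: "i \<in> space M" "r > 0" and j: "j \<in> space M" "r' > 0"
  and sub: "B j r' \<subseteq> B i b" "b \<le> r"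
  and E: "E \<in> sets M" "\<forall>y\<in>B i b - E. norm (T1 (cut (B i r) f) y) \<le> A * \<kappa> * avg f i r"
   "\<forall>y\<in>B i b - E. \<forall>R. 0 < R \<longrightarrow> R \<le> r \<longrightarrow> measure (nu M f) (B i r \<inter> B y R) \<le> A * avg f i r * V y R"
  and E': "E' \<in> sets M" "\<forall>y\<in>B j (5 * (c_d\<^sup>2)^3 * a * r') - E'. norm (T1 (cut (B j r') f) y) \<le> A * \<kappa> * avg f j r'"
  and meas: "measure M (E \<inter> B j (5 * (c_d\<^sup>2)^3 * a * r')) \<le> V j (5 * (c_d\<^sup>2)^3 * a * r') / 4"
   "measure M (E' \<inter> B j (5 * (c_d\<^sup>2)^3 * a * r')) \<le> V j (5 * (c_d\<^sup>2)^3 * a * r') / 4"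
 shows "AE x in M. x \<in> B j (5 * (c_d\<^sup>2)^3 * a * r') \<longrightarrow>
  norm (T1 (cut (B i r) f) x) \<le> A * (1 + (C2 + A) * dq 4) * \<kappa> * avg f i r
    + norm (T1 (cut (B j r') f) x)"
proof -
 interpret nuf: finite_measure "nu M f" by (rule finite_measure_nu[OF f])
 define q where "q = c_d\<^sup>2"
 have q1: "q \<ge> 1" and cq: "c_d \<le> q" using cd2 by (auto simp: q_def)
 define D where "D = dq 4"
 have D: "D \<ge> 1" using dbl_ge_1 by (simp add: D_def)
 define b' where "b' = 5 * (c_d\<^sup>2)^3 * a * r'"
 have "5 * q^3 * a \<le> 1000 * q^8 * a"
  using a q1 by (intro mult_right_mono mult_mono power_increasing) auto
 then have "5 * q^3 * a \<le> 1" using a(2) by (simp only: q_def)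
 then have b': "0 < b'" "b' \<le> r'"
  using a(1) c_d j mult_right_mono[of "5 * q^3 * a" 1 r'] by (simp_all add: b'_def q_def)
 define m where "m = avg f i r"
 have m: "m \<ge> 0" using avg_nonneg by (simp add: m_def)
 define fi where "fi = cut (B i r) f"
 define fj where "fj = cut (B j r') f"
 define g where "g = (\<lambda>x. fi x - fj x)"
 have L1: "fi \<in> Lp_space M 1" "fj \<in> Lp_space M 1" "g \<in> Lp_space M 1"
  using f i j by (auto simp: fi_def fj_def g_def intro!: L1_cut L1_diff)
 have sm: "strongly_measurable M f" "strongly_measurable M g" using f L1 by (auto simp: L1_iff)
 have subr: "B j r' \<subseteq> B i r" using sub B_mono[of b r i] by auto
 have g0: "g x = 0" if "x \<in> B j r'" for x
  using that subr by (auto simp: g_def fi_def fj_def cut_def)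
 have g_le: "measure (nu M g) X \<le> measure (nu M f) (B i r \<inter> X)" if X: "X \<in> sets M" for X
 proof -
  interpret nug: finite_measure "nu M g" by (rule finite_measure_nu[OF L1(3)])
  have "emeasure (nu M g) X \<le> emeasure (nu M f) (B i r \<inter> X)"
   using X i sm subr by (auto simp: emeasure_nu intro!: nn_integral_mono)
    (auto simp: g_def fi_def fj_def cut_def indicator_def)
  then show ?thesis by (simp add: nuf.emeasure_eq_measure nug.emeasure_eq_measure)
 qed
 have "\<not> B j b' \<subseteq> E \<union> E' \<union> N" if N: "N \<in> null_sets M" for N
 proof
  assume s: "B j b' \<subseteq> E \<union> E' \<union> N"
  have "emeasure M (B j b') \<le> emeasure M ((E \<inter> B j b') \<union> (E' \<inter> B j b') \<union> N)"
   using s E E' N j by (intro emeasure_mono) auto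
  also have "... \<le> emeasure M (E \<inter> B j b') + emeasure M (E' \<inter> B j b') + emeasure M N"
   using E E' N j by (intro order_trans[OF emeasure_subadditive] add_right_mono emeasure_subadditive) auto
  also have "... = ennreal (measure M (E \<inter> B j b') + measure M (E' \<inter> B j b'))"
   using N emeasure_eq_measure_subset_B[OF j(1), of "E \<inter> B j b'" b'] emeasure_eq_measure_subset_B[OF j(1), of "E' \<inter> B j b'" b']
   by auto
  also have "... \<le> ennreal (V j b' / 4 + V j b' / 4)"
   using meas by (intro ennreal_leI add_mono) (auto simp: b'_def)
  finally have "V j b' \<le> V j b' / 4 + V j b' / 4" using j V_nonneg by (simp add: emeasure_B ennreal_le_iff)
  then show False using V_pos[OF j(1) b'(1)] by simp
 qed note good = this
 \<comment> \<open>The growth condition for the oscillation bound at the centre \<open>j\<close>. Up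
   to scale \<open>r\<close> it is the maximal bound at the good point \<open>y\<close>, recentred;
   beyond that scale the total mass in \<open>B i r\<close> suffices.\<close>
 have nu_mass: "measure (nu M f) (B i r \<inter> B j R) \<le> A * m * D * V j R"
  if R: "R \<ge> r'" and y: "y \<in> B j b' - E" for R y
 proof -
  have "y \<in> B j r'" using y B_mono[of b' r' j] b' by blast
  then have yM: "y \<in> space M" "d j y < b'" "y \<in> B i b - E"
   using y sub by (auto simp: mem_B[of y j])
  have dy: "d j y \<le> R" "d y j \<le> R" using yM b' R j sym[of y j] by auto
  have Rp: "R > 0" using R j by simp
  show ?thesis
  proof (cases "2 * c_d * R \<le> r")
   case True
   have "B j R \<subseteq> B y (2 * c_d * R)"
    using yM j dy by (intro B_subset[where s=R]) auto
   then have "measure (nu M f) (B i r \<inter> B j R) \<le> measure (nu M f) (B i r \<inter> B y (2 * c_d * R))"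
    using i yM by (intro nuf.finite_measure_mono) auto
   also have "... \<le> A * m * V y (2 * c_d * R)"
    using E(3) yM True Rp c_d by (auto simp: m_def)
   also have "... \<le> A * m * (D * V j R)"
    unfolding D_def
   proof (intro mult_left_mono V_compare[where s=R])
    have "c_d * (R + 2 * c_d * R) = (c_d + 2 * c_d\<^sup>2) * R" by (simp add: algebra_simps power2_eq_square)
    also have "... \<le> 4 * c_d\<^sup>2 * R" using cd2 Rp by (intro mult_right_mono) auto
    finally show "c_d * (R + 2 * c_d * R) \<le> 4 * c_d\<^sup>2 * R" .
   qed (use j yM dy Rp c_d A m in auto)
   finally show ?thesis by (simp add: mult_ac)
  next
   case False
   have "measure (nu M f) (B i r \<inter> B j R) \<le> measure (nu M f) (B i r)"
    using i by (intro nuf.finite_measure_mono) auto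
   also have "... = m * V i r" using measure_nu_B[OF i, of f] by (simp add: m_def)
   also have "... \<le> m * (D * V j R)"
    unfolding D_def
   proof (intro mult_left_mono V_compare[where s=r])
    have "j \<in> B i r" using subr B_center[OF j] by blast
    then show "d j i \<le> r" using i j sym[of j i] by (auto simp: mem_B)
    have "c_d * (r + r) = 2 * c_d * r" by simp
    also have "... \<le> 2 * c_d * (2 * c_d * R)" using False c_d by (intro mult_left_mono) auto
    finally show "c_d * (r + r) \<le> 4 * c_d\<^sup>2 * R" by (simp add: power2_eq_square)
   qed (use j i Rp c_d m in auto)
   also have "... \<le> A * (m * (D * V j R))"
    using A m D V_nonneg mult_right_mono[of 1 A "m * (D * V j R)"] by simp
   finally show ?thesis by (simp add: mult_ac)
  qed
 qed
 obtain y0 where y0: "y0 \<in> B j b' - E" using good[of "{}"] by blast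
 have "\<forall>R\<ge>r'. measure (nu M g) (B j R) \<le> A * m * D * V j R"
  using nu_mass[OF _ y0] g_le j by (meson B_sets order_trans)
 moreover have "0 \<le> A * m * D" using A m D by simp
 ultimately obtain N where N: "N \<in> null_sets M"
  "\<forall>y\<in>B j b' - N. \<forall>y'\<in>B j b' - N. norm (T1 g y - T1 g y') \<le> C2 * \<kappa> * (A * m * D)"
  using T_osc[OF L1(3) j, of "A * m * D"] g0 by (auto simp: b'_def)
 have "AE s in M. T1 (\<lambda>x. fj x + g x) s = T1 fj s + T1 g s" by (rule T_add[OF L1(2,3)])
 moreover have "(\<lambda>x. fj x + g x) = fi" by (simp add: g_def)
 ultimately have "AE s in M. T1 fi s = T1 fj s + T1 g s" by simp
 then obtain N' where N': "N' \<in> null_sets M" "\<And>s. s \<in> space M - N' \<Longrightarrow> T1 fi s = T1 fj s + T1 g s"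
  by (auto elim!: AE_E3)
 have "\<not> B j b' \<subseteq> E \<union> E' \<union> (N \<union> N')" using good N(1) N'(1) by blast
 then obtain y where y: "y \<in> B j b'" "y \<notin> E" "y \<notin> E'" "y \<notin> N" "y \<notin> N'" by blast
 have "y \<in> B j r'" using y B_mono[of b' r' j] b' by blast
 then have yM: "y \<in> space M" "y \<in> B i b" using sub B_space by blast+
 have mj: "avg f j r' \<le> A * m * D"
 proof -
  have "measure (nu M f) (B j r') \<le> A * m * D * V j r'"
   using nu_mass[of r' y] y subr by (simp add: Int_absorb1)
  then show ?thesis using V_pos[OF j] by (simp add: avg_def pos_divide_le_eq)
 qed
 have "norm (T1 g y) \<le> norm (T1 fi y) + norm (T1 fj y)"
  using N'(2)[of y] yM y by (simp add: norm_triangle_ineq4[of "T1 fj y + T1 g y" "T1 fj y", simplified])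
 also have "... \<le> A * \<kappa> * m + A * \<kappa> * (A * m * D)"
 proof (rule add_mono)
  show "norm (T1 fi y) \<le> A * \<kappa> * m" using E(2) yM y by (auto simp: fi_def m_def)
  have "norm (T1 fj y) \<le> A * \<kappa> * avg f j r'" using E'(2) y by (auto simp: fj_def b'_def)
  also have "... \<le> A * \<kappa> * (A * m * D)" using mj A \<kappa> by (intro mult_left_mono) auto
  finally show "norm (T1 fj y) \<le> A * \<kappa> * (A * m * D)" .
 qed
 finally have gy: "norm (T1 g y) \<le> A * \<kappa> * m + A * \<kappa> * (A * m * D)" .
 have main: "norm (T1 fi x) \<le> A * (1 + (C2 + A) * D) * \<kappa> * m + norm (T1 fj x)"
  if x: "x \<in> B j b'" "x \<notin> N" "x \<notin> N'" for x
 proof -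
  have "norm (T1 fi x) = norm (T1 fj x + T1 g y + (T1 g x - T1 g y))"
   using N'(2)[of x] x by (auto simp: mem_B)
  also have "... \<le> norm (T1 fj x) + norm (T1 g y) + norm (T1 g x - T1 g y)"
   by (intro order_trans[OF norm_triangle_ineq] add_right_mono norm_triangle_ineq)
  also have "norm (T1 g x - T1 g y) \<le> C2 * \<kappa> * (A * m * D)" using N(2) x y by blast
  finally have "norm (T1 fi x) \<le> norm (T1 fj x) + (A * \<kappa> * m + A * \<kappa> * (A * m * D)) + C2 * \<kappa> * (A * m * D)"
   using gy by linarith
  also have "... = A * (1 + (C2 + A) * D) * \<kappa> * m + norm (T1 fj x)"
   by (simp add: algebra_simps)
  finally show ?thesis .
 qed
 have "N \<union> N' \<in> null_sets M" using N(1) N'(1) by blast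
 then have "AE x in M. x \<notin> N \<union> N'" by (rule AE_not_in)
 then show ?thesis
  using main by (auto simp: fi_def fj_def m_def D_def b'_def)
qed

text \<open>A point lies in one covering ball of each generation until it leaves the open sets.
  Along this finite chain the truncations telescope, each step costing one average, and at its end
  the point is outside the exceptional set of the last ball. The set \<open>E j\<close> is a small
  ball without the next open set: at least half of it remains, and generations are disjoint because
  later small balls lie in that open set.\<close>

lemma ball_sparse_domination:
 assumes f: "f \<in> Lp_space M 1" and supp: "boundedly_supported M d f"
  and \<tau>: "\<tau> > 0" "\<tau> < 1" "\<tau> * dbl c_mu (1 / (c_d\<^sup>2 * a)) \<le> 1/4"
  and \<epsilon>: "\<epsilon> > 0" "\<epsilon> \<le> 1/4" "dq 5 * dq 3 / \<tau> * \<epsilon> * dbl c_mu (1 / a) \<le> 1/2"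
  and A: "A \<ge> 1" "(C1 + dq 5) * dbl c_mu (1 / a) \<le> A * \<epsilon>"
 obtains J :: "(nat \<times> 'a) set" and r :: "nat \<times> 'a \<Rightarrow> real" and E :: "nat \<times> 'a \<Rightarrow> 'a set" where
  "countable J" "\<And>j. j \<in> J \<Longrightarrow> snd j \<in> space M" "\<And>j. j \<in> J \<Longrightarrow> r j > 0"
  "\<And>j. j \<in> J \<Longrightarrow> E j \<in> sets M" "\<And>j. j \<in> J \<Longrightarrow> E j \<subseteq> B (snd j) (r j)"
  "\<And>j. j \<in> J \<Longrightarrow> measure M (E j) \<ge> 1 / (2 * dbl c_mu (1 / a)) * V (snd j) (r j)"
  "disjoint_family_on E J"
  "AE s in M. \<exists>F\<subseteq>J. finite F \<and> (\<forall>j\<in>F. s \<in> B (snd j) (r j)) \<and>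
    norm (T1 f s) \<le> A * (1 + (C2 + A) * dq 4) * \<kappa> * (\<Sum>j\<in>F. avg f (snd j) (r j))"
proof -
 define q where "q = c_d\<^sup>2"
 have q1: "q \<ge> 1" and cq: "c_d \<le> q" using cd2 by (auto simp: q_def)
 have small: "n * q^k * a \<le> 1" if "n \<le> 1000" "k \<le> 8" "0 \<le> n" for n k
  using small_power[OF a(1,2) that] by (simp only: q_def)
 define a1 where "a1 = 5 * (c_d\<^sup>2)^3 * a"
 define a2 where "a2 = 13 * (c_d\<^sup>2)^4 * a"
 define C3 where "C3 = A * (1 + (C2 + A) * dq 4)"
 have a12: "0 < a1" "a1 \<le> a2" "a2 \<le> 1" "a \<le> a1" "a \<le> 1" "0 < a2"
 proof -
  show "0 < a1" "0 < a2" using a(1) c_d by (simp_all add: a1_def a2_def)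
  have "5 * q^3 * a \<le> 13 * q^4 * a" using q1 a by (intro mult_right_mono mult_mono power_increasing) auto
  then show "a1 \<le> a2" by (simp only: a1_def a2_def q_def)
  show "a2 \<le> 1" using small[of 13 4] by (simp only: a2_def q_def)
  have "1 * q^0 * a \<le> 5 * q^3 * a" using q1 a by (intro mult_right_mono mult_mono power_increasing) auto
  then show "a \<le> a1" by (simp only: a1_def q_def) simp
  show "a \<le> 1" using small[of 1 0] by simp
 qed
 obtain s0 r0 where s0: "s0 \<in> space M" "r0 > 0" "{t\<in>space M. f t \<noteq> 0} \<subseteq> B s0 r0"
  using supp by (auto simp: boundedly_supported_def)
 define P where "P x r E \<longleftrightarrow> E \<in> sets M \<and> E \<subseteq> B x (a2 * r) \<and> measure M E \<le> \<epsilon> * V x (a * r) \<and>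
   (\<forall>y\<in>B x (a2 * r) - E. norm (T1 (cut (B x r) f) y) \<le> A * \<kappa> * avg f x r) \<and>
   (\<forall>y\<in>B x (a2 * r) - E. \<forall>R. 0 < R \<longrightarrow> R \<le> r \<longrightarrow> measure (nu M f) (B x r \<inter> B y R) \<le> A * avg f x r * V y R)"
  for x r E
 define bad where "bad x r = (SOME E. P x r E)" for x r
 have bad': "P x r (bad x r)" if "x \<in> space M" "r > 0" for x r
 proof -
  have "A > 0" "a2 * r > 0" using A(1) a12 that by auto
  then have "\<exists>E. P x r E"
   using bad_set[OF f that _ _ A(2), of "a2 * r"] unfolding P_def by blast
  then show ?thesis unfolding bad_def by (rule someI_ex)
 qed
 have bad: "bad x r \<in> sets M" "bad x r \<subseteq> B x (a2 * r)" "measure M (bad x r) \<le> \<epsilon> * V x (a * r)"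
  "\<forall>y\<in>B x (a2 * r) - bad x r. norm (T1 (cut (B x r) f) y) \<le> A * \<kappa> * avg f x r"
  "\<forall>y\<in>B x (a2 * r) - bad x r. \<forall>R. 0 < R \<longrightarrow> R \<le> r \<longrightarrow>
    measure (nu M f) (B x r \<inter> B y R) \<le> A * avg f x r * V y R"
  if "x \<in> space M" "r > 0" for x r
  using bad'[OF that] unfolding P_def by blast+
 obtain \<Omega> :: "nat \<Rightarrow> 'a set" and \<rho> :: "nat \<Rightarrow> 'a \<Rightarrow> real" and I :: "nat \<Rightarrow> 'a set" where
  st0: "\<Omega> 0 = space M" "\<rho> 0 = (\<lambda>x. c_d * (d x s0 + r0))" and
  st: "\<And>k. whitney (\<Omega> k) (\<rho> k)" "\<And>k. I k \<subseteq> \<Omega> k" "\<And>k. countable (I k)"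
  "\<And>k. disjoint_family_on (\<lambda>i. B i (a * \<rho> k i)) (I k)"
  "\<And>k x. x \<in> \<Omega> k \<Longrightarrow> \<exists>i\<in>I k. x \<in> B i (a1 * \<rho> k i)"
  "\<And>k. \<Omega> (Suc k) \<subseteq> \<Omega> k"
  "\<And>k y. y \<in> \<Omega> k \<Longrightarrow> measure M (\<Omega> (Suc k) \<inter> B y (a * \<rho> k y)) \<le> V y (a * \<rho> k y) / 2"
  "\<And>k. AE x in M. x \<in> (\<Union>i\<in>I k. bad i (\<rho> k i)) \<longrightarrow> x \<in> \<Omega> (Suc k)"
  "\<And>k x. x \<in> \<Omega> (Suc k) \<Longrightarrow> \<rho> (Suc k) x \<le> a * \<rho> k x"
  "\<And>k i j. j \<in> \<Omega> (Suc k) \<Longrightarrow> i \<in> I k \<Longrightarrow>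
    measure M (bad i (\<rho> k i) \<inter> B j (a1 * \<rho> (Suc k) j)) \<le> V j (a1 * \<rho> (Suc k) j) / 4"
  "AE x in M. \<exists>k. x \<notin> \<Omega> k"
  using stopping_generations[OF a \<tau> \<epsilon>(1,3) bad(1) bad(2)[unfolded a2_def] bad(3) s0(1,2), folded a1_def] by blast
 have I: "i \<in> space M" "\<rho> k i > 0" "i \<in> \<Omega> k" if "i \<in> I k" for i k
  using that st(2)[of k] whitneyD(2,3)[OF st(1)] by auto
 define Tf where "Tf k i = T1 (cut (B i (\<rho> k i)) f)" for k i
 have T0: "cut (B i (\<rho> 0 i)) f s = f s" if i: "i \<in> I 0" and s: "s \<in> space M" for i s
 proof (cases "f s = 0")
  case False
  then have "s \<in> B s0 r0" using s s0 by auto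
  moreover have "B s0 r0 \<subseteq> B i (\<rho> 0 i)"
   unfolding st0(2) using I(1)[OF i] s0 by (intro B_subset[where s="d i s0"]) auto
  ultimately show ?thesis by (auto simp: cut_def)
 qed (simp add: cut_def)
 \<comment> \<open>The first truncation equals \<open>f\<close> on the space. \<open>T1\<close>
   respects this almost everywhere: the difference is null, its image vanishes by the weak type, and
   the two are joined by additivity.\<close>
 have step0: "AE s in M. \<forall>i\<in>I 0. norm (T1 f s) \<le> norm (Tf 0 i s)"
 proof (rule AE_ball_countable[THEN iffD2, OF st(3)], intro ballI)
  fix i assume i: "i \<in> I 0"
  let ?f0 = "cut (B i (\<rho> 0 i)) f"
  have L: "?f0 \<in> Lp_space M 1" "(\<lambda>x. f x - ?f0 x) \<in> Lp_space M 1"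
   using f I[OF i] by (auto intro!: L1_cut L1_diff)
  have "emeasure (nu M (\<lambda>x. f x - ?f0 x)) (space M) = 0"
  proof -
   have "emeasure (nu M (\<lambda>x. f x - ?f0 x)) (space M) = L1_dist M f ?f0"
    using L by (intro emeasure_nu_space) (simp add: L1_iff)
   also have "... = (\<integral>\<^sup>+x. 0 \<partial>M)" using T0[OF i] by (intro nn_integral_cong) simp
   finally show ?thesis by simp
  qed
  then have "emeasure M {s\<in>space M. norm (T1 (\<lambda>x. f x - ?f0 x) s) > l} = 0" if "l > 0" for l
   using T_weak[OF L(2) that] by simp
  then have "AE s in M. T1 (\<lambda>x. f x - ?f0 x) s = 0" by (rule AE_zero_levels[OF T_meas[OF L(2)]])
  moreover have "AE s in M. T1 (\<lambda>x. ?f0 x + (f x - ?f0 x)) s = T1 ?f0 s + T1 (\<lambda>x. f x - ?f0 x) s"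
   by (rule T_add[OF L])
  ultimately show "AE s in M. norm (T1 f s) \<le> norm (Tf 0 i s)"
   by eventually_elim (simp add: Tf_def)
 qed
 have step: "AE s in M. \<forall>k. \<forall>i\<in>I k. \<forall>j\<in>I (Suc k). s \<in> B i (a1 * \<rho> k i) \<longrightarrow> s \<in> B j (a1 * \<rho> (Suc k) j) \<longrightarrow>
   norm (Tf k i s) \<le> C3 * \<kappa> * avg f i (\<rho> k i) + norm (Tf (Suc k) j s)"
  unfolding AE_all_countable
 proof (intro allI, rule AE_ball_countable[THEN iffD2, OF st(3)], rule ballI,
   rule AE_ball_countable[THEN iffD2, OF st(3)], rule ballI)
  fix k i j assume i: "i \<in> I k" and j: "j \<in> I (Suc k)"
  show "AE s in M. s \<in> B i (a1 * \<rho> k i) \<longrightarrow> s \<in> B j (a1 * \<rho> (Suc k) j) \<longrightarrow>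
    norm (Tf k i s) \<le> C3 * \<kappa> * avg f i (\<rho> k i) + norm (Tf (Suc k) j s)"
  proof (cases "B i (a1 * \<rho> k i) \<inter> B j (a1 * \<rho> (Suc k) j) = {}")
   case True
   then show ?thesis by (intro AE_I2) blast
  next
   case False
   then obtain x where x: "x \<in> B i (a1 * \<rho> k i)" "x \<in> B j (a1 * \<rho> (Suc k) j)" by blast
   have jk: "j \<in> \<Omega> k" "j \<in> \<Omega> (Suc k)" using I(3)[OF j] st(6) by auto
   have n1: "B j (\<rho> (Suc k) j) \<subseteq> B i (a2 * \<rho> k i)"
    unfolding a2_def using x[unfolded a1_def]
    by (intro whitney_descendant_subset[OF st(1) a I(3)[OF i] jk(1) I(2)[OF j] st(9)[OF jk(2)], of x]) auto
   have n2: "a2 * \<rho> k i \<le> \<rho> k i" using a12 I[OF i] by (simp add: mult_le_cancel_right1)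
   have "a1 * \<rho> (Suc k) j \<le> a2 * \<rho> (Suc k) j" using a12 I[OF j] by (intro mult_right_mono) auto
   then have n3: "\<forall>y\<in>B j (a1 * \<rho> (Suc k) j) - bad j (\<rho> (Suc k) j). norm (T1 (cut (B j (\<rho> (Suc k) j)) f) y) \<le> A * \<kappa> * avg f j (\<rho> (Suc k) j)"
    using bad(4)[OF I(1,2)[OF j]] B_mono[of "a1 * \<rho> (Suc k) j" "a2 * \<rho> (Suc k) j" j] by auto
   have n4: "measure M (bad j (\<rho> (Suc k) j) \<inter> B j (a1 * \<rho> (Suc k) j)) \<le> V j (a1 * \<rho> (Suc k) j) / 4"
   proof -
    have "measure M (bad j (\<rho> (Suc k) j) \<inter> B j (a1 * \<rho> (Suc k) j)) \<le> measure M (bad j (\<rho> (Suc k) j))"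
     using I[OF j] bad(1,2) by (intro measure_mono_B[of j _ _ "a2 * \<rho> (Suc k) j"]) auto
    also have "... \<le> \<epsilon> * V j (a * \<rho> (Suc k) j)" using I[OF j] bad(3) by auto
    also have "... \<le> 1/4 * V j (a1 * \<rho> (Suc k) j)"
     using \<epsilon> a12 I[OF j] V_nonneg by (intro mult_mono V_mono_subset B_mono mult_right_mono) auto
    finally show ?thesis by simp
   qed
   have "AE s in M. s \<in> B j (a1 * \<rho> (Suc k) j) \<longrightarrow>
    norm (Tf k i s) \<le> C3 * \<kappa> * avg f i (\<rho> k i) + norm (Tf (Suc k) j s)"
    unfolding Tf_def
    by (rule consecutive_truncations[folded a1_def, OF f A(1) I(1,2)[OF i] I(1,2)[OF j] n1 n2
     bad(1)[OF I(1,2)[OF i]] bad(4)[OF I(1,2)[OF i]] bad(5)[OF I(1,2)[OF i]]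
     bad(1)[OF I(1,2)[OF j]] n3 st(10)[OF jk(2) i] n4, folded C3_def])
   then show ?thesis by eventually_elim auto
  qed
 qed
 have final: "AE s in M. \<forall>k. s \<in> (\<Union>i\<in>I k. bad i (\<rho> k i)) \<longrightarrow> s \<in> \<Omega> (Suc k)"
  unfolding AE_all_countable using st(8) by blast
 \<comment> \<open>The same centre may occur in several generations with different radii, so the
   generation is part of the index.\<close>
 define J where "J = (SIGMA k:UNIV. I k)"
 define r where "r j = \<rho> (fst j) (snd j)" for j :: "nat \<times> 'a"
 define E where "E j = B (snd j) (a * r j) - \<Omega> (Suc (fst j))" for j :: "nat \<times> 'a"
 have \<Omega>s: "\<Omega> k \<in> sets M" for k using qopen_sets[OF whitneyD(1)[OF st(1)]] .
 have \<Omega>mono: "\<Omega> l \<subseteq> \<Omega> k" if "k \<le> l" for k l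
  using that by (rule lift_Suc_antimono_le[of \<Omega>, OF st(6)])
 have J: "snd j \<in> space M" "r j > 0" "snd j \<in> \<Omega> (fst j)" "snd j \<in> I (fst j)" if "j \<in> J" for j
  using that I[of "snd j" "fst j"] by (auto simp: J_def r_def)
 have Bsub: "B (snd j) (a * r j) \<subseteq> B (snd j) (r j)" "B (snd j) (a * r j) \<subseteq> \<Omega> (fst j)" if "j \<in> J" for j
 proof -
  have "a * r j \<le> r j" using a12 J[OF that] by (simp add: mult_le_cancel_right1)
  then show "B (snd j) (a * r j) \<subseteq> B (snd j) (r j)" by (rule B_mono)
  then show "B (snd j) (a * r j) \<subseteq> \<Omega> (fst j)"
   using whitneyD(4)[OF st(1) J(3)[OF that]] by (auto simp: r_def)
 qed
 show ?thesis
 proof (rule that[of J r E])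
  show "countable J" unfolding J_def using st(3) by (intro countable_SIGMA) auto
  fix j assume j: "j \<in> J"
  show "snd j \<in> space M" "r j > 0" using J[OF j] by auto
  show "E j \<in> sets M" using J[OF j] \<Omega>s by (auto simp: E_def)
  show "E j \<subseteq> B (snd j) (r j)" using Bsub[OF j] by (auto simp: E_def)
  have "V (snd j) (a * r j) = measure M (E j) + measure M (\<Omega> (Suc (fst j)) \<inter> B (snd j) (a * r j))"
   unfolding E_def using V_split[OF J(1)[OF j] \<Omega>s] .
  moreover have "measure M (\<Omega> (Suc (fst j)) \<inter> B (snd j) (a * r j)) \<le> V (snd j) (a * r j) / 2"
   unfolding r_def using st(7) J[OF j] by auto
  moreover have "V (snd j) (r j) \<le> dbl c_mu (1 / a) * V (snd j) (a * r j)"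
   using V_dbl[of "snd j" "a * r j" "1 / a"] J[OF j] a by simp
  ultimately have "V (snd j) (r j) \<le> dbl c_mu (1 / a) * (2 * measure M (E j))"
   using mult_left_mono[of "V (snd j) (a * r j)" "2 * measure M (E j)" "dbl c_mu (1 / a)"] dbl_pos[of "1 / a"]
   by linarith
  then show "measure M (E j) \<ge> 1 / (2 * dbl c_mu (1 / a)) * V (snd j) (r j)"
   using dbl_pos[of "1 / a"] by (simp add: field_simps)
 next
  show "disjoint_family_on E J"
   unfolding disjoint_family_on_def
  proof (intro ballI impI)
   have lt: "E j \<inter> E j' = {}" if "j \<in> J" "j' \<in> J" "fst j < fst j'" for j j'
    using Bsub(2)[OF that(2)] \<Omega>mono[of "Suc (fst j)" "fst j'"] that by (auto simp: E_def)
   fix j j' assume j: "j \<in> J" "j' \<in> J" "j \<noteq> j'"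
   consider "fst j < fst j'" | "fst j' < fst j" | "fst j = fst j'" "snd j \<noteq> snd j'"
    using j(3) by (metis linorder_neqE_nat prod_eq_iff)
   then show "E j \<inter> E j' = {}"
   proof cases
    case 3
    then have "B (snd j) (a * r j) \<inter> B (snd j') (a * r j') = {}"
     unfolding r_def using disjoint_family_onD[OF st(4)[of "fst j'"], of "snd j" "snd j'"] J(4)[OF j(1)] J(4)[OF j(2)]
     by simp
    then show ?thesis by (auto simp: E_def)
   qed (use lt j in blast)+
  qed
  show "AE s in M. \<exists>F\<subseteq>J. finite F \<and> (\<forall>j\<in>F. s \<in> B (snd j) (r j)) \<and>
    norm (T1 f s) \<le> A * (1 + (C2 + A) * dq 4) * \<kappa> * (\<Sum>j\<in>F. avg f (snd j) (r j))"
   using step0 step final st(11) AE_space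
  proof eventually_elim
   case (elim s)
   \<comment> \<open>The first generation without \<open>s\<close>; it is not 0, as
     \<open>\<Omega> 0\<close> is the whole space. The chain ends one generation earlier, and
     \<open>final\<close> keeps \<open>s\<close> out of the exceptional set there.\<close>
   define K where "K = (LEAST k. s \<notin> \<Omega> k)"
   have K: "s \<notin> \<Omega> K" unfolding K_def using elim(4) by (metis LeastI)
   have less: "s \<in> \<Omega> k" if "k < K" for k using that not_less_Least unfolding K_def by blast
   have "K \<noteq> 0" using K elim(5) st0(1) by metis
   then obtain n where n: "K = Suc n" by (cases K) auto
   have "\<forall>k\<in>{..n}. \<exists>i. i \<in> I k \<and> s \<in> B i (a1 * \<rho> k i)"
    using less n st(5) by (metis atMost_iff le_imp_less_Suc)
   then obtain i where i: "\<And>k. k \<le> n \<Longrightarrow> i k \<in> I k" "\<And>k. k \<le> n \<Longrightarrow> s \<in> B (i k) (a1 * \<rho> k (i k))"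
    unfolding bchoice_iff by auto
   have C3\<kappa>: "C3 * \<kappa> \<ge> A * \<kappa>"
   proof -
    have "A * 1 \<le> C3" unfolding C3_def
     using A(1) C2 dbl_pos[of "4 * c_d\<^sup>2"] by (intro mult_left_mono) auto
    then show ?thesis using \<kappa> by (intro mult_right_mono) auto
   qed
   have chain: "norm (T1 f s) \<le> C3 * \<kappa> * (\<Sum>k<m. avg f (i k) (\<rho> k (i k))) + norm (Tf m (i m) s)" if "m \<le> n" for m
    using that
   proof (induction m)
    case 0
    then show ?case using elim(1) i(1)[of 0] by auto
   next
    case (Suc m)
    have "norm (Tf m (i m) s) \<le> C3 * \<kappa> * avg f (i m) (\<rho> m (i m)) + norm (Tf (Suc m) (i (Suc m)) s)"
     using elim(2) i[of m] i[of "Suc m"] Suc by auto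
    then show ?case using Suc by (simp add: algebra_simps)
   qed
   have ss: "s \<in> B (i k) (\<rho> k (i k))" "s \<in> B (i k) (a2 * \<rho> k (i k))" if "k \<le> n" for k
   proof -
    have p: "\<rho> k (i k) > 0" using I i that by auto
    have "a1 * \<rho> k (i k) \<le> a2 * \<rho> k (i k)" "a1 * \<rho> k (i k) \<le> \<rho> k (i k)"
     using a12 p by (simp_all add: mult_le_cancel_right1)
    then show "s \<in> B (i k) (\<rho> k (i k))" "s \<in> B (i k) (a2 * \<rho> k (i k))"
     using i(2)[OF that] by (auto simp: mem_B)
   qed
   have "s \<notin> bad (i n) (\<rho> n (i n))" using elim(3) K n i(1)[of n] by blast
   then have "norm (Tf n (i n) s) \<le> A * \<kappa> * avg f (i n) (\<rho> n (i n))"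
    unfolding Tf_def using bad(4)[of "i n" "\<rho> n (i n)"] I i(1)[of n] ss(2)[of n] by auto
   also have "... \<le> C3 * \<kappa> * avg f (i n) (\<rho> n (i n))" by (rule mult_right_mono[OF C3\<kappa> avg_nonneg])
   finally have "norm (T1 f s) \<le> C3 * \<kappa> * (\<Sum>k<Suc n. avg f (i k) (\<rho> k (i k)))"
    using chain[of n] by (simp add: algebra_simps)
   also have "(\<Sum>k<Suc n. avg f (i k) (\<rho> k (i k))) = (\<Sum>j\<in>(\<lambda>k. (k, i k)) ` {..n}. avg f (snd j) (r j))"
    by (subst sum.reindex) (auto simp: inj_on_def r_def lessThan_Suc_atMost)
   finally show ?case
    using i ss by (intro exI[of _ "(\<lambda>k. (k, i k)) ` {..n}"]) (auto simp: J_def r_def C3_def)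
  qed
 qed
qed

end

end

section \<open>Kernel estimates\<close>

text \<open>By monotonicity \<open>\<omega> t / t\<close> is at least the \<open>k\<close>-th term
  times \<open>2 ^ k\<close> on the interval from \<open>(1/2) ^ Suc k\<close> to
  \<open>(1/2) ^ k\<close>, whose length is half of \<open>(1/2) ^ k\<close>; hence the factor
  2.\<close>

lemma dini_sum:
 assumes nonneg: "\<And>u. u \<in> {0..1} \<Longrightarrow> \<omega> u \<ge> 0" and mono: "mono_on {0..1} \<omega>"
 shows "(\<Sum>k. ennreal (\<omega> ((1/2) ^ Suc k))) \<le> 2 * dini_norm \<omega>"
proof -
 let ?p = "\<lambda>k. (1/2::real) ^ k"
 define I where "I k = {?p (Suc k)<..?p k}" for k
 have p01: "?p k \<in> {0..1}" for k by (simp add: power_le_one)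
 have disj: "t \<notin> I l" if t: "t \<in> I k" and kl: "k \<noteq> l" for t k l
 proof -
  consider "Suc k \<le> l" | "Suc l \<le> k" using kl by linarith
  then show ?thesis
  proof cases
   case 1
   then have "?p l \<le> ?p (Suc k)" by (intro power_decreasing) auto
   then show ?thesis using t by (auto simp: I_def)
  next
   case 2
   then have "?p k \<le> ?p (Suc l)" by (intro power_decreasing) auto
   then show ?thesis using t by (auto simp: I_def)
  qed
 qed
 have bnd: "ennreal (\<omega> (?p (Suc k)) / ?p k) * indicator (I k) t \<le> ennreal (\<omega> t / t) * indicator {0<..1} t" for k t
 proof (cases "t \<in> I k")
  case True
  then have t: "?p (Suc k) < t" "t \<le> ?p k" by (auto simp: I_def)
  have t0: "0 < t" "t \<le> 1" using t p01[of k] p01[of "Suc k"] by auto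
  have "\<omega> (?p (Suc k)) \<le> \<omega> t" using mono t p01[of "Suc k"] t0 by (intro mono_onD[OF mono]) auto
  then have "\<omega> (?p (Suc k)) / ?p k \<le> \<omega> t / t"
   using t t0 nonneg[of t] by (intro frac_le) auto
  then show ?thesis using True t0 by (auto intro: ennreal_leI)
 qed auto
 have "(\<integral>\<^sup>+t. (\<Sum>k. ennreal (\<omega> (?p (Suc k)) / ?p k) * indicator (I k) t) \<partial>lborel) \<le> dini_norm \<omega>"
  unfolding dini_norm_def
 proof (rule nn_integral_mono)
  fix t
  show "(\<Sum>k. ennreal (\<omega> (?p (Suc k)) / ?p k) * indicator (I k) t) \<le> ennreal (\<omega> t / t) * indicator {0<..1} t"
  proof (cases "\<exists>k. t \<in> I k")
   case True
   then obtain k where k: "t \<in> I k" by blast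
   have "(\<Sum>l. ennreal (\<omega> (?p (Suc l)) / ?p l) * indicator (I l) t)
     = (\<Sum>l\<in>{k}. ennreal (\<omega> (?p (Suc l)) / ?p l) * indicator (I l) t)"
    using disj[OF k] by (intro suminf_finite) (auto simp: indicator_def)
   also have "... = ennreal (\<omega> (?p (Suc k)) / ?p k) * indicator (I k) t" by (simp only: sum.insert sum.empty finite.emptyI empty_iff not_False_eq_True add_0_right)
   finally show ?thesis using bnd[of k t] by (simp only:)
  qed (simp add: indicator_def)
 qed
 moreover have "(\<integral>\<^sup>+t. (\<Sum>k. ennreal (\<omega> (?p (Suc k)) / ?p k) * indicator (I k) t) \<partial>lborel)
   = (\<Sum>k. \<integral>\<^sup>+t. ennreal (\<omega> (?p (Suc k)) / ?p k) * indicator (I k) t \<partial>lborel)"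
  by (intro nn_integral_suminf) (auto simp: I_def)
 moreover have "(\<integral>\<^sup>+t. ennreal (\<omega> (?p (Suc k)) / ?p k) * indicator (I k) t \<partial>lborel) = ennreal (\<omega> (?p (Suc k)) / 2)" for k
 proof -
  have "(\<integral>\<^sup>+t. ennreal (\<omega> (?p (Suc k)) / ?p k) * indicator (I k) t \<partial>lborel)
    = ennreal (\<omega> (?p (Suc k)) / ?p k) * ennreal (?p k - ?p (Suc k))"
   by (subst nn_integral_cmult_indicator) (auto simp: I_def)
  also have "... = ennreal (\<omega> (?p (Suc k)) / ?p k * (?p k - ?p (Suc k)))"
   using nonneg[OF p01[of "Suc k"]] by (intro ennreal_mult[symmetric]) auto
  also have "\<omega> (?p (Suc k)) / ?p k * (?p k - ?p (Suc k)) = \<omega> (?p (Suc k)) / 2" by (simp add: field_simps)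
  finally show ?thesis .
 qed
 ultimately have "(\<Sum>k. ennreal (\<omega> (?p (Suc k)) / 2)) \<le> dini_norm \<omega>" by simp
 then have "2 * (\<Sum>k. ennreal (\<omega> (?p (Suc k)) / 2)) \<le> 2 * dini_norm \<omega>" by (rule mult_left_mono) simp
 moreover have "2 * (\<Sum>k. ennreal (\<omega> (?p (Suc k)) / 2)) = (\<Sum>k. ennreal (\<omega> (?p (Suc k))))"
 proof -
  have "2 * ennreal (\<omega> (?p (Suc k)) / 2) = ennreal (\<omega> (?p (Suc k)))" for k
  proof -
   have "2 * ennreal (\<omega> (?p (Suc k)) / 2) = ennreal (2 * (\<omega> (?p (Suc k)) / 2))"
    using nonneg[OF p01[of "Suc k"]] by (subst ennreal_mult) auto
   then show ?thesis by simp
  qed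
  then show ?thesis by (simp flip: ennreal_suminf_cmult)
 qed
 ultimately show ?thesis by simp
qed

section \<open>Integration over dyadic annuli\<close>

lemma dyadic_scale:
 fixes x :: real assumes "x \<ge> 1"
 obtains k :: nat where "2 ^ k \<le> x" "x < 2 ^ Suc k"
proof -
 obtain n :: nat where "x < 2 ^ n" using real_arch_pow[of 2 x] by auto
 define m where "m = (LEAST n. x < 2 ^ n)"
 have m: "x < 2 ^ m" unfolding m_def using \<open>x < 2 ^ n\<close> by (rule LeastI)
 then have "m \<noteq> 0" using assms by (intro notI) simp
 then obtain k where k: "m = Suc k" by (cases m) auto
 have "\<not> x < 2 ^ k" using not_less_Least[of k "\<lambda>n. x < 2 ^ n"] k unfolding m_def by simp
 then show ?thesis using that[of k] m k by simp
qed

context homogeneous_type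
begin

text \<open>Each point beyond the inner ball belongs to one annulus, and a single term of the series
  bounds \<open>F\<close> there. \<open>F\<close> stands for norms of kernel expressions; only the
  majorant is integrated term by term.\<close>

lemma nn_integral_annuli:
 assumes y: "y \<in> space M" and r: "r > 0" and [measurable]: "\<phi> \<in> borel_measurable M"
  and inner: "\<And>t. t \<in> space M \<Longrightarrow> d y t < r \<Longrightarrow> F t = 0"
  and outer: "\<And>t k. t \<in> space M \<Longrightarrow> 2 ^ k * r \<le> d y t \<Longrightarrow> d y t < 2 ^ Suc k * r \<Longrightarrow> F t \<le> c k * \<phi> t"
 shows "(\<integral>\<^sup>+t. F t \<partial>M) \<le> (\<Sum>k. c k * (\<integral>\<^sup>+t\<in>B y (2 ^ Suc k * r). \<phi> t \<partial>M))"
proof -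
 have [measurable]: "B y s \<in> sets M" for s using y by simp
 have "(\<integral>\<^sup>+t. F t \<partial>M) \<le> (\<integral>\<^sup>+t. (\<Sum>k. c k * (\<phi> t * indicator (B y (2 ^ Suc k * r)) t)) \<partial>M)"
 proof (rule nn_integral_mono)
  fix t assume t: "t \<in> space M"
  show "F t \<le> (\<Sum>k. c k * (\<phi> t * indicator (B y (2 ^ Suc k * r)) t))"
  proof (cases "d y t < r")
   case False
   then have "d y t / r \<ge> 1" using r by simp
   then obtain k where "2 ^ k \<le> d y t / r" "d y t / r < 2 ^ Suc k" by (rule dyadic_scale)
   then have k: "2 ^ k * r \<le> d y t" "d y t < 2 ^ Suc k * r" using r by (simp_all add: field_simps)
   have "F t \<le> c k * (\<phi> t * indicator (B y (2 ^ Suc k * r)) t)"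
    using outer[OF t k] t k by (auto simp: mem_B)
   also have "... = sum (\<lambda>k. c k * (\<phi> t * indicator (B y (2 ^ Suc k * r)) t)) {k}" by simp
   also have "... \<le> (\<Sum>k. c k * (\<phi> t * indicator (B y (2 ^ Suc k * r)) t))"
    by (rule sum_le_suminf) auto
   finally show ?thesis .
  qed (use inner[OF t] in auto)
 qed
 also have "... = (\<Sum>k. \<integral>\<^sup>+t. c k * (\<phi> t * indicator (B y (2 ^ Suc k * r)) t) \<partial>M)"
  by (intro nn_integral_suminf) measurable
 also have "... = (\<Sum>k. c k * (\<integral>\<^sup>+t\<in>B y (2 ^ Suc k * r). \<phi> t \<partial>M))"
  by (intro suminf_cong nn_integral_cmult) measurable
 finally show ?thesis .
qed

section \<open>Smoothness of the kernel in each variable\<close>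

context
 fixes K :: "'a \<Rightarrow> 'a \<Rightarrow> 'b::banach \<Rightarrow>\<^sub>L 'c::banach" and \<omega> :: "real \<Rightarrow> real" and c_K :: real
 assumes dini: "dini_kernel M d K \<omega> c_K"
begin

interpretation dini_kernel M d K \<omega> c_K by (rule dini)

text \<open>Hoermander's argument in the first variable: on the \<open>k\<close>-th annulus around
  \<open>y\<close> the smoothness gives a dyadic value of \<omega> divided by a volume, and the
  growth condition on the mass of \<open>g\<close> supplies that volume, so that
  \<open>dini_sum\<close> applies.\<close>

lemma kernel_oscillation:
 fixes g :: "'a \<Rightarrow> 'b"
 assumes g: "g \<in> Lp_space M 1" and z: "z \<in> space M" and r: "r > 0"
  and g0: "\<And>x. x \<in> B z r \<Longrightarrow> g x = 0" and A: "A \<ge> 0" "\<And>R. R \<ge> r \<Longrightarrow> measure (nu M g) (B z R) \<le> A * V z R"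
  and b: "b > 0" "4 * c_d\<^sup>2 * c_K * b \<le> 1" and y: "y \<in> B z (b * r)" and y': "y' \<in> B z (b * r)"
 shows "(\<integral>\<^sup>+t. enorm (K y t (g t) - K y' t (g t)) \<partial>M) \<le> ennreal (2 * dq 6 * A) * dini_norm \<omega>"
proof -
 interpret nug: finite_measure "nu M g" by (rule finite_measure_nu[OF g])
 have yM: "y \<in> space M" "y' \<in> space M" "d z y < b * r" "d z y' < b * r" using y y' by (auto simp: mem_B)
 have cdp: "c_d > 0" using c_d by simp
 have sm: "strongly_measurable M g" using g by (simp add: L1_iff)
 \<comment> \<open>As \<open>c_d * (s + s) = r\<close> and \<open>b * r \<le> s\<close>, the ball
   \<open>B y s\<close> lies in \<open>B z r\<close>, where \<open>g\<close> vanishes.\<close>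
 define s where "s = r / (2 * c_d)"
 have s: "s > 0" using r c_d by (simp add: s_def)
 have cK0: "c_K > 0" using c_K by simp
 \<comment> \<open>Here \<open>c_K \<ge> 2\<close> enters: the condition that brings
   \<open>y\<close> and \<open>y'\<close> within reach of the smoothness estimate also makes the
   ratios at most \<open>(1/2) ^ Suc k\<close>.\<close>
 have b8: "8 * c_d\<^sup>2 * b \<le> 1"
 proof -
  have "(8 * c_d\<^sup>2 * b) * 1 \<le> (4 * c_d\<^sup>2 * b) * c_K" using c_K b mult_left_mono[of 2 c_K "4 * c_d\<^sup>2 * b"] by simp
  then show ?thesis using b(2) by (simp add: mult_ac)
 qed
 have bc: "b * (2 * c_d) \<le> 1"
 proof -
  have "b * (2 * c_d) \<le> b * (8 * c_d\<^sup>2)" using b cd2 c_d by (intro mult_left_mono) auto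
  then show ?thesis using b8 by (simp add: mult_ac)
 qed
 have brs: "b * r \<le> s"
  using mult_right_mono[OF bc, of "r / (2 * c_d)"] r c_d by (simp add: s_def)
 have dyy: "d y y' \<le> 2 * c_d * b * r"
  using d_lt_triangle[of y z y' "b * r" "b * r"] yM z sym[of y z] by (simp add: mult_ac)
 let ?D = "dq 6"
 define c where "c k = ennreal (\<omega> ((1/2) ^ Suc k) / V y (2 ^ k * s))" for k
 have "(\<integral>\<^sup>+t. enorm (K y t (g t) - K y' t (g t)) \<partial>M)
   \<le> (\<Sum>k. c k * (\<integral>\<^sup>+t\<in>B y (2 ^ Suc k * s). enorm (g t) \<partial>M))"
 proof (rule nn_integral_annuli[OF yM(1) s])
  show "(\<lambda>t. enorm (g t)) \<in> borel_measurable M" using strongly_measurable_norm[OF sm] by measurable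
  show "enorm (K y t (g t) - K y' t (g t)) = 0" if t: "t \<in> space M" "d y t < s" for t
  proof -
   have "d z t < c_d * (b * r + s)" using t yM z by (intro d_lt_triangle[of z y t]) auto
   also have "... \<le> c_d * (s + s)" using brs c_d by (intro mult_left_mono add_right_mono) auto
   also have "... = r" using c_d by (simp add: s_def)
   finally have "g t = 0" using g0[of t] t by (simp add: mem_B)
   then show ?thesis by simp
  qed
  fix t k assume t: "t \<in> space M" "2 ^ k * s \<le> d y t" "d y t < 2 ^ Suc k * s"
  have dt: "d y t > 0" using t(2) s by (smt (verit) mult_pos_pos zero_less_power)
  show "enorm (K y t (g t) - K y' t (g t)) \<le> c k * enorm (g t)"
  proof (cases "y = y'")
   case False
   have dp: "d y y' > 0" using False zero_iff[OF yM(1,2)] nonneg[OF yM(1,2)] by linarith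
   have p1: "(1::real) \<le> 2 ^ k" by simp
   have "s \<le> 2 ^ k * s" using mult_right_mono[OF p1, of s] s by simp
   then have st: "s \<le> d y t" using t(2) by simp
   have "c_K * d y y' \<le> c_K * (2 * c_d * b * r)" using dyy cK0 by (intro mult_left_mono) auto
   also have "... = (4 * c_d\<^sup>2 * c_K * b) * s" using c_d by (simp add: s_def power2_eq_square)
   also have "... \<le> 1 * s" using b s by (intro mult_right_mono) auto
   finally have close: "d y y' \<le> 1 / c_K * d y t" using st cK0 by (simp add: field_simps)
   have ratio: "d y y' / d y t \<le> (1/2) ^ Suc k"
   proof -
    have "d y y' / d y t \<le> (2 * c_d * b * r) / (2 ^ k * s)"
     using dyy t(2) s dp by (intro frac_le order_trans[OF _ dyy]) auto
    also have "... = (8 * c_d\<^sup>2 * b) * (1/2) ^ Suc k"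
     using c_d r by (simp add: s_def power2_eq_square field_simps)
    also have "... \<le> 1 * (1/2) ^ Suc k" using b8 by (intro mult_right_mono) auto
    finally show ?thesis by simp
   qed
   have p01: "(1/2::real) ^ Suc k \<in> {0..1}" using power_le_one[of "1/2::real" "Suc k"] by simp
   have "norm (K y t - K y' t) \<le> \<omega> (d y y' / d y t) * (1 / V y (d y t))"
    using smooth_left[OF yM(1,2) t(1) dp close] by (simp add: V_def)
   also have "... \<le> \<omega> ((1/2) ^ Suc k) * (1 / V y (2 ^ k * s))"
   proof (intro mult_mono)
    show "\<omega> (d y y' / d y t) \<le> \<omega> ((1/2) ^ Suc k)"
    proof (rule mono_onD[OF omega_mono _ p01 ratio])
     have "0 \<le> d y y' / d y t" using dp dt by simp
     moreover have "d y y' / d y t \<le> 1" by (rule order_trans[OF ratio]) (use p01 in simp)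
     ultimately show "d y y' / d y t \<in> {0..1}" by (simp only: atLeastAtMost_iff)
    qed
    show "1 / V y (d y t) \<le> 1 / V y (2 ^ k * s)"
     using t(2) yM s dt by (intro divide_left_mono V_mono_subset B_mono mult_pos_pos V_pos) auto
   qed (use omega_nonneg[OF p01] V_nonneg in auto)
   finally have "norm (K y t - K y' t) \<le> \<omega> ((1/2) ^ Suc k) / V y (2 ^ k * s)" by simp
   then have "norm ((K y t - K y' t) (g t)) \<le> \<omega> ((1/2) ^ Suc k) / V y (2 ^ k * s) * norm (g t)"
    using norm_blinfun[of "K y t - K y' t" "g t"] by (meson mult_right_mono norm_ge_zero order_trans)
   then show ?thesis
    unfolding c_def using omega_nonneg[OF p01] V_nonneg
    by (subst ennreal_mult[symmetric]) (auto simp: minus_blinfun.rep_eq intro!: ennreal_leI)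
  qed simp
 qed
 also have "... \<le> (\<Sum>k. ennreal (?D * A) * ennreal (\<omega> ((1/2) ^ Suc k)))"
 proof (rule suminf_le)
  fix k
  define R where "R = 2 ^ Suc k * s"
  have p1: "(1::real) \<le> 2 ^ k" by simp
  have "2 * s \<le> R" using mult_right_mono[OF p1, of "2 * s"] s by (simp add: R_def)
  then have R: "R > 0" "r \<le> c_d * R" "b * r \<le> R"
   using s brs c_d mult_left_mono[of "2 * s" R c_d] by (auto simp: s_def)
  define R' where "R' = c_d * (b * r + R)"
  have "B y R \<subseteq> B z R'" unfolding R'_def using yM z by (intro B_subset[where s="b * r"]) auto
  then have "measure (nu M g) (B y R) \<le> measure (nu M g) (B z R')" using z by (intro nug.finite_measure_mono) auto
  also have "... \<le> A * V z R'"
  proof (rule A(2))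
   have "c_d * R \<le> R'" unfolding R'_def using c_d b r by (intro mult_left_mono) auto
   then show "r \<le> R'" using R by simp
  qed
  also have "... \<le> A * (?D * V y (2 ^ k * s))"
  proof (intro mult_left_mono V_compare[where s="b * r"])
   have "c_d * (b * r + R') \<le> c_d * (R + c_d * (R + R))"
    unfolding R'_def using R c_d by (intro mult_left_mono add_mono) auto
   also have "... = (c_d + 2 * c_d\<^sup>2) * R" by (simp add: algebra_simps power2_eq_square)
   also have "... \<le> (3 * c_d\<^sup>2) * R" using cd2 R by (intro mult_right_mono) auto
   finally show "c_d * (b * r + R') \<le> 6 * c_d\<^sup>2 * (2 ^ k * s)" by (simp add: R_def)
   show "d y z \<le> b * r" using yM z sym[of y z] by simp
  qed (use yM z s A cdp in auto)
  finally have m: "measure (nu M g) (B y R) \<le> A * (?D * V y (2 ^ k * s))" .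
  have p01: "(1/2::real) ^ Suc k \<in> {0..1}" using power_le_one[of "1/2::real" "Suc k"] by simp
  have "c k * (\<integral>\<^sup>+t\<in>B y R. enorm (g t) \<partial>M) = c k * ennreal (measure (nu M g) (B y R))"
   using emeasure_nu[OF sm, of "B y R"] yM by (simp add: nug.emeasure_eq_measure)
  also have "... \<le> c k * ennreal (A * (?D * V y (2 ^ k * s)))" using m by (intro mult_left_mono ennreal_leI) auto
  also have "... = ennreal (\<omega> ((1/2) ^ Suc k) / V y (2 ^ k * s) * (A * (?D * V y (2 ^ k * s))))"
   unfolding c_def using omega_nonneg[OF p01] V_nonneg A dbl_pos[of "6 * c_d\<^sup>2"] by (intro ennreal_mult[symmetric]) auto
  also have "\<omega> ((1/2) ^ Suc k) / V y (2 ^ k * s) * (A * (?D * V y (2 ^ k * s))) = ?D * A * \<omega> ((1/2) ^ Suc k)"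
   using V_pos[OF yM(1), of "2 ^ k * s"] s by simp
  also have "ennreal ... = ennreal (?D * A) * ennreal (\<omega> ((1/2) ^ Suc k))"
   using omega_nonneg[OF p01] A dbl_pos[of "6 * c_d\<^sup>2"] by (intro ennreal_mult) auto
  finally show "c k * (\<integral>\<^sup>+t\<in>B y (2 ^ Suc k * s). enorm (g t) \<partial>M) \<le> ennreal (?D * A) * ennreal (\<omega> ((1/2) ^ Suc k))"
   by (simp add: R_def)
 qed auto
 also have "... = ennreal (?D * A) * (\<Sum>k. ennreal (\<omega> ((1/2) ^ Suc k)))" by simp
 also have "... \<le> ennreal (?D * A) * (2 * dini_norm \<omega>)"
  by (intro mult_left_mono dini_sum omega_nonneg omega_mono) auto
 also have "... = ennreal (2 * ?D * A) * dini_norm \<omega>"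
 proof -
  have "ennreal (2 * ?D * A) = 2 * ennreal (?D * A)"
   using A dbl_pos[of "6 * c_d\<^sup>2"] by (simp add: ennreal_mult mult_ac)
  then show ?thesis by (simp add: mult_ac)
 qed
 finally show ?thesis .
qed

text \<open>Hoermander's argument in the second variable. As \<open>h\<close> has integral zero, the
  kernel frozen at \<open>z\<close> may be subtracted, and integration over annuli around
  \<open>z\<close> cancels the volumes. Those of the smoothness condition are centred at
  \<open>s\<close>; moving them to \<open>z\<close> costs \<open>dbl c_mu (4 * c_d)\<close>.\<close>

lemma kernel_mean_zero:
 fixes h :: "'a \<Rightarrow> 'b" and Th :: "'a \<Rightarrow> 'c"
 assumes h: "sintegrable M h" "sintegral M h = 0"
  and z: "z \<in> space M" and r: "r > 0" and b: "b > 0" "c_K * b \<le> 1"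
  and supp: "\<And>x. x \<in> space M \<Longrightarrow> x \<notin> B z (b * r) \<Longrightarrow> h x = 0"
  and X: "X \<in> sets M" "X \<inter> B z r = {}"
  and Th: "strongly_measurable M Th"
   "AE s in M. s \<in> X \<longrightarrow> has_strong_bochner_integral M (\<lambda>t. K s t (h t)) (Th s)"
 shows "(\<integral>\<^sup>+s\<in>X. enorm (Th s) \<partial>M)
   \<le> ennreal (2 * dbl c_mu (4 * c_d)) * dini_norm \<omega> * L1_mass M h"
proof -
 have cK0: "c_K > 0" using c_K by simp
 have b2: "b \<le> 1/2" using mult_right_mono[OF c_K, of b] b by linarith
 have cdp: "c_d > 0" using c_d by simp
 let ?D = "dbl c_mu (4 * c_d)" and ?H = "\<integral>\<^sup>+t. enorm (h t) \<partial>M"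
 have sh: "simple_function M h" using h by (auto elim: simple_bochner_integrable.cases)
 have mh[measurable]: "(\<lambda>t. norm (h t)) \<in> borel_measurable M"
  by (intro strongly_measurable_norm strongly_measurable_simple sh)
 \<comment> \<open>A fixed bounded operator commutes with the integral of a simple function; this is
   how the cancellation enters.\<close>
 have zero: "has_strong_bochner_integral M (\<lambda>t. blinfun_apply k (h t)) 0" for k :: "'b \<Rightarrow>\<^sub>L 'c"
 proof -
  have i: "sintegrable M (\<lambda>t. blinfun_apply k (h t))"
   by (rule simple_bochner_integrable_compose2[of "\<lambda>x y. blinfun_apply k x", OF _ h(1) h(1)]) simp
  have "sintegral M (\<lambda>t. blinfun_apply k (h t)) = blinfun_apply k 0"
   using simple_bochner_integral_linear[OF _ h(1), of "blinfun_apply k"] h(2)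
   by (simp add: bounded_linear.linear[OF blinfun.bounded_linear_right])
  then show ?thesis
   unfolding has_strong_bochner_integral_def using i
   by (intro conjI exI[of _ "\<lambda>n t. blinfun_apply k (h t)"] strongly_measurable_simple)
    (auto elim: simple_bochner_integrable.cases)
 qed
 define c where "c k = ennreal (\<omega> ((1/2) ^ Suc k) * ?D / V z (2 ^ Suc k * r)) * ?H" for k
 have bound: "enorm (Th s) \<le> c k"
  if s: "s \<in> space M" "has_strong_bochner_integral M (\<lambda>t. K s t (h t)) (Th s)"
   "2 ^ k * r \<le> d z s" "d z s < 2 ^ Suc k * r" for s k
 proof -
  have ds: "d s z = d z s" using s z by (intro sym) auto
  have p1: "(1::real) \<le> 2 ^ k" by simp
  have rs: "r \<le> d z s" using mult_right_mono[OF p1 less_imp_le[OF r]] s(3) by linarith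
  have p01: "(1/2::real) ^ Suc k \<in> {0..1}" using power_le_one[of "1/2::real" "Suc k"] by simp
  have "enorm (Th s) = enorm (Th s - 0)" by simp
  also have "... \<le> (\<integral>\<^sup>+t. enorm (K s t (h t) - K s z (h t)) \<partial>M)"
   by (rule has_strong_bochner_integral_diff_le[OF s(2) zero])
  also have "... \<le> (\<integral>\<^sup>+t. ennreal (\<omega> ((1/2) ^ Suc k) * ?D / V z (2 ^ Suc k * r)) * enorm (h t) \<partial>M)"
  proof (rule nn_integral_mono)
   fix t assume t: "t \<in> space M"
   have C: "0 \<le> \<omega> ((1/2) ^ Suc k) * ?D / V z (2 ^ Suc k * r)"
    using omega_nonneg[OF p01] dbl_pos[of "4 * c_d"] V_nonneg by simp
   have "norm (K s t (h t) - K s z (h t)) \<le> \<omega> ((1/2) ^ Suc k) * ?D / V z (2 ^ Suc k * r) * norm (h t)"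
   proof (cases "h t = 0 \<or> t = z")
    case False
    then have dzt: "d z t < b * r" "d z t > 0"
     using supp[OF t] t z zero_iff[OF z t] nonneg[OF z t] by (auto simp: mem_B)
    have "c_K * d z t \<le> c_K * (b * r)" using dzt cK0 by (intro mult_left_mono) auto
    also have "... \<le> 1 * r" using mult_right_mono[OF b(2), of r] r by (simp add: mult_ac)
    finally have close: "d z t \<le> 1 / c_K * d s z" using rs ds cK0 by (simp add: field_simps)
    have ratio: "d z t / d s z \<le> (1/2) ^ Suc k"
    proof -
     have "d z t / d s z \<le> (b * r) / (2 ^ k * r)"
      using dzt s(3) ds r by (intro frac_le) auto
     also have "... = b * (1/2) ^ k" using r by (simp add: field_simps)
     also have "... \<le> (1/2) * (1/2) ^ k" using b2 by (intro mult_right_mono) auto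
     finally show ?thesis by simp
    qed
    have "norm (K s z - K s t) \<le> \<omega> (d z t / d s z) * (1 / V s (d s z))"
     using smooth_right[OF s(1) z t dzt(2) close] by (simp add: V_def)
    also have "... \<le> \<omega> ((1/2) ^ Suc k) * (?D / V z (2 ^ Suc k * r))"
    proof (intro mult_mono)
     show "\<omega> (d z t / d s z) \<le> \<omega> ((1/2) ^ Suc k)"
     proof (rule mono_onD[OF omega_mono _ p01 ratio])
      have "0 \<le> d z t / d s z" using dzt rs r ds by simp
      moreover have "d z t / d s z \<le> 1" by (rule order_trans[OF ratio]) (use p01 in simp)
      ultimately show "d z t / d s z \<in> {0..1}" by (simp only: atLeastAtMost_iff)
     qed
     have "V z (2 ^ Suc k * r) \<le> ?D * V s (d s z)"
     proof (rule V_compare[where s="d s z"])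
      have "c_d * (d s z + 2 ^ Suc k * r) \<le> c_d * (d s z + 2 * d s z + d s z)"
       using s(3) ds rs r c_d by (intro mult_left_mono) auto
      then show "c_d * (d s z + 2 ^ Suc k * r) \<le> 4 * c_d * d s z" by simp
     qed (use s z rs r ds cdp in auto)
     moreover have "V s (d s z) > 0" "V z (2 ^ Suc k * r) > 0" using s z rs r ds by (auto intro!: V_pos)
     ultimately show "1 / V s (d s z) \<le> ?D / V z (2 ^ Suc k * r)"
      by (simp add: field_simps)
    qed (use omega_nonneg[OF p01] V_nonneg in auto)
    finally have "norm (K s t - K s z) \<le> \<omega> ((1/2) ^ Suc k) * ?D / V z (2 ^ Suc k * r)"
     by (simp add: norm_minus_commute)
    then have "norm ((K s t - K s z) (h t)) \<le> \<omega> ((1/2) ^ Suc k) * ?D / V z (2 ^ Suc k * r) * norm (h t)"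
     using norm_blinfun[of "K s t - K s z" "h t"] by (meson mult_right_mono norm_ge_zero order_trans)
    then show ?thesis by (simp add: minus_blinfun.rep_eq)
   next
    case True
    then have "norm (K s t (h t) - K s z (h t)) = 0" by auto
    then show ?thesis using mult_nonneg_nonneg[OF C norm_ge_zero] by (simp only:)
   qed
   then show "enorm (K s t (h t) - K s z (h t))
     \<le> ennreal (\<omega> ((1/2) ^ Suc k) * ?D / V z (2 ^ Suc k * r)) * enorm (h t)"
    using C by (subst ennreal_mult[symmetric]) (auto intro!: ennreal_leI)
  qed
  also have "... = c k" unfolding c_def by (rule nn_integral_cmult) measurable
  finally show ?thesis .
 qed
 \<comment> \<open>The estimate over annuli asks for bounds at every point, so the null set where
   the representation fails is removed from \<open>X\<close> first.\<close>
 obtain N where N: "N \<in> null_sets M" "\<And>s. s \<in> space M - N \<Longrightarrow> s \<in> X \<longrightarrow> has_strong_bochner_integral M (\<lambda>t. K s t (h t)) (Th s)"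
  using Th(2) by (auto elim!: AE_E3)
 have AEN: "AE s in M. s \<notin> N" using N(1) by (rule AE_not_in)
 have "(\<integral>\<^sup>+s\<in>X. enorm (Th s) \<partial>M) \<le> (\<integral>\<^sup>+s. enorm (Th s) * indicator (X - N) s \<partial>M)"
  by (intro nn_integral_mono_AE eventually_mono[OF AEN]) (auto simp: indicator_def)
 also have "... \<le> (\<Sum>k. c k * (\<integral>\<^sup>+t\<in>B z (2 ^ Suc k * r). 1 \<partial>M))"
 proof (rule nn_integral_annuli[OF z r])
  show "enorm (Th t) * indicator (X - N) t = 0" if "t \<in> space M" "d z t < r" for t
   using that X(2) by (auto simp: mem_B indicator_def)
  show "enorm (Th t) * indicator (X - N) t \<le> c k * 1"
   if "t \<in> space M" "2 ^ k * r \<le> d z t" "d z t < 2 ^ Suc k * r" for t k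
   using bound[OF that(1) _ that(2,3)] N(2)[of t] that(1) by (auto simp: indicator_def)
 qed simp
 also have "... = (\<Sum>k. (ennreal ?D * ?H) * ennreal (\<omega> ((1/2) ^ Suc k)))"
 proof (rule suminf_cong)
  fix k
  have p01: "(1/2::real) ^ Suc k \<in> {0..1}" using power_le_one[of "1/2::real" "Suc k"] by simp
  have Vp: "V z (2 ^ Suc k * r) > 0" using z r by (intro V_pos) auto
  have "c k * (\<integral>\<^sup>+t\<in>B z (2 ^ Suc k * r). 1 \<partial>M)
    = ?H * (ennreal (\<omega> ((1/2) ^ Suc k) * ?D / V z (2 ^ Suc k * r)) * ennreal (V z (2 ^ Suc k * r)))"
   using z by (simp add: c_def emeasure_B mult_ac)
  also have "ennreal (\<omega> ((1/2) ^ Suc k) * ?D / V z (2 ^ Suc k * r)) * ennreal (V z (2 ^ Suc k * r))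
    = ennreal (\<omega> ((1/2) ^ Suc k) * ?D / V z (2 ^ Suc k * r) * V z (2 ^ Suc k * r))"
   using omega_nonneg[OF p01] dbl_pos[of "4 * c_d"] V_nonneg by (intro ennreal_mult[symmetric]) auto
  also have "\<omega> ((1/2) ^ Suc k) * ?D / V z (2 ^ Suc k * r) * V z (2 ^ Suc k * r) = \<omega> ((1/2) ^ Suc k) * ?D"
   using Vp by simp
  also have "ennreal ... = ennreal (\<omega> ((1/2) ^ Suc k)) * ennreal ?D"
   using omega_nonneg[OF p01] dbl_pos[of "4 * c_d"] by (intro ennreal_mult) auto
  finally show "c k * (\<integral>\<^sup>+t\<in>B z (2 ^ Suc k * r). 1 \<partial>M) = (ennreal ?D * ?H) * ennreal (\<omega> ((1/2) ^ Suc k))"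
   by (simp add: mult_ac)
 qed
 also have "... = (ennreal ?D * ?H) * (\<Sum>k. ennreal (\<omega> ((1/2) ^ Suc k)))" by simp
 also have "... \<le> (ennreal ?D * ?H) * (2 * dini_norm \<omega>)"
  by (intro mult_left_mono dini_sum omega_nonneg omega_mono) auto
 also have "... = ennreal (2 * ?D) * dini_norm \<omega> * ?H"
  using dbl_pos[of "4 * c_d"] by (simp add: ennreal_mult mult_ac)
 finally show ?thesis .
qed

end


section \<open>Simple functions with bounded support\<close>

lemma boundedly_supported_iff:
 assumes x0: "x0 \<in> space M"
 shows "boundedly_supported M d f \<longleftrightarrow> (\<exists>R>0. {t\<in>space M. f t \<noteq> 0} \<subseteq> B x0 R)"
proof
 assume "boundedly_supported M d f"
 then obtain s r where s: "s \<in> space M" "r > 0" "{t\<in>space M. f t \<noteq> 0} \<subseteq> B s r"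
  by (auto simp: boundedly_supported_def)
 have "B s r \<subseteq> B x0 (c_d * (d x0 s + r))" using s x0 by (intro B_subset[where s="d x0 s"]) auto
 moreover have "c_d * (d x0 s + r) > 0" using c_d s nonneg[OF x0 s(1)] by (simp add: add_nonneg_pos)
 ultimately show "\<exists>R>0. {t\<in>space M. f t \<noteq> 0} \<subseteq> B x0 R" using s by blast
qed (use x0 in \<open>auto simp: boundedly_supported_def\<close>)

lemma boundedly_supported_compose2:
 assumes "boundedly_supported M d f" "boundedly_supported M d g" "p 0 0 = 0"
 shows "boundedly_supported M d (\<lambda>x. p (f x) (g x))"
proof -
 obtain s where s: "s \<in> space M" using assms(1) by (auto simp: boundedly_supported_def)
 obtain R where R1: "R > 0" "{t\<in>space M. f t \<noteq> 0} \<subseteq> B s R"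
  using assms(1) unfolding boundedly_supported_iff[OF s] by (elim exE conjE)
 obtain R' where R2: "R' > 0" "{t\<in>space M. g t \<noteq> 0} \<subseteq> B s R'"
  using assms(2) unfolding boundedly_supported_iff[OF s] by (elim exE conjE)
 note R = R1 R2
 have "{t\<in>space M. p (f t) (g t) \<noteq> 0} \<subseteq> B s (max R R')"
 proof
  fix t assume t: "t \<in> {t\<in>space M. p (f t) (g t) \<noteq> 0}"
  then have "f t \<noteq> 0 \<or> g t \<noteq> 0" using assms(3) by auto
  then show "t \<in> B s (max R R')" using R t by (auto simp: mem_B)
 qed
 then show ?thesis using R s unfolding boundedly_supported_iff[OF s] by (intro exI[of _ "max R R'"]) auto
qed

text \<open>The test functions. They have finite integrals of every power \<open>p > 0\<close>, are
  dense, and are stable under sums and truncation; their integrals are finite sums, which makes the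
  mean over a cell elementary.\<close>

definition V0 :: "('a \<Rightarrow> 'b::real_normed_vector) set" where
 "V0 = {g. simple_function M g \<and> boundedly_supported M d g}"

lemma V0_compose2: "f \<in> V0 \<Longrightarrow> g \<in> V0 \<Longrightarrow> p 0 0 = 0 \<Longrightarrow> (\<lambda>x. p (f x) (g x)) \<in> V0"
 by (auto simp: V0_def intro: simple_function_compose2 boundedly_supported_compose2)

lemma V0_add: "f \<in> V0 \<Longrightarrow> g \<in> V0 \<Longrightarrow> (\<lambda>x. f x + g x) \<in> V0"
 by (rule V0_compose2[where p="(+)"]) auto

lemma V0_diff: "f \<in> V0 \<Longrightarrow> g \<in> V0 \<Longrightarrow> (\<lambda>x. f x - g x) \<in> V0"
 by (rule V0_compose2[where p="(-)"]) auto

lemma V0_scaleR: "f \<in> V0 \<Longrightarrow> (\<lambda>x. c *\<^sub>R f x) \<in> V0"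
 by (rule V0_compose2[where p="\<lambda>x y. c *\<^sub>R x"]) auto

lemma boundedly_supported_cut: "boundedly_supported M d f \<Longrightarrow> boundedly_supported M d (cut A f)"
 unfolding boundedly_supported_def cut_def by (fastforce split: if_splits)

lemma V0_cut: "f \<in> V0 \<Longrightarrow> A \<in> sets M \<Longrightarrow> cut A f \<in> V0"
 by (auto simp: V0_def simple_function_cut boundedly_supported_cut)

lemma V0_const: "x \<in> space M \<Longrightarrow> A \<in> sets M \<Longrightarrow> A \<subseteq> B x r \<Longrightarrow> cut A (\<lambda>_. v) \<in> V0"
 unfolding V0_def boundedly_supported_iff[of x]
 by (intro CollectI conjI simple_function_cut exI[of _ "max r 1"]) (auto simp: cut_def mem_B)

lemma V0_zero: "space M \<noteq> {} \<Longrightarrow> (\<lambda>_. 0) \<in> V0"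
 by (auto simp: V0_def boundedly_supported_def intro: exI[of _ 1])

lemma V0_sum:
 assumes "space M \<noteq> {}" "finite F" "\<And>i. i \<in> F \<Longrightarrow> u i \<in> V0"
 shows "(\<lambda>x. \<Sum>i\<in>F. u i x) \<in> V0"
 using assms(2,3) by (induction F) (auto intro: V0_zero[OF assms(1)] V0_add)

lemma V0_bounded:
 assumes "g \<in> V0" obtains C where "C > 0" "\<And>x. x \<in> space M \<Longrightarrow> norm (g x) \<le> C"
proof -
 have "finite (g ` space M)" using assms by (auto simp: V0_def simple_function_def)
 then have "bounded (g ` space M)" by (rule finite_imp_bounded)
 then obtain C where "C > 0" "\<forall>x\<in>g ` space M. norm x \<le> C" by (auto simp: bounded_pos)
 then show ?thesis using that by auto
qed

lemma V0_support_finite: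
 assumes "g \<in> V0" shows "emeasure M {x\<in>space M. g x \<noteq> 0} < \<infinity>"
 using assms emeasure_subset_B_finite unfolding V0_def boundedly_supported_def by blast

lemma V0_simple_bochner: "g \<in> V0 \<Longrightarrow> sintegrable M g"
 using V0_support_finite[of g] by (auto simp: V0_def intro!: simple_bochner_integrable.intros)

lemma V0_strongly_measurable: "g \<in> V0 \<Longrightarrow> strongly_measurable M g"
 by (auto simp: V0_def strongly_measurable_simple)

lemma V0_Lp_integral:
 assumes g: "g \<in> V0" and p: "p > 0"
 shows "(\<integral>\<^sup>+x. ennreal (norm (g x) powr p) \<partial>M) < \<infinity>"
proof -
 obtain C where C: "C > 0" "\<And>x. x \<in> space M \<Longrightarrow> norm (g x) \<le> C" using V0_bounded[OF g] by blast
 define Z where "Z = {x\<in>space M. g x \<noteq> 0}"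
 have Z: "Z \<in> sets M"
 proof -
  have "Z = superlevel M g 0" by (auto simp: Z_def)
  then show ?thesis using strongly_measurable_norm_le[OF V0_strongly_measurable[OF g], of 0] by (simp only:)
 qed
 have "(\<integral>\<^sup>+x. ennreal (norm (g x) powr p) \<partial>M) \<le> (\<integral>\<^sup>+x. ennreal (C powr p) * indicator Z x \<partial>M)"
  using C p by (intro nn_integral_mono) (auto simp: Z_def indicator_def intro!: ennreal_leI powr_mono2)
 also have "... = ennreal (C powr p) * emeasure M Z" using Z by (rule nn_integral_cmult_indicator)
 also have "... < \<infinity>" using V0_support_finite[OF g] by (simp add: Z_def ennreal_mult_less_top)
 finally show ?thesis .
qed

lemma V0_L1: "g \<in> V0 \<Longrightarrow> g \<in> Lp_space M 1"
 using V0_Lp_integral[of g 1] by (simp add: L1_iff V0_strongly_measurable)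

section \<open>The Calderon-Zygmund decomposition\<close>

text \<open>The union of the interiors of all balls with average above \<open>h\<close>. Radii are
  first bounded by \<open>n\<close> for the covering lemma; the resulting bound does not depend on
  \<open>n\<close> and passes to the increasing union.\<close>

lemma maximal_open_set:
 fixes f :: "'a \<Rightarrow> 'b::real_normed_vector"
 assumes f: "f \<in> Lp_space M 1" and h: "h > 0"
 obtains \<Omega> where "qopen \<Omega>"
  "emeasure M \<Omega> \<le> ennreal (dq 5 * dq 3 / h * measure (nu M f) (space M))"
  "\<And>w r. w \<in> space M \<Longrightarrow> w \<notin> \<Omega> \<Longrightarrow> r > 0 \<Longrightarrow> measure (nu M f) (B w r) \<le> h * V w r"
  "AE x in M. x \<notin> \<Omega> \<longrightarrow> norm (f x) \<le> 2 * h"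
proof -
 interpret nuf: finite_measure "nu M f" by (rule finite_measure_nu[OF f])
 have sm: "strongly_measurable M f" using f by (simp add: L1_iff)
 have [measurable]: "(\<lambda>x. norm (f x)) \<in> borel_measurable M" using strongly_measurable_norm[OF sm] .
 define W where "W n = (\<Union>(x, r)\<in>{(x, r). x \<in> space M \<and> 0 < r \<and> r \<le> real n \<and> measure (nu M f) (B x r) > h * V x r}. U x r)" for n
 define \<Omega> where "\<Omega> = (\<Union>n. W n)"
 have W: "qopen (W n)" for n unfolding W_def by (intro openin_Union) (auto simp: U_open)
 then have op: "qopen \<Omega>" unfolding \<Omega>_def by (intro openin_Union) auto
 have in\<Omega>: "U x r \<subseteq> \<Omega>" if "x \<in> space M" "r > 0" "measure (nu M f) (B x r) > h * V x r" for x r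
 proof -
  obtain n where "r \<le> real n" using real_arch_simple by blast
  then have "U x r \<subseteq> W n" using that unfolding W_def by blast
  then show ?thesis by (auto simp: \<Omega>_def)
 qed
 let ?Dm = "dq 5 * dq 3"
 have Wn: "emeasure M (W n) \<le> ennreal (?Dm / h * measure (nu M f) (space M))" for n
 proof -
  define l where "l = h / dq 3"
  have l: "l > 0" using h dbl_pos by (simp add: l_def)
  obtain A where A: "A \<in> sets M" "emeasure M A \<le> ennreal (dq 5 / l) * emeasure (nu M f) (space M)"
   "\<And>v r. v \<in> space M \<Longrightarrow> v \<notin> A \<Longrightarrow> 0 < r \<Longrightarrow> r \<le> 2 * c_d * real n \<Longrightarrow>
    emeasure (nu M f) (B v r) \<le> ennreal l * emeasure M (B v r)"
   using weak_maximal[of "nu M f" l "2 * c_d * real n"] l by auto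
  have "W n \<subseteq> A"
  proof (rule subsetI, rule ccontr)
   fix v assume "v \<in> W n" and vA: "v \<notin> A"
   then obtain x r where x: "x \<in> space M" "0 < r" "r \<le> real n" "measure (nu M f) (B x r) > h * V x r"
    and vU: "v \<in> U x r" unfolding W_def by blast
   have "v \<in> B x r" using vU U_subset by blast
   then have v: "v \<in> space M" "d x v < r" by (auto simp: mem_B)
   have dvx: "d v x \<le> r" using v x sym[of v x] by simp
   have "V v (2 * c_d * r) \<le> dq 3 * V x r"
   proof (rule V_compare[where s=r])
    have "c_d * (r + 2 * c_d * r) = (c_d + 2 * c_d\<^sup>2) * r" by (simp add: algebra_simps power2_eq_square)
    also have "... \<le> (3 * c_d\<^sup>2) * r" using cd2 x by (intro mult_right_mono) auto
    finally show "c_d * (r + 2 * c_d * r) \<le> 3 * c_d\<^sup>2 * r" .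
   qed (use v x c_d in auto)
   then have "l * V v (2 * c_d * r) \<le> l * (dq 3 * V x r)"
    using l by (intro mult_left_mono) auto
   also have "... = h * V x r" using dbl_pos[of "3 * c_d\<^sup>2"] by (simp add: l_def)
   also have "... < measure (nu M f) (B x r)" by fact
   also have "... \<le> measure (nu M f) (B v (2 * c_d * r))"
    using dvx x v by (intro nuf.finite_measure_mono B_subset[where s=r]) auto
   finally have 1: "l * V v (2 * c_d * r) < measure (nu M f) (B v (2 * c_d * r))" .
   have "emeasure (nu M f) (B v (2 * c_d * r)) \<le> ennreal l * emeasure M (B v (2 * c_d * r))"
    using v vA x c_d by (intro A(3) mult_left_mono) auto
   then have "measure (nu M f) (B v (2 * c_d * r)) \<le> l * V v (2 * c_d * r)"
    using v l V_nonneg by (simp add: nuf.emeasure_eq_measure emeasure_B flip: ennreal_mult)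
   then show False using 1 by simp
  qed
  then have "emeasure M (W n) \<le> emeasure M A" using A(1) by (rule emeasure_mono)
  also have "... \<le> ennreal (dq 5 / l) * ennreal (measure (nu M f) (space M))"
   using A(2) nuf.emeasure_eq_measure[of "space M"] by simp
  also have "... = ennreal (dq 5 / l * measure (nu M f) (space M))"
   using l dbl_pos[of "5 * c_d\<^sup>2"] by (intro ennreal_mult[symmetric]) auto
  finally show ?thesis by (simp add: l_def)
 qed
 have "incseq W"
 proof (rule incseq_SucI)
  fix n
  have "r \<le> real n \<Longrightarrow> r \<le> real (Suc n)" for r by simp
  then show "W n \<subseteq> W (Suc n)" unfolding W_def by blast
 qed
 then have "emeasure M \<Omega> = (SUP n. emeasure M (W n))"
  unfolding \<Omega>_def using W qopen_sets by (intro SUP_emeasure_incseq[symmetric]) auto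
 also have "... \<le> ennreal (?Dm / h * measure (nu M f) (space M))" using Wn by (intro SUP_least) auto
 finally have m\<Omega>: "emeasure M \<Omega> \<le> ennreal (?Dm / h * measure (nu M f) (space M))" .
 \<comment> \<open>Around a density point of \<open>H\<close> at least three quarters of a small
   ball carry values above \<open>2 * h\<close>. The average there exceeds \<open>h\<close>, which
   puts the point into \<Omega>, a contradiction.\<close>
 define H where "H = superlevel M f (2 * h) - \<Omega>"
 have Hs: "H \<in> sets M" unfolding H_def using strongly_measurable_norm_le[OF sm] qopen_sets[OF op] by auto
 have "(1/4 :: real) > 0" by simp
 from density_points[OF Hs this] AE_space
 have ae: "AE x in M. x \<notin> \<Omega> \<longrightarrow> norm (f x) \<le> 2 * h"
 proof eventually_elim
  case (elim x)
  show ?case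
  proof (intro impI, rule ccontr)
   assume x: "x \<notin> \<Omega>" "\<not> norm (f x) \<le> 2 * h"
   then have "x \<in> H" using elim by (auto simp: H_def)
   then obtain r0 where r0: "r0 > 0" "\<And>r. 0 < r \<Longrightarrow> r < r0 \<Longrightarrow> measure M (B x r - H) \<le> 1/4 * V x r"
    using elim(1) by auto
   define r where "r = r0 / 2"
   have r: "r > 0" "r < r0" using r0 by (auto simp: r_def)
   have Vp: "V x r > 0" using V_pos[OF elim(2) r(1)] .
   have "measure M (H \<inter> B x r) \<ge> 3/4 * V x r"
    using V_split[OF elim(2) Hs, of r] r0(2)[OF r] by simp
   moreover have "2 * h * measure M (H \<inter> B x r) \<le> measure (nu M f) (B x r)"
   proof -
    have "ennreal (2 * h * measure M (H \<inter> B x r)) = ennreal (2 * h) * emeasure M (H \<inter> B x r)"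
     using h emeasure_eq_measure_subset_B[OF elim(2), of "H \<inter> B x r" r] by (simp add: ennreal_mult)
    also have "... = (\<integral>\<^sup>+t. ennreal (2 * h) * indicator (H \<inter> B x r) t \<partial>M)"
     using Hs elim(2) by (intro nn_integral_cmult_indicator[symmetric]) auto
    also have "... \<le> (\<integral>\<^sup>+t\<in>B x r. enorm (f t) \<partial>M)"
     by (intro nn_integral_mono) (auto simp: H_def indicator_def intro!: ennreal_leI)
    also have "... = ennreal (measure (nu M f) (B x r))"
     using elim(2) by (subst emeasure_nu[OF sm, symmetric]) (auto simp: nuf.emeasure_eq_measure)
    finally show ?thesis by simp
   qed
   ultimately have "2 * h * (3/4 * V x r) \<le> measure (nu M f) (B x r)"
    using h mult_left_mono[of "3/4 * V x r" "measure M (H \<inter> B x r)" "2 * h"] by linarith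
   moreover have "h * V x r < 2 * h * (3/4 * V x r)" using h Vp by simp
   ultimately have "U x r \<subseteq> \<Omega>" using elim(2) r by (intro in\<Omega>) auto
   then show False using U_center[OF elim(2) r(1)] x(1) by blast
  qed
 qed
 show ?thesis
 proof (rule that[OF op m\<Omega> _ ae])
  fix w r assume w: "w \<in> space M" "w \<notin> \<Omega>" "0 < (r::real)"
  show "measure (nu M f) (B w r) \<le> h * V w r"
  proof (rule ccontr)
   assume "\<not> ?thesis"
   then have "U w r \<subseteq> \<Omega>" using w by (intro in\<Omega>) auto
   then show False using w U_center[OF w(1,3)] by blast
  qed
 qed
qed

text \<open>A point of some \<open>b j\<close> goes to that index, any other point to the first
  \<open>C i\<close> containing it. As \<open>P i\<close> contains \<open>b i\<close>, its measure
  is comparable to that of the ball, which later bounds the mean of \<open>f\<close> over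
  it.\<close>

lemma partition_between:
 assumes I: "countable I" and dis: "disjoint_family_on b I" and sub: "\<And>i. i \<in> I \<Longrightarrow> b i \<subseteq> C i"
  and b: "\<And>i. i \<in> I \<Longrightarrow> b i \<in> sets M" and C: "\<And>i. i \<in> I \<Longrightarrow> C i \<in> sets M"
 obtains P where "\<And>i. i \<in> I \<Longrightarrow> P i \<in> sets M" "\<And>i. i \<in> I \<Longrightarrow> b i \<subseteq> P i" "\<And>i. i \<in> I \<Longrightarrow> P i \<subseteq> C i"
  "disjoint_family_on P I" "(\<Union>i\<in>I. P i) = (\<Union>i\<in>I. C i)"
proof -
 define n where "n = to_nat_on I"
 have inj: "inj_on n I" unfolding n_def by (rule inj_on_to_nat_on[OF I])
 define P where "P i = b i \<union> (C i - (\<Union>j\<in>I. b j) - (\<Union>j\<in>{j\<in>I. n j < n i}. C j))" for i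
 have cj: "countable {j\<in>I. n j < n i}" for i using I by (rule countable_subset[rotated]) auto
 show ?thesis
 proof (rule that[of P])
  show "P i \<in> sets M" if "i \<in> I" for i
   unfolding P_def using that b C I cj by (intro sets.Un sets.Diff sets.countable_UN'') auto
  show "b i \<subseteq> P i" for i by (auto simp: P_def)
  show "P i \<subseteq> C i" if "i \<in> I" for i using sub[OF that] by (auto simp: P_def)
  show "disjoint_family_on P I"
   unfolding disjoint_family_on_def
  proof (intro ballI impI)
   fix i j assume ij: "i \<in> I" "j \<in> I" "i \<noteq> j"
   have "b i \<inter> b j = {}" using ij disjoint_family_onD[OF dis] by blast
   moreover have "n i \<noteq> n j" using ij inj by (auto simp: inj_on_def)
   ultimately show "P i \<inter> P j = {}" using ij unfolding P_def by (cases "n i < n j") (auto simp: not_less)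
  qed
  show "(\<Union>i\<in>I. P i) = (\<Union>i\<in>I. C i)"
  proof
   show "(\<Union>i\<in>I. P i) \<subseteq> (\<Union>i\<in>I. C i)" using sub by (auto simp: P_def)
   show "(\<Union>i\<in>I. C i) \<subseteq> (\<Union>i\<in>I. P i)"
   proof
    fix x assume "x \<in> (\<Union>i\<in>I. C i)"
    then have ex: "\<exists>i. i \<in> I \<and> x \<in> C i" by blast
    define i where "i = arg_min n (\<lambda>i. i \<in> I \<and> x \<in> C i)"
    have i: "i \<in> I" "x \<in> C i" and min: "\<And>j. j \<in> I \<Longrightarrow> x \<in> C j \<Longrightarrow> n i \<le> n j"
     using arg_min_nat_lemma[of "\<lambda>i. i \<in> I \<and> x \<in> C i", of _ n] ex unfolding i_def by blast+
    show "x \<in> (\<Union>i\<in>I. P i)"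
    proof (cases "x \<in> (\<Union>j\<in>I. b j)")
     case True
     then show ?thesis by (auto simp: P_def)
    next
     case False
     have "x \<notin> (\<Union>j\<in>{j\<in>I. n j < n i}. C j)" using min by (auto simp: not_less[symmetric])
     then have "x \<in> P i" using i False by (auto simp: P_def)
     then show ?thesis using i by blast
    qed
   qed
  qed
 qed
qed

text \<open>Test functions allow finite sums only. The remaining cells can be made so small in total
  measure that the bound at \<open>p0\<close> takes care of them.\<close>

lemma finite_part_of_partition:
 assumes I: "countable I" and P: "\<And>i. i \<in> I \<Longrightarrow> P i \<in> sets M" "disjoint_family_on P I"
  and fin: "emeasure M (\<Union>i\<in>I. P i) < \<infinity>" and e: "e > (0::real)"
 obtains F where "finite F" "F \<subseteq> I" "emeasure M (\<Union>i\<in>I - F. P i) < ennreal e"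
proof -
 define n where "n = to_nat_on I"
 have inj: "inj_on n I" unfolding n_def by (rule inj_on_to_nat_on[OF I])
 define A where "A k = (\<Union>i\<in>{i\<in>I. n i \<ge> k}. P i)" for k
 have As: "A k \<in> sets M" for k
  unfolding A_def using P by (intro sets.countable_UN'' countable_subset[OF _ I]) auto
 have "(\<lambda>k. emeasure M (A k)) \<longlonglongrightarrow> emeasure M (\<Inter>k. A k)"
 proof (rule Lim_emeasure_decseq)
  show "range A \<subseteq> sets M" using As by auto
  show "decseq A" unfolding decseq_def A_def by (auto intro: order_trans)
  show "emeasure M (A k) \<noteq> \<infinity>" for k
  proof -
   have "emeasure M (A k) \<le> emeasure M (\<Union>i\<in>I. P i)"
    using P(1) I by (intro emeasure_mono sets.countable_UN'') (auto simp: A_def)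
   then show ?thesis using fin by (auto simp: top_unique)
  qed
 qed
 moreover have "(\<Inter>k. A k) = {}"
 proof (rule ccontr)
  assume "\<not> ?thesis"
  then obtain x where x: "\<And>k. x \<in> A k" by blast
  obtain i where i: "i \<in> I" "x \<in> P i" using x[of 0] by (auto simp: A_def)
  obtain j where j: "j \<in> I" "n j \<ge> Suc (n i)" "x \<in> P j" using x[of "Suc (n i)"] by (auto simp: A_def)
  then have "i \<noteq> j" by auto
  then show False using i j disjoint_family_onD[OF P(2), of i j] by blast
 qed
 ultimately have "(\<lambda>k. emeasure M (A k)) \<longlonglongrightarrow> 0" by simp
 then have "\<forall>\<^sub>F k in sequentially. emeasure M (A k) < ennreal e"
  using e by (intro order_tendstoD(2)) auto
 then obtain k where k: "emeasure M (A k) < ennreal e" by (auto simp: eventually_sequentially)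
 define F where "F = {i\<in>I. n i < k}"
 have "finite F"
  by (rule finite_imageD[of n]) (auto simp: F_def inj_on_def intro: finite_subset[of _ "{..<k}"] inj_onD[OF inj])
 moreover have "(\<Union>i\<in>I - F. P i) = A k" by (auto simp: F_def A_def)
 ultimately show ?thesis using that[of F] k by (auto simp: F_def)
qed

end

lemma simple_bochner_integral_cut_const:
 fixes v :: "'b::real_normed_vector"
 assumes A: "A \<in> sets M" "emeasure M A < \<infinity>"
 shows "sintegral M (cut A (\<lambda>_. v)) = measure M A *\<^sub>R v"
proof -
 have i: "sintegrable M (indicator A :: 'a \<Rightarrow> real)"
 proof (rule simple_bochner_integrable.intros)
  have "{y\<in>space M. indicator A y \<noteq> (0::real)} = A"
   using sets.sets_into_space[OF A(1)] by (auto simp: indicator_def)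
  then show "emeasure M {y\<in>space M. indicator A y \<noteq> (0::real)} \<noteq> \<infinity>" using A by simp
 qed (use A in simp)
 have "ennreal (sintegral M (indicator A :: 'a \<Rightarrow> real)) = emeasure M A"
  using simple_bochner_integral_eq_nn_integral[OF i] A(1) by (simp add: ennreal_indicator)
 then have 1: "sintegral M (indicator A :: 'a \<Rightarrow> real) = measure M A"
  using simple_bochner_integral_nonneg[of "indicator A :: 'a \<Rightarrow> real" M]
  by (metis enn2real_ennreal indicator_pos_le measure_def)
 have "linear (\<lambda>r::real. r *\<^sub>R v)" by (intro linearI) (auto simp: algebra_simps)
 from simple_bochner_integral_linear[OF this i] 1
 have "sintegral M (\<lambda>x. indicator A x *\<^sub>R v) = measure M A *\<^sub>R v" by simp
 moreover have "(\<lambda>x. indicator A x *\<^sub>R v) = cut A (\<lambda>_. v)" by (auto simp: cut_def indicator_def)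
 ultimately show ?thesis by simp
qed

lemma norm_simple_bochner_integral_le:
 fixes h :: "'a \<Rightarrow> 'b::real_normed_vector"
 assumes "sintegrable M h"
 shows "enorm (sintegral M h) \<le> L1_mass M h"
proof -
 have i: "sintegrable M (\<lambda>x. norm (h x))"
  by (rule simple_bochner_integrable_compose2[where p="\<lambda>x y. norm x", OF _ assms assms]) simp
 show ?thesis
  using ennreal_leI[OF simple_bochner_integral_norm_bound[OF assms]]
   simple_bochner_integral_eq_nn_integral[OF i] by simp
qed

context homogeneous_type
begin

text \<open>The summands belong to the good function, to the open set itself and to the bad
  functions off that set.\<close>

definition cz_const :: "real \<Rightarrow> real \<Rightarrow> real" where
 "cz_const p0 a = 3 powr p0 * (max 2 (dbl c_mu (5 * (c_d\<^sup>2)^2 / a))) powr (p0 - 1)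
   + dq 5 * dq 3 + 12 * dbl c_mu (4 * c_d)"


section \<open>Weak type (1,1) on test functions\<close>

context
 fixes K :: "'a \<Rightarrow> 'a \<Rightarrow> 'b::banach \<Rightarrow>\<^sub>L 'c::banach" and \<omega> :: "real \<Rightarrow> real" and c_K p0 \<kappa> a :: real
  and T :: "('a \<Rightarrow> 'b) \<Rightarrow> ('a \<Rightarrow> 'c)"
 assumes dini: "dini_kernel M d K \<omega> c_K" and p0: "p0 \<ge> 1" and \<kappa>: "\<kappa> > 0" and dini_le: "dini_norm \<omega> \<le> ennreal \<kappa>"
  and a: "a > 0" "1000 * (c_d\<^sup>2)^8 * a \<le> 1" "5 * (c_d\<^sup>2)^3 * a * c_K \<le> 1"
  and T_meas: "\<And>g. g \<in> V0 \<Longrightarrow> strongly_measurable M (T g)"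
  and T_add: "\<And>f g. f \<in> V0 \<Longrightarrow> g \<in> V0 \<Longrightarrow> AE s in M. T (\<lambda>x. f x + g x) s = T f s + T g s"
  and T_p0: "\<And>g l. g \<in> V0 \<Longrightarrow> l > 0 \<Longrightarrow>
   emeasure M (superlevel M (T g) l) \<le> ennreal ((\<kappa> / l) powr p0) * (\<integral>\<^sup>+x. ennreal (norm (g x) powr p0) \<partial>M)"
  and T_kernel: "\<And>g. g \<in> V0 \<Longrightarrow> AE s in M. (\<exists>e>0. \<forall>t\<in>B s e. g t = 0) \<longrightarrow>
   has_strong_bochner_integral M (\<lambda>t. K s t (g t)) (T g s)"
begin

lemma T_null:
 assumes g: "g \<in> V0" and z: "\<And>x. x \<in> space M \<Longrightarrow> g x = 0"
 shows "AE s in M. T g s = 0"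
proof -
 have "(\<integral>\<^sup>+x. ennreal (norm (g x) powr p0) \<partial>M) = (\<integral>\<^sup>+x. 0 \<partial>M)" using z by (intro nn_integral_cong) simp
 then have "emeasure M (superlevel M (T g) l) = 0" if "l > 0" for l using T_p0[OF g that] by simp
 then show ?thesis by (rule AE_zero_levels[OF T_meas[OF g]])
qed

lemma T_cong:
 assumes "f \<in> V0" "g \<in> V0" "\<And>x. x \<in> space M \<Longrightarrow> f x = g x"
 shows "AE s in M. T f s = T g s"
proof -
 have d: "(\<lambda>x. f x - g x) \<in> V0" using assms by (intro V0_diff)
 have "AE s in M. T (\<lambda>x. g x + (f x - g x)) s = T g s + T (\<lambda>x. f x - g x) s" by (rule T_add[OF assms(2) d])
 moreover have "AE s in M. T (\<lambda>x. f x - g x) s = 0" using assms by (intro T_null[OF d]) simp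
 ultimately show ?thesis by eventually_elim simp
qed

lemma T_sum:
 assumes ne: "space M \<noteq> {}" and "finite F" "\<And>i. i \<in> F \<Longrightarrow> u i \<in> V0"
 shows "AE s in M. T (\<lambda>x. \<Sum>i\<in>F. u i x) s = (\<Sum>i\<in>F. T (u i) s)"
 using assms(2,3)
proof (induction F)
 case empty
 then show ?case using T_null[OF V0_zero[OF ne]] by simp
next
 case (insert i F)
 have "AE s in M. T (\<lambda>x. u i x + (\<Sum>i\<in>F. u i x)) s = T (u i) s + T (\<lambda>x. \<Sum>i\<in>F. u i x) s"
  using insert by (intro T_add V0_sum[OF ne]) auto
 moreover have "AE s in M. T (\<lambda>x. \<Sum>i\<in>F. u i x) s = (\<Sum>i\<in>F. T (u i) s)" using insert by simp
 ultimately show ?case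
  by eventually_elim (use insert in simp)
qed

text \<open>For a function bounded by \<open>C * h\<close> the power \<open>p0\<close> of the norm
  is at most \<open>(C * h) powr (p0 - 1)\<close> times the norm, so the bound at \<open>p0\<close>
  becomes a bound in the mean, with \<open>h\<close> to the power -1.\<close>

lemma weak_type_good:
 assumes g: "g \<in> V0" and h: "h > 0" "AE x in M. norm (g x) \<le> C * h" and C: "C > 0"
  and F: "L1_mass M g \<le> ennreal F" "F \<ge> 0"
 shows "emeasure M {s\<in>space M. norm (T g s) > \<kappa> * h / 3} \<le> ennreal (3 powr p0 * C powr (p0 - 1) / h * F)"
proof -
 have [measurable]: "(\<lambda>x. norm (g x)) \<in> borel_measurable M"
  using strongly_measurable_norm[OF V0_strongly_measurable[OF g]] .
 have "(\<integral>\<^sup>+x. ennreal (norm (g x) powr p0) \<partial>M) \<le> (\<integral>\<^sup>+x. ennreal ((C * h) powr (p0 - 1)) * enorm (g x) \<partial>M)"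
  using h(2)
 proof (intro nn_integral_mono_AE, eventually_elim)
  case (elim x)
  have "norm (g x) powr p0 = norm (g x) powr (p0 - 1) * norm (g x)"
   by (cases "g x = 0") (auto simp: powr_mult_base[symmetric] powr_diff)
  also have "... \<le> (C * h) powr (p0 - 1) * norm (g x)"
   using elim p0 by (intro mult_right_mono powr_mono2) auto
  finally show ?case by (subst ennreal_mult[symmetric]) (auto intro: ennreal_leI)
 qed
 also have "... = ennreal ((C * h) powr (p0 - 1)) * L1_mass M g"
  by (rule nn_integral_cmult) measurable
 also have "... \<le> ennreal ((C * h) powr (p0 - 1)) * ennreal F" using F by (intro mult_left_mono) auto
 finally have "emeasure M {s\<in>space M. norm (T g s) > \<kappa> * h / 3}
   \<le> ennreal ((\<kappa> / (\<kappa> * h / 3)) powr p0) * (ennreal ((C * h) powr (p0 - 1)) * ennreal F)"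
  using \<kappa> h by (intro order_trans[OF T_p0[OF g]] mult_left_mono) auto
 also have "... = ennreal ((\<kappa> / (\<kappa> * h / 3)) powr p0 * ((C * h) powr (p0 - 1) * F))"
  using F by (simp flip: ennreal_mult)
 also have "(\<kappa> / (\<kappa> * h / 3)) powr p0 * ((C * h) powr (p0 - 1) * F) = 3 powr p0 * C powr (p0 - 1) / h * F"
 proof -
  have "(\<kappa> / (\<kappa> * h / 3)) powr p0 = 3 powr p0 / h powr p0"
   using \<kappa> h by (simp add: powr_divide)
  moreover have "(C * h) powr (p0 - 1) = C powr (p0 - 1) * (h powr p0 / h)"
   using h C by (simp add: powr_mult powr_diff)
  ultimately show ?thesis using h by simp
 qed
 finally show ?thesis .
qed

text \<open>Chebyshev's inequality for the sum of the norms on \<open>X\<close>, which avoids all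
  the balls \<open>B i (\<rho> i)\<close>. In the factor 12, 3 comes from the level, 2 from
  \<open>kernel_mean_zero\<close> and 2 from the mass of \<open>u i\<close>.\<close>

lemma weak_type_bad:
 assumes ne: "space M \<noteq> {}" and F: "finite F" and u: "\<And>i. i \<in> F \<Longrightarrow> u i \<in> V0" "\<And>i. i \<in> F \<Longrightarrow> sintegral M (u i) = 0"
  and i: "\<And>i. i \<in> F \<Longrightarrow> i \<in> space M" "\<And>i. i \<in> F \<Longrightarrow> \<rho> i > 0"
  and supp: "\<And>i x. i \<in> F \<Longrightarrow> x \<in> space M \<Longrightarrow> x \<notin> B i (5 * (c_d\<^sup>2)^3 * a * \<rho> i) \<Longrightarrow> u i x = 0"
  and X: "X \<in> sets M" "\<And>i. i \<in> F \<Longrightarrow> X \<inter> B i (\<rho> i) = {}"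
  and m: "\<And>i. i \<in> F \<Longrightarrow> (L1_mass M (u i)) \<le> ennreal (2 * m i)" "\<And>i. i \<in> F \<Longrightarrow> m i \<ge> 0"
  and h: "h > 0"
 shows "emeasure M {s\<in>X. norm (T (\<lambda>x. \<Sum>i\<in>F. u i x) s) > \<kappa> * h / 3} \<le> ennreal (12 * dbl c_mu (4 * c_d) / h * (\<Sum>i\<in>F. m i))"
proof -
 define q where "q = c_d\<^sup>2"
 have q1: "q \<ge> 1" and cq: "c_d \<le> q" using cd2 by (auto simp: q_def)
 define a1 where "a1 = 5 * (c_d\<^sup>2)^3 * a"
 have a1: "a1 > 0" "c_K * a1 \<le> 1" using a c_d by (simp_all add: a1_def mult_ac)
 have a1c: "2 * c_d * a1 \<le> 1"
 proof -
  have "2 * c_d * a1 \<le> 2 * q * (5 * q^3 * a)"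
   unfolding a1_def q_def[symmetric] using cq a q1 by (intro mult_right_mono) auto
  also have "... = 10 * q^4 * a" by (simp add: power_numeral_reduce)
  also have "... \<le> 1000 * q^8 * a" using q1 a by (intro mult_right_mono mult_mono power_increasing) auto
  finally show ?thesis using a(2) by (simp only: q_def)
 qed
 have cdp: "c_d > 0" using c_d by simp
 let ?D = "dbl c_mu (4 * c_d)"
 have single: "(\<integral>\<^sup>+s\<in>X. enorm (T (u j) s) \<partial>M) \<le> ennreal (4 * ?D * \<kappa> * m j)" if j: "j \<in> F" for j
 proof -
  \<comment> \<open>The support of \<open>u j\<close> sits well inside the avoided ball, so around
    each point of \<open>X\<close> there is a ball free of it and the kernel formula
    applies.\<close>
  have sep: "\<exists>e>0. \<forall>t\<in>B s e. u j t = 0" if s: "s \<in> X" for s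
  proof (intro exI[of _ "\<rho> j / (2 * c_d)"] conjI ballI)
   show "\<rho> j / (2 * c_d) > 0" using i[OF j] cdp by simp
   fix t assume t: "t \<in> B s (\<rho> j / (2 * c_d))"
   have sM: "s \<in> space M" "t \<in> space M" using s sets.sets_into_space[OF X(1)] t by (auto simp: mem_B)
   have "t \<notin> B j (a1 * \<rho> j)"
   proof
    assume "t \<in> B j (a1 * \<rho> j)"
    then have "d j s < c_d * (a1 * \<rho> j + \<rho> j / (2 * c_d))"
     using t sM i[OF j] sym[of t s] by (intro d_lt_triangle[of j t s]) (auto simp: mem_B)
    also have "... = (2 * c_d * a1) / 2 * \<rho> j + \<rho> j / 2" using cdp by (simp add: algebra_simps)
    also have "... \<le> 1 / 2 * \<rho> j + \<rho> j / 2"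
     using a1c i[OF j] by (intro add_right_mono mult_right_mono divide_right_mono) auto
    finally have "s \<in> B j (\<rho> j)" using sM by (simp add: mem_B)
    then show False using X(2)[OF j] s by blast
   qed
   then show "u j t = 0" using supp[OF j sM(2)] by (simp add: a1_def)
  qed
  have "(\<integral>\<^sup>+s\<in>X. enorm (T (u j) s) \<partial>M) \<le> ennreal (2 * ?D) * dini_norm \<omega> * L1_mass M (u j)"
  proof (rule kernel_mean_zero[OF dini V0_simple_bochner[OF u(1)[OF j]] u(2)[OF j] i(1)[OF j] i(2)[OF j] a1])
   show "AE s in M. s \<in> X \<longrightarrow> has_strong_bochner_integral M (\<lambda>t. K s t (u j t)) (T (u j) s)"
    using T_kernel[OF u(1)[OF j]] by eventually_elim (use sep in blast)
  qed (use supp[OF j] X T_meas[OF u(1)[OF j]] j in \<open>auto simp: a1_def\<close>)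
  also have "... \<le> ennreal (2 * ?D) * ennreal \<kappa> * ennreal (2 * m j)"
   using m[OF j] dini_le by (intro mult_mono) auto
  also have "... = ennreal (2 * ?D * \<kappa> * (2 * m j))"
   using \<kappa> m[OF j] dbl_pos[of "4 * c_d"] by (simp flip: ennreal_mult)
  finally show ?thesis by (simp add: mult_ac)
 qed
 have [measurable]: "(\<lambda>s. norm (T (u j) s)) \<in> borel_measurable M" if "j \<in> F" for j
  using strongly_measurable_norm[OF T_meas[OF u(1)[OF that]]] .
 note [measurable] = X(1)
 define \<psi> where "\<psi> s = (\<Sum>j\<in>F. enorm (T (u j) s) * indicator X s)" for s
 have [measurable]: "\<psi> \<in> borel_measurable M" unfolding \<psi>_def by measurable
 have "(\<integral>\<^sup>+s. \<psi> s \<partial>M) = (\<Sum>j\<in>F. (\<integral>\<^sup>+s\<in>X. enorm (T (u j) s) \<partial>M))"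
  unfolding \<psi>_def by (intro nn_integral_sum) measurable
 also have "... \<le> (\<Sum>j\<in>F. ennreal (4 * ?D * \<kappa> * m j))" by (intro sum_mono single)
 also have "... = ennreal (4 * ?D * \<kappa> * (\<Sum>j\<in>F. m j))"
  using m \<kappa> dbl_pos[of "4 * c_d"] by (subst sum_ennreal) (auto simp: sum_distrib_left)
 finally have \<psi>int: "(\<integral>\<^sup>+s. \<psi> s \<partial>M) \<le> ennreal (4 * ?D * \<kappa> * (\<Sum>j\<in>F. m j))" .
 define S where "S = {s\<in>space M. 1 \<le> ennreal (3 / (\<kappa> * h)) * \<psi> s}"
 have "emeasure M {s\<in>X. norm (T (\<lambda>x. \<Sum>i\<in>F. u i x) s) > \<kappa> * h / 3} \<le> emeasure M S"
 proof (rule emeasure_mono_AE)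
  show "S \<in> sets M" unfolding S_def by measurable
  have "AE s in M. T (\<lambda>x. \<Sum>i\<in>F. u i x) s = (\<Sum>i\<in>F. T (u i) s)"
   using T_sum[OF ne F] u(1) by blast
  then show "AE s in M. s \<in> {s\<in>X. norm (T (\<lambda>x. \<Sum>i\<in>F. u i x) s) > \<kappa> * h / 3} \<longrightarrow> s \<in> S"
   using AE_space
  proof eventually_elim
   case (elim s)
   show ?case
   proof
    assume s: "s \<in> {s\<in>X. norm (T (\<lambda>x. \<Sum>i\<in>F. u i x) s) > \<kappa> * h / 3}"
    have "\<kappa> * h / 3 < norm (\<Sum>i\<in>F. T (u i) s)" using s elim by simp
    also have "... \<le> (\<Sum>i\<in>F. norm (T (u i) s))" by (rule norm_sum)
    finally have "ennreal (\<kappa> * h / 3) \<le> ennreal (\<Sum>i\<in>F. norm (T (u i) s))" by (intro ennreal_leI) simp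
    also have "... = \<psi> s" using s by (simp add: \<psi>_def sum_ennreal)
    finally have "ennreal (3 / (\<kappa> * h)) * ennreal (\<kappa> * h / 3) \<le> ennreal (3 / (\<kappa> * h)) * \<psi> s"
     by (rule mult_left_mono) simp
    moreover have "ennreal (3 / (\<kappa> * h)) * ennreal (\<kappa> * h / 3) = 1"
     using \<kappa> h by (simp flip: ennreal_mult)
    ultimately show "s \<in> S" using elim by (simp add: S_def)
   qed
  qed
 qed
 also have "... \<le> ennreal (3 / (\<kappa> * h)) * (\<integral>\<^sup>+s. \<psi> s \<partial>M)"
 proof -
  have "emeasure M ({s\<in>space M. 1 \<le> ennreal (3 / (\<kappa> * h)) * \<psi> s} \<inter> space M) \<le> ennreal (3 / (\<kappa> * h)) * (\<integral>\<^sup>+s. \<psi> s * indicator (space M) s \<partial>M)"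
   using nn_integral_Markov_inequality[of "\<lambda>s. \<psi> s" "space M" M "ennreal (3 / (\<kappa> * h))"]
   by (simp add: Int_def conj_commute)
  then show ?thesis by (simp add: S_def Int_def cong: conj_cong nn_integral_cong)
 qed
 also have "... \<le> ennreal (3 / (\<kappa> * h)) * ennreal (4 * ?D * \<kappa> * (\<Sum>j\<in>F. m j))"
  using \<psi>int by (rule mult_left_mono) simp
 also have "... = ennreal (3 / (\<kappa> * h) * (4 * ?D * \<kappa> * (\<Sum>j\<in>F. m j)))"
  using \<kappa> h m dbl_pos[of "4 * c_d"] by (intro ennreal_mult[symmetric]) (auto intro!: mult_nonneg_nonneg sum_nonneg)
 also have "3 / (\<kappa> * h) * (4 * ?D * \<kappa> * (\<Sum>j\<in>F. m j)) = 12 * ?D / h * (\<Sum>i\<in>F. m i)"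
  using \<kappa> h by simp
 finally show ?thesis .
qed

lemma sum_cut_disjoint:
 assumes "finite F" "disjoint_family_on P F" "j \<in> F" "x \<in> P j"
 shows "(\<Sum>i\<in>F. cut (P i) (w i) x) = w j x"
proof -
 have "cut (P i) (w i) x = 0" if "i \<in> F - {j}" for i
  using that assms disjoint_family_onD[OF assms(2), of i j] by (auto simp: cut_def)
 then have "(\<Sum>i\<in>F. cut (P i) (w i) x) = (\<Sum>i\<in>{j}. cut (P i) (w i) x)"
  using assms by (intro sum.mono_neutral_right) auto
 then show ?thesis using assms by (simp add: cut_def)
qed

lemma nn_integral_norm_cut_const:
 "A \<in> sets M \<Longrightarrow> (\<integral>\<^sup>+x. enorm (cut A (\<lambda>_. v) x) \<partial>M) = enorm v * emeasure M A"
 by (subst nn_integral_cmult_indicator[symmetric]) (auto intro!: nn_integral_cong simp: cut_def indicator_def)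

lemma nn_integral_norm_cut:
 "strongly_measurable M f \<Longrightarrow> A \<in> sets M \<Longrightarrow> (L1_mass M (cut A f)) = emeasure (nu M f) A"
 by (subst emeasure_nu) (auto intro!: nn_integral_cong simp: cut_def indicator_def)

text \<open>The decomposition at height \<open>l / \<kappa>\<close>. The cells are cut out of a
  Whitney covering of the open set, and only finitely many are used; what \<open>f\<close> has on
  the others forms a third function, small at \<open>p0\<close>, whose contribution \<open>e\<close>
  is arbitrary.\<close>

lemma weak_type_test:
 assumes f: "f \<in> V0" and l: "l > 0"
 shows "emeasure M (superlevel M (T f) l) \<le> ennreal (cz_const p0 a * \<kappa> / l) * emeasure (nu M f) (space M)"
proof -
 define q where "q = c_d\<^sup>2"
 have q1: "q \<ge> 1" and cq: "c_d \<le> q" using cd2 by (auto simp: q_def)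
 have cdp: "c_d > 0" using c_d by simp
 have small: "n * q^k * a \<le> 1" if "n \<le> 1000" "k \<le> 8" "0 \<le> n" for n k
  using small_power[OF a(1,2) that] by (simp only: q_def)
 have a2: "a * (2 * c_d\<^sup>2) \<le> 1" using small[of 2 1] by (simp add: q_def mult_ac)
 define a1 where "a1 = 5 * (c_d\<^sup>2)^3 * a"
 have a1: "0 < a1" "a1 \<le> 1" "a \<le> a1"
 proof -
  show "0 < a1" using a(1) c_d by (simp add: a1_def)
  show "a1 \<le> 1" using small[of 5 3] by (simp only: a1_def q_def)
  have "1 * q^0 * a \<le> 5 * q^3 * a" using q1 a by (intro mult_right_mono mult_mono power_increasing) auto
  then show "a \<le> a1" by (simp only: a1_def q_def) simp
 qed
 have fL: "f \<in> Lp_space M 1" using V0_L1[OF f] .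
 have sm: "strongly_measurable M f" using V0_strongly_measurable[OF f] .
 interpret nuf: finite_measure "nu M f" by (rule finite_measure_nu[OF fL])
 define F where "F = measure (nu M f) (space M)"
 have F0: "F \<ge> 0" and eF: "emeasure (nu M f) (space M) = ennreal F" by (auto simp: F_def nuf.emeasure_eq_measure)
 define h where "h = l / \<kappa>"
 have h: "h > 0" "\<kappa> * h = l" using l \<kappa> by (auto simp: h_def)
 let ?Dm = "dq 5 * dq 3"
 define D4 where "D4 = dbl c_mu (5 * (c_d\<^sup>2)^2 / a)"
 define C where "C = max 2 D4"
 have C: "C > 0" "C \<ge> 2" "C \<ge> D4" by (auto simp: C_def)
 have cz: "cz_const p0 a = 3 powr p0 * C powr (p0 - 1) + ?Dm + 12 * dbl c_mu (4 * c_d)"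
  by (simp add: cz_const_def C_def D4_def)
 have Dpos: "?Dm > 0" "dbl c_mu (4 * c_d) > 0" using dbl_pos by simp_all
 have czF: "cz_const p0 a * \<kappa> / l * F = 3 powr p0 * C powr (p0 - 1) / h * F + ?Dm / h * F + 12 * dbl c_mu (4 * c_d) / h * F"
  using \<kappa> l by (simp add: cz h_def field_simps)
 have nn: "0 \<le> 3 powr p0 * C powr (p0 - 1) / h * F" "0 \<le> ?Dm / h * F" "0 \<le> 12 * dbl c_mu (4 * c_d) / h * F"
  using h F0 Dpos by (auto intro!: mult_nonneg_nonneg divide_nonneg_nonneg)
 have goal: "ennreal (cz_const p0 a * \<kappa> / l) * emeasure (nu M f) (space M) = ennreal (cz_const p0 a * \<kappa> / l * F)"
 proof -
  have "cz_const p0 a \<ge> 0" unfolding cz using Dpos by simp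
  then have "cz_const p0 a * \<kappa> / l \<ge> 0" using \<kappa> l by simp
  then show ?thesis unfolding eF using F0 by (rule ennreal_mult[symmetric])
 qed
 obtain \<Omega> where \<Omega>: "qopen \<Omega>" "emeasure M \<Omega> \<le> ennreal (?Dm / h * F)"
  "\<And>w r. w \<in> space M \<Longrightarrow> w \<notin> \<Omega> \<Longrightarrow> r > 0 \<Longrightarrow> measure (nu M f) (B w r) \<le> h * V w r"
  "AE x in M. x \<notin> \<Omega> \<longrightarrow> norm (f x) \<le> 2 * h"
  using maximal_open_set[OF fL h(1)] unfolding F_def by blast
 have \<Omega>s: "\<Omega> \<in> sets M" using qopen_sets[OF \<Omega>(1)] .
 show ?thesis
 \<comment> \<open>Without a complement there is no Whitney radius, but then the bound on the
   measure of \<Omega> is enough.\<close>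
 proof (cases "space M \<subseteq> \<Omega>")
  case True
  then have "emeasure M (superlevel M (T f) l) \<le> emeasure M \<Omega>"
   using \<Omega>s by (intro emeasure_mono) auto
  also have "... \<le> ennreal (?Dm / h * F)" by (rule \<Omega>(2))
  also have "... \<le> ennreal (cz_const p0 a * \<kappa> / l * F)" unfolding czF using nn by (intro ennreal_leI) linarith
  finally show ?thesis using goal by simp
 next
  case False
  then obtain z where z: "z \<in> space M" "z \<notin> \<Omega>" by blast
  have ne: "space M \<noteq> {}" using z by blast
  define \<rho> where "\<rho> = wrad \<Omega>"
  note w = whitney_wrad[OF \<Omega>(1) z, folded \<rho>_def]
  obtain I where I: "I \<subseteq> \<Omega>" "countable I" "disjoint_family_on (\<lambda>i. B i (a * \<rho> i)) I"
   "\<And>x. x \<in> \<Omega> \<Longrightarrow> \<exists>i\<in>I. x \<in> B i (a1 * \<rho> i)"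
   using whitney_cover[OF w a(1) a2, folded a1_def] by blast
  have i: "i \<in> space M" "\<rho> i > 0" "i \<in> \<Omega>" "B i (\<rho> i) \<subseteq> \<Omega>" if "i \<in> I" for i
   using that I(1) whitneyD(2,3,4)[OF w] by blast+
  have sub: "B i (a * \<rho> i) \<subseteq> B i (a1 * \<rho> i)" "B i (a1 * \<rho> i) \<subseteq> B i (\<rho> i)" if "i \<in> I" for i
   using a1 i[OF that] by (auto intro!: B_mono simp: mult_le_cancel_right1)
  have Bs: "B i r \<in> sets M" if "i \<in> I" for i r using i(1)[OF that] by simp
  obtain P where P: "\<And>i. i \<in> I \<Longrightarrow> P i \<in> sets M" "\<And>i. i \<in> I \<Longrightarrow> B i (a * \<rho> i) \<subseteq> P i"
   "\<And>i. i \<in> I \<Longrightarrow> P i \<subseteq> B i (a1 * \<rho> i)" "disjoint_family_on P I" "(\<Union>i\<in>I. P i) = (\<Union>i\<in>I. B i (a1 * \<rho> i))"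
   using partition_between[OF I(2,3) sub(1) Bs Bs] that by blast
  have UP: "(\<Union>i\<in>I. P i) = \<Omega>"
  proof
   show "(\<Union>i\<in>I. P i) \<subseteq> \<Omega>" using P(3) sub(2) i(4) by blast
   show "\<Omega> \<subseteq> (\<Union>i\<in>I. P i)" unfolding P(5) using I(4) by blast
  qed
  have Pm: "emeasure M (P i) = ennreal (measure M (P i))" "V i (a * \<rho> i) \<le> measure M (P i)" "measure M (P i) > 0"
   if "i \<in> I" for i
  proof -
   show "emeasure M (P i) = ennreal (measure M (P i))"
    by (rule emeasure_eq_measure_subset_B[OF i(1)[OF that] P(3)[OF that]])
   show 1: "V i (a * \<rho> i) \<le> measure M (P i)"
    unfolding V_def using P(1,2,3)[of i] that i(1)[OF that] by (intro measure_mono_B[of i _ _ "a1 * \<rho> i"]) auto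
   have "V i (a * \<rho> i) > 0" using i[OF that] a by (intro V_pos) auto
   then show "measure M (P i) > 0" using 1 by linarith
  qed
  define mP where "mP i = measure (nu M f) (P i)" for i
  have emP: "emeasure (nu M f) (P i) = ennreal (mP i)" for i by (simp add: mP_def nuf.emeasure_eq_measure)
  have mP0: "mP i \<ge> 0" for i by (simp add: mP_def)
  have mP: "mP i \<le> D4 * h * measure M (P i)" if iI: "i \<in> I" for i
  proof -
   \<comment> \<open>The mass on the cell is bounded through a ball centred at a point outside
     \<Omega>, where all averages are at most \<open>h\<close>; \<open>D4\<close> bounds the volume
     of this ball relative to the small Whitney ball.\<close>
   have "wrad \<Omega> i < 2 * \<rho> i" using i[OF iI] by (simp add: \<rho>_def)
   then obtain v where v: "v \<in> space M" "v \<notin> \<Omega>" "d i v < 2 * \<rho> i"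
    using wrad_exit[OF \<Omega>(1) z i(3)[OF iI]] by blast
   have dvi: "d v i \<le> 2 * \<rho> i" using v i[OF iI] sym[of v i] by simp
   have "P i \<subseteq> B v (3 * q * \<rho> i)"
   proof (rule order_trans[OF P(3)[OF iI]], rule B_subset[where s="2 * \<rho> i"])
    have "c_d * (2 * \<rho> i + a1 * \<rho> i) \<le> q * (2 * \<rho> i + 1 * \<rho> i)"
     using a1 i[OF iI] c_d q1 by (intro mult_mono[OF cq add_left_mono] mult_right_mono) auto
    then show "c_d * (2 * \<rho> i + a1 * \<rho> i) \<le> 3 * q * \<rho> i" by simp
   qed (use v i[OF iI] dvi in auto)
   then have "mP i \<le> measure (nu M f) (B v (3 * q * \<rho> i))"
    unfolding mP_def using v by (intro nuf.finite_measure_mono) auto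
   also have "... \<le> h * V v (3 * q * \<rho> i)" using v i[OF iI] q1 by (intro \<Omega>(3)) auto
   also have "... \<le> h * (D4 * V i (a * \<rho> i))"
    unfolding D4_def
   proof (intro mult_left_mono V_compare[where s="2 * \<rho> i"])
    have "c_d * (2 * \<rho> i + 3 * q * \<rho> i) \<le> c_d * (2 * q * \<rho> i + 3 * q * \<rho> i)"
     using q1 c_d i[OF iI] by (intro mult_left_mono add_right_mono mult_right_mono) auto
    also have "... = 5 * (c_d * q) * \<rho> i" by (simp add: algebra_simps)
    also have "5 * (c_d * q) * \<rho> i \<le> 5 * (q * q) * \<rho> i"
     using cq q1 i[OF iI] by (intro mult_right_mono mult_left_mono) auto
    finally show "c_d * (2 * \<rho> i + 3 * q * \<rho> i) \<le> 5 * (c_d\<^sup>2)^2 / a * (a * \<rho> i)"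
     using a by (simp add: q_def power2_eq_square)
   qed (use v i[OF iI] a h cdp in auto)
   also have "... \<le> h * (D4 * measure M (P i))"
    using Pm(2)[OF iI] h dbl_pos[of "5 * (c_d\<^sup>2)^2 / a"] by (intro mult_left_mono) (auto simp: D4_def)
   finally show ?thesis by (simp add: mult_ac)
  qed
  \<comment> \<open>The mean over the cell; subtracting it leaves a \<open>u i\<close> of integral
    zero.\<close>
  define v where "v i = (1 / measure M (P i)) *\<^sub>R sintegral M (cut (P i) f)" for i
  define u where "u i = (\<lambda>x. cut (P i) f x - cut (P i) (\<lambda>_. v i) x)" for i
  have V0P: "cut (P i) f \<in> V0" "cut (P i) (\<lambda>_. v i) \<in> V0" "u i \<in> V0" if "i \<in> I" for i
   using V0_cut[OF f P(1)[OF that]] V0_const[OF i(1)[OF that] P(1)[OF that] P(3)[OF that], of "v i"]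
   by (auto simp: u_def intro!: V0_diff)
  have vP: "norm (v i) * measure M (P i) \<le> mP i" if iI: "i \<in> I" for i
  proof -
   have "enorm (sintegral M (cut (P i) f)) \<le> ennreal (mP i)"
    using norm_simple_bochner_integral_le[OF V0_simple_bochner[OF V0P(1)[OF iI]]]
    unfolding nn_integral_norm_cut[OF sm P(1)[OF iI]] emP .
   then show ?thesis using Pm(3)[OF iI] mP0[of i] by (simp add: v_def ennreal_le_iff)
  qed
  have vn: "norm (v i) \<le> D4 * h" if iI: "i \<in> I" for i
   using order_trans[OF vP[OF iI] mP[OF iI]] Pm(3)[OF iI] by simp
  have vint: "(\<integral>\<^sup>+x. enorm (cut (P i) (\<lambda>_. v i) x) \<partial>M) \<le> ennreal (mP i)" if iI: "i \<in> I" for i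
   using vP[OF iI] by (simp add: nn_integral_norm_cut_const[OF P(1)[OF iI]] Pm(1)[OF iI] flip: ennreal_mult) (simp add: ennreal_leI)
  have u0: "sintegral M (u i) = 0" if iI: "i \<in> I" for i
   using simple_bochner_integral_diff[OF V0_simple_bochner[OF V0P(1)[OF iI]] V0_simple_bochner[OF V0P(2)[OF iI]]]
    simple_bochner_integral_cut_const[OF P(1)[OF iI], of "v i"] Pm(1,3)[OF iI]
   by (simp add: u_def v_def)
  have uint: "L1_mass M (u i) \<le> ennreal (2 * mP i)" if iI: "i \<in> I" for i
  proof -
   have [measurable]: "(\<lambda>x. norm (cut (P i) f x)) \<in> borel_measurable M" "(\<lambda>x. norm (cut (P i) (\<lambda>_. v i) x)) \<in> borel_measurable M"
    using V0P(1,2)[OF iI] by (auto intro!: strongly_measurable_norm V0_strongly_measurable)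
   have "L1_mass M (u i) \<le> (\<integral>\<^sup>+t. enorm (cut (P i) f t) + enorm (cut (P i) (\<lambda>_. v i) t) \<partial>M)"
    unfolding u_def by (intro nn_integral_mono) (auto simp flip: ennreal_plus intro!: ennreal_leI norm_triangle_ineq4)
   also have "... = (\<integral>\<^sup>+t. enorm (cut (P i) f t) \<partial>M) + (\<integral>\<^sup>+t. enorm (cut (P i) (\<lambda>_. v i) t) \<partial>M)"
    by (rule nn_integral_add) auto
   also have "... \<le> ennreal (mP i) + ennreal (mP i)"
    using vint[OF iI] by (intro add_mono) (auto simp: nn_integral_norm_cut[OF sm P(1)[OF iI]] emP)
   finally show ?thesis using mP0[of i] by (simp flip: ennreal_plus)
  qed
  have main: "emeasure M (superlevel M (T f) l) \<le> ennreal (cz_const p0 a * \<kappa> / l * F) + ennreal e" if e: "e > 0" for e :: real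
  proof -
   obtain Cf where Cf: "Cf > 0" "\<And>x. x \<in> space M \<Longrightarrow> norm (f x) \<le> Cf" using V0_bounded[OF f] by blast
   \<comment> \<open>Chosen so that the \<open>p0\<close> bound at level \<open>l / 3\<close>, for a
     function below \<open>Cf\<close> supported on a set of measure \<delta>, equals
     \<open>e\<close>.\<close>
   define \<delta> where "\<delta> = e / ((\<kappa> / (l / 3)) powr p0 * Cf powr p0)"
   have \<delta>: "\<delta> > 0" using e \<kappa> l Cf by (simp add: \<delta>_def)
   have fin: "emeasure M (\<Union>i\<in>I. P i) < \<infinity>" unfolding UP using \<Omega>(2) by (auto intro: le_less_trans)
   obtain F0 where F0: "finite F0" "F0 \<subseteq> I" "emeasure M (\<Union>i\<in>I - F0. P i) < ennreal \<delta>"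
    using finite_part_of_partition[OF I(2) P(1,4) fin \<delta>] by blast
   define R where "R = (\<Union>i\<in>I - F0. P i)"
   have Rs: "R \<in> sets M" unfolding R_def using P(1) I(2) by (intro sets.countable_UN'') auto
   have disF: "disjoint_family_on P F0" using P(4) F0(2) by (rule disjoint_family_on_mono[rotated])
   \<comment> \<open>On the cells in use the good function is the mean; on the other cells it is
     zero, as \<open>f\<close> is left to \<open>cut R f\<close> there.\<close>
   define g where "g = (\<lambda>x. cut (space M - \<Omega>) f x + (\<Sum>i\<in>F0. cut (P i) (\<lambda>_. v i) x))"
   define b where "b = (\<lambda>x. \<Sum>i\<in>F0. u i x)"
   have V0s: "g \<in> V0" "b \<in> V0" "cut R f \<in> V0"
   proof -
    show "g \<in> V0"
     unfolding g_def using V0P(2) F0(2) \<Omega>s by (intro V0_add V0_sum[OF ne F0(1)] V0_cut[OF f]) auto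
    show "b \<in> V0" unfolding b_def using V0P(3) F0(2) by (intro V0_sum[OF ne F0(1)]) auto
    show "cut R f \<in> V0" using V0_cut[OF f Rs] .
   qed
   have decomp: "f x = cut R f x + (g x + b x)" if x: "x \<in> space M" for x
   proof -
    have "g x + b x = cut (space M - \<Omega>) f x + (\<Sum>i\<in>F0. cut (P i) f x)"
     by (simp add: g_def b_def u_def sum_subtractf)
    moreover have "f x = cut R f x + (cut (space M - \<Omega>) f x + (\<Sum>i\<in>F0. cut (P i) f x))"
    proof (cases "x \<in> \<Omega>")
     case True
     then obtain j where j: "j \<in> I" "x \<in> P j" using UP by blast
     show ?thesis
     proof (cases "j \<in> F0")
      case jF: True
      have "x \<notin> R"
       using j jF disjoint_family_onD[OF P(4), of j] F0(2) by (fastforce simp: R_def)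
      then show ?thesis
       using sum_cut_disjoint[where w="\<lambda>_. f", OF F0(1) disF jF j(2)] True by (simp add: cut_def[of R] cut_def[of "space M - \<Omega>"])
     next
      case False
      then have "x \<in> R" using j by (auto simp: R_def)
      moreover have "cut (P i) f x = 0" if "i \<in> F0" for i
       using that False j F0(2) disjoint_family_onD[OF P(4), of j i] by (auto simp: cut_def)
      ultimately show ?thesis using True by (simp add: cut_def[of R] cut_def[of "space M - \<Omega>"])
     qed
    next
     case False
     then have "x \<notin> R" "\<And>i. i \<in> F0 \<Longrightarrow> x \<notin> P i" using UP F0(2) by (auto simp: R_def)
     then show ?thesis using False x by (simp add: cut_def)
    qed
    ultimately show ?thesis by simp
   qed
   have gh: "AE x in M. norm (g x) \<le> C * h"
    using \<Omega>(4) AE_space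
   proof eventually_elim
    case (elim x)
    show ?case
    proof (cases "\<exists>j\<in>F0. x \<in> P j")
     case True
     then obtain j where j: "j \<in> F0" "x \<in> P j" by blast
     then have "x \<in> \<Omega>" using UP F0(2) by blast
     then have "g x = v j"
      using sum_cut_disjoint[where w="\<lambda>i _. v i", OF F0(1) disF j] by (simp add: g_def cut_def[of "space M - \<Omega>"])
     then have "norm (g x) \<le> D4 * h" using vn[of j] j F0(2) by auto
     also have "... \<le> C * h" using C h by (intro mult_right_mono) auto
     finally show ?thesis .
    next
     case False
     then have "g x = cut (space M - \<Omega>) f x" by (simp add: g_def cut_def)
     then have "norm (g x) \<le> 2 * h" using elim h by (auto simp: cut_def)
     also have "... \<le> C * h" using C h by (intro mult_right_mono) auto
     finally show ?thesis .
    qed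
   qed
   have sum_mP: "measure (nu M f) (space M - \<Omega>) + (\<Sum>i\<in>F0. mP i) \<le> F"
   proof -
    have "(\<Sum>i\<in>F0. mP i) = measure (nu M f) (\<Union>i\<in>F0. P i)"
     unfolding mP_def using F0 P(1) disF by (intro nuf.finite_measure_finite_Union[symmetric]) auto
    also have "... \<le> measure (nu M f) \<Omega>" using UP F0 \<Omega>s by (intro nuf.finite_measure_mono) auto
    finally have "measure (nu M f) (space M - \<Omega>) + (\<Sum>i\<in>F0. mP i) \<le> measure (nu M f) (space M - \<Omega>) + measure (nu M f) \<Omega>"
     by simp
    also have "... = measure (nu M f) ((space M - \<Omega>) \<union> \<Omega>)"
     using \<Omega>s by (intro nuf.finite_measure_Union[symmetric]) auto
    also have "... \<le> F" unfolding F_def using sets.sets_into_space[OF \<Omega>s] by (intro nuf.finite_measure_mono) auto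
    finally show ?thesis .
   qed
   have gint: "L1_mass M g \<le> ennreal F"
   proof -
    have [measurable]: "(\<lambda>x. norm (cut (space M - \<Omega>) f x)) \<in> borel_measurable M"
     using sm \<Omega>s by (intro strongly_measurable_norm strongly_measurable_cut) auto
    have [measurable]: "(\<lambda>x. norm (cut (P i) (\<lambda>_. v i) x)) \<in> borel_measurable M" if "i \<in> F0" for i
     using V0P(2)[of i] that F0(2) by (auto intro!: strongly_measurable_norm V0_strongly_measurable)
    have "L1_mass M g
      \<le> (\<integral>\<^sup>+x. enorm (cut (space M - \<Omega>) f x) + (\<Sum>i\<in>F0. enorm (cut (P i) (\<lambda>_. v i) x)) \<partial>M)"
    proof (rule nn_integral_mono)
     fix x
     have "norm (g x) \<le> norm (cut (space M - \<Omega>) f x) + (\<Sum>i\<in>F0. norm (cut (P i) (\<lambda>_. v i) x))"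
      unfolding g_def by (intro order_trans[OF norm_triangle_ineq] add_left_mono norm_sum)
     then have "enorm (g x) \<le> ennreal (norm (cut (space M - \<Omega>) f x) + (\<Sum>i\<in>F0. norm (cut (P i) (\<lambda>_. v i) x)))"
      by (rule ennreal_leI)
     then show "enorm (g x) \<le> enorm (cut (space M - \<Omega>) f x) + (\<Sum>i\<in>F0. enorm (cut (P i) (\<lambda>_. v i) x))"
      by (simp add: sum_nonneg sum_ennreal)
    qed
    also have "... = (\<integral>\<^sup>+x. enorm (cut (space M - \<Omega>) f x) \<partial>M) + (\<Sum>i\<in>F0. \<integral>\<^sup>+x. enorm (cut (P i) (\<lambda>_. v i) x) \<partial>M)"
    proof -
     have eq: "(\<integral>\<^sup>+x. (\<Sum>i\<in>F0. enorm (cut (P i) (\<lambda>_. v i) x)) \<partial>M) = (\<Sum>i\<in>F0. \<integral>\<^sup>+x. enorm (cut (P i) (\<lambda>_. v i) x) \<partial>M)"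
      by (intro nn_integral_sum) measurable
     have M1: "(\<lambda>x. \<Sum>i\<in>F0. enorm (cut (P i) (\<lambda>_. v i) x)) \<in> borel_measurable M"
      by (intro borel_measurable_sum) measurable
     have M2: "(\<lambda>x. enorm (cut (space M - \<Omega>) f x)) \<in> borel_measurable M" by measurable
     show ?thesis using nn_integral_add[OF M2 M1] eq by (simp only:)
    qed
    also have "... \<le> ennreal (measure (nu M f) (space M - \<Omega>)) + (\<Sum>i\<in>F0. ennreal (mP i))"
     using vint F0(2) \<Omega>s by (intro add_mono sum_mono) (auto simp: nn_integral_norm_cut[OF sm] nuf.emeasure_eq_measure)
    also have "... = ennreal (measure (nu M f) (space M - \<Omega>) + (\<Sum>i\<in>F0. mP i))"
     using mP0 by (simp add: sum_nonneg)
    also have "... \<le> ennreal F" using sum_mP by (rule ennreal_leI)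
    finally show ?thesis .
   qed
   define E1 where "E1 = {s\<in>space M. norm (T (cut R f) s) > l / 3}"
   define E2 where "E2 = {s\<in>space M. norm (T g s) > \<kappa> * h / 3}"
   define E4 where "E4 = {s\<in>space M - \<Omega>. norm (T b s) > \<kappa> * h / 3}"
   have Es: "E1 \<in> sets M" "E2 \<in> sets M" "E4 \<in> sets M"
   proof -
    show "E1 \<in> sets M" "E2 \<in> sets M"
     unfolding E1_def E2_def by (rule strongly_measurable_norm_le[OF T_meas[OF V0s(3)]])
      (rule strongly_measurable_norm_le[OF T_meas[OF V0s(1)]])
    have "E4 = {s\<in>space M. norm (T b s) > \<kappa> * h / 3} - \<Omega>" by (auto simp: E4_def)
    then show "E4 \<in> sets M"
     using sets.Diff[OF strongly_measurable_norm_le[OF T_meas[OF V0s(2)], of "\<kappa> * h / 3"] \<Omega>s] by (simp only:)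
   qed
   have m1: "emeasure M E1 \<le> ennreal e"
   proof -
    have "(\<integral>\<^sup>+x. ennreal (norm (cut R f x) powr p0) \<partial>M) \<le> (\<integral>\<^sup>+x. ennreal (Cf powr p0) * indicator R x \<partial>M)"
     using Cf p0 by (intro nn_integral_mono) (auto simp: cut_def indicator_def intro!: ennreal_leI powr_mono2)
    also have "... = ennreal (Cf powr p0) * emeasure M R" using Rs by (rule nn_integral_cmult_indicator)
    also have "... \<le> ennreal (Cf powr p0) * ennreal \<delta>" using F0(3) by (intro mult_left_mono) (auto simp: R_def)
    finally have "emeasure M E1 \<le> ennreal ((\<kappa> / (l / 3)) powr p0) * (ennreal (Cf powr p0) * ennreal \<delta>)"
     unfolding E1_def using l by (intro order_trans[OF T_p0[OF V0s(3)]] mult_left_mono) auto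
    also have "... = ennreal ((\<kappa> / (l / 3)) powr p0 * (Cf powr p0 * \<delta>))" using \<delta> by (simp flip: ennreal_mult)
    also have "(\<kappa> / (l / 3)) powr p0 * (Cf powr p0 * \<delta>) = e"
     using \<kappa> l Cf by (simp add: \<delta>_def)
    finally show ?thesis .
   qed
   have m2: "emeasure M E2 \<le> ennreal (3 powr p0 * C powr (p0 - 1) / h * F)"
    unfolding E2_def by (rule weak_type_good[OF V0s(1) h(1) gh C(1) gint \<open>F \<ge> 0\<close>])
   have m4: "emeasure M E4 \<le> ennreal (12 * dbl c_mu (4 * c_d) / h * F)"
   proof -
    have "emeasure M E4 \<le> ennreal (12 * dbl c_mu (4 * c_d) / h * (\<Sum>i\<in>F0. mP i))"
     unfolding E4_def b_def
    proof (rule weak_type_bad[where \<rho>=\<rho>, OF ne F0(1)])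
     fix i assume iF: "i \<in> F0"
     then have iI: "i \<in> I" using F0(2) by blast
     show "u i \<in> V0" "sintegral M (u i) = 0" "i \<in> space M" "\<rho> i > 0"
      "L1_mass M (u i) \<le> ennreal (2 * mP i)" "mP i \<ge> 0"
      using V0P(3)[OF iI] u0[OF iI] i[OF iI] uint[OF iI] mP0 by auto
     show "(space M - \<Omega>) \<inter> B i (\<rho> i) = {}" using i(4)[OF iI] by blast
     fix x assume x: "x \<notin> B i (5 * (c_d\<^sup>2)^3 * a * \<rho> i)"
     then have "x \<notin> P i" using P(3)[OF iI] by (auto simp: a1_def)
     then show "u i x = 0" by (simp add: u_def cut_def)
    qed (use \<Omega>s h in auto)
    also have "... \<le> ennreal (12 * dbl c_mu (4 * c_d) / h * F)"
    proof (intro ennreal_leI mult_left_mono)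
     show "(\<Sum>i\<in>F0. mP i) \<le> F" using sum_mP measure_nonneg[of "nu M f" "space M - \<Omega>"] by linarith
    qed (use h Dpos in auto)
    finally show ?thesis .
   qed
   have Teq: "AE s in M. T f s = T (cut R f) s + (T g s + T b s)"
   proof -
    have gb: "(\<lambda>x. g x + b x) \<in> V0" using V0s by (intro V0_add)
    have "AE s in M. T f s = T (\<lambda>x. cut R f x + (g x + b x)) s"
     by (rule T_cong[OF f V0_add[OF V0s(3) gb] decomp])
    moreover have "AE s in M. T (\<lambda>x. cut R f x + (g x + b x)) s = T (cut R f) s + T (\<lambda>x. g x + b x) s"
     by (rule T_add[OF V0s(3) gb])
    moreover have "AE s in M. T (\<lambda>x. g x + b x) s = T g s + T b s" by (rule T_add[OF V0s(1,2)])
    ultimately show ?thesis by eventually_elim simp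
   qed
   \<comment> \<open>The level is split in three. \<Omega> is discarded as a whole, because the bad
     functions are controlled only away from it.\<close>
   have "emeasure M (superlevel M (T f) l) \<le> emeasure M (E1 \<union> (E2 \<union> (\<Omega> \<union> E4)))"
   proof (rule emeasure_mono_AE)
    show "E1 \<union> (E2 \<union> (\<Omega> \<union> E4)) \<in> sets M" using Es \<Omega>s by auto
    show "AE s in M. s \<in> superlevel M (T f) l \<longrightarrow> s \<in> E1 \<union> (E2 \<union> (\<Omega> \<union> E4))"
     using Teq
    proof eventually_elim
     case (elim s)
     have "norm (T f s) \<le> norm (T (cut R f) s) + (norm (T g s) + norm (T b s))"
      unfolding elim by (intro order_trans[OF norm_triangle_ineq] add_left_mono norm_triangle_ineq)
     then show ?case unfolding E1_def E2_def E4_def h(2) by auto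
    qed
   qed
   also have "... \<le> emeasure M E1 + (emeasure M E2 + (emeasure M \<Omega> + emeasure M E4))"
    using Es \<Omega>s by (intro order_trans[OF emeasure_subadditive] add_left_mono sets.Un) auto
   also have "... \<le> ennreal e + (ennreal (3 powr p0 * C powr (p0 - 1) / h * F) + (ennreal (?Dm / h * F) + ennreal (12 * dbl c_mu (4 * c_d) / h * F)))"
    using m1 m2 \<Omega>(2) m4 by (intro add_mono)
   also have "... = ennreal (cz_const p0 a * \<kappa> / l * F) + ennreal e"
    unfolding czF using nn by (simp add: ennreal_plus add_ac)
   finally show ?thesis .
  qed
  show ?thesis unfolding goal by (rule ennreal_le_epsilon) (use main in auto)
 qed
qed

end

end

section \<open>Extension to integrable functions\<close>

lemma ennreal_mult_add:
 "0 \<le> x \<Longrightarrow> 0 \<le> y \<Longrightarrow> 0 \<le> z \<Longrightarrow> ennreal x * ennreal y + ennreal z = ennreal (x * y + z)"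
 by (simp add: ennreal_mult)

lemma ennreal_mult_add_mult:
 "0 \<le> x \<Longrightarrow> 0 \<le> y \<Longrightarrow> 0 \<le> z \<Longrightarrow> 0 \<le> w \<Longrightarrow>
   ennreal x * ennreal y + ennreal z * ennreal w = ennreal (x * y + z * w)"
 by (simp add: ennreal_mult)

lemma emeasure_levels_add:
 fixes \<phi> :: "'a \<Rightarrow> 'b::real_normed_vector" and \<psi> :: "'a \<Rightarrow> 'c::real_normed_vector"
  and \<theta> :: "'a \<Rightarrow> 'd::real_normed_vector"
 assumes "strongly_measurable M \<phi>" "strongly_measurable M \<psi>"
  and le: "AE s in M. norm (\<theta> s) \<le> norm (\<phi> s) + norm (\<psi> s)"
 shows "emeasure M {s\<in>space M. norm (\<theta> s) > l}
  \<le> emeasure M {s\<in>space M. norm (\<phi> s) > l / 2} + emeasure M {s\<in>space M. norm (\<psi> s) > l / 2}"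
proof -
 note m = strongly_measurable_norm_le[OF assms(1), of "l / 2"] strongly_measurable_norm_le[OF assms(2), of "l / 2"]
 have "emeasure M {s\<in>space M. norm (\<theta> s) > l}
   \<le> emeasure M ({s\<in>space M. norm (\<phi> s) > l / 2} \<union> {s\<in>space M. norm (\<psi> s) > l / 2})"
  using m by (intro emeasure_mono_AE eventually_mono[OF le] sets.Un) auto
 also have "... \<le> emeasure M {s\<in>space M. norm (\<phi> s) > l / 2} + emeasure M {s\<in>space M. norm (\<psi> s) > l / 2}"
  by (rule emeasure_subadditive[OF m])
 finally show ?thesis .
qed

text \<open>The exceptional sets have summable measures, so almost every point belongs to finitely
  many of them, and off them the error is at most \<open>(1/2)^n\<close>.\<close>

lemma borel_cantelli_tendsto:
 fixes F :: "nat \<Rightarrow> 'a \<Rightarrow> 'b::real_normed_vector"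
 assumes F: "\<And>n. strongly_measurable M (F n)" and h: "strongly_measurable M h"
  and le: "\<And>n. emeasure M (superlevel M (\<lambda>s. h s - F n s) ((1/2)^n)) \<le> ennreal (C * (1/2)^n)"
 shows "AE s in M. (\<lambda>n. F n s) \<longlonglongrightarrow> h s"
proof -
 define A where "A n = (superlevel M (\<lambda>s. h s - F n s) ((1/2)^n))" for n
 have As: "A n \<in> sets M" for n
  unfolding A_def by (intro strongly_measurable_norm_le strongly_measurable_diff h F)
 have fin: "emeasure M (A n) < \<infinity>" for n unfolding A_def by (rule le_less_trans[OF le]) simp
 have "summable (\<lambda>n. measure M (A n))"
 proof (rule summable_comparison_test)
  show "\<exists>N. \<forall>n\<ge>N. norm (measure M (A n)) \<le> \<bar>C\<bar> * (1/2)^n"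
  proof (intro exI allI impI)
   fix n
   have "emeasure M (A n) \<le> ennreal (\<bar>C\<bar> * (1/2)^n)"
    unfolding A_def by (rule order_trans[OF le ennreal_leI]) (auto intro!: mult_right_mono)
   then show "norm (measure M (A n)) \<le> \<bar>C\<bar> * (1/2)^n"
    by (simp add: measure_def enn2real_leI)
  qed
 qed (auto intro!: summable_mult summable_geometric)
 then have "AE s in M. \<forall>\<^sub>F n in sequentially. s \<in> space M - A n"
  using As fin by (intro borel_cantelli_AE1) auto
 then show ?thesis
 proof eventually_elim
  case (elim s)
  have "(\<lambda>n. (1/2::real)^n) \<longlonglongrightarrow> 0" by (rule LIMSEQ_realpow_zero) auto
  moreover have "\<forall>\<^sub>F n in sequentially. norm (F n s - h s) \<le> (1/2)^n"
   using elim by eventually_elim (auto simp: A_def norm_minus_commute)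
  ultimately have "(\<lambda>n. F n s - h s) \<longlonglongrightarrow> 0" by (rule Lim_null_comparison[rotated])
  then show ?case by (simp add: LIM_zero_iff)
 qed
qed

section \<open>Density of the test functions\<close>

context homogeneous_type
begin

text \<open>One sequence approximates at every exponent at which \<open>f\<close> is integrable, by
  dominated convergence with majorant \<open>3 * norm (f x)\<close>. Agreement of the extension with
  \<open>T\<close> uses the exponents 1 and \<open>p0\<close> for the same sequence.\<close>

lemma V0_dense:
 fixes f :: "'a \<Rightarrow> 'b::real_normed_vector"
 assumes ne: "space M \<noteq> {}" and f: "strongly_measurable M f"
 obtains G where "\<And>n. G n \<in> V0" "\<And>n x. x \<in> space M \<Longrightarrow> norm (G n x) \<le> 2 * norm (f x)"
  "\<And>p. p > 0 \<Longrightarrow> (\<integral>\<^sup>+x. ennreal (norm (f x) powr p) \<partial>M) < \<infinity> \<Longrightarrow>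
    (\<lambda>n. \<integral>\<^sup>+x. ennreal (norm (f x - G n x) powr p) \<partial>M) \<longlonglongrightarrow> 0"
proof -
 obtain x0 where x0: "x0 \<in> space M" using ne by blast
 obtain H where H: "\<And>n. simple_function M (H n)" "\<And>x. x \<in> space M \<Longrightarrow> (\<lambda>n. H n x) \<longlonglongrightarrow> f x"
  "\<And>n x. x \<in> space M \<Longrightarrow> norm (H n x) \<le> 2 * norm (f x)"
  using strongly_measurable_approx[OF f] by blast
 define G where "G n = cut (B x0 (real n)) (H n)" for n
 have Gsm: "strongly_measurable M (G n)" for n
  unfolding G_def using H(1) x0 by (intro strongly_measurable_cut strongly_measurable_simple) auto
 have Gle: "norm (G n x) \<le> 2 * norm (f x)" if "x \<in> space M" for n x
  using H(3)[OF that, of n] by (simp add: G_def cut_def)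
 have Glim: "(\<lambda>n. G n x) \<longlonglongrightarrow> f x" if x: "x \<in> space M" for x
 proof -
  obtain m :: nat where m: "d x0 x < real m" using reals_Archimedean2 by blast
  have "\<forall>\<^sub>F n in sequentially. H n x = G n x"
   using eventually_ge_at_top[of m] by eventually_elim (use m x in \<open>auto simp: G_def cut_def mem_B\<close>)
  then show ?thesis using H(2)[OF x] by (rule Lim_transform_eventually[rotated])
 qed
 show ?thesis
 proof (rule that[of G])
  show "G n \<in> V0" for n
  proof -
   have "{t\<in>space M. G n t \<noteq> 0} \<subseteq> B x0 (real n + 1)" by (auto simp: G_def cut_def mem_B)
   then have "boundedly_supported M d (G n)"
    unfolding boundedly_supported_iff[OF x0] by (intro exI[of _ "real n + 1"]) auto
   moreover have "simple_function M (G n)" unfolding G_def using H(1) x0 by (intro simple_function_cut) auto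
   ultimately show ?thesis by (simp add: V0_def)
  qed
  show "norm (G n x) \<le> 2 * norm (f x)" if "x \<in> space M" for n x using Gle[OF that] .
  fix p :: real assume p: "p > 0" "(\<integral>\<^sup>+x. ennreal (norm (f x) powr p) \<partial>M) < \<infinity>"
  have [measurable]: "(\<lambda>x. norm (f x)) \<in> borel_measurable M" "\<And>n. (\<lambda>x. norm (f x - G n x)) \<in> borel_measurable M"
   using f Gsm by (auto intro!: strongly_measurable_norm strongly_measurable_diff)
  have "(\<lambda>n. \<integral>\<^sup>+x. ennreal (norm (f x - G n x) powr p) \<partial>M) \<longlonglongrightarrow> (\<integral>\<^sup>+x. 0 \<partial>M)"
  proof (rule nn_integral_dominated_convergence[where w="\<lambda>x. ennreal (3 powr p) * ennreal (norm (f x) powr p)"])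
   show "AE x in M. ennreal (norm (f x - G n x) powr p) \<le> ennreal (3 powr p) * ennreal (norm (f x) powr p)" for n
    using AE_space
   proof eventually_elim
    case (elim x)
    have "norm (f x - G n x) \<le> 3 * norm (f x)"
     using Gle[OF elim, of n] norm_triangle_ineq4[of "f x" "G n x"] by simp
    then have "norm (f x - G n x) powr p \<le> (3 * norm (f x)) powr p" using p by (intro powr_mono2) auto
    also have "... = 3 powr p * norm (f x) powr p" by (simp add: powr_mult)
    finally show ?case by (subst ennreal_mult[symmetric]) (auto intro: ennreal_leI)
   qed
   show "(\<integral>\<^sup>+x. ennreal (3 powr p) * ennreal (norm (f x) powr p) \<partial>M) < \<infinity>"
    using p by (subst nn_integral_cmult) (auto simp: ennreal_mult_less_top)
   show "AE x in M. (\<lambda>n. ennreal (norm (f x - G n x) powr p)) \<longlonglongrightarrow> 0"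
    using AE_space
   proof eventually_elim
    case (elim x)
    have "(\<lambda>n. f x - G n x) \<longlonglongrightarrow> f x - f x" using Glim[OF elim] by (intro tendsto_diff tendsto_const)
    then have "(\<lambda>n. norm (f x - G n x)) \<longlonglongrightarrow> 0" by (simp add: tendsto_norm_zero)
    then have "(\<lambda>n. norm (f x - G n x) powr p) \<longlonglongrightarrow> 0 powr p"
     using p by (intro tendsto_powr') auto
    then show ?case using tendsto_ennrealI by fastforce
   qed
  qed auto
  then show "(\<lambda>n. \<integral>\<^sup>+x. ennreal (norm (f x - G n x) powr p) \<partial>M) \<longlonglongrightarrow> 0" by simp
 qed
qed

lemma V0_dense_L1:
 assumes "space M \<noteq> {}" "f \<in> Lp_space M 1" "e > (0::real)"
 obtains g where "g \<in> V0" "\<And>x. x \<in> space M \<Longrightarrow> norm (g x) \<le> 2 * norm (f x)"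
  "L1_dist M f g < ennreal e"
proof -
 obtain G where G: "\<And>n. G n \<in> V0" "\<And>n x. x \<in> space M \<Longrightarrow> norm (G n x) \<le> 2 * norm (f x)"
  "\<And>p. p > 0 \<Longrightarrow> (\<integral>\<^sup>+x. ennreal (norm (f x) powr p) \<partial>M) < \<infinity> \<Longrightarrow>
    (\<lambda>n. \<integral>\<^sup>+x. ennreal (norm (f x - G n x) powr p) \<partial>M) \<longlonglongrightarrow> 0"
  using V0_dense[OF assms(1), of f] assms(2) unfolding L1_iff by blast
 have "(\<lambda>n. \<integral>\<^sup>+x. enorm (f x - G n x) \<partial>M) \<longlonglongrightarrow> 0"
  using G(3)[of 1] assms(2) by (simp add: L1_iff)
 then have "\<forall>\<^sub>F n in sequentially. (L1_dist M f (G n)) < ennreal e"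
  using assms(3) by (intro order_tendstoD(2)) auto
 then obtain n where "L1_dist M f (G n) < ennreal e" by (auto simp: eventually_sequentially)
 then show ?thesis using that[of "G n"] G(1,2) by blast
qed

lemma nn_integral_norm_triangle:
 fixes f g h :: "'a \<Rightarrow> 'b::real_normed_vector"
 assumes "strongly_measurable M f" "strongly_measurable M g" "strongly_measurable M h"
 shows "L1_dist M f h
  \<le> L1_dist M f g + L1_dist M g h"
proof -
 have [measurable]: "(\<lambda>x. norm (f x - g x)) \<in> borel_measurable M" "(\<lambda>x. norm (g x - h x)) \<in> borel_measurable M"
  using assms by (auto intro!: strongly_measurable_norm strongly_measurable_diff)
 have "L1_dist M f h \<le> (\<integral>\<^sup>+x. enorm (f x - g x) + enorm (g x - h x) \<partial>M)"
 proof (rule nn_integral_mono)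
  fix x
  have "norm (f x - h x) \<le> norm (f x - g x) + norm (g x - h x)" by norm
  then show "enorm (f x - h x) \<le> enorm (f x - g x) + enorm (g x - h x)"
   by (simp flip: ennreal_plus add: ennreal_leI)
 qed
 also have "... = L1_dist M f g + L1_dist M g h"
  by (rule nn_integral_add) auto
 finally show ?thesis .
qed

section \<open>Extension by limits in measure\<close>

context
 fixes T :: "('a \<Rightarrow> 'b::banach) \<Rightarrow> ('a \<Rightarrow> 'c::banach)" and W :: real
 assumes ne: "space M \<noteq> {}" and W: "W > 0"
  and T_meas: "\<And>g. g \<in> V0 \<Longrightarrow> strongly_measurable M (T g)"
  and T_add: "\<And>f g. f \<in> V0 \<Longrightarrow> g \<in> V0 \<Longrightarrow> AE s in M. T (\<lambda>x. f x + g x) s = T f s + T g s"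
  and T_weak: "\<And>g l. g \<in> V0 \<Longrightarrow> l > 0 \<Longrightarrow>
   emeasure M (superlevel M (T g) l) \<le> ennreal (W / l) * L1_mass M g"
begin

lemma T_diff:
 assumes "f \<in> V0" "g \<in> V0"
 shows "AE s in M. T f s - T g s = T (\<lambda>x. f x - g x) s"
proof -
 have "AE s in M. T (\<lambda>x. g x + (f x - g x)) s = T g s + T (\<lambda>x. f x - g x) s"
  by (rule T_add[OF assms(2) V0_diff[OF assms]])
 then show ?thesis by eventually_elim simp
qed

lemma T_diff_weak:
 assumes fg: "f \<in> V0" "g \<in> V0" and l: "l > 0"
 shows "emeasure M (superlevel M (\<lambda>s. T f s - T g s) l) \<le> ennreal (W / l) * L1_dist M f g"
proof -
 have d: "(\<lambda>x. f x - g x) \<in> V0" using V0_diff[OF fg] .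
 have "emeasure M (superlevel M (\<lambda>s. T f s - T g s) l) \<le> emeasure M {s\<in>space M. norm (T (\<lambda>x. f x - g x) s) > l}"
  using strongly_measurable_norm_le[OF T_meas[OF d]]
  by (intro emeasure_mono_AE eventually_mono[OF T_diff[OF fg]]) auto
 then show ?thesis using T_weak[OF d l] by (rule order_trans)
qed

text \<open>\<open>h\<close> is a limit in measure of \<open>T g\<close> along test functions \<open>g\<close> converging to \<open>f\<close> in mean; this
 estimate characterises it up to null sets.\<close>

definition T_limit :: "('a \<Rightarrow> 'b) \<Rightarrow> ('a \<Rightarrow> 'c) \<Rightarrow> bool" where
 "T_limit f h \<longleftrightarrow> strongly_measurable M h \<and> (\<forall>g\<in>V0. \<forall>l>0.
   emeasure M (superlevel M (\<lambda>s. h s - T g s) l) \<le> ennreal (2 * W / l) * L1_dist M f g)"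

text \<open>With errors \<open>(1/4)^n\<close> in the mean and levels \<open>(1/2)^n\<close> the
  weak type leaves sets of measure of order \<open>(1/2)^n\<close>; off their tails
  \<open>Z n\<close> the images form a Cauchy sequence. The factor 2 in \<open>T_limit\<close> comes
  from halving a level when another test function is compared.\<close>

lemma T_limit_exists:
 assumes f: "f \<in> Lp_space M 1"
 shows "\<exists>h. T_limit f h"
proof -
 have fsm: "strongly_measurable M f" using f by (simp add: L1_iff)
 have "\<forall>n. \<exists>g. g \<in> V0 \<and> (L1_dist M f g) \<le> ennreal ((1/4)^n)"
 proof
  fix n
  show "\<exists>g. g \<in> V0 \<and> (L1_dist M f g) \<le> ennreal ((1/4)^n)"
   by (rule V0_dense_L1[OF ne f, of "(1/4)^n"]) (auto intro: less_imp_le)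
 qed
 then obtain G where G: "\<And>n. G n \<in> V0" "\<And>n. (L1_dist M f (G n)) \<le> ennreal ((1/4)^n)"
  by metis
 have Gsm: "strongly_measurable M (G n)" for n using V0_strongly_measurable[OF G(1)] .
 define A where "A n = {s\<in>space M. norm (T (G (Suc n)) s - T (G n) s) > (1/2)^n}" for n
 have As: "A n \<in> sets M" for n
  unfolding A_def by (intro strongly_measurable_norm_le strongly_measurable_diff T_meas G)
 have mA: "emeasure M (A n) \<le> ennreal (2 * W * (1/2)^n)" for n
 proof -
  have "(\<integral>\<^sup>+x. enorm (G (Suc n) x - G n x) \<partial>M)
    \<le> (\<integral>\<^sup>+x. enorm (G (Suc n) x - f x) \<partial>M) + L1_dist M f (G n)"
   by (rule nn_integral_norm_triangle[OF Gsm fsm Gsm])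
  also have "... \<le> ennreal ((1/4)^Suc n) + ennreal ((1/4)^n)"
   using G(2)[of "Suc n"] G(2)[of n] by (intro add_mono) (simp_all add: norm_minus_commute)
  also have "... \<le> ennreal (2 * (1/4)^n)"
   by (simp flip: ennreal_plus add: ennreal_leI)
  finally have "emeasure M (A n) \<le> ennreal (W / (1/2)^n) * ennreal (2 * (1/4)^n)"
   unfolding A_def by (intro order_trans[OF T_diff_weak[OF G(1) G(1)]] mult_left_mono) auto
  also have "... = ennreal (W / (1/2)^n * (2 * (1/4)^n))" using W by (simp flip: ennreal_mult)
  also have "W / (1/2)^n * (2 * (1/4)^n) = 2 * W * (1/2)^n"
   by (simp add: power_mult_distrib[symmetric] power_divide field_simps)
  finally show ?thesis .
 qed
 define Z where "Z n = (\<Union>k. A (n + k))" for n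
 have Zs: "Z n \<in> sets M" for n unfolding Z_def using As by blast
 have mZ: "emeasure M (Z n) \<le> ennreal (4 * W * (1/2)^n)" for n
 proof -
  have "emeasure M (Z n) \<le> (\<Sum>k. emeasure M (A (n + k)))"
   unfolding Z_def using As by (intro emeasure_subadditive_countably) auto
  also have "... \<le> (\<Sum>k. ennreal (2 * W * (1/2)^n * (1/2)^k))"
  proof (rule suminf_le)
   show "emeasure M (A (n + k)) \<le> ennreal (2 * W * (1/2)^n * (1/2)^k)" for k
    using mA[of "n + k"] by (simp add: power_add mult.assoc)
  qed auto
  also have "... = ennreal (\<Sum>k. 2 * W * (1/2)^n * (1/2)^k)"
   using W by (intro suminf_ennreal2) (auto intro!: summable_mult summable_geometric)
  also have "(\<Sum>k. 2 * W * (1/2)^n * (1/2::real)^k) = 4 * W * (1/2)^n"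
   by (subst suminf_mult) (auto intro!: summable_geometric simp: suminf_geometric)
  finally show ?thesis .
 qed
 have tail: "norm (T (G (n + k)) s - T (G n) s) \<le> 2 * (1/2)^n - 2 * (1/2)^(n + k)"
  if "s \<in> space M" "s \<notin> Z n" for s n k
 proof (induction k)
  case (Suc k)
  have "s \<notin> A (n + k)" using that by (auto simp: Z_def)
  then have "norm (T (G (Suc (n + k))) s - T (G (n + k)) s) \<le> (1/2)^(n + k)"
   using that by (auto simp: A_def)
  then have "norm (T (G (n + Suc k)) s - T (G n) s) \<le> (1/2)^(n + k) + norm (T (G (n + k)) s - T (G n) s)"
   using norm_triangle_ineq[of "T (G (Suc (n + k))) s - T (G (n + k)) s" "T (G (n + k)) s - T (G n) s"] by simp
  then show ?case using Suc by simp
 qed simp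
 define D where "D = space M - (\<Inter>n. Z n)"
 have Ds: "D \<in> sets M" unfolding D_def using Zs by (intro sets.Diff sets.countable_INT) auto
 have conv: "convergent (\<lambda>n. T (G n) s)" if sD: "s \<in> D" for s
 proof -
  obtain n where n: "s \<notin> Z n" "s \<in> space M" using sD by (auto simp: D_def)
  have Zmono: "Z m \<subseteq> Z n" if mn: "m \<ge> n" for m
  proof
   fix s assume "s \<in> Z m"
   then obtain k where "s \<in> A (m + k)" by (auto simp: Z_def)
   then show "s \<in> Z n" using mn unfolding Z_def by (intro UN_I[of "m + k - n"]) auto
  qed
  have "Cauchy (\<lambda>n. T (G n) s)"
  proof (rule metric_CauchyI)
   fix e :: real assume e: "e > 0"
   have "(\<lambda>n. 4 * (1/2::real)^n) \<longlonglongrightarrow> 4 * 0" by (intro tendsto_mult tendsto_const LIMSEQ_realpow_zero) auto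
   then have "\<forall>\<^sub>F n in sequentially. 4 * (1/2::real)^n < e" using e by (intro order_tendstoD(2)) auto
   then obtain m0 where m0: "\<And>m. m \<ge> m0 \<Longrightarrow> 4 * (1/2::real)^m < e" by (auto simp: eventually_sequentially)
   define m where "m = max n m0"
   have sZ: "s \<notin> Z m" using n Zmono[of m] by (auto simp: m_def)
   have le: "norm (T (G i) s - T (G m) s) \<le> 2 * (1/2)^m" if i: "i \<ge> m" for i
   proof -
    have "norm (T (G (m + (i - m))) s - T (G m) s) \<le> 2 * (1/2)^m - 2 * (1/2)^(m + (i - m))"
     by (rule tail[OF n(2) sZ])
    also have "... \<le> 2 * (1/2)^m" by simp
    finally show ?thesis using i by simp
   qed
   have "dist (T (G i) s) (T (G j) s) < e" if "i \<ge> m" "j \<ge> m" for i j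
   proof -
    have "dist (T (G i) s) (T (G j) s) \<le> dist (T (G i) s) (T (G m) s) + dist (T (G j) s) (T (G m) s)"
     by (rule dist_triangle2)
    also have "... \<le> 2 * (1/2)^m + 2 * (1/2)^m" using le that by (intro add_mono) (auto simp: dist_norm)
    also have "... < e" using m0[of m] by (simp add: m_def)
    finally show ?thesis .
   qed
   then show "\<exists>M. \<forall>i\<ge>M. \<forall>j\<ge>M. dist (T (G i) s) (T (G j) s) < e" by blast
  qed
  then show ?thesis by (rule Cauchy_convergent)
 qed
 \<comment> \<open>On points lying in every \<open>Z n\<close> the value is 0, which makes
   \<open>h\<close> an everywhere limit of truncated images and hence strongly measurable.\<close>
 define h where "h = cut D (\<lambda>s. lim (\<lambda>n. T (G n) s))"
 have hlim: "(\<lambda>n. T (G n) s) \<longlonglongrightarrow> h s" if "s \<in> D" for s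
  using conv[OF that] that by (simp add: h_def cut_def convergent_LIMSEQ_iff)
 have hsm: "strongly_measurable M h"
 proof (rule strongly_measurable_LIMSEQ)
  show "strongly_measurable M (cut D (T (G n)))" for n
   by (intro strongly_measurable_cut T_meas G Ds)
  show "(\<lambda>n. cut D (T (G n)) s) \<longlonglongrightarrow> h s" for s
   using hlim[of s] by (cases "s \<in> D") (auto simp: cut_def h_def)
 qed
 have near: "emeasure M {s\<in>space M. norm (h s - T (G n) s) > 2 * (1/2)^n} \<le> ennreal (4 * W * (1/2)^n)" for n
 proof -
  have "{s\<in>space M. norm (h s - T (G n) s) > 2 * (1/2)^n} \<subseteq> Z n"
  proof (rule subsetI, rule ccontr)
   fix s assume s: "s \<in> {s\<in>space M. norm (h s - T (G n) s) > 2 * (1/2)^n}" "s \<notin> Z n"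
   then have sD: "s \<in> D" by (auto simp: D_def)
   have "(\<lambda>k. norm (T (G (n + k)) s - T (G n) s)) \<longlonglongrightarrow> norm (h s - T (G n) s)"
    using LIMSEQ_ignore_initial_segment[OF hlim[OF sD], of n]
    by (intro tendsto_norm tendsto_diff tendsto_const) (simp add: add.commute)
   moreover have "norm (T (G (n + k)) s - T (G n) s) \<le> 2 * (1/2)^n" for k
   proof -
    have "norm (T (G (n + k)) s - T (G n) s) \<le> 2 * (1/2)^n - 2 * (1/2)^(n + k)"
     using s by (intro tail) auto
    also have "... \<le> 2 * (1/2)^n" by simp
    finally show ?thesis .
   qed
   ultimately have "norm (h s - T (G n) s) \<le> 2 * (1/2)^n" by (intro LIMSEQ_le_const2) auto
   then show False using s by auto
  qed
  then have "emeasure M {s\<in>space M. norm (h s - T (G n) s) > 2 * (1/2)^n} \<le> emeasure M (Z n)"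
   using Zs by (rule emeasure_mono)
  then show ?thesis using mZ[of n] by (rule order_trans)
 qed
 have "emeasure M (superlevel M (\<lambda>s. h s - T g s) l) \<le> ennreal (2 * W / l) * L1_dist M f g"
  if g: "g \<in> V0" and l: "l > 0" for g l
 proof -
  let ?I = "\<integral>\<^sup>+x. enorm (f x - g x) \<partial>M"
  have gsm: "strongly_measurable M g" using V0_strongly_measurable[OF g] .
  \<comment> \<open>The comparison of \<open>h\<close> with \<open>T g\<close> goes through
    \<open>T (G n)\<close>; the additional terms disappear as n grows.\<close>
  have b: "emeasure M (superlevel M (\<lambda>s. h s - T g s) l) \<le> ennreal (4 * W * (1/2)^n) + ennreal (2 * W / l) * (ennreal ((1/4)^n) + ?I)"
   if n: "2 * (1/2)^n \<le> l / 2" for n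
  proof -
   have "emeasure M (superlevel M (\<lambda>s. h s - T g s) l)
     \<le> emeasure M {s\<in>space M. norm (h s - T (G n) s) > l / 2} + emeasure M {s\<in>space M. norm (T (G n) s - T g s) > l / 2}"
   proof (rule emeasure_levels_add)
    show "AE s in M. norm (h s - T g s) \<le> norm (h s - T (G n) s) + norm (T (G n) s - T g s)"
     by (intro AE_I2) norm
   qed (intro strongly_measurable_diff hsm T_meas G g)+
   also have "... \<le> ennreal (4 * W * (1/2)^n) + ennreal (W / (l / 2)) * L1_dist M (G n) g"
   proof (rule add_mono)
    have "emeasure M {s\<in>space M. norm (h s - T (G n) s) > l / 2} \<le> emeasure M {s\<in>space M. norm (h s - T (G n) s) > 2 * (1/2)^n}"
     using n by (intro emeasure_mono strongly_measurable_norm_le strongly_measurable_diff hsm T_meas G) auto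
    then show "emeasure M {s\<in>space M. norm (h s - T (G n) s) > l / 2} \<le> ennreal (4 * W * (1/2)^n)"
     using near[of n] by (rule order_trans)
    show "emeasure M {s\<in>space M. norm (T (G n) s - T g s) > l / 2} \<le> ennreal (W / (l / 2)) * L1_dist M (G n) g"
     using T_diff_weak[OF G(1) g, of "l / 2" n] l by simp
   qed
   also have "... \<le> ennreal (4 * W * (1/2)^n) + ennreal (2 * W / l) * (ennreal ((1/4)^n) + ?I)"
   proof (rule add_left_mono)
    have "L1_dist M (G n) g \<le> L1_dist M (G n) f + ?I"
     by (rule nn_integral_norm_triangle[OF Gsm fsm gsm])
    also have "... \<le> ennreal ((1/4)^n) + ?I" using G(2)[of n] by (intro add_right_mono) (simp add: norm_minus_commute)
    finally show "ennreal (W / (l / 2)) * L1_dist M (G n) g \<le> ennreal (2 * W / l) * (ennreal ((1/4)^n) + ?I)"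
     by (intro mult_mono) (auto simp: mult_ac)
   qed
   finally show ?thesis .
  qed
  have lim: "(\<lambda>n. ennreal (4 * W * (1/2)^n) + ennreal (2 * W / l) * (ennreal ((1/4)^n) + ?I))
    \<longlonglongrightarrow> ennreal (4 * W * 0) + ennreal (2 * W / l) * (ennreal 0 + ?I)"
   by (intro tendsto_add tendsto_const ennreal_tendsto_cmult tendsto_ennrealI tendsto_mult LIMSEQ_realpow_zero) auto
  have z: "(\<lambda>n. 2 * (1/2::real)^n) \<longlonglongrightarrow> 2 * 0" by (intro tendsto_mult tendsto_const LIMSEQ_realpow_zero) auto
  have "\<forall>\<^sub>F n in sequentially. 2 * (1/2::real)^n < l / 2" using l by (intro order_tendstoD(2)[OF z]) simp
  then have "\<forall>\<^sub>F n in sequentially. emeasure M (superlevel M (\<lambda>s. h s - T g s) l)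
    \<le> ennreal (4 * W * (1/2)^n) + ennreal (2 * W / l) * (ennreal ((1/4)^n) + ?I)"
   by eventually_elim (rule b, simp)
  then have "emeasure M (superlevel M (\<lambda>s. h s - T g s) l) \<le> ennreal (4 * W * 0) + ennreal (2 * W / l) * (ennreal 0 + ?I)"
   by (intro tendsto_lowerbound[OF lim]) auto
  then show ?thesis by simp
 qed
 then show ?thesis using hsm unfolding T_limit_def by blast
qed

definition T_ext :: "('a \<Rightarrow> 'b) \<Rightarrow> ('a \<Rightarrow> 'c)" where
 "T_ext f = (SOME h. T_limit f h)"

lemma T_ext:
 assumes "f \<in> Lp_space M 1"
 shows "strongly_measurable M (T_ext f)"
  "\<And>g l. g \<in> V0 \<Longrightarrow> l > 0 \<Longrightarrow> emeasure M (superlevel M (\<lambda>s. T_ext f s - T g s) l)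
    \<le> ennreal (2 * W / l) * L1_dist M f g"
proof -
 have "T_limit f (T_ext f)" unfolding T_ext_def using someI_ex[OF T_limit_exists[OF assms]] .
 then show "strongly_measurable M (T_ext f)"
  "\<And>g l. g \<in> V0 \<Longrightarrow> l > 0 \<Longrightarrow> emeasure M (superlevel M (\<lambda>s. T_ext f s - T g s) l)
    \<le> ennreal (2 * W / l) * L1_dist M f g"
  unfolding T_limit_def by blast+
qed

lemma T_ext_weak:
 assumes f: "f \<in> Lp_space M 1" and l: "l > 0"
 shows "emeasure M (superlevel M (T_ext f) l) \<le> ennreal (2 * W / l) * L1_mass M f"
proof -
 have 0: "(\<lambda>_. 0) \<in> V0" using V0_zero[OF ne] .
 have "AE s in M. T (\<lambda>_. 0) s = 0"
  using T_weak[OF 0] by (intro AE_zero_levels T_meas[OF 0]) auto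
 then have "emeasure M (superlevel M (T_ext f) l) \<le> emeasure M {s\<in>space M. norm (T_ext f s - T (\<lambda>_. 0) s) > l}"
  by (intro emeasure_mono_AE strongly_measurable_norm_le strongly_measurable_diff T_ext[OF f] T_meas[OF 0]) auto
 also have "... \<le> ennreal (2 * W / l) * (\<integral>\<^sup>+x. enorm (f x - 0) \<partial>M)" by (rule T_ext(2)[OF f 0 l])
 finally show ?thesis by simp
qed

text \<open>Linearity and agreement with \<open>T\<close> both reduce to this: it suffices to
  exhibit, close to \<open>f\<close> in the mean, a test function whose image is close to the
  claimed value in measure.\<close>

lemma T_ext_unique:
 assumes f: "f \<in> Lp_space M 1" and h: "strongly_measurable M h"
  and C: "C > 0" and near: "\<And>e l. e > 0 \<Longrightarrow> l > 0 \<Longrightarrow> \<exists>g\<in>V0. (L1_dist M f g) \<le> ennreal e \<and>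
   emeasure M (superlevel M (\<lambda>s. T g s - h s) l) \<le> ennreal (C * e / l)"
 shows "AE s in M. T_ext f s = h s"
proof -
 have "AE s in M. T_ext f s - h s = 0"
 proof (rule AE_zero_levels)
  show "strongly_measurable M (\<lambda>s. T_ext f s - h s)" by (intro strongly_measurable_diff T_ext[OF f] h)
  fix l :: real assume l: "l > 0"
  have "emeasure M (superlevel M (\<lambda>s. T_ext f s - h s) l) \<le> 0 + ennreal e" if e: "e > 0" for e
  proof -
   \<comment> \<open>Solved so that the two halves of the level together contribute
     \<open>e\<close>.\<close>
   define e' where "e' = e * l / (4 * W + 2 * C)"
   have "4 * W + 2 * C > 0" using W C by simp
   then have e': "e' > 0" "(4 * W + 2 * C) * e' / l = e" using e l by (simp_all add: e'_def)
   obtain g where g: "g \<in> V0" "L1_dist M f g \<le> ennreal e'"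
    "emeasure M (superlevel M (\<lambda>s. T g s - h s) (l / 2)) \<le> ennreal (C * e' / (l / 2))"
    using near[OF e'(1), of "l / 2"] l by auto
   have "emeasure M (superlevel M (\<lambda>s. T_ext f s - h s) l)
     \<le> emeasure M (superlevel M (\<lambda>s. T_ext f s - T g s) (l / 2)) + emeasure M (superlevel M (\<lambda>s. T g s - h s) (l / 2))"
   proof (rule emeasure_levels_add)
    show "AE s in M. norm (T_ext f s - h s) \<le> norm (T_ext f s - T g s) + norm (T g s - h s)"
     by (intro AE_I2) norm
   qed (intro strongly_measurable_diff T_ext[OF f] T_meas g h)+
   also have "... \<le> ennreal (2 * W / (l / 2)) * ennreal e' + ennreal (C * e' / (l / 2))"
    using l g by (intro add_mono order_trans[OF T_ext(2)[OF f g(1)]] mult_left_mono) auto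
   also have "... = ennreal (2 * W / (l / 2) * e' + C * e' / (l / 2))"
    using W l e' C by (intro ennreal_mult_add) auto
   also have "2 * W / (l / 2) * e' + C * e' / (l / 2) = (4 * W + 2 * C) * e' / l" by (simp add: add_divide_distrib distrib_right)
   finally show ?thesis unfolding e'(2) by simp
  qed
  then have "emeasure M (superlevel M (\<lambda>s. T_ext f s - h s) l) \<le> 0"
   by (rule ennreal_le_epsilon)
  then show "emeasure M (superlevel M (\<lambda>s. T_ext f s - h s) l) = 0" by simp
 qed
 then show ?thesis by eventually_elim simp
qed

lemma T_ext_add:
 assumes f: "f \<in> Lp_space M 1" and f': "f' \<in> Lp_space M 1"
 shows "AE s in M. T_ext (\<lambda>x. f x + f' x) s = T_ext f s + T_ext f' s"
proof (rule T_ext_unique[where C="4 * W"])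
 fix e l :: real assume e: "e > 0" and l: "l > 0"
 obtain g where g: "g \<in> V0" "L1_dist M f g < ennreal (e / 2)"
  using V0_dense_L1[OF ne f, of "e / 2"] e by auto
 obtain g' where g': "g' \<in> V0" "L1_dist M f' g' < ennreal (e / 2)"
  using V0_dense_L1[OF ne f', of "e / 2"] e by auto
 have sm: "strongly_measurable M f" "strongly_measurable M f'" "strongly_measurable M g" "strongly_measurable M g'"
  using f f' g g' by (auto simp: L1_iff V0_strongly_measurable)
 have [measurable]: "(\<lambda>x. norm (f x - g x)) \<in> borel_measurable M" "(\<lambda>x. norm (f' x - g' x)) \<in> borel_measurable M"
  using sm by (auto intro!: strongly_measurable_norm strongly_measurable_diff)
 have gg: "(\<lambda>x. g x + g' x) \<in> V0" using g g' by (intro V0_add)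
 have 1: "(\<integral>\<^sup>+x. enorm (f x + f' x - (g x + g' x)) \<partial>M) \<le> ennreal e"
 proof -
  have "(\<integral>\<^sup>+x. enorm (f x + f' x - (g x + g' x)) \<partial>M)
    \<le> (\<integral>\<^sup>+x. enorm (f x - g x) + enorm (f' x - g' x) \<partial>M)"
  proof (rule nn_integral_mono)
   fix x
   have "norm (f x + f' x - (g x + g' x)) \<le> norm (f x - g x) + norm (f' x - g' x)" by norm
   then show "enorm (f x + f' x - (g x + g' x)) \<le> enorm (f x - g x) + enorm (f' x - g' x)"
    by (simp flip: ennreal_plus add: ennreal_leI)
  qed
  also have "... = L1_dist M f g + L1_dist M f' g'"
   by (rule nn_integral_add) auto
  also have "... \<le> ennreal (e / 2) + ennreal (e / 2)" using g g' by (intro add_mono) auto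
  finally show ?thesis using e by (simp flip: ennreal_plus)
 qed
 have "emeasure M {s\<in>space M. norm (T (\<lambda>x. g x + g' x) s - (T_ext f s + T_ext f' s)) > l}
   \<le> emeasure M (superlevel M (\<lambda>s. T_ext f s - T g s) (l / 2)) + emeasure M (superlevel M (\<lambda>s. T_ext f' s - T g' s) (l / 2))"
 proof (rule emeasure_levels_add)
  show "AE s in M. norm (T (\<lambda>x. g x + g' x) s - (T_ext f s + T_ext f' s)) \<le> norm (T_ext f s - T g s) + norm (T_ext f' s - T g' s)"
   using T_add[OF g(1) g'(1)]
  proof eventually_elim
   case (elim s)
   show ?case unfolding elim by norm
  qed
 qed (intro strongly_measurable_diff T_ext f f' T_meas g g')+
 also have "... \<le> ennreal (2 * W / (l / 2)) * ennreal (e / 2) + ennreal (2 * W / (l / 2)) * ennreal (e / 2)"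
  using l g g' by (intro add_mono order_trans[OF T_ext(2)[OF f g(1)]] order_trans[OF T_ext(2)[OF f' g'(1)]] mult_left_mono) auto
 also have "... = ennreal (2 * W / (l / 2) * (e / 2) + 2 * W / (l / 2) * (e / 2))"
  using W l e by (intro ennreal_mult_add_mult) auto
 also have "2 * W / (l / 2) * (e / 2) + 2 * W / (l / 2) * (e / 2) = 4 * W * e / l" by simp
 finally show "\<exists>g\<in>V0. (\<integral>\<^sup>+x. enorm (f x + f' x - g x) \<partial>M) \<le> ennreal e \<and>
   emeasure M {s\<in>space M. norm (T g s - (T_ext f s + T_ext f' s)) > l} \<le> ennreal (4 * W * e / l)"
  using gg 1 by (intro bexI[OF _ gg]) auto
qed (use W f f' in \<open>auto intro!: L1_add strongly_measurable_add T_ext\<close>)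

lemma T_ext_scaleR:
 assumes f: "f \<in> Lp_space M 1" and T_scale: "\<And>g. g \<in> V0 \<Longrightarrow> AE s in M. T (\<lambda>x. c *\<^sub>R g x) s = c *\<^sub>R T g s"
 shows "AE s in M. T_ext (\<lambda>x. c *\<^sub>R f x) s = c *\<^sub>R T_ext f s"
proof (rule T_ext_unique[where C="2 * W"])
 fix e l :: real assume e: "e > 0" and l: "l > 0"
 \<comment> \<open>Adding 1 keeps the divisor positive for \<open>c = 0\<close>.\<close>
 define k where "k = \<bar>c\<bar> + 1"
 have k: "k > 0" "\<bar>c\<bar> \<le> k" by (auto simp: k_def)
 obtain g where g: "g \<in> V0" "L1_dist M f g < ennreal (e / k)"
  using V0_dense_L1[OF ne f, of "e / k"] e k by auto
 have [measurable]: "(\<lambda>x. norm (f x - g x)) \<in> borel_measurable M"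
  using f g(1) V0_strongly_measurable by (intro strongly_measurable_norm strongly_measurable_diff) (auto simp: L1_iff)
 have cg: "(\<lambda>x. c *\<^sub>R g x) \<in> V0" using g by (intro V0_scaleR)
 have kle: "norm (c *\<^sub>R v) \<le> k * norm v" for v :: "'z::real_normed_vector" using k by (simp add: mult_right_mono)
 have 1: "(\<integral>\<^sup>+x. enorm (c *\<^sub>R f x - c *\<^sub>R g x) \<partial>M) \<le> ennreal e"
 proof -
  have "(\<integral>\<^sup>+x. enorm (c *\<^sub>R f x - c *\<^sub>R g x) \<partial>M) \<le> (\<integral>\<^sup>+x. ennreal k * enorm (f x - g x) \<partial>M)"
   using kle k by (intro nn_integral_mono) (auto simp flip: ennreal_mult scaleR_diff_right intro!: ennreal_leI)
  also have "... = ennreal k * L1_dist M f g" by (rule nn_integral_cmult) measurable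
  also have "... \<le> ennreal k * ennreal (e / k)" using g by (intro mult_left_mono) auto
  also have "... = ennreal e" using k e by (simp flip: ennreal_mult)
  finally show ?thesis .
 qed
 have "emeasure M {s\<in>space M. norm (T (\<lambda>x. c *\<^sub>R g x) s - c *\<^sub>R T_ext f s) > l} \<le> emeasure M (superlevel M (\<lambda>s. T_ext f s - T g s) (l / k))"
 proof (rule emeasure_mono_AE)
  show "AE s in M. s \<in> {s\<in>space M. norm (T (\<lambda>x. c *\<^sub>R g x) s - c *\<^sub>R T_ext f s) > l} \<longrightarrow> s \<in> superlevel M (\<lambda>s. T_ext f s - T g s) (l / k)"
   using T_scale[OF g(1)]
  proof eventually_elim
   case (elim s)
   have "norm (T (\<lambda>x. c *\<^sub>R g x) s - c *\<^sub>R T_ext f s) \<le> k * norm (T_ext f s - T g s)"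
    using kle[of "T g s - T_ext f s"] by (simp add: elim scaleR_diff_right norm_minus_commute)
   then show ?case using k by (auto simp: pos_divide_less_eq mult_ac)
  qed
 qed (intro strongly_measurable_norm_le strongly_measurable_diff T_ext f T_meas g)
 also have "... \<le> ennreal (2 * W / (l / k)) * ennreal (e / k)"
  using l k g by (intro order_trans[OF T_ext(2)[OF f g(1)]] mult_left_mono) auto
 also have "... = ennreal (2 * W / (l / k) * (e / k))" using W l k e by (intro ennreal_mult[symmetric]) auto
 also have "2 * W / (l / k) * (e / k) = 2 * W * e / l" using k by simp
 finally show "\<exists>g\<in>V0. (\<integral>\<^sup>+x. enorm (c *\<^sub>R f x - g x) \<partial>M) \<le> ennreal e \<and>
   emeasure M {s\<in>space M. norm (T g s - c *\<^sub>R T_ext f s) > l} \<le> ennreal (2 * W * e / l)"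
  using 1 by (intro bexI[OF _ cg]) auto
qed (use W f in \<open>auto intro!: L1_scaleR strongly_measurable_scaleR T_ext\<close>)

text \<open>The bound by \<open>2 * norm (f x)\<close> makes the approximants vanish wherever
  \<open>f\<close> does, on which the kernel formula relies. Errors of \<open>(1/4)^n\<close> turn
  convergence in measure into convergence almost everywhere.\<close>

lemma T_ext_approx:
 assumes f: "f \<in> Lp_space M 1"
 obtains G where "\<And>n. G n \<in> V0" "\<And>n x. x \<in> space M \<Longrightarrow> norm (G n x) \<le> 2 * norm (f x)"
  "AE s in M. (\<lambda>n. T (G n) s) \<longlonglongrightarrow> T_ext f s"
proof -
 have "\<forall>n. \<exists>g. g \<in> V0 \<and> (\<forall>x\<in>space M. norm (g x) \<le> 2 * norm (f x)) \<and> (L1_dist M f g) \<le> ennreal ((1/4)^n)"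
 proof
  fix n
  show "\<exists>g. g \<in> V0 \<and> (\<forall>x\<in>space M. norm (g x) \<le> 2 * norm (f x)) \<and> (L1_dist M f g) \<le> ennreal ((1/4)^n)"
   by (rule V0_dense_L1[OF ne f, of "(1/4)^n"]) (auto intro: less_imp_le)
 qed
 then obtain G where G: "\<And>n. G n \<in> V0" "\<And>n x. x \<in> space M \<Longrightarrow> norm (G n x) \<le> 2 * norm (f x)"
  "\<And>n. (L1_dist M f (G n)) \<le> ennreal ((1/4)^n)"
  by metis
 have "AE s in M. (\<lambda>n. T (G n) s) \<longlonglongrightarrow> T_ext f s"
 proof (rule borel_cantelli_tendsto[where C="2 * W"])
  fix n
  have "emeasure M {s\<in>space M. norm (T_ext f s - T (G n) s) > (1/2)^n} \<le> ennreal (2 * W / (1/2)^n) * ennreal ((1/4)^n)"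
   using G(3) by (intro order_trans[OF T_ext(2)[OF f G(1)]] mult_left_mono) auto
  also have "... = ennreal (2 * W / (1/2)^n * (1/4)^n)" using W by (simp flip: ennreal_mult)
  also have "2 * W / (1/2)^n * (1/4)^n = 2 * W * (1/2)^n"
   by (simp add: power_mult_distrib[symmetric] power_divide field_simps)
  finally show "emeasure M {s\<in>space M. norm (T_ext f s - T (G n) s) > (1/2)^n} \<le> ennreal (2 * W * (1/2)^n)" .
 qed (intro T_meas G T_ext f)+
 then show ?thesis using that G(1,2) by blast
qed

end

end

section \<open>Covering balls by laminar families\<close>

text \<open>The nesting property of dyadic cubes. It is stated for an indexed family since several
  balls may receive the same set.\<close>

definition laminar :: "'i set \<Rightarrow> ('i \<Rightarrow> 'a set) \<Rightarrow> bool" where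
 "laminar I Q \<longleftrightarrow> (\<forall>i\<in>I. \<forall>j\<in>I. Q i \<inter> Q j = {} \<or> Q i \<subseteq> Q j \<or> Q j \<subseteq> Q i)"

text \<open>Elements are coloured one at a time; each has to avoid at most \<open>N\<close> of the
  \<open>N + 1\<close> colours.\<close>

lemma greedy_colouring:
 assumes "finite Z" "\<And>x y. rel x y \<Longrightarrow> rel y x" "\<And>z. z \<in> Z \<Longrightarrow> card {y\<in>Z. rel z y} \<le> N"
 shows "\<exists>col::'a \<Rightarrow> nat. (\<forall>z. col z \<le> N) \<and> (\<forall>x\<in>Z. \<forall>y\<in>Z. x \<noteq> y \<longrightarrow> rel x y \<longrightarrow> col x \<noteq> col y)"
 using assms(1,3)
proof (induction Z)
 case empty
 then show ?case by (intro exI[of _ "\<lambda>_. 0"]) auto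
next
 case (insert z Z)
 have "card {y\<in>Z. rel x y} \<le> N" if "x \<in> Z" for x
  using insert.prems[of x] that insert.hyps(1) card_mono[of "{y\<in>insert z Z. rel x y}" "{y\<in>Z. rel x y}"] by fastforce
 then obtain col :: "'a \<Rightarrow> nat" where col: "\<forall>z. col z \<le> N" "\<forall>x\<in>Z. \<forall>y\<in>Z. x \<noteq> y \<longrightarrow> rel x y \<longrightarrow> col x \<noteq> col y"
  using insert.IH by blast
 define A where "A = col ` {y\<in>Z. rel z y}"
 have "card A \<le> card {y\<in>Z. rel z y}" unfolding A_def using insert.hyps(1) by (intro card_image_le) auto
 also have "... \<le> card {y\<in>insert z Z. rel z y}" using insert.hyps(1) by (intro card_mono) auto
 also have "... \<le> N" using insert.prems by simp
 finally have "card A < card {..N}" by simp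
 then have "\<not> {..N} \<subseteq> A" using card_mono[of A "{..N}"] insert.hyps(1) by (auto simp: A_def)
 then obtain c where c: "c \<le> N" "c \<notin> A" by auto
 show ?case
 proof (intro exI[of _ "col(z := c)"] conjI ballI impI allI)
  show "(col(z := c)) x \<le> N" for x using col c by simp
  fix x y assume "x \<in> insert z Z" "y \<in> insert z Z" "x \<noteq> y" "rel x y"
  then show "(col(z := c)) x \<noteq> (col(z := c)) y"
   using col(2) c insert.hyps(2) assms(2)[of x y] by (auto simp: A_def)
 qed
qed

section \<open>Nets and absorption of smaller scales\<close>

context homogeneous_type
begin

text \<open>The ratio \<open>4 * c_d\<^sup>2\<close> of consecutive scales is large enough for a
  ball to absorb all smaller sets it meets while its radius grows by a factor of at most
  \<open>2 * c_d\<^sup>2\<close>.\<close>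

definition scale :: "int \<Rightarrow> real" where
 "scale k = (4 * c_d\<^sup>2) powr real_of_int k"

lemma scale_pos: "scale k > 0"
 using c_d by (simp add: scale_def)

lemma scale_less:
 assumes "k < l" shows "4 * c_d\<^sup>2 * scale k \<le> scale l"
proof -
 have "4 * c_d\<^sup>2 * scale k = (4 * c_d\<^sup>2) powr (real_of_int k + 1)"
  using c_d by (simp add: scale_def powr_add)
 also have "... \<le> scale l"
  unfolding scale_def using assms cd2 by (intro powr_mono) auto
 finally show ?thesis .
qed

lemma scale_exists:
 assumes "r > 0" obtains k where "r \<le> scale k" "scale k \<le> 4 * c_d\<^sup>2 * r"
proof -
 define b where "b = 4 * c_d\<^sup>2"
 have b: "b > 1" using cd2 by (simp add: b_def)
 define k where "k = \<lceil>log b r\<rceil>"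
 have "r = b powr (log b r)" using b assms by simp
 also have "... \<le> b powr real_of_int k" using b by (intro powr_mono) (auto simp: k_def)
 finally have 1: "r \<le> scale k" by (simp add: scale_def b_def)
 have "b powr real_of_int k \<le> b powr (log b r + 1)"
 proof (intro powr_mono)
  show "real_of_int k \<le> log b r + 1" unfolding k_def by linarith
 qed (use b in simp)
 also have "... = b * r" using b assms by (simp add: powr_add)
 finally have "scale k \<le> 4 * c_d\<^sup>2 * r" by (simp add: scale_def b_def)
 with 1 show ?thesis by (rule that)
qed

text \<open>Induction by increasing scale: the new ball absorbs every set of strictly smaller scale
  that it meets, and the older sets never change. Sets of equal scale stay disjoint by the
  separation of their centres.\<close>

lemma laminar_absorb:
 assumes "finite S" and "\<And>e. e \<in> S \<Longrightarrow> fst e \<in> space M"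
  and "\<And>e e'. e \<in> S \<Longrightarrow> e' \<in> S \<Longrightarrow> e \<noteq> e' \<Longrightarrow> snd e = snd e' \<Longrightarrow> 12 * (c_d\<^sup>2)^3 * scale (snd e) \<le> d (fst e) (fst e')"
 shows "\<exists>Q. (\<forall>e\<in>S. Q e \<in> sets M \<and> B (fst e) (3 * c_d\<^sup>2 * scale (snd e)) \<subseteq> Q e \<and> Q e \<subseteq> B (fst e) (6 * (c_d\<^sup>2)^2 * scale (snd e))) \<and> laminar S Q"
 using assms
proof (induction S rule: finite_ranking_induct[where f="snd :: 'a \<times> int \<Rightarrow> int"])
 case empty
 then show ?case by (simp add: laminar_def)
next
 case (insert x S)
 define q where "q = c_d\<^sup>2"
 have q1: "q \<ge> 1" and cq: "c_d \<le> q" using cd2 by (auto simp: q_def)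
 obtain Q where Q: "\<And>e. e \<in> S \<Longrightarrow> Q e \<in> sets M" "\<And>e. e \<in> S \<Longrightarrow> B (fst e) (3 * q * scale (snd e)) \<subseteq> Q e"
  "\<And>e. e \<in> S \<Longrightarrow> Q e \<subseteq> B (fst e) (6 * q^2 * scale (snd e))" "laminar S Q"
  using insert.IH insert.prems unfolding q_def by (metis insertI2)
 show ?case
 proof (cases "x \<in> S")
  case True
  then show ?thesis using Q unfolding q_def by (metis insert_absorb)
 next
  case False
  define R where "R = scale (snd x)"
  have R: "R > 0" by (simp add: R_def scale_pos)
  define A where "A = {e\<in>S. snd e < snd x \<and> Q e \<inter> B (fst x) (3 * q * R) \<noteq> {}}"
  define X where "X = B (fst x) (3 * q * R) \<union> (\<Union>e\<in>A. Q e)"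
  have xM: "fst x \<in> space M" using insert.prems by simp
  have Xs: "X \<in> sets M" unfolding X_def A_def using Q(1) xM insert.hyps(1) by (intro sets.Un sets.finite_UN) auto
  have X_sub: "X \<subseteq> B (fst x) (6 * q^2 * R)"
  proof
   fix y assume "y \<in> X"
   then consider "y \<in> B (fst x) (3 * q * R)" | e where "e \<in> A" "y \<in> Q e" by (auto simp: X_def)
   then show "y \<in> B (fst x) (6 * q^2 * R)"
   proof cases
    case 1
    have "3 * q * R \<le> 6 * q^2 * R" using q1 R self_le_power[of q 2] by (intro mult_right_mono mult_mono) auto
    then show ?thesis using 1 B_mono by blast
   next
    case (2 e)
    then have e: "e \<in> S" "snd e < snd x" by (auto simp: A_def)
    obtain p where p: "p \<in> Q e" "p \<in> B (fst x) (3 * q * R)" using 2 by (auto simp: A_def)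
    have eM: "fst e \<in> space M" using insert.prems e by simp
    have pe: "p \<in> space M" "d (fst e) p < 6 * q^2 * scale (snd e)" "d (fst x) p < 3 * q * R"
     using Q(3)[OF e(1)] p by (auto simp: mem_B)
    have ye: "y \<in> space M" "d (fst e) y < 6 * q^2 * scale (snd e)"
     using Q(3)[OF e(1)] 2 by (auto simp: mem_B)
    \<comment> \<open>The absorbed set lies in a ball of radius \<open>t\<close>. The ratio of the
      scales gives \<open>4 * q * t \<le> 6 * q^2 * R\<close>, so crossing this set adds at most
      \<open>3 * q^2 * R\<close>.\<close>
    define t where "t = 6 * q^2 * scale (snd e)"
    have t: "t > 0" "4 * q * t \<le> 6 * q^2 * R"
    proof -
     show "t > 0" using q1 scale_pos by (simp add: t_def)
     have "6 * q^2 * (4 * q * scale (snd e)) \<le> 6 * q^2 * R"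
      using scale_less[OF e(2)] by (intro mult_left_mono) (auto simp: q_def R_def)
     then show "4 * q * t \<le> 6 * q^2 * R" by (simp add: t_def mult_ac)
    qed
    have "d p y < c_d * (t + t)"
     using pe ye eM sym[of p "fst e"] by (intro d_lt_triangle[of p "fst e" y]) (auto simp: t_def)
    then have "d (fst x) y < c_d * (3 * q * R + c_d * (t + t))"
     using pe ye xM by (intro d_lt_triangle[of "fst x" p y]) auto
    also have "... \<le> q * (3 * q * R) + 2 * q * t"
    proof -
     have "c_d * (3 * q * R) \<le> q * (3 * q * R)" using cq q1 R by (intro mult_right_mono) auto
     moreover have "c_d * (c_d * (t + t)) = 2 * q * t" by (simp add: q_def power2_eq_square)
     moreover have "c_d * (3 * q * R + c_d * (t + t)) = c_d * (3 * q * R) + c_d * (c_d * (t + t))"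
      by (rule distrib_left)
     ultimately show ?thesis by linarith
    qed
    also have "... \<le> 6 * q^2 * R" using t(2) by (simp add: power2_eq_square)
    finally show ?thesis using ye by (simp add: mem_B)
   qed
  qed
  have lam: "Q e \<inter> X = {} \<or> Q e \<subseteq> X" if e: "e \<in> S" for e
  proof (cases "snd e < snd x")
   case True
   show ?thesis
   proof (cases "Q e \<inter> B (fst x) (3 * q * R) = {}")
    case False
    then show ?thesis using e True by (auto simp: X_def A_def)
   next
    case dis: True
    show ?thesis
    proof (cases "\<exists>e'\<in>A. Q e \<inter> Q e' \<noteq> {}")
     case True
     then obtain e' where e': "e' \<in> A" "Q e \<inter> Q e' \<noteq> {}" by blast
     \<comment> \<open>Older sets that meet are nested. The absorbed \<open>Q e'\<close> reaches the
       core ball of \<open>x\<close> while \<open>Q e\<close> avoids it, so \<open>Q e\<close> is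
       the smaller one.\<close>
     then have "Q e \<subseteq> Q e' \<or> Q e' \<subseteq> Q e" using Q(4) e by (auto simp: laminar_def A_def)
     moreover have "\<not> Q e' \<subseteq> Q e" using dis e'(1) by (auto simp: A_def)
     ultimately show ?thesis using e'(1) by (auto simp: X_def)
    next
     case False
     then show ?thesis using dis by (auto simp: X_def)
    qed
   qed
  next
   case False
   then have eq: "snd e = snd x" using insert.hyps(2)[OF e] by simp
   have "Q e \<inter> X = {}"
   proof (rule ccontr)
    assume "\<not> ?thesis"
    then obtain y where "y \<in> Q e" "y \<in> X" by blast
    then have y: "y \<in> space M" "d (fst e) y < 6 * q^2 * R" "d (fst x) y < 6 * q^2 * R"
     using Q(3)[OF e] X_sub eq by (auto simp: mem_B R_def)
    have eM: "fst e \<in> space M" using insert.prems e by simp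
    have "d (fst e) (fst x) < c_d * (6 * q^2 * R + 6 * q^2 * R)"
     using y eM xM sym[of y "fst x"] by (intro d_lt_triangle[of "fst e" y "fst x"]) auto
    also have "... \<le> q * (12 * q^2 * R)" using cq q1 R by (intro mult_mono) auto
    also have "... = 12 * q^3 * R" by (simp add: power3_eq_cube power2_eq_square)
    finally show False
     using insert.prems(2)[of e x] e eq \<open>x \<notin> S\<close> by (auto simp: q_def R_def)
   qed
   then show ?thesis ..
  qed
  have Q': "(Q(x := X)) e = Q e" if "e \<in> S" for e using that \<open>x \<notin> S\<close> by auto
  show ?thesis
  proof (intro exI[of _ "Q(x := X)"] conjI ballI)
   fix e assume e: "e \<in> insert x S"
   show "(Q(x := X)) e \<in> sets M" using e Q(1) Q' Xs by (cases "e = x") auto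
   show "B (fst e) (3 * c_d\<^sup>2 * scale (snd e)) \<subseteq> (Q(x := X)) e"
   proof (cases "e = x")
    case False
    then show ?thesis using e Q(2)[of e] by (simp add: q_def)
   qed (auto simp: X_def R_def q_def)
   show "(Q(x := X)) e \<subseteq> B (fst e) (6 * (c_d\<^sup>2)^2 * scale (snd e))"
   proof (cases "e = x")
    case False
    then show ?thesis using e Q(3)[of e] unfolding q_def by simp
   next
    case True
    then show ?thesis using X_sub unfolding q_def R_def by simp
   qed
  next
   show "laminar (insert x S) (Q(x := X))"
    unfolding laminar_def
   proof (intro ballI)
    fix i j assume ij: "i \<in> insert x S" "j \<in> insert x S"
    consider "i = x" "j = x" | "i = x" "j \<in> S" | "i \<in> S" "j = x" | "i \<in> S" "j \<in> S" using ij by blast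
    then show "(Q(x := X)) i \<inter> (Q(x := X)) j = {} \<or> (Q(x := X)) i \<subseteq> (Q(x := X)) j \<or> (Q(x := X)) j \<subseteq> (Q(x := X)) i"
    proof cases
     case 2
     then show ?thesis using lam[of j] Q'[of j] by (auto simp del: fun_upd_apply simp: fun_upd_same)
    next
     case 3
     then show ?thesis using lam[of i] Q'[of i] by (auto simp del: fun_upd_apply simp: fun_upd_same)
    next
     case 4
     then show ?thesis using Q(4) Q'[of i] Q'[of j] unfolding laminar_def by (auto simp del: fun_upd_apply)
    qed auto
   qed
  qed
 qed
qed

text \<open>One more than the packing bound for net points of one scale within the separation
  distance, as greedy colouring requires.\<close>

definition colours :: nat where
 "colours = Suc (nat \<lfloor>dbl c_mu (25 * (c_d\<^sup>2)^5)\<rfloor>)"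

text \<open>Each ball is moved to a point of a maximal net of comparable scale. By packing,
  boundedly many net points of that scale are too close to each other, so a bounded number of
  colours achieves the separation that \<open>laminar_absorb\<close> asks for.\<close>

lemma laminar_cover:
 assumes J: "finite J" and x: "\<And>j. j \<in> J \<Longrightarrow> x j \<in> space M" "\<And>j. j \<in> J \<Longrightarrow> r j > 0"
 obtains Q and col :: "'j \<Rightarrow> nat" where "\<And>j. j \<in> J \<Longrightarrow> Q j \<in> sets M" "\<And>j. j \<in> J \<Longrightarrow> B (x j) (r j) \<subseteq> Q j"
  "\<And>j. j \<in> J \<Longrightarrow> Q j \<subseteq> B (x j) (32 * (c_d\<^sup>2)^4 * r j)" "\<And>j. j \<in> J \<Longrightarrow> col j < colours"
  "\<And>c. laminar {j\<in>J. col j = c} Q"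
proof -
 define q where "q = c_d\<^sup>2"
 have q1: "q \<ge> 1" and cq: "c_d \<le> q" and cdp: "c_d > 0" using cd2 c_d by (auto simp: q_def)
 define net where "net k Z \<longleftrightarrow> Z \<subseteq> space M \<and> disjoint_family_on (\<lambda>z. B z (scale k)) Z \<and>
   (\<forall>y\<in>space M. \<exists>z\<in>Z. B y (scale k) \<inter> B z (scale k) \<noteq> {})" for k Z
 have "\<exists>Z. net k Z" for k
 proof (rule maximal_disjoint[of "space M" "\<lambda>z. B z (scale k)"])
  fix Z assume Z: "Z \<subseteq> space M" "disjoint_family_on (\<lambda>z. B z (scale k)) Z"
   "\<And>y. y \<in> space M \<Longrightarrow> B y (scale k) \<noteq> {} \<Longrightarrow> \<exists>z\<in>Z. B y (scale k) \<inter> B z (scale k) \<noteq> {}"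
  have "\<exists>z\<in>Z. B y (scale k) \<inter> B z (scale k) \<noteq> {}" if "y \<in> space M" for y
   using Z(3)[OF that] B_center[OF that scale_pos[of k]] by blast
  then have "net k Z" using Z(1,2) by (simp add: net_def)
  then show ?thesis ..
 qed
 then obtain Z where "\<And>k. net k (Z k)" by metis
 then have Z: "\<And>k. Z k \<subseteq> space M" "\<And>k. disjoint_family_on (\<lambda>z. B z (scale k)) (Z k)"
  "\<And>k y. y \<in> space M \<Longrightarrow> \<exists>z\<in>Z k. B y (scale k) \<inter> B z (scale k) \<noteq> {}"
  by (simp_all add: net_def)
 have "\<forall>j\<in>J. \<exists>k. r j \<le> scale k \<and> scale k \<le> 4 * q * r j"
  using scale_exists[OF x(2)] unfolding q_def by metis
 then obtain k where k: "\<And>j. j \<in> J \<Longrightarrow> r j \<le> scale (k j)" "\<And>j. j \<in> J \<Longrightarrow> scale (k j) \<le> 4 * q * r j"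
  by metis
 have "\<forall>j\<in>J. \<exists>z. z \<in> Z (k j) \<and> B (x j) (scale (k j)) \<inter> B z (scale (k j)) \<noteq> {}"
  using Z(3)[OF x(1)] by blast
 then obtain z where z: "\<And>j. j \<in> J \<Longrightarrow> z j \<in> Z (k j)" "\<And>j. j \<in> J \<Longrightarrow> B (x j) (scale (k j)) \<inter> B (z j) (scale (k j)) \<noteq> {}"
  by metis
 have zM: "z j \<in> space M" if "j \<in> J" for j using z(1)[OF that] Z(1) by blast
 have dzx: "d (z j) (x j) < c_d * (scale (k j) + scale (k j))" if j: "j \<in> J" for j
 proof -
  obtain y where "y \<in> B (x j) (scale (k j))" "y \<in> B (z j) (scale (k j))" using z(2)[OF j] by blast
  then show ?thesis
   using x(1)[OF j] zM[OF j] sym[of y "x j"] by (intro d_lt_triangle[of "z j" y "x j"]) (auto simp: mem_B)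
 qed
 \<comment> \<open>Balls attached to the same net point at the same scale share one set.\<close>
 define S where "S = (\<lambda>j. (z j, k j)) ` J"
 have S: "finite S" "\<And>e. e \<in> S \<Longrightarrow> fst e \<in> Z (snd e)" "\<And>e. e \<in> S \<Longrightarrow> fst e \<in> space M"
  using J z(1) zM by (auto simp: S_def)
 define rel where "rel e e' \<longleftrightarrow> snd e = snd e' \<and> fst e \<in> space M \<and> fst e' \<in> space M \<and> d (fst e) (fst e') < 12 * q^3 * scale (snd e)" for e e' :: "'a \<times> int"
 have relsym: "rel e' e" if "rel e e'" for e e' using that sym[of "fst e" "fst e'"] by (auto simp: rel_def)
 define N where "N = nat \<lfloor>dbl c_mu (25 * (c_d\<^sup>2)^5)\<rfloor>"
 \<comment> \<open>Packing: the disjoint balls at nearby net points lie in one ball, and each has a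
   fixed share of its volume.\<close>
 have cardN: "card {e'\<in>S. rel e e'} \<le> N" if e: "e \<in> S" for e
 proof -
  define A where "A = fst ` {e'\<in>S. rel e e'}"
  define R where "R = scale (snd e)"
  have R: "R > 0" by (simp add: R_def scale_pos)
  have eM: "fst e \<in> space M" using S(3)[OF e] .
  have "inj_on fst {e'\<in>S. rel e e'}" by (auto simp: inj_on_def rel_def prod_eq_iff)
  then have cA: "card {e'\<in>S. rel e e'} = card A" by (simp add: A_def card_image)
  have finA: "finite A" using S(1) by (simp add: A_def)
  have AZ: "A \<subseteq> Z (snd e)" using S(2) by (auto simp: A_def rel_def)
  have Ad: "d (fst e) a < 12 * q^3 * R" "a \<in> space M" if "a \<in> A" for a using that by (auto simp: A_def rel_def R_def)
  have Vc: "V (fst e) (13 * q^4 * R) \<le> dbl c_mu (25 * q^5) * V a R" if a: "a \<in> A" for a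
  proof (rule V_compare[where s="12 * q^3 * R"])
   have "q^3 \<le> q^4" using q1 by (intro power_increasing) auto
   then have "12 * q^3 * R + 13 * q^4 * R \<le> 25 * q^4 * R"
    using R mult_right_mono[of "q^3" "q^4" R] by simp
   then have "c_d * (12 * q^3 * R + 13 * q^4 * R) \<le> q * (25 * q^4 * R)"
    using cq q1 R by (intro mult_mono) auto
   then show "c_d * (12 * q^3 * R + 13 * q^4 * R) \<le> 25 * q^5 * R" by (simp add: power_numeral_reduce mult_ac)
   show "d a (fst e) \<le> 12 * q^3 * R" using Ad[OF a] eM sym[of a "fst e"] by simp
  qed (use Ad[OF a] eM R q1 in auto)
  have sub: "B a R \<subseteq> B (fst e) (13 * q^4 * R)" if a: "a \<in> A" for a
  proof (rule B_subset[where s="12 * q^3 * R"])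
   have "1 \<le> q^3" using q1 by simp
   then have "12 * q^3 * R + R \<le> 13 * q^3 * R" using R mult_right_mono[of 1 "q^3" R] by simp
   then have "c_d * (12 * q^3 * R + R) \<le> q * (13 * q^3 * R)" using cq q1 R by (intro mult_mono) auto
   then show "c_d * (12 * q^3 * R + R) \<le> 13 * q^4 * R" by (simp add: power_numeral_reduce mult_ac)
  qed (use Ad[OF a] eM in auto)
  have "real (card A) * V (fst e) (13 * q^4 * R) = (\<Sum>a\<in>A. V (fst e) (13 * q^4 * R))" by simp
  also have "... \<le> (\<Sum>a\<in>A. dbl c_mu (25 * q^5) * V a R)" by (intro sum_mono Vc)
  also have "... = dbl c_mu (25 * q^5) * (\<Sum>a\<in>A. measure M (B a R))" by (simp add: V_def sum_distrib_left)
  also have "(\<Sum>a\<in>A. measure M (B a R)) = measure M (\<Union>a\<in>A. B a R)"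
  proof (rule measure_finite_Union[symmetric])
   show "disjoint_family_on (\<lambda>a. B a R) A"
    unfolding R_def by (rule disjoint_family_on_mono[OF AZ Z(2)])
   show "\<And>a. a \<in> A \<Longrightarrow> emeasure M (B a R) \<noteq> \<infinity>" using Ad emeasure_B_finite by (metis less_irrefl)
  qed (use finA Ad in auto)
  also have "dbl c_mu (25 * q^5) * ... \<le> dbl c_mu (25 * q^5) * V (fst e) (13 * q^4 * R)"
   using sub Ad finA eM dbl_pos[of "25 * q^5"]
   by (intro mult_left_mono) (auto simp: V_def intro!: measure_mono_B[of "fst e" _ _ "13 * q^4 * R"])
  finally have "real (card A) \<le> dbl c_mu (25 * q^5)"
   using V_pos[OF eM, of "13 * q^4 * R"] R q1 by (simp add: mult_le_cancel_right)
  then have "card A \<le> N" by (simp add: N_def q_def le_nat_floor)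
  then show ?thesis using cA by simp
 qed
 obtain col :: "'a \<times> int \<Rightarrow> nat" where col: "\<forall>e. col e \<le> N" "\<forall>e\<in>S. \<forall>e'\<in>S. e \<noteq> e' \<longrightarrow> rel e e' \<longrightarrow> col e \<noteq> col e'"
  using greedy_colouring[of S rel N] S(1) relsym cardN by blast
 define good where "good c Q \<longleftrightarrow> (\<forall>e\<in>{e\<in>S. col e = c}. Q e \<in> sets M \<and> B (fst e) (3 * c_d\<^sup>2 * scale (snd e)) \<subseteq> Q e \<and>
   Q e \<subseteq> B (fst e) (6 * (c_d\<^sup>2)^2 * scale (snd e))) \<and> laminar {e\<in>S. col e = c} Q" for c Q
 have "\<exists>Q. good c Q" for c
  unfolding good_def
 proof (rule laminar_absorb)
  fix e e' assume e: "e \<in> {e\<in>S. col e = c}" "e' \<in> {e\<in>S. col e = c}" "e \<noteq> e'" "snd e = snd e'"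
  then have "e \<in> S" "e' \<in> S" "col e = col e'" by auto
  then have "\<not> rel e e'" using col(2) e(3) by blast
  then show "12 * (c_d\<^sup>2)^3 * scale (snd e) \<le> d (fst e) (fst e')"
   using e S(3) by (auto simp: rel_def q_def)
 qed (use S in auto)
 then obtain Q where "\<And>c. good c (Q c)" by metis
 then have Q: "\<And>c e. e \<in> S \<Longrightarrow> col e = c \<Longrightarrow> Q c e \<in> sets M \<and> B (fst e) (3 * q * scale (snd e)) \<subseteq> Q c e \<and>
   Q c e \<subseteq> B (fst e) (6 * q^2 * scale (snd e))" "\<And>c. laminar {e\<in>S. col e = c} (Q c)"
  unfolding q_def good_def by blast+
 define ej where "ej j = (z j, k j)" for j
 have ej: "ej j \<in> S" if "j \<in> J" for j using that by (auto simp: ej_def S_def)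
 show ?thesis
 proof (rule that[of "\<lambda>j. Q (col (ej j)) (ej j)" "\<lambda>j. col (ej j)"])
  fix j assume j: "j \<in> J"
  define R where "R = scale (k j)"
  have R: "R > 0" "r j \<le> R" "R \<le> 4 * q * r j" using k[OF j] by (auto simp: R_def scale_pos)
  note Qj = Q(1)[OF ej[OF j] refl]
  show "Q (col (ej j)) (ej j) \<in> sets M" using Qj by blast
  have "col (ej j) \<le> N" using col(1) by blast
  then show "col (ej j) < colours" by (simp add: colours_def N_def)
  have "B (x j) (r j) \<subseteq> B (z j) (3 * q * R)"
  proof (rule B_subset[where s="c_d * (R + R)"])
   have "1 * R \<le> c_d * R" using c_d R by (intro mult_right_mono) auto
   then have "r j \<le> c_d * R" using R by linarith
   then have "c_d * (c_d * (R + R) + r j) \<le> c_d * (c_d * (R + R) + c_d * R)"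
    using c_d by (intro mult_left_mono add_left_mono) auto
   also have "... = 3 * q * R" by (simp add: q_def power2_eq_square)
   finally show "c_d * (c_d * (R + R) + r j) \<le> 3 * q * R" .
  qed (use zM[OF j] x(1)[OF j] dzx[OF j] in \<open>auto simp: R_def\<close>)
  then show "B (x j) (r j) \<subseteq> Q (col (ej j)) (ej j)" using Qj by (auto simp: ej_def R_def)
  have "B (z j) (6 * q^2 * R) \<subseteq> B (x j) (32 * q^4 * r j)"
  proof (rule B_subset[where s="c_d * (R + R)"])
   show "d (x j) (z j) \<le> c_d * (R + R)"
    using dzx[OF j] sym[of "x j" "z j"] zM[OF j] x(1)[OF j] by (simp add: R_def)
   have "c_d * (R + R) \<le> q^2 * (R + R)" using cq q1 R self_le_power[of q 2] by (intro mult_right_mono) auto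
   then have "c_d * (c_d * (R + R) + 6 * q^2 * R) \<le> q * (q^2 * (R + R) + 6 * q^2 * R)"
    using cq q1 R cdp by (intro mult_mono add_right_mono) auto
   also have "... = 8 * q^3 * R" by (simp add: power3_eq_cube power2_eq_square)
   also have "... \<le> 8 * q^3 * (4 * q * r j)" using R q1 by (intro mult_left_mono) auto
   also have "... = 32 * q^4 * r j" by (simp add: power_numeral_reduce)
   finally show "c_d * (c_d * (R + R) + 6 * q^2 * R) \<le> 32 * q^4 * r j" .
  qed (use zM[OF j] x(1)[OF j] in auto)
  then show "Q (col (ej j)) (ej j) \<subseteq> B (x j) (32 * (c_d\<^sup>2)^4 * r j)"
   using Qj by (auto simp: ej_def R_def q_def)
 next
  fix c
  show "laminar {j\<in>J. col (ej j) = c} (\<lambda>j. Q (col (ej j)) (ej j))"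
   unfolding laminar_def
  proof (intro ballI)
   fix i j assume ij: "i \<in> {j\<in>J. col (ej j) = c}" "j \<in> {j\<in>J. col (ej j) = c}"
   have h: "ej i \<in> {e\<in>S. col e = c}" "ej j \<in> {e\<in>S. col e = c}" and c: "col (ej i) = c" "col (ej j) = c"
    using ij ej by auto
   show "Q (col (ej i)) (ej i) \<inter> Q (col (ej j)) (ej j) = {} \<or>
     Q (col (ej i)) (ej i) \<subseteq> Q (col (ej j)) (ej j) \<or> Q (col (ej j)) (ej j) \<subseteq> Q (col (ej i)) (ej i)"
    unfolding c by (rule bspec[OF bspec[OF Q(2)[of c, unfolded laminar_def] h(1)] h(2)])
  qed
 qed
qed

end

section \<open>Maximal functions of laminar families\<close>

text \<open>The maximal sets of a finite laminar family are disjoint and have the same union, so no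
  doubling constant of the measure \<open>N\<close> enters. Values of \<open>u\<close> up to
  \<open>l / 2\<close> account for at most half of each integral, which leaves the part where
  \<open>u\<close> is larger.\<close>

lemma laminar_weak_type:
 assumes F: "finite F" "laminar F Q" and Q: "\<And>j. j \<in> F \<Longrightarrow> Q j \<in> sets N" "\<And>j. j \<in> F \<Longrightarrow> emeasure N (Q j) < \<infinity>"
  and u[measurable]: "u \<in> borel_measurable N" and l: "l > (0::real)"
  and le: "\<And>j. j \<in> F \<Longrightarrow> ennreal l * emeasure N (Q j) \<le> (\<integral>\<^sup>+x\<in>Q j. ennreal (u x) \<partial>N)"
 shows "emeasure N (\<Union>j\<in>F. Q j) \<le> ennreal (2 / l) * (\<integral>\<^sup>+x. ennreal (u x) * indicator {x. u x > l / 2} x \<partial>N)"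
proof -
 define \<Q> where "\<Q> = Q ` F"
 define \<M> where "\<M> = {A\<in>\<Q>. \<forall>B\<in>\<Q>. A \<subseteq> B \<longrightarrow> A = B}"
 have fin: "finite \<Q>" "finite \<M>" using F by (auto simp: \<Q>_def \<M>_def)
 have "\<exists>B\<in>\<M>. A \<subseteq> B" if AQ: "A \<in> \<Q>" for A
 proof -
  obtain B where "B \<in> \<Q>" "A \<subseteq> B" "\<forall>C\<in>\<Q>. B \<subseteq> C \<longrightarrow> B = C"
   using finite_has_maximal2[OF fin(1) AQ] by metis
  then show ?thesis by (auto simp: \<M>_def)
 qed
 then have "\<Union>\<Q> \<subseteq> \<Union>\<M>" by (meson Union_iff subsetD subsetI)
 moreover have "\<M> \<subseteq> \<Q>" by (auto simp: \<M>_def)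
 ultimately have U: "(\<Union>j\<in>F. Q j) = \<Union>\<M>" unfolding \<Q>_def by blast
 have dis: "disjoint_family_on (\<lambda>A. A) \<M>"
  unfolding disjoint_family_on_def
 proof (intro ballI impI)
  fix A B assume AB: "A \<in> \<M>" "B \<in> \<M>" "A \<noteq> B"
  then have "A \<in> \<Q>" "B \<in> \<Q>" by (auto simp: \<M>_def)
  then have "A \<inter> B = {} \<or> A \<subseteq> B \<or> B \<subseteq> A" using F(2) unfolding laminar_def \<Q>_def by blast
  then show "A \<inter> B = {}" using AB by (auto simp: \<M>_def)
 qed
 let ?v = "\<lambda>x. ennreal (u x) * indicator {x. u x > l / 2} x"
 have A: "emeasure N A \<le> ennreal (2 / l) * (\<integral>\<^sup>+x\<in>A. ?v x \<partial>N)" "A \<in> sets N" if AM: "A \<in> \<M>" for A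
 proof -
  obtain j where j: "j \<in> F" "A = Q j" using AM unfolding \<M>_def \<Q>_def by blast
  show As[measurable]: "A \<in> sets N" using j Q by simp
  obtain m where m: "emeasure N A = ennreal m" "m \<ge> 0"
   using Q(2)[OF j(1)] j(2) by (cases "emeasure N A") auto
  have "ennreal (l / 2 * m) + ennreal (l / 2 * m) = ennreal l * emeasure N A"
   using m l by (simp flip: ennreal_plus ennreal_mult)
  also have "... \<le> (\<integral>\<^sup>+x\<in>A. ennreal (u x) \<partial>N)" using le[OF j(1)] j(2) by simp
  also have "... \<le> (\<integral>\<^sup>+x. ennreal (l / 2) * indicator A x + ?v x * indicator A x \<partial>N)"
   by (intro nn_integral_mono) (auto simp: indicator_def not_less intro: ennreal_leI)
  also have "... = (\<integral>\<^sup>+x. ennreal (l / 2) * indicator A x \<partial>N) + (\<integral>\<^sup>+x\<in>A. ?v x \<partial>N)"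
   by (rule nn_integral_add) measurable
  also have "(\<integral>\<^sup>+x. ennreal (l / 2) * indicator A x \<partial>N) = ennreal (l / 2 * m)"
   using l m by (subst nn_integral_cmult_indicator) (auto simp: m(1) ennreal_mult[symmetric])
  finally have "ennreal (l / 2 * m) \<le> (\<integral>\<^sup>+x\<in>A. ?v x \<partial>N)"
   by (simp add: ennreal_add_left_cancel_le)
  then have "ennreal (2 / l) * ennreal (l / 2 * m) \<le> ennreal (2 / l) * (\<integral>\<^sup>+x\<in>A. ?v x \<partial>N)"
   by (rule mult_left_mono) simp
  then show "emeasure N A \<le> ennreal (2 / l) * (\<integral>\<^sup>+x\<in>A. ?v x \<partial>N)"
   using l m by (simp flip: ennreal_mult)
 qed
 have "emeasure N (\<Union>\<M>) = emeasure N (\<Union>A\<in>\<M>. A)" by simp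
 also have "... = (\<Sum>A\<in>\<M>. emeasure N A)"
  using A(2) dis fin by (intro sum_emeasure[symmetric]) auto
 also have "... \<le> (\<Sum>A\<in>\<M>. ennreal (2 / l) * (\<integral>\<^sup>+x\<in>A. ?v x \<partial>N))" by (intro sum_mono A)
 also have "... = ennreal (2 / l) * (\<integral>\<^sup>+x. (\<Sum>A\<in>\<M>. ?v x * indicator A x) \<partial>N)"
  using A(2) by (subst nn_integral_sum) (auto simp: sum_distrib_left)
 also have "... \<le> ennreal (2 / l) * (\<integral>\<^sup>+x. ?v x \<partial>N)"
 proof (intro mult_left_mono nn_integral_mono)
  fix x
  have "(\<Sum>A\<in>\<M>. indicator A x :: ennreal) \<le> 1"
  proof (cases "\<exists>A\<in>\<M>. x \<in> A")
   case True
   then obtain A where A: "A \<in> \<M>" "x \<in> A" by blast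
   have "x \<notin> B" if "B \<in> \<M> - {A}" for B
    using that A disjoint_family_onD[OF dis, of A B] by auto
   then have "(\<Sum>B\<in>\<M>. indicator B x :: ennreal) = (\<Sum>B\<in>{A}. indicator B x)"
    using fin A by (intro sum.mono_neutral_right) auto
   also have "... = 1" using A(2) by simp
   finally show ?thesis by simp
  next
   case False
   then have "(\<Sum>A\<in>\<M>. indicator A x :: ennreal) = (\<Sum>A\<in>\<M>. 0)" by (intro sum.cong) auto
   then show ?thesis by simp
  qed
  then have "?v x * (\<Sum>A\<in>\<M>. indicator A x) \<le> ?v x * 1" by (intro mult_left_mono) auto
  then show "(\<Sum>A\<in>\<M>. ?v x * indicator A x) \<le> ?v x" by (simp add: sum_distrib_left)
 qed auto
 finally show ?thesis using U by simp
qed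

text \<open>Counted downwards from \<open>m\<close>, the terms belong to a geometric series in
  \<open>1/q\<close>.\<close>

lemma geometric_int_sum:
 fixes q :: real and K :: "int set"
 assumes q: "q > 1" and K: "finite K" "\<And>k. k \<in> K \<Longrightarrow> k \<le> (m :: int)"
 shows "(\<Sum>k\<in>K. q powr k) \<le> q powr m * (q / (q - 1))"
proof -
 define n where "n k = nat (m - k)" for k
 have inj: "inj_on n K" 
 proof (rule inj_onI)
  fix i j assume "i \<in> K" "j \<in> K" "n i = n j"
  then show "i = j" using K(2)[of i] K(2)[of j] by (simp add: n_def eq_nat_nat_iff)
 qed
 have "(\<Sum>k\<in>K. q powr k) = (\<Sum>k\<in>K. q powr m * (1/q) ^ n k)"
 proof (rule sum.cong[OF refl])
  fix k assume "k \<in> K"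
  then have "real_of_int k = real_of_int m - real (n k)" using K(2) by (simp add: n_def)
  then have "q powr k = q powr m / q powr real (n k)" using q by (simp add: powr_diff)
  also have "... = q powr m * (1/q) ^ n k" using q by (simp add: powr_realpow power_divide)
  finally show "q powr k = q powr m * (1/q) ^ n k" .
 qed
 also have "... = q powr m * (\<Sum>i\<in>n ` K. (1/q) ^ i)"
  using inj by (simp add: sum.reindex sum_distrib_left)
 also have "... \<le> q powr m * (\<Sum>i. (1/q) ^ i)"
  using q K by (intro mult_left_mono sum_le_suminf summable_geometric) auto
 also have "(\<Sum>i. (1/q) ^ i) = q / (q - 1)"
  using q by (subst suminf_geometric) (auto simp: field_simps)
 finally show ?thesis .
qed

text \<open>The quotient comes from a geometric series of ratio \<open>2 powr (p - 1)\<close>;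
  \<open>2 powr (p + 1)\<close> collects the constants of one level.\<close>

definition maximal_const :: "real \<Rightarrow> real" where
 "maximal_const p = 2 powr (p + 1) * (2 powr (p - 1))\<^sup>2 / (2 powr (p - 1) - 1)"

lemma maximal_const_pos: "p > 1 \<Longrightarrow> maximal_const p > 0"
 by (simp add: maximal_const_def)

text \<open>The weak type estimate is summed over the dyadic levels of the averages \<open>a j\<close>.\<close>

lemma laminar_maximal:
 assumes p: "p > 1" and F: "finite F" "laminar F Q"
  and Q: "\<And>j. j \<in> F \<Longrightarrow> Q j \<in> sets N" "\<And>j. j \<in> F \<Longrightarrow> emeasure N (Q j) < \<infinity>"
  and E: "\<And>j. j \<in> F \<Longrightarrow> E j \<in> sets N" "\<And>j. j \<in> F \<Longrightarrow> E j \<subseteq> Q j" "disjoint_family_on E F"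
  and u[measurable]: "u \<in> borel_measurable N" "\<And>x. u x \<ge> 0"
  and a: "\<And>j. j \<in> F \<Longrightarrow> a j \<ge> 0" "\<And>j. j \<in> F \<Longrightarrow> ennreal (a j) * emeasure N (Q j) \<le> (\<integral>\<^sup>+x\<in>Q j. ennreal (u x) \<partial>N)"
 shows "(\<Sum>j\<in>F. emeasure N (E j) * ennreal (a j powr p)) \<le> ennreal (maximal_const p) * (\<integral>\<^sup>+x. ennreal (u x powr p) \<partial>N)"
proof -
 define F' where "F' = {j\<in>F. a j > 0}"
 define k where "k j = \<lceil>log 2 (a j)\<rceil> - 1" for j
 have k: "2 powr (k j) \<le> a j" "a j \<le> 2 powr (k j + 1)" if "j \<in> F'" for j
 proof -
  have aj: "a j > 0" using that by (simp add: F'_def)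
  have "2 powr (real_of_int (k j)) \<le> 2 powr (log 2 (a j))"
   unfolding k_def by (intro powr_mono; linarith)
  then show "2 powr (k j) \<le> a j" using aj by simp
  have "2 powr (log 2 (a j)) \<le> 2 powr (k j + 1)"
   unfolding k_def by (intro powr_mono) simp_all
  then show "a j \<le> 2 powr (k j + 1)" using aj by simp
 qed
 define K where "K = k ` F'"
 have fin: "finite F'" "finite K" using F by (auto simp: F'_def K_def)
 \<comment> \<open>On level \<open>i\<close> the averages are at most \<open>2 powr (i + 1)\<close>,
   and \<open>2 / 2 powr i\<close> is the weak type constant.\<close>
 define c where "c i = (2 powr (real_of_int i + 1)) powr p * (2 / 2 powr (real_of_int i))" for i :: int
 have level: "(\<Sum>j\<in>{j\<in>F'. k j = i}. emeasure N (E j) * ennreal (a j powr p))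
   \<le> ennreal (c i) * (\<integral>\<^sup>+x. ennreal (u x) * indicator {x. u x > 2 powr i / 2} x \<partial>N)" for i
 proof -
  define G where "G = {j\<in>F'. k j = i}"
  have G: "finite G" "G \<subseteq> F" using fin F by (auto simp: G_def F'_def)
  have "(\<Sum>j\<in>G. emeasure N (E j) * ennreal (a j powr p)) \<le> (\<Sum>j\<in>G. emeasure N (E j) * ennreal ((2 powr (real_of_int i + 1)) powr p))"
   using k p a by (intro sum_mono mult_left_mono ennreal_leI powr_mono2) (auto simp: G_def F'_def)
  also have "... = ennreal ((2 powr (real_of_int i + 1)) powr p) * (\<Sum>j\<in>G. emeasure N (E j))"
   by (simp add: sum_distrib_right mult.commute)
  also have "(\<Sum>j\<in>G. emeasure N (E j)) = emeasure N (\<Union>j\<in>G. E j)"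
   using G E disjoint_family_on_mono[OF G(2) E(3)] by (intro sum_emeasure) auto
  also have "... \<le> emeasure N (\<Union>j\<in>G. Q j)"
   using G E(2) Q(1) by (intro emeasure_mono sets.finite_UN) blast+
  also have "... \<le> ennreal (2 / 2 powr i) * (\<integral>\<^sup>+x. ennreal (u x) * indicator {x. u x > 2 powr i / 2} x \<partial>N)"
  proof (rule laminar_weak_type)
   show "laminar G Q" using F(2) G(2) unfolding laminar_def by blast
   fix j assume j: "j \<in> G"
   then have jF: "j \<in> F" "j \<in> F'" "k j = i" using G by (auto simp: G_def)
   show "Q j \<in> sets N" "emeasure N (Q j) < \<infinity>" using Q jF by auto
   have "ennreal (2 powr i) * emeasure N (Q j) \<le> ennreal (a j) * emeasure N (Q j)"
    using k(1)[OF jF(2)] jF(3) by (intro mult_right_mono ennreal_leI) auto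
   then show "ennreal (2 powr i) * emeasure N (Q j) \<le> (\<integral>\<^sup>+x\<in>Q j. ennreal (u x) \<partial>N)"
    using a(2)[OF jF(1)] by (rule order_trans)
  qed (use G in auto)
  finally have "(\<Sum>j\<in>G. emeasure N (E j) * ennreal (a j powr p))
    \<le> ennreal ((2 powr (real_of_int i + 1)) powr p) * (ennreal (2 / 2 powr i) * (\<integral>\<^sup>+x. ennreal (u x) * indicator {x. u x > 2 powr i / 2} x \<partial>N))"
   by (simp add: mult_left_mono)
  also have "... = ennreal (c i) * (\<integral>\<^sup>+x. ennreal (u x) * indicator {x. u x > 2 powr i / 2} x \<partial>N)"
   unfolding c_def mult.assoc[symmetric] by (subst ennreal_mult) auto
  finally show ?thesis by (simp add: G_def)
 qed
 have pointwise: "(\<Sum>i\<in>K. ennreal (c i) * (ennreal (u x) * indicator {x. u x > 2 powr i / 2} x)) \<le> ennreal (maximal_const p) * ennreal (u x powr p)" for x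
 proof (cases "u x = 0")
  case False
  define t where "t = u x"
  have t: "t > 0" using False u(2)[of x] by (simp add: t_def)
  define q where "q = 2 powr (p - 1)"
  have q: "q > 1" using p by (simp add: q_def)
  \<comment> \<open>At a given point only levels with \<open>2 powr i < 2 * t\<close> contribute, a
    geometric sum governed by its largest term.\<close>
  define K' where "K' = {i\<in>K. t > 2 powr i / 2}"
  define m where "m = \<lfloor>1 + log 2 t\<rfloor>"
  have ci: "c i = 2 powr (p + 1) * q powr i" for i
  proof -
   have "c i = 2 powr ((real_of_int i + 1) * p) * (2 powr 1 / 2 powr (real_of_int i))" by (simp add: c_def powr_powr)
   also have "... = 2 powr ((real_of_int i + 1) * p + 1 - real_of_int i)" by (simp add: powr_add powr_diff)
   also have "(real_of_int i + 1) * p + 1 - real_of_int i = (p + 1) + (p - 1) * real_of_int i" by (simp add: algebra_simps)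
   also have "2 powr ... = 2 powr (p + 1) * q powr i" by (simp add: q_def powr_powr powr_add)
   finally show ?thesis .
  qed
  have "(\<Sum>i\<in>K'. q powr i) \<le> q powr m * (q / (q - 1))"
  proof (rule geometric_int_sum[OF q])
   show "finite K'" using fin by (simp add: K'_def)
   fix i assume "i \<in> K'"
   then have "2 powr i < 2 * t" by (simp add: K'_def)
   then have "log 2 (2 powr i) < log 2 (2 * t)" using t by (subst log_less_cancel_iff) auto
   then have "real_of_int i < 1 + log 2 t" using t by (simp add: log_mult)
   then show "i \<le> m" unfolding m_def by linarith
  qed
  also have "... \<le> (q * t powr (p - 1)) * (q / (q - 1))"
  proof (rule mult_right_mono)
   have "q powr m \<le> q powr (1 + log 2 t)" using q by (intro powr_mono) (auto simp: m_def)
   also have "... = q * q powr (log 2 t)" using q by (simp add: powr_add)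
   also have "q powr (log 2 t) = (2 powr (log 2 t)) powr (p - 1)" by (simp add: q_def powr_powr mult.commute)
   also have "... = t powr (p - 1)" using t by simp
   finally show "q powr m \<le> q * t powr (p - 1)" .
  qed (use q in auto)
  finally have S: "(\<Sum>i\<in>K'. q powr i) \<le> (q * t powr (p - 1)) * (q / (q - 1))" .
  have "(\<Sum>i\<in>K. ennreal (c i) * (ennreal (u x) * indicator {x. u x > 2 powr i / 2} x)) = (\<Sum>i\<in>K'. ennreal (c i * t))"
  proof -
   have "(\<Sum>i\<in>K. ennreal (c i) * (ennreal (u x) * indicator {x. u x > 2 powr i / 2} x))
     = (\<Sum>i\<in>K'. ennreal (c i) * (ennreal (u x) * indicator {x. u x > 2 powr i / 2} x))"
    using fin by (intro sum.mono_neutral_right) (auto simp: K'_def t_def)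
   also have "... = (\<Sum>i\<in>K'. ennreal (c i * t))"
   proof (rule sum.cong[OF refl])
    fix i assume "i \<in> K'"
    moreover have "c i \<ge> 0" by (simp add: c_def)
    ultimately show "ennreal (c i) * (ennreal (u x) * indicator {x. u x > 2 powr i / 2} x) = ennreal (c i * t)"
     using t by (simp add: K'_def t_def ennreal_mult)
   qed
   finally show ?thesis .
  qed
  also have "... = ennreal (\<Sum>i\<in>K'. c i * t)" using t by (intro sum_ennreal) (auto simp: c_def)
  also have "(\<Sum>i\<in>K'. c i * t) = 2 powr (p + 1) * t * (\<Sum>i\<in>K'. q powr i)"
   unfolding ci by (subst sum_distrib_left) (simp add: mult_ac)
  also have "ennreal ... \<le> ennreal (2 powr (p + 1) * t * ((q * t powr (p - 1)) * (q / (q - 1))))"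
   using S t by (intro ennreal_leI mult_left_mono) auto
  also have "2 powr (p + 1) * t * ((q * t powr (p - 1)) * (q / (q - 1))) = maximal_const p * (t * t powr (p - 1))"
   by (simp add: maximal_const_def q_def power2_eq_square)
  also have "t * t powr (p - 1) = t powr p" using t by (simp add: powr_diff)
  also have "ennreal (maximal_const p * t powr p) = ennreal (maximal_const p) * ennreal (u x powr p)"
   using maximal_const_pos[OF p] by (simp add: t_def ennreal_mult)
  finally show ?thesis .
 qed simp
 have "(\<Sum>j\<in>F. emeasure N (E j) * ennreal (a j powr p)) = (\<Sum>j\<in>F'. emeasure N (E j) * ennreal (a j powr p))"
 proof (rule sum.mono_neutral_right)
  have "a j = 0" if "j \<in> F - F'" for j using that a(1)[of j] by (auto simp: F'_def not_less)
  then show "\<forall>j\<in>F - F'. emeasure N (E j) * ennreal (a j powr p) = 0" by auto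
 qed (use F in \<open>auto simp: F'_def\<close>)
 also have "... = (\<Sum>i\<in>K. \<Sum>j\<in>{j\<in>F'. k j = i}. emeasure N (E j) * ennreal (a j powr p))"
  using fin by (intro sum.group[symmetric]) (auto simp: K_def)
 also have "... \<le> (\<Sum>i\<in>K. ennreal (c i) * (\<integral>\<^sup>+x. ennreal (u x) * indicator {x. u x > 2 powr i / 2} x \<partial>N))"
  by (intro sum_mono level)
 also have "... = (\<integral>\<^sup>+x. (\<Sum>i\<in>K. ennreal (c i) * (ennreal (u x) * indicator {x. u x > 2 powr i / 2} x)) \<partial>N)"
  by (subst nn_integral_sum) (auto simp: nn_integral_cmult)
 also have "... \<le> (\<integral>\<^sup>+x. ennreal (maximal_const p) * ennreal (u x powr p) \<partial>N)"
  by (intro nn_integral_mono pointwise)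
 also have "... = ennreal (maximal_const p) * (\<integral>\<^sup>+x. ennreal (u x powr p) \<partial>N)"
  by (rule nn_integral_cmult) measurable
 finally show ?thesis .
qed

section \<open>Weighted bounds for sparse sums\<close>

lemma Holder_sum:
 fixes \<alpha> \<beta> :: "'i \<Rightarrow> real"
 assumes pq: "p > 1" "q > 1" "1/p + 1/q = 1" and nn: "\<And>j. j \<in> F \<Longrightarrow> \<alpha> j \<ge> 0" "\<And>j. j \<in> F \<Longrightarrow> \<beta> j \<ge> 0"
 shows "(\<Sum>j\<in>F. \<alpha> j * \<beta> j) \<le> (\<Sum>j\<in>F. \<alpha> j powr p) powr (1/p) * (\<Sum>j\<in>F. \<beta> j powr q) powr (1/q)"
proof (cases "finite F")
 case fin: True
 define A where "A = (\<Sum>j\<in>F. \<alpha> j powr p)"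
 define C where "C = (\<Sum>j\<in>F. \<beta> j powr q)"
 have AC: "A \<ge> 0" "C \<ge> 0" by (auto simp: A_def C_def intro: sum_nonneg)
 show ?thesis
 proof (cases "A = 0 \<or> C = 0")
  case True
  then have "(\<forall>j\<in>F. \<alpha> j = 0) \<or> (\<forall>j\<in>F. \<beta> j = 0)"
   using fin unfolding A_def C_def by (auto simp: sum_nonneg_eq_0_iff)
  then have "(\<Sum>j\<in>F. \<alpha> j * \<beta> j) = 0" by (intro sum.neutral) auto
  then show ?thesis by simp
 next
  case False
  then have pos: "A > 0" "C > 0" using AC by auto
  define A' where "A' = A powr (1/p)"
  define C' where "C' = C powr (1/q)"
  have pos': "A' > 0" "C' > 0" using pos by (auto simp: A'_def C'_def)
  have pw: "A' powr p = A" "C' powr q = C" using pos pq by (auto simp: A'_def C'_def powr_powr)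
  have "(\<Sum>j\<in>F. \<alpha> j / A' * (\<beta> j / C')) \<le> (\<Sum>j\<in>F. (\<alpha> j / A') powr p / p + (\<beta> j / C') powr q / q)"
   using pq nn pos' by (intro sum_mono Youngs_inequality) auto
  also have "... = (\<Sum>j\<in>F. \<alpha> j powr p / A / p + \<beta> j powr q / C / q)"
   using nn pos' pw by (intro sum.cong) (auto simp: powr_divide)
  also have "... = A / A / p + C / C / q"
   by (simp only: sum.distrib A_def C_def sum_divide_distrib)
  also have "... = 1" using pos pq by simp
  finally have "(\<Sum>j\<in>F. \<alpha> j * \<beta> j) / (A' * C') \<le> 1" by (simp add: sum_divide_distrib)
  then show ?thesis using pos' by (simp add: A'_def C'_def A_def C_def pos_divide_le_eq)
 qed
qed simp

text \<open>Young's inequality for the two weights divided by their masses on \<open>E\<close>,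
  integrated over \<open>E\<close>: the right-hand side becomes \<open>1/p + 1/q\<close>, and the
  left-hand side is constant because the weights are dual.\<close>

lemma Holder_weights:
 assumes pq: "p > 1" "q > 1" "1/p + 1/q = 1" and [measurable]: "w \<in> borel_measurable M" "s \<in> borel_measurable M" "E \<in> sets M"
  and pos: "\<And>x. x \<in> space M \<Longrightarrow> w x > 0" "\<And>x. x \<in> space M \<Longrightarrow> s x > 0"
  and one: "\<And>x. x \<in> space M \<Longrightarrow> w x powr (1/p) * s x powr (1/q) = 1"
  and W: "(\<integral>\<^sup>+x\<in>E. ennreal (w x) \<partial>M) = ennreal W" "W > 0" and S: "(\<integral>\<^sup>+x\<in>E. ennreal (s x) \<partial>M) = ennreal S" "S > 0"
 shows "emeasure M E \<le> ennreal (W powr (1/p) * S powr (1/q))"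
proof -
 have "(\<integral>\<^sup>+x\<in>E. ennreal (1 / (W powr (1/p) * S powr (1/q))) \<partial>M)
   \<le> (\<integral>\<^sup>+x. ennreal (1 / (p * W)) * (ennreal (w x) * indicator E x) + ennreal (1 / (q * S)) * (ennreal (s x) * indicator E x) \<partial>M)"
 proof (rule nn_integral_mono)
  fix x assume x: "x \<in> space M"
  have "1 / (W powr (1/p) * S powr (1/q)) = (w x / W) powr (1/p) * (s x / S) powr (1/q)"
   using one[OF x] pos[OF x] W S by (simp add: powr_divide)
  also have "... \<le> 1/p * (w x / W) + 1/q * (s x / S)"
   using pq pos[OF x] W S by (intro Youngs_inequality_0) auto
  also have "... = 1 / (p * W) * w x + 1 / (q * S) * s x" by simp
  finally have le: "1 / (W powr (1/p) * S powr (1/q)) \<le> 1 / (p * W) * w x + 1 / (q * S) * s x" .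
  have "ennreal (1 / (W powr (1/p) * S powr (1/q))) \<le> ennreal (1 / (p * W)) * ennreal (w x) + ennreal (1 / (q * S)) * ennreal (s x)"
   using ennreal_leI[OF le] ennreal_mult_add_mult[of "1 / (p * W)" "w x" "1 / (q * S)" "s x"] pos[OF x] W S pq by simp
  then show "ennreal (1 / (W powr (1/p) * S powr (1/q))) * indicator E x
   \<le> ennreal (1 / (p * W)) * (ennreal (w x) * indicator E x) + ennreal (1 / (q * S)) * (ennreal (s x) * indicator E x)"
   by (auto simp: indicator_def)
 qed
 also have "... = ennreal (1 / (p * W)) * ennreal W + ennreal (1 / (q * S)) * ennreal S"
  by (subst nn_integral_add) (auto simp: nn_integral_cmult W S)
 also have "... = ennreal (1 / (p * W) * W + 1 / (q * S) * S)"
  using W S pq by (intro ennreal_mult_add_mult) auto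
 also have "1 / (p * W) * W + 1 / (q * S) * S = 1" using W S pq by simp
 finally have "(\<integral>\<^sup>+x\<in>E. ennreal (1 / (W powr (1/p) * S powr (1/q))) \<partial>M) \<le> 1" by simp
 then have le: "ennreal (1 / (W powr (1/p) * S powr (1/q))) * emeasure M E \<le> 1"
  by (subst (asm) nn_integral_cmult_indicator) auto
 define t where "t = W powr (1/p) * S powr (1/q)"
 have t: "t > 0" using W S by (simp add: t_def)
 have "emeasure M E = ennreal t * (ennreal (1 / t) * emeasure M E)"
  using t by (simp add: mult.assoc[symmetric] flip: ennreal_mult)
 also have "... \<le> ennreal t * 1" using le by (intro mult_left_mono) (auto simp: t_def)
 finally show ?thesis by (simp add: t_def)
qed

text \<open>Moen's estimate: for \<open>p \<ge> 2\<close> the power of \<open>S\<close> left over from the testing quantity is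
 nonpositive, so \<open>S\<close> may be replaced by the mass of the smaller set.\<close>

lemma testing_coefficient:
 fixes p q m e W S We Se \<Phi> \<eta> :: real
 assumes p: "p \<ge> 2" and q: "q = p / (p - 1)" and pos: "m > 0" "e > 0" "W > 0" "S > 0" "We > 0" "Se > 0" "\<eta> > 0"
  and e: "\<eta> * m \<le> e" "e \<le> We powr (1/p) * Se powr (1/q)" and S: "Se \<le> S"
  and \<Phi>: "W / m * (S / m) powr (p - 1) \<le> \<Phi>"
 shows "S * W / m \<le> \<Phi> * \<eta> powr (1 - p) * (Se powr (1/p) * We powr (1/q))"
proof -
 have \<Phi>0: "\<Phi> \<ge> 0" using \<Phi> pos by (smt (verit) divide_pos_pos mult_pos_pos powr_gt_zero)
 have mp: "m powr (p - 1) \<le> \<eta> powr (1 - p) * e powr (p - 1)"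
 proof -
  have "m powr (p - 1) \<le> (e / \<eta>) powr (p - 1)" using pos p e by (intro powr_mono2) (auto simp: field_simps)
  also have "... = \<eta> powr (1 - p) * e powr (p - 1)"
   using pos powr_minus[of \<eta> "p - 1"] by (simp add: powr_divide) (simp add: divide_inverse mult.commute)
  finally show ?thesis .
 qed
 have ep: "e powr (p - 1) \<le> We powr (1/q) * Se powr ((p - 1) / q)"
 proof -
  have "e powr (p - 1) \<le> (We powr (1/p) * Se powr (1/q)) powr (p - 1)" using pos p e by (intro powr_mono2) auto
  also have "... = We powr ((p - 1) / p) * Se powr ((p - 1) / q)"
   using pos by (simp add: powr_mult powr_powr)
  also have "(p - 1) / p = 1 / q" using p by (simp add: q)
  finally show ?thesis .
 qed
 have Sp: "S powr (2 - p) \<le> Se powr (2 - p)" using pos S p by (intro powr_mono2') auto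
 have expo: "(p - 1) / q + (2 - p) = 1 / p" using p by (simp add: q field_simps)
 \<comment> \<open>The splitting exhibits the quantity bounded by \<Phi>; the factor
   \<open>m powr (p - 1)\<close> is then turned into masses of the smaller set by sparseness and
   Hoelder's inequality.\<close>
 have "S = (S / m) powr (p - 1) * (m powr (p - 1) * S powr (2 - p))"
  using pos by (simp add: powr_divide powr_add[symmetric])
 then have "S * W / m = (W / m * (S / m) powr (p - 1)) * (m powr (p - 1) * S powr (2 - p))"
  by (metis (no_types, opaque_lifting) mult.assoc mult.commute times_divide_eq_left times_divide_eq_right)
 also have "... \<le> \<Phi> * ((\<eta> powr (1 - p) * e powr (p - 1)) * Se powr (2 - p))"
  using \<Phi> \<Phi>0 mp Sp pos by (intro mult_mono) auto
 also have "... \<le> \<Phi> * ((\<eta> powr (1 - p) * (We powr (1/q) * Se powr ((p - 1) / q))) * Se powr (2 - p))"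
  using \<Phi>0 ep by (intro mult_left_mono mult_right_mono) auto
 also have "... = \<Phi> * \<eta> powr (1 - p) * ((Se powr ((p - 1) / q) * Se powr (2 - p)) * We powr (1/q))" by simp
 also have "Se powr ((p - 1) / q) * Se powr (2 - p) = Se powr (1/p)" using expo by (simp flip: powr_add)
 finally show ?thesis .
qed

text \<open>For \<open>p < 2\<close> the weights change roles: the dual weight satisfies the
  condition at the exponent \<open>q \<ge> 2\<close> with constant
  \<open>\<Phi> powr (1 / (p - 1))\<close>. This is where the maximum in the final exponent
  arises.\<close>

lemma testing_coefficient_all:
 fixes p q m e W S We Se \<Phi> \<eta> :: real
 assumes p: "p > 1" and q: "q = p / (p - 1)" and pos: "m > 0" "e > 0" "W > 0" "S > 0" "We > 0" "Se > 0" "\<eta> > 0"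
  and e: "\<eta> * m \<le> e" "e \<le> We powr (1/p) * Se powr (1/q)" and sub: "Se \<le> S" "We \<le> W"
  and \<Phi>: "W / m * (S / m) powr (p - 1) \<le> \<Phi>"
 shows "S * W / m \<le> \<Phi> powr (max (1 / (p - 1)) 1) * \<eta> powr (1 - max p q) * (Se powr (1/p) * We powr (1/q))"
proof (cases "p \<ge> 2")
 case True
 have "1 / (p - 1) \<le> 1" "q \<le> p" using True by (simp_all add: q field_simps)
 moreover have "\<Phi> > 0" using \<Phi> pos by (smt (verit) divide_pos_pos mult_pos_pos powr_gt_zero)
 ultimately show ?thesis
  using testing_coefficient[OF True q pos e sub(1) \<Phi>] by (simp add: max_def)
next
 case False
 then have q2: "q \<ge> 2" and pq: "p = q / (q - 1)" and mx: "1 / (p - 1) \<ge> 1" "p \<le> q" and q1: "q - 1 = 1 / (p - 1)"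
  using p by (simp_all add: q field_simps)
 have "S / m * (W / m) powr (q - 1) = (W / m * (S / m) powr (p - 1)) powr (1 / (p - 1))"
  using p pos by (simp add: powr_mult powr_powr q1 powr_divide mult.commute)
 also have "... \<le> \<Phi> powr (1 / (p - 1))" using \<Phi> p pos by (intro powr_mono2) auto
 finally have 1: "S / m * (W / m) powr (q - 1) \<le> \<Phi> powr (1 / (p - 1))" .
 have "W * S / m \<le> \<Phi> powr (1 / (p - 1)) * \<eta> powr (1 - q) * (We powr (1/q) * Se powr (1/p))"
  using e by (intro testing_coefficient[OF q2 pq pos(1,2,4,3,6,5,7) e(1) _ sub(2) 1]) (simp add: mult.commute)
 moreover have "max (1 / (p - 1)) 1 = 1 / (p - 1)" "max p q = q" using mx by auto
 ultimately show ?thesis by (simp add: mult_ac)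
qed

lemma density_pos:
 assumes [measurable]: "w \<in> borel_measurable M" and w: "\<And>x. x \<in> space M \<Longrightarrow> w x > 0"
  and E[measurable]: "E \<in> sets M" and pos: "emeasure M E > 0"
 shows "emeasure (density M (\<lambda>x. ennreal (w x))) E > 0"
proof (rule ccontr)
 assume "\<not> emeasure (density M (\<lambda>x. ennreal (w x))) E > 0"
 then have "(\<integral>\<^sup>+x. ennreal (w x) * indicator E x \<partial>M) = 0" by (simp add: emeasure_density)
 then have "AE x in M. ennreal (w x) * indicator E x = 0" by (subst (asm) nn_integral_0_iff_AE) auto
 then have "AE x in M. x \<notin> E"
  using AE_space by eventually_elim (use w in \<open>force simp: indicator_def split: if_splits\<close>)
 then have "emeasure M E = 0" using sets.sets_into_space[OF E] by (subst (asm) AE_iff_measurable[of E]) auto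
 then show False using pos by simp
qed

text \<open>Write \<open>X\<close> as \<open>X powr (1/p) * X powr (1/q)\<close> and cancel the
  second factor, which is possible because \<open>X\<close> is finite.\<close>

lemma ennreal_self_bound:
 fixes X H K p q :: real
 assumes "X \<ge> 0" "H \<ge> 0" "K \<ge> 0" "p > 1" "q = p / (p - 1)" "X \<le> K * (H powr (1/p) * X powr (1/q))"
 shows "X \<le> K powr p * H"
proof (cases "X = 0")
 case False
 then have X: "X > 0" using assms by simp
 have "X = X powr (1/p) * X powr (1/q)"
 proof -
  have "1/p + 1/q = 1" using assms(4) by (simp add: assms(5) field_simps)
  then show ?thesis using X by (simp flip: powr_add)
 qed
 then have "X powr (1/p) * X powr (1/q) \<le> (K * H powr (1/p)) * X powr (1/q)" using assms(6) by (simp add: mult.assoc)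
 then have "X powr (1/p) \<le> K * H powr (1/p)" using X by simp
 then have "(X powr (1/p)) powr p \<le> (K * H powr (1/p)) powr p" using assms by (intro powr_mono2) auto
 then show ?thesis using X assms by (simp add: powr_mult powr_powr)
qed (use assms in simp)

context homogeneous_type
begin

text \<open>The factors are the number of laminar families, the volume lost in enlarging a ball, the
  power of the sparseness in \<open>testing_coefficient_all\<close>, and the two maximal functions
  joined by Hoelder's inequality.\<close>

definition weighted_const :: "real \<Rightarrow> real \<Rightarrow> real" where
 "weighted_const \<eta> p = real colours * dbl c_mu (32 * (c_d\<^sup>2)^4) *
   (\<eta> / dbl c_mu (32 * (c_d\<^sup>2)^4)) powr (1 - max p (p / (p - 1))) *
   (maximal_const p powr (1/p) * maximal_const (p / (p - 1)) powr ((p - 1) / p))"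

lemma weighted_const_pos: "\<eta> > 0 \<Longrightarrow> p > 1 \<Longrightarrow> weighted_const \<eta> p > 0"
 using dbl_pos[of "32 * (c_d\<^sup>2)^4"] maximal_const_pos[of p] maximal_const_pos[of "p / (p - 1)"]
 unfolding weighted_const_def colours_def by (intro mult_pos_pos) auto

section \<open>Sparse sums with respect to a fixed weight\<close>

context
 fixes p q \<Phi> :: real and w s :: "'a \<Rightarrow> real"
 assumes p: "p > 1" and q: "q = p / (p - 1)"
  and w[measurable]: "w \<in> borel_measurable M" and w_pos: "\<And>x. x \<in> space M \<Longrightarrow> w x > 0"
  and s: "s = (\<lambda>x. w x powr (- 1 / (p - 1)))"
  and w_fin: "\<And>x r. x \<in> space M \<Longrightarrow> r > 0 \<Longrightarrow> emeasure (density M (\<lambda>x. ennreal (w x))) (B x r) < \<infinity>"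
  and s_fin: "\<And>x r. x \<in> space M \<Longrightarrow> r > 0 \<Longrightarrow> emeasure (density M (\<lambda>x. ennreal (s x))) (B x r) < \<infinity>"
  and \<Phi>: "\<Phi> > 0" "\<And>x r. x \<in> space M \<Longrightarrow> r > 0 \<Longrightarrow>
   measure (density M (\<lambda>x. ennreal (w x))) (B x r) / V x r *
   (measure (density M (\<lambda>x. ennreal (s x))) (B x r) / V x r) powr (p - 1) \<le> \<Phi>"
begin

abbreviation "Wm \<equiv> density M (\<lambda>x. ennreal (w x))"
abbreviation "Sm \<equiv> density M (\<lambda>x. ennreal (s x))"

lemma s_measurable[measurable]: "s \<in> borel_measurable M" unfolding s by measurable

lemma s_pos: "x \<in> space M \<Longrightarrow> s x > 0" using w_pos by (force simp: s)

lemma pq: "q > 1" "1/p + 1/q = 1" "(p - 1) * q = p" "1/q = (p - 1) / p"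
 using p by (simp_all add: q field_simps)

lemma ws_one: "x \<in> space M \<Longrightarrow> w x powr (1/p) * s x powr (1/q) = 1"
proof -
 assume x: "x \<in> space M"
 have "- 1 / (p - 1) * (1/q) = - (1/p)" using p by (simp add: q field_simps)
 then show ?thesis using w_pos[OF x] by (simp add: s powr_powr powr_add[symmetric])
qed

text \<open>The set \<open>Q\<close> is tested inside the ball of radius
  \<open>32 * (c_d\<^sup>2)^4 * r\<close>, where the \<open>A_p\<close> condition is available.
  Returning to the volume of \<open>B x r\<close> costs \<open>\<Lambda>\<close>, and relative to
  the larger ball the sparseness of \<open>E\<close> drops to
  \<open>\<eta> / \<Lambda>\<close>.\<close>

lemma weighted_sparse_term:
 assumes x: "x \<in> space M" "r > 0" and E: "E \<in> sets M" "E \<subseteq> B x r" "measure M E \<ge> \<eta> * V x r" and \<eta>: "\<eta> > 0"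
  and Q: "Q \<in> sets M" "B x r \<subseteq> Q" "Q \<subseteq> B x (32 * (c_d\<^sup>2)^4 * r)"
 defines "\<Lambda> \<equiv> dbl c_mu (32 * (c_d\<^sup>2)^4)"
 shows "measure Sm Q * measure Wm Q / V x r \<le> \<Lambda> * (\<Phi> powr (max (1 / (p - 1)) 1) * (\<eta> / \<Lambda>) powr (1 - max p q) *
   (measure Sm E powr (1/p) * measure Wm E powr (1/q)))" (is "_ \<le> \<Lambda> * ?R")
  and "measure Wm Q > 0" "measure Sm Q > 0" "emeasure Wm Q = ennreal (measure Wm Q)" "emeasure Sm Q = ennreal (measure Sm Q)"
  and "emeasure Wm E = ennreal (measure Wm E)" "emeasure Sm E = ennreal (measure Sm E)"
proof -
 define R where "R = 32 * (c_d\<^sup>2)^4 * r"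
 have c1: "32 * (c_d\<^sup>2)^4 \<ge> 1" using cd2 one_le_power[of "c_d\<^sup>2" 4] by simp
 have R: "r \<le> R" using x(2) mult_right_mono[OF c1, of r] by (simp add: R_def)
 have R: "R > 0" "r \<le> R" using R x(2) by auto
 have \<Lambda>0: "\<Lambda> > 0" by (simp add: \<Lambda>_def dbl_pos)
 have VR: "V x R \<le> \<Lambda> * V x r" unfolding \<Lambda>_def R_def using c1 x by (intro V_dbl) auto
 have Vp: "V x r > 0" "V x R > 0" using V_pos x R by auto
 have QR: "Q \<subseteq> B x R" using Q by (simp add: R_def)
 have Es: "E \<subseteq> Q" using E Q by blast
 have "measure M E > 0" using E(3) \<eta> Vp by (smt (verit) mult_pos_pos)
 then have Epos: "emeasure M E > 0" by (metis emeasure_notin_sets less_numeral_extra(3) measure_def enn2real_0 not_gr_zero)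
 have Em: "emeasure M E = ennreal (measure M E)" by (rule emeasure_eq_measure_subset_B[OF x(1) E(2)])
 have fin: "emeasure Wm A = ennreal (measure Wm A)" "emeasure Sm A = ennreal (measure Sm A)" if "A \<subseteq> B x R" for A
 proof -
  have "emeasure Wm A \<le> emeasure Wm (B x R)" "emeasure Sm A \<le> emeasure Sm (B x R)"
   using B_sets x R that by (auto intro!: emeasure_mono)
  then show "emeasure Wm A = ennreal (measure Wm A)" "emeasure Sm A = ennreal (measure Sm A)"
   using w_fin[OF x(1) R(1)] s_fin[OF x(1) R(1)] by (auto intro!: emeasure_eq_ennreal_measure)
 qed
 show WQ: "emeasure Wm Q = ennreal (measure Wm Q)" and SQ: "emeasure Sm Q = ennreal (measure Sm Q)"
  and WE: "emeasure Wm E = ennreal (measure Wm E)" and SE: "emeasure Sm E = ennreal (measure Sm E)"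
  using fin[of Q] fin[of E] QR Es by auto
 have le: "measure Wm A \<le> measure Wm C" "measure Sm A \<le> measure Sm C" if "A \<subseteq> C" "C \<subseteq> B x R" "C \<in> sets M" for A C
 proof -
  have "emeasure Wm A \<le> emeasure Wm C" "emeasure Sm A \<le> emeasure Sm C" using that by (auto intro!: emeasure_mono)
  then show "measure Wm A \<le> measure Wm C" "measure Sm A \<le> measure Sm C"
   using fin[of A] fin[of C] that by auto
 qed
 have pE: "measure Wm E > 0" "measure Sm E > 0"
  using density_pos[OF w w_pos E(1) Epos] density_pos[OF s_measurable s_pos E(1) Epos] WE SE by auto
 show pQ: "measure Wm Q > 0" "measure Sm Q > 0" using pE le[OF Es QR Q(1)] by auto
 have H: "measure M E \<le> measure Wm E powr (1/p) * measure Sm E powr (1/q)"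
 proof -
  have "emeasure M E \<le> ennreal (measure Wm E powr (1/p) * measure Sm E powr (1/q))"
   using WE SE pE E(1) by (intro Holder_weights[OF p pq(1,2) w s_measurable E(1) w_pos s_pos ws_one]) (auto simp: emeasure_density)
  then show ?thesis using Em by simp
 qed
 have "measure Sm Q * measure Wm Q / V x R \<le> ?R"
 proof (rule testing_coefficient_all[OF p q])
  show "\<eta> / \<Lambda> * V x R \<le> measure M E"
  proof -
   have "\<eta> / \<Lambda> * V x R \<le> \<eta> / \<Lambda> * (\<Lambda> * V x r)" using \<eta> \<Lambda>0 VR by (intro mult_left_mono) auto
   then show ?thesis using E(3) \<Lambda>0 by simp
  qed
  have "measure Wm Q / V x R * (measure Sm Q / V x R) powr (p - 1)
    \<le> measure Wm (B x R) / V x R * (measure Sm (B x R) / V x R) powr (p - 1)"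
   using le[OF QR order_refl B_sets] x R Vp p by (intro mult_mono powr_mono2 divide_right_mono) auto
  also have "... \<le> \<Phi>" using x R by (intro \<Phi>)
  finally show "measure Wm Q / V x R * (measure Sm Q / V x R) powr (p - 1) \<le> \<Phi>" .
 qed (use Vp pE pQ \<eta> \<Lambda>0 H le[OF Es QR Q(1)] \<open>measure M E > 0\<close> in auto)
 then have "\<Lambda> * (measure Sm Q * measure Wm Q / V x R) \<le> \<Lambda> * ?R" using \<Lambda>0 by (intro mult_left_mono) auto
 moreover have "measure Sm Q * measure Wm Q / V x r \<le> \<Lambda> * (measure Sm Q * measure Wm Q / V x R)"
 proof -
  have "measure Sm Q * measure Wm Q * V x R \<le> measure Sm Q * measure Wm Q * (\<Lambda> * V x r)"
   using VR pQ by (intro mult_left_mono) auto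
  then show ?thesis using Vp by (simp add: field_simps)
 qed
 ultimately show "measure Sm Q * measure Wm Q / V x r \<le> \<Lambda> * ?R" by linarith
qed

text \<open>With \<open>g = D powr (p - 1)\<close> the integral of \<open>D powr p\<close> is a sum
  of products of an average of \<open>f\<close> and an integral of \<open>g\<close>. These are
  expressed by averages over \<open>Q j\<close> for the dual weight and for the weight; on each
  laminar family the maximal functions bound them in terms of \<open>f\<close> and of
  \<open>D powr p\<close> itself.\<close>

lemma weighted_sparse_finite:
 fixes f :: "'a \<Rightarrow> 'b::real_normed_vector" and x :: "'j \<Rightarrow> 'a"
 assumes f: "f \<in> Lp_space M 1" and J: "finite J" "\<And>j. j \<in> J \<Longrightarrow> x j \<in> space M" "\<And>j. j \<in> J \<Longrightarrow> r j > 0"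
  and E: "\<And>j. j \<in> J \<Longrightarrow> E j \<in> sets M" "\<And>j. j \<in> J \<Longrightarrow> E j \<subseteq> B (x j) (r j)"
   "\<And>j. j \<in> J \<Longrightarrow> measure M (E j) \<ge> \<eta> * V (x j) (r j)" "disjoint_family_on E J" and \<eta>: "\<eta> > 0"
 defines "D \<equiv> \<lambda>y. (\<Sum>j\<in>J. avg f (x j) (r j) * indicator (B (x j) (r j)) y)"
 shows "(\<integral>\<^sup>+y. ennreal (D y powr p) \<partial>Wm) \<le>
   ennreal ((weighted_const \<eta> p * \<Phi> powr (max (1 / (p - 1)) 1)) powr p) * (\<integral>\<^sup>+y. ennreal (norm (f y) powr p) \<partial>Wm)"
proof -
 define mx where "mx = max (1 / (p - 1)) 1"
 define \<Lambda> where "\<Lambda> = dbl c_mu (32 * (c_d\<^sup>2)^4)"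
 have \<Lambda>0: "\<Lambda> > 0" by (simp add: \<Lambda>_def dbl_pos)
 define k0 where "k0 = \<Lambda> * (\<Phi> powr mx * (\<eta> / \<Lambda>) powr (1 - max p q))"
 have k0: "k0 \<ge> 0" using \<Lambda>0 by (simp add: k0_def)
 have sm: "strongly_measurable M f" using f by (simp add: Lp_space_def)
 have [measurable]: "(\<lambda>y. norm (f y)) \<in> borel_measurable M" by (rule strongly_measurable_norm[OF sm])
 note Bs[measurable] = B_sets
 have D_meas[measurable]: "D \<in> borel_measurable M" unfolding D_def using J by (intro borel_measurable_sum) (auto intro!: Bs)
 have c0: "avg f (x j) (r j) \<ge> 0" if "j \<in> J" for j using avg_nonneg J that by auto
 have D0: "D y \<ge> 0" for y unfolding D_def using c0 by (intro sum_nonneg) auto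
 have kp: "(weighted_const \<eta> p * \<Phi> powr mx) powr p > 0" using weighted_const_pos[OF \<eta> p] \<Phi>(1) by simp
 show ?thesis
 proof (cases "(\<integral>\<^sup>+y. ennreal (norm (f y) powr p) \<partial>Wm) = \<infinity>")
  case True
  then show ?thesis using kp by (simp add: ennreal_mult_top mx_def)
 next
  case False
  then obtain H where H: "(\<integral>\<^sup>+y. ennreal (norm (f y) powr p) \<partial>Wm) = ennreal H" "H \<ge> 0"
   by (cases "(\<integral>\<^sup>+y. ennreal (norm (f y) powr p) \<partial>Wm)") auto
  define g where "g y = D y powr (p - 1)" for y
  have [measurable]: "g \<in> borel_measurable M" unfolding g_def by measurable
  have Dg: "D y powr p = D y * g y" for y
   using D0[of y] by (cases "D y = 0") (auto simp: g_def powr_diff)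
  have gq: "g y powr q = D y powr p" for y by (simp add: g_def powr_powr pq)
  obtain Q and col :: "'j \<Rightarrow> nat" where Q: "\<And>j. j \<in> J \<Longrightarrow> Q j \<in> sets M" "\<And>j. j \<in> J \<Longrightarrow> B (x j) (r j) \<subseteq> Q j"
   "\<And>j. j \<in> J \<Longrightarrow> Q j \<subseteq> B (x j) (32 * (c_d\<^sup>2)^4 * r j)" "\<And>j. j \<in> J \<Longrightarrow> col j < colours"
   and lam: "\<And>c. laminar {j\<in>J. col j = c} Q"
   by (rule laminar_cover[where x=x and r=r, OF J], assumption, assumption, rule that)
  note T = weighted_sparse_term[OF J(2,3) E(1-3) \<eta> Q(1-3), folded \<Lambda>_def]
  define A where "A = (\<Sum>j\<in>J. avg f (x j) (r j))"
  have DA: "D y \<le> A" for y unfolding D_def A_def using c0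
   by (intro sum_mono) (auto simp: indicator_def)
  \<comment> \<open>A priori finiteness for the cancellation at the end: \<open>D\<close> is bounded
    and lives on finitely many balls of finite weight.\<close>
  have fin: "(\<integral>\<^sup>+y. ennreal (D y powr p) \<partial>Wm) < \<infinity>"
  proof -
   have "(\<integral>\<^sup>+y. ennreal (D y powr p) \<partial>Wm) \<le> (\<integral>\<^sup>+y. ennreal (A powr p) * indicator (\<Union>j\<in>J. B (x j) (r j)) y \<partial>Wm)"
   proof (rule nn_integral_mono)
    fix y
    have "D y = 0" if "y \<notin> (\<Union>j\<in>J. B (x j) (r j))" using that unfolding D_def by (intro sum.neutral) auto
    then show "ennreal (D y powr p) \<le> ennreal (A powr p) * indicator (\<Union>j\<in>J. B (x j) (r j)) y"
     using D0[of y] DA[of y] p by (auto simp: indicator_def intro!: ennreal_leI powr_mono2)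
   qed
   also have "... = ennreal (A powr p) * emeasure Wm (\<Union>j\<in>J. B (x j) (r j))"
    using J by (subst nn_integral_cmult_indicator) (auto intro!: sets.finite_UN Bs)
   also have "... < \<infinity>"
   proof -
    have "emeasure Wm (\<Union>j\<in>J. B (x j) (r j)) \<le> (\<Sum>j\<in>J. emeasure Wm (B (x j) (r j)))"
     using J by (intro emeasure_subadditive_finite) (auto intro!: Bs)
    also have "... < \<infinity>" using J w_fin by (simp add: less_top[symmetric])
    finally show ?thesis by (simp add: ennreal_mult_less_top)
   qed
   finally show ?thesis .
  qed
  then obtain X where X: "(\<integral>\<^sup>+y. ennreal (D y powr p) \<partial>Wm) = ennreal X" "X \<ge> 0"
   by (cases "(\<integral>\<^sup>+y. ennreal (D y powr p) \<partial>Wm)") auto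
  \<comment> \<open>The average of \<open>norm (f y) / s y\<close> over \<open>Q j\<close> for the
    dual weight; \<open>b j\<close> below is that of \<open>g\<close> for the weight
    \<open>w\<close>.\<close>
  define a where "a j = measure (nu M f) (Q j) / measure Sm (Q j)" for j
  have gfin: "(\<integral>\<^sup>+y\<in>Q j. ennreal (g y) \<partial>Wm) < \<infinity>" if j: "j \<in> J" for j
  proof -
   have "(\<integral>\<^sup>+y\<in>Q j. ennreal (g y) \<partial>Wm) \<le> (\<integral>\<^sup>+y. ennreal (A powr (p - 1)) * indicator (Q j) y \<partial>Wm)"
    using D0 DA p by (intro nn_integral_mono) (auto simp: indicator_def g_def intro!: ennreal_leI powr_mono2)
   also have "... = ennreal (A powr (p - 1)) * emeasure Wm (Q j)"
    using Q(1)[OF j] by (subst nn_integral_cmult_indicator) auto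
   also have "... < \<infinity>" using T(4)[OF j j j j j j j j] by (simp add: ennreal_mult_less_top)
   finally show ?thesis .
  qed
  define G where "G j = enn2real (\<integral>\<^sup>+y\<in>Q j. ennreal (g y) \<partial>Wm)" for j
  have G: "(\<integral>\<^sup>+y\<in>Q j. ennreal (g y) \<partial>Wm) = ennreal (G j)" if "j \<in> J" for j
   using gfin[OF that] by (simp add: G_def)
  define b where "b j = G j / measure Wm (Q j)" for j
  have ab0: "a j \<ge> 0" "b j \<ge> 0" for j by (simp_all add: a_def b_def G_def)
  define \<alpha> where "\<alpha> j = measure Sm (E j) powr (1/p) * a j" for j
  define \<beta> where "\<beta> j = measure Wm (E j) powr (1/q) * b j" for j
  have ab1: "\<alpha> j \<ge> 0" "\<beta> j \<ge> 0" for j using ab0 by (simp_all add: \<alpha>_def \<beta>_def)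
  have term_le: "avg f (x j) (r j) * G j \<le> k0 * (\<alpha> j * \<beta> j)" if j: "j \<in> J" for j
  proof -
   note Tj = T[OF j j j j j j j j]
   have "measure (nu M f) (B (x j) (r j)) \<le> measure (nu M f) (Q j)"
    using Q(1,2)[OF j] finite_measure_nu[OF f] by (intro finite_measure.finite_measure_mono) auto
   then have "avg f (x j) (r j) * G j \<le> measure (nu M f) (Q j) / V (x j) (r j) * G j"
    using V_nonneg unfolding avg_def by (intro mult_right_mono divide_right_mono) (auto simp: G_def)
   also have "... = measure Sm (Q j) * measure Wm (Q j) / V (x j) (r j) * (a j * b j)"
    using Tj(2,3) by (simp add: a_def b_def)
   also have "... \<le> \<Lambda> * (\<Phi> powr mx * (\<eta> / \<Lambda>) powr (1 - max p q) *
     (measure Sm (E j) powr (1/p) * measure Wm (E j) powr (1/q))) * (a j * b j)"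
    using Tj(1) ab0 unfolding mx_def by (intro mult_right_mono) auto
   also have "... = k0 * (\<alpha> j * \<beta> j)" by (simp add: k0_def \<alpha>_def \<beta>_def)
   finally show ?thesis .
  qed
  have max1: "(\<Sum>j\<in>F. \<alpha> j powr p) \<le> maximal_const p * H" if F: "F \<subseteq> J" "laminar F Q" for F
  proof -
   have Fin: "finite F" using F J finite_subset by blast
   have "(\<Sum>j\<in>F. emeasure Sm (E j) * ennreal (a j powr p)) \<le> ennreal (maximal_const p) * (\<integral>\<^sup>+y. ennreal ((norm (f y) / s y) powr p) \<partial>Sm)"
   proof (rule laminar_maximal[OF p Fin F(2)])
    fix j assume "j \<in> F"
    then have j: "j \<in> J" using F by auto
    note Tj = T[OF j j j j j j j j]
    show "Q j \<in> sets Sm" "E j \<in> sets Sm" using Q(1) E(1) j by auto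
    show "E j \<subseteq> Q j" using E(2)[OF j] Q(2)[OF j] by (rule order_trans)
    show "emeasure Sm (Q j) < \<infinity>" using Tj(5) by simp
    have "ennreal (a j) * emeasure Sm (Q j) = ennreal (measure (nu M f) (Q j))"
     unfolding Tj(5) using Tj(3) by (subst ennreal_mult[symmetric]) (auto simp: a_def)
    also have "... = emeasure (nu M f) (Q j)"
     using finite_measure.emeasure_eq_measure[OF finite_measure_nu[OF f]] by simp
    also have "... = (\<integral>\<^sup>+y\<in>Q j. enorm (f y) \<partial>M)"
     using Q(1)[OF j] sm by (intro emeasure_nu)
    also have "... = (\<integral>\<^sup>+y. ennreal (s y) * (ennreal (norm (f y) / s y) * indicator (Q j) y) \<partial>M)"
    proof (rule nn_integral_cong)
     fix y assume "y \<in> space M"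
     then have "ennreal (s y) * ennreal (norm (f y) / s y) = enorm (f y)"
      using s_pos[of y] by (simp add: ennreal_mult[symmetric])
     then show "enorm (f y) * indicator (Q j) y = ennreal (s y) * (ennreal (norm (f y) / s y) * indicator (Q j) y)"
      by (simp add: mult.assoc[symmetric])
    qed
    also have "... = (\<integral>\<^sup>+y\<in>Q j. ennreal (norm (f y) / s y) \<partial>Sm)"
     using Q(1)[OF j] by (subst nn_integral_density) auto
    finally show "ennreal (a j) * emeasure Sm (Q j) \<le> (\<integral>\<^sup>+y\<in>Q j. ennreal (norm (f y) / s y) \<partial>Sm)" by simp
   qed (use ab0 disjoint_family_on_mono[OF F(1) E(4)] in \<open>auto simp: s\<close>)
   also have "(\<integral>\<^sup>+y. ennreal ((norm (f y) / s y) powr p) \<partial>Sm) = (\<integral>\<^sup>+y. ennreal (s y) * ennreal ((norm (f y) / s y) powr p) \<partial>M)"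
    by (subst nn_integral_density) auto
   also have "... = (\<integral>\<^sup>+y. ennreal (w y) * ennreal (norm (f y) powr p) \<partial>M)"
   proof (rule nn_integral_cong)
    fix y assume y: "y \<in> space M"
    \<comment> \<open>The dual weight is made for this: \<open>s powr (1 - p) = w\<close>, so the
      integral of the power \<open>p\<close> of \<open>norm f / s\<close> for \<open>Sm\<close> is
      that of \<open>norm f\<close> for \<open>Wm\<close>.\<close>
    have "- 1 / (p - 1) * (1 - p) = 1" using p by (simp add: field_simps)
    then have "s y powr (1 - p) = w y" using w_pos[OF y] unfolding s powr_powr by simp
    moreover have "s y * (norm (f y) / s y) powr p = s y powr (1 - p) * norm (f y) powr p"
     using s_pos[OF y] by (simp add: powr_divide powr_diff)
    ultimately show "ennreal (s y) * ennreal ((norm (f y) / s y) powr p) = ennreal (w y) * ennreal (norm (f y) powr p)"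
     using s_pos[OF y] w_pos[OF y] by (simp add: ennreal_mult[symmetric])
   qed
   also have "... = ennreal H" using H(1) by (subst (asm) nn_integral_density) auto
   finally have "(\<Sum>j\<in>F. emeasure Sm (E j) * ennreal (a j powr p)) \<le> ennreal (maximal_const p * H)"
    using maximal_const_pos[OF p] H by (simp add: ennreal_mult)
   moreover have "(\<Sum>j\<in>F. emeasure Sm (E j) * ennreal (a j powr p)) = (\<Sum>j\<in>F. ennreal (\<alpha> j powr p))"
   proof (rule sum.cong[OF refl])
    fix j assume "j \<in> F"
    then have j: "j \<in> J" using F by auto
    show "emeasure Sm (E j) * ennreal (a j powr p) = ennreal (\<alpha> j powr p)"
     using T(7)[OF j j j j j j j j] p ab0 by (simp add: \<alpha>_def powr_mult powr_powr ennreal_mult)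
   qed
   ultimately show ?thesis using maximal_const_pos[OF p] H by (simp add: sum_ennreal)
  qed
  have max2: "(\<Sum>j\<in>F. \<beta> j powr q) \<le> maximal_const q * X" if F: "F \<subseteq> J" "laminar F Q" for F
  proof -
   have Fin: "finite F" using F J finite_subset by blast
   have "(\<Sum>j\<in>F. emeasure Wm (E j) * ennreal (b j powr q)) \<le> ennreal (maximal_const q) * (\<integral>\<^sup>+y. ennreal (g y powr q) \<partial>Wm)"
   proof (rule laminar_maximal[OF pq(1) Fin F(2)])
    fix j assume "j \<in> F"
    then have j: "j \<in> J" using F by auto
    note Tj = T[OF j j j j j j j j]
    show "Q j \<in> sets Wm" "E j \<in> sets Wm" using Q(1) E(1) j by auto
    show "E j \<subseteq> Q j" using E(2)[OF j] Q(2)[OF j] by (rule order_trans)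
    show "emeasure Wm (Q j) < \<infinity>" using Tj(4) by simp
    show "ennreal (b j) * emeasure Wm (Q j) \<le> (\<integral>\<^sup>+y\<in>Q j. ennreal (g y) \<partial>Wm)"
     unfolding G[OF j] Tj(4) using Tj(2) by (subst ennreal_mult[symmetric]) (auto simp: b_def G_def)
   qed (use ab0 disjoint_family_on_mono[OF F(1) E(4)] in \<open>auto simp: g_def\<close>)
   then have "(\<Sum>j\<in>F. emeasure Wm (E j) * ennreal (b j powr q)) \<le> ennreal (maximal_const q * X)"
    using maximal_const_pos[OF pq(1)] X by (simp add: ennreal_mult gq)
   moreover have "(\<Sum>j\<in>F. emeasure Wm (E j) * ennreal (b j powr q)) = (\<Sum>j\<in>F. ennreal (\<beta> j powr q))"
   proof (rule sum.cong[OF refl])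
    fix j assume "j \<in> F"
    then have j: "j \<in> J" using F by auto
    show "emeasure Wm (E j) * ennreal (b j powr q) = ennreal (\<beta> j powr q)"
     using T(6)[OF j j j j j j j j] pq(1) ab0 by (simp add: \<beta>_def powr_mult powr_powr ennreal_mult)
   qed
   ultimately show ?thesis using maximal_const_pos[OF pq(1)] X by (simp add: sum_ennreal)
  qed
  define mm where "mm = maximal_const p powr (1/p) * maximal_const q powr (1/q)"
  have colour: "(\<Sum>j\<in>{j\<in>J. col j = c}. \<alpha> j * \<beta> j) \<le> mm * (H powr (1/p) * X powr (1/q))" for c
  proof -
   let ?F = "{j\<in>J. col j = c}"
   have "(\<Sum>j\<in>?F. \<alpha> j * \<beta> j) \<le> (\<Sum>j\<in>?F. \<alpha> j powr p) powr (1/p) * (\<Sum>j\<in>?F. \<beta> j powr q) powr (1/q)"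
    using p pq ab1 by (intro Holder_sum) auto
   also have "... \<le> (maximal_const p * H) powr (1/p) * (maximal_const q * X) powr (1/q)"
    using max1[OF _ lam[of c]] max2[OF _ lam[of c]] p pq by (intro mult_mono powr_mono2 sum_nonneg) auto
   also have "... = mm * (H powr (1/p) * X powr (1/q))"
    using maximal_const_pos[OF p] maximal_const_pos[OF pq(1)] H X by (simp add: mm_def powr_mult)
   finally show ?thesis .
  qed
  have "ennreal X = (\<integral>\<^sup>+y. (\<Sum>j\<in>J. ennreal (avg f (x j) (r j)) * (ennreal (g y) * indicator (B (x j) (r j)) y)) \<partial>Wm)"
   unfolding X(1)[symmetric]
  proof (rule nn_integral_cong)
   fix y
   have "ennreal (D y powr p) = ennreal (\<Sum>j\<in>J. avg f (x j) (r j) * (g y * indicator (B (x j) (r j)) y))"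
    unfolding Dg unfolding D_def by (subst sum_distrib_right) (simp add: mult_ac)
   also have "... = (\<Sum>j\<in>J. ennreal (avg f (x j) (r j) * (g y * indicator (B (x j) (r j)) y)))"
    using c0 by (intro sum_ennreal[symmetric]) (simp add: g_def)
   also have "... = (\<Sum>j\<in>J. ennreal (avg f (x j) (r j)) * (ennreal (g y) * indicator (B (x j) (r j)) y))"
   proof (rule sum.cong[OF refl])
    fix j assume "j \<in> J"
    then show "ennreal (avg f (x j) (r j) * (g y * indicator (B (x j) (r j)) y)) = ennreal (avg f (x j) (r j)) * (ennreal (g y) * indicator (B (x j) (r j)) y)"
     using c0[of j] by (simp add: indicator_def ennreal_mult g_def)
   qed
   finally show "ennreal (D y powr p) = (\<Sum>j\<in>J. ennreal (avg f (x j) (r j)) * (ennreal (g y) * indicator (B (x j) (r j)) y))" .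
  qed
  also have "... = (\<Sum>j\<in>J. ennreal (avg f (x j) (r j)) * (\<integral>\<^sup>+y\<in>B (x j) (r j). ennreal (g y) \<partial>Wm))"
   using J by (subst nn_integral_sum) (auto intro!: sum.cong nn_integral_cmult Bs borel_measurable_times_ennreal borel_measurable_indicator)
  also have "... \<le> (\<Sum>j\<in>J. ennreal (k0 * (\<alpha> j * \<beta> j)))"
  proof (rule sum_mono)
   fix j assume j: "j \<in> J"
   have "(\<integral>\<^sup>+y\<in>B (x j) (r j). ennreal (g y) \<partial>Wm) \<le> ennreal (G j)"
    unfolding G[OF j, symmetric] using Q(2)[OF j] by (intro nn_integral_mono) (auto simp: indicator_def)
   then have "ennreal (avg f (x j) (r j)) * (\<integral>\<^sup>+y\<in>B (x j) (r j). ennreal (g y) \<partial>Wm) \<le> ennreal (avg f (x j) (r j)) * ennreal (G j)"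
    by (rule mult_left_mono) simp
   also have "... = ennreal (avg f (x j) (r j) * G j)" using c0[OF j] by (simp add: ennreal_mult G_def)
   also have "... \<le> ennreal (k0 * (\<alpha> j * \<beta> j))" by (intro ennreal_leI term_le j)
   finally show "ennreal (avg f (x j) (r j)) * (\<integral>\<^sup>+y\<in>B (x j) (r j). ennreal (g y) \<partial>Wm) \<le> ennreal (k0 * (\<alpha> j * \<beta> j))" .
  qed
  also have "... = ennreal (\<Sum>j\<in>J. k0 * (\<alpha> j * \<beta> j))" using k0 ab1 by (intro sum_ennreal) auto
  finally have "X \<le> (\<Sum>j\<in>J. k0 * (\<alpha> j * \<beta> j))"
   using k0 ab1 by (subst (asm) ennreal_le_iff) (auto intro!: sum_nonneg)
  also have "... = k0 * (\<Sum>c<colours. \<Sum>j\<in>{j\<in>J. col j = c}. \<alpha> j * \<beta> j)"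
   using J Q(4) by (subst sum.group) (auto simp: sum_distrib_left)
  also have "... \<le> k0 * (\<Sum>c<colours. mm * (H powr (1/p) * X powr (1/q)))"
   using k0 by (intro mult_left_mono sum_mono colour)
  also have "... = (weighted_const \<eta> p * \<Phi> powr mx) * (H powr (1/p) * X powr (1/q))"
   unfolding weighted_const_def k0_def mm_def pq(4) \<Lambda>_def[symmetric] q[symmetric] by (simp add: mult_ac)
  finally have "X \<le> (weighted_const \<eta> p * \<Phi> powr mx) powr p * H"
   using X H weighted_const_pos[OF \<eta> p] by (intro ennreal_self_bound[OF _ _ _ p q]) auto
  then show ?thesis unfolding X(1) H(1) mx_def[symmetric] using H kp by (simp add: ennreal_mult[symmetric] ennreal_leI)
 qed
qed

text \<open>Monotone convergence: each pointwise finite set \<open>F\<close> lies in an initial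
  segment of an enumeration of \<open>J\<close>, and the bound for finite sums does not depend on
  the number of terms.\<close>

lemma weighted_sparse:
 fixes f :: "'a \<Rightarrow> 'b::real_normed_vector" and x :: "'j \<Rightarrow> 'a"
 assumes f: "f \<in> Lp_space M 1" and J: "countable J" "\<And>j. j \<in> J \<Longrightarrow> x j \<in> space M" "\<And>j. j \<in> J \<Longrightarrow> r j > 0"
  and E: "\<And>j. j \<in> J \<Longrightarrow> E j \<in> sets M" "\<And>j. j \<in> J \<Longrightarrow> E j \<subseteq> B (x j) (r j)"
   "\<And>j. j \<in> J \<Longrightarrow> measure M (E j) \<ge> \<eta> * V (x j) (r j)" "disjoint_family_on E J" and \<eta>: "\<eta> > 0"
  and h: "\<And>y. h y \<ge> 0" and C: "C \<ge> 0"
  and dom: "AE y in M. \<exists>F\<subseteq>J. finite F \<and> (\<forall>j\<in>F. y \<in> B (x j) (r j)) \<and> h y \<le> C * (\<Sum>j\<in>F. avg f (x j) (r j))"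
 shows "(\<integral>\<^sup>+y. ennreal (h y powr p) \<partial>Wm) \<le>
   ennreal ((C * (weighted_const \<eta> p * \<Phi> powr (max (1 / (p - 1)) 1))) powr p) * (\<integral>\<^sup>+y. ennreal (norm (f y) powr p) \<partial>Wm)"
proof -
 define Jn where "Jn n = {j\<in>J. to_nat_on J j < n}" for n
 define c where "c j = avg f (x j) (r j)" for j
 have c0: "c j \<ge> 0" if "j \<in> J" for j using avg_nonneg J that by (auto simp: c_def)
 have Jn: "finite (Jn n)" "Jn n \<subseteq> J" for n
 proof -
  have "inj_on (to_nat_on J) (Jn n)" using inj_on_to_nat_on[OF J(1)] by (rule inj_on_subset) (auto simp: Jn_def)
  moreover have "finite (to_nat_on J ` Jn n)" by (rule finite_subset[of _ "{..<n}"]) (auto simp: Jn_def)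
  ultimately show "finite (Jn n)" by (rule finite_imageD[rotated])
 qed (auto simp: Jn_def)
 define D where "D n y = (\<Sum>j\<in>Jn n. c j * indicator (B (x j) (r j)) y)" for n y
 have D_meas: "D n \<in> borel_measurable M" for n
  unfolding D_def using J Jn(2) by (intro borel_measurable_sum borel_measurable_times borel_measurable_indicator B_sets) auto
 have D0: "D n y \<ge> 0" for n y unfolding D_def using c0 Jn(2)[of n] by (intro sum_nonneg) auto
 have D_mono: "D n y \<le> D m y" if "n \<le> m" for n m y
  unfolding D_def using that c0 Jn by (intro sum_mono2) (auto simp: Jn_def)
 have "AE y in Wm. ennreal (h y powr p) \<le> (SUP n. ennreal (C powr p) * ennreal (D n y powr p))"
 proof -
  have "AE y in M. ennreal (h y powr p) \<le> (SUP n. ennreal (C powr p) * ennreal (D n y powr p))"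
   using dom
  proof eventually_elim
   fix y assume "\<exists>F\<subseteq>J. finite F \<and> (\<forall>j\<in>F. y \<in> B (x j) (r j)) \<and> h y \<le> C * (\<Sum>j\<in>F. avg f (x j) (r j))"
   then obtain F where F: "F \<subseteq> J" "finite F" "\<forall>j\<in>F. y \<in> B (x j) (r j)" "h y \<le> C * (\<Sum>j\<in>F. c j)"
    by (auto simp: c_def)
   define n where "n = Suc (Max (to_nat_on J ` F))"
   have FJ: "F \<subseteq> Jn n" using F by (auto simp: Jn_def n_def less_Suc_eq_le)
   have "(\<Sum>j\<in>F. c j) = (\<Sum>j\<in>F. c j * indicator (B (x j) (r j)) y)" using F by (intro sum.cong) auto
   also have "... \<le> D n y" unfolding D_def using FJ Jn c0 by (intro sum_mono2 mult_nonneg_nonneg) (auto dest: subsetD[OF Jn(2)])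
   finally have "h y \<le> C * D n y" using F(4) C by (meson mult_left_mono order_trans)
   then have "h y powr p \<le> (C * D n y) powr p" using h p by (intro powr_mono2) auto
   then have "ennreal (h y powr p) \<le> ennreal (C powr p) * ennreal (D n y powr p)"
    using C D0 by (simp add: powr_mult ennreal_mult[symmetric] ennreal_leI)
   then show "ennreal (h y powr p) \<le> (SUP n. ennreal (C powr p) * ennreal (D n y powr p))"
    by (rule SUP_upper2[rotated]) simp
  qed
  then show ?thesis by (subst AE_density) auto
 qed
 then have "(\<integral>\<^sup>+y. ennreal (h y powr p) \<partial>Wm) \<le> (\<integral>\<^sup>+y. (SUP n. ennreal (C powr p) * ennreal (D n y powr p)) \<partial>Wm)"
  by (rule nn_integral_mono_AE)
 also have "... = (SUP n. \<integral>\<^sup>+y. ennreal (C powr p) * ennreal (D n y powr p) \<partial>Wm)"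
 proof (rule nn_integral_monotone_convergence_SUP)
  show "incseq (\<lambda>n y. ennreal (C powr p) * ennreal (D n y powr p))"
   using D_mono D0 p by (auto simp: incseq_def le_fun_def intro!: mult_left_mono ennreal_leI powr_mono2)
 qed (use D_meas in measurable)
 also have "... \<le> ennreal ((C * (weighted_const \<eta> p * \<Phi> powr (max (1 / (p - 1)) 1))) powr p) * (\<integral>\<^sup>+y. ennreal (norm (f y) powr p) \<partial>Wm)"
 proof (rule SUP_least)
  fix n
  have EB: "E j \<subseteq> B (x j) (r j)" if "j \<in> Jn n" for j using E(2)[of j] Jn(2) that by blast
  have "(\<integral>\<^sup>+y. ennreal (C powr p) * ennreal (D n y powr p) \<partial>Wm) = ennreal (C powr p) * (\<integral>\<^sup>+y. ennreal (D n y powr p) \<partial>Wm)"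
   using D_meas by (intro nn_integral_cmult) measurable
  also have "... \<le> ennreal (C powr p) * (ennreal ((weighted_const \<eta> p * \<Phi> powr (max (1 / (p - 1)) 1)) powr p) * (\<integral>\<^sup>+y. ennreal (norm (f y) powr p) \<partial>Wm))"
   unfolding D_def c_def using J Jn E \<eta> disjoint_family_on_mono[OF Jn(2) E(4)]
   by (intro mult_left_mono weighted_sparse_finite[OF f, where E=E] EB) (auto dest: subsetD[OF Jn(2)])
  also have "... = ennreal ((C * (weighted_const \<eta> p * \<Phi> powr (max (1 / (p - 1)) 1))) powr p) * (\<integral>\<^sup>+y. ennreal (norm (f y) powr p) \<partial>Wm)"
   using C weighted_const_pos[OF \<eta> p] by (simp add: powr_mult ennreal_mult mult.assoc)
  finally show "(\<integral>\<^sup>+y. ennreal (C powr p) * ennreal (D n y powr p) \<partial>Wm) \<le> ennreal ((C * (weighted_const \<eta> p * \<Phi> powr (max (1 / (p - 1)) 1))) powr p) * (\<integral>\<^sup>+y. ennreal (norm (f y) powr p) \<partial>Wm)" .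
 qed
 finally show ?thesis .
qed

end

end

section \<open>Dini operators\<close>

lemma enn_powr_mono: "x \<le> y \<Longrightarrow> a > 0 \<Longrightarrow> enn_powr x a \<le> enn_powr y a"
 by (cases x; cases y) (auto simp: enn_powr_def top_unique intro!: ennreal_leI powr_mono2)

lemma enn_powr_ennreal: "x \<ge> 0 \<Longrightarrow> enn_powr (ennreal x) a = ennreal (x powr a)"
 by (simp add: enn_powr_def)

lemma enn_powr_less_top: "enn_powr x a < \<infinity> \<longleftrightarrow> x < \<infinity>"
 by (auto simp: enn_powr_def less_top)

lemma Lp_space_iff:
 "f \<in> Lp_space M p \<longleftrightarrow> strongly_measurable M f \<and> (\<integral>\<^sup>+x. ennreal (norm (f x) powr p) \<partial>M) < \<infinity>"
 by (simp only: Lp_space_def Lp_norm_def enn_powr_less_top mem_Collect_eq)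

lemma weak_Lp_normD:
 assumes le: "weak_Lp_norm M p g \<le> ennreal c" and "c \<ge> 0" "p > 0" "l > 0"
 shows "emeasure M (superlevel M g l) \<le> ennreal ((c / l) powr p)"
proof -
 let ?m = "emeasure M (superlevel M g l)"
 have "ennreal l * enn_powr ?m (1/p) \<le> weak_Lp_norm M p g"
  unfolding weak_Lp_norm_def using \<open>l > 0\<close> by (intro SUP_upper) auto
 then have *: "ennreal l * enn_powr ?m (1/p) \<le> ennreal c" using le by (rule order_trans)
 show ?thesis
 proof (cases ?m)
  case (real r)
  then have "ennreal (l * r powr (1/p)) \<le> ennreal c" using * assms by (simp add: enn_powr_ennreal ennreal_mult)
  then have "r powr (1/p) \<le> c / l" using assms by (simp add: field_simps)
  then have "(r powr (1/p)) powr p \<le> (c / l) powr p" using assms by (intro powr_mono2) auto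
  then show ?thesis using real assms by (simp add: powr_powr ennreal_leI)
 next
  case top
  then show ?thesis using * assms by (simp add: enn_powr_def ennreal_mult_top top_unique)
 qed
qed

lemma weak_L1_normI:
 assumes "\<And>l. l > 0 \<Longrightarrow> emeasure M (superlevel M g l) \<le> ennreal (c / l) * N" "c \<ge> 0"
 shows "weak_Lp_norm M 1 g \<le> ennreal c * N"
 unfolding weak_Lp_norm_def
proof (rule SUP_least)
 fix l :: real assume "l \<in> {0<..}"
 then have l: "l > 0" by simp
 have "ennreal l * enn_powr (emeasure M (superlevel M g l)) (1/1) \<le> ennreal l * (ennreal (c / l) * N)"
  using assms(1)[OF l] by (simp add: mult_left_mono)
 also have "... = ennreal (l * (c / l)) * N" using l assms(2) by (simp only: ennreal_mult mult.assoc divide_nonneg_pos less_imp_le)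
 finally show "ennreal l * enn_powr (emeasure M (superlevel M g l)) (1/1) \<le> ennreal c * N" using l by simp
qed

lemma emeasure_levels_cong:
 assumes "strongly_measurable M f" "strongly_measurable M g" "AE s in M. f s = g s"
 shows "emeasure M (superlevel M f l) = emeasure M (superlevel M g l)"
proof (rule emeasure_eq_AE)
 show "AE s in M. (s \<in> superlevel M f l) = (s \<in> superlevel M g l)"
  using assms(3) by eventually_elim simp
qed (use assms in \<open>auto intro: strongly_measurable_norm_le\<close>)

lemma C_T_finite:
 fixes T :: "('a \<Rightarrow> 'b::banach) \<Rightarrow> ('a \<Rightarrow> 'c::banach)"
 assumes "dini_operator M d p0 T K \<omega> c_K"
 shows "C_T M p0 T \<omega> < \<infinity>"
proof -
 obtain Bd where Bd: "\<And>f. f \<in> Lp_space M p0 \<Longrightarrow> weak_Lp_norm M p0 (T f) \<le> ennreal Bd * Lp_norm M p0 f"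
  using assms unfolding dini_operator_def bounded_linear_operator_def by blast
 have "op_norm (Lp_space M p0) (Lp_norm M p0) (weak_Lp_norm M p0) T \<le> ennreal Bd"
  unfolding op_norm_def
 proof (rule SUP_least)
  fix f :: "'a \<Rightarrow> 'b" assume f: "f \<in> {f \<in> Lp_space M p0. Lp_norm M p0 f \<le> 1}"
  have "weak_Lp_norm M p0 (T f) \<le> ennreal Bd * Lp_norm M p0 f" using f Bd by simp
  also have "... \<le> ennreal Bd * 1" using f by (intro mult_left_mono) auto
  finally show "weak_Lp_norm M p0 (T f) \<le> ennreal Bd" by simp
 qed
 moreover have "dini_norm \<omega> < \<infinity>" using assms dini_kernel.dini_finite unfolding dini_operator_def by blast
 ultimately show ?thesis unfolding C_T_def using le_less_trans[OF _ ennreal_less_top] by simp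
qed

text \<open>The operator norm is a supremum over the unit ball, so \<open>f\<close> is divided by
  its norm. A function of norm zero is handled by the bound contained in
  \<open>bounded_linear_operator\<close>.\<close>

lemma dini_operator_weak_type:
 assumes op: "dini_operator M d p0 T K \<omega> c_K" and p0: "p0 \<ge> 1" and CT: "C_T M p0 T \<omega> \<le> ennreal \<kappa>" "\<kappa> \<ge> 0"
  and f: "f \<in> Lp_space M p0" and l: "l > 0"
 shows "emeasure M (superlevel M (T f) l) \<le> ennreal ((\<kappa> / l) powr p0) * (\<integral>\<^sup>+x. ennreal (norm (f x) powr p0) \<partial>M)"
proof -
 have bl: "bounded_linear_operator M (Lp_space M p0) (Lp_norm M p0) (weak_Lp_norm M p0) T"
  using op by (simp add: dini_operator_def)
 obtain i where i: "(\<integral>\<^sup>+x. ennreal (norm (f x) powr p0) \<partial>M) = ennreal i" "i \<ge> 0"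
  using f by (cases "\<integral>\<^sup>+x. ennreal (norm (f x) powr p0) \<partial>M") (auto simp: Lp_space_iff)
 have sm: "strongly_measurable M f" using f by (simp add: Lp_space_iff)
 have [measurable]: "(\<lambda>x. norm (f x)) \<in> borel_measurable M" by (rule strongly_measurable_norm[OF sm])
 show ?thesis
 proof (cases "i = 0")
  case True
  obtain Bd where "\<And>f. f \<in> Lp_space M p0 \<Longrightarrow> weak_Lp_norm M p0 (T f) \<le> ennreal Bd * Lp_norm M p0 f"
   using bl unfolding bounded_linear_operator_def by blast
  then have "weak_Lp_norm M p0 (T f) \<le> ennreal Bd * Lp_norm M p0 f" using f by blast
  also have "Lp_norm M p0 f = 0" using i True by (simp add: Lp_norm_def enn_powr_def)
  finally have "weak_Lp_norm M p0 (T f) \<le> ennreal 0" by simp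
  then show ?thesis using weak_Lp_normD[of M p0 "T f" 0 l] p0 l by simp
 next
  case False
  define n where "n = i powr (1 / p0)"
  have n: "n > 0" "n powr p0 = i" using False i p0 by (auto simp: n_def powr_powr)
  define g where "g x = (1 / n) *\<^sub>R f x" for x
  have "(\<integral>\<^sup>+x. ennreal (norm (g x) powr p0) \<partial>M) = (\<integral>\<^sup>+x. ennreal (1 / i) * ennreal (norm (f x) powr p0) \<partial>M)"
   using n p0 i by (intro nn_integral_cong, subst ennreal_mult[symmetric]) (auto simp: g_def powr_divide)
  also have "... = ennreal (1 / i) * ennreal i" using i by (subst nn_integral_cmult) auto
  also have "... = 1" using i False by (simp flip: ennreal_mult)
  finally have g1: "(\<integral>\<^sup>+x. ennreal (norm (g x) powr p0) \<partial>M) = 1" .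
  have g: "g \<in> Lp_space M p0" 
   unfolding Lp_space_iff g1 using strongly_measurable_scaleR[OF sm, of "1 / n"] by (simp add: g_def[abs_def])
  have "Lp_norm M p0 g \<le> 1" using g1 by (simp add: Lp_norm_def enn_powr_def)
  then have "weak_Lp_norm M p0 (T g) \<le> op_norm (Lp_space M p0) (Lp_norm M p0) (weak_Lp_norm M p0) T"
   unfolding op_norm_def using g by (intro SUP_upper) simp
  also have "... \<le> C_T M p0 T \<omega>" by (simp add: C_T_def)
  finally have "weak_Lp_norm M p0 (T g) \<le> ennreal \<kappa>" using CT(1) by (rule order_trans)
  then have "emeasure M (superlevel M (T g) (l / n)) \<le> ennreal ((\<kappa> / (l / n)) powr p0)"
   using CT p0 l n by (intro weak_Lp_normD) auto
  also have "\<kappa> / (l / n) = \<kappa> / l * n" by simp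
  also have "ennreal ((\<kappa> / l * n) powr p0) = ennreal ((\<kappa> / l) powr p0) * ennreal i"
   using powr_mult[of "\<kappa> / l" n p0] n CT l i by (simp only: ennreal_mult powr_ge_zero n(2))
  finally have le: "emeasure M (superlevel M (T g) (l / n)) \<le> ennreal ((\<kappa> / l) powr p0) * ennreal i" .
  have "AE s in M. T g s = (1 / n) *\<^sub>R T f s"
   using bl f unfolding bounded_linear_operator_def g_def[abs_def] by blast
  then have "emeasure M (superlevel M (T g) (l / n)) = emeasure M {s\<in>space M. norm ((1 / n) *\<^sub>R T f s) > l / n}"
   using bl f g unfolding bounded_linear_operator_def by (intro emeasure_levels_cong strongly_measurable_scaleR) auto
  also have "{s\<in>space M. norm ((1 / n) *\<^sub>R T f s) > l / n} = superlevel M (T f) l"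
   using n by (auto simp: divide_less_cancel)
  finally show ?thesis using le i by simp
 qed
qed

section \<open>Choice of the constants\<close>

context homogeneous_type
begin

text \<open>The ratio \<open>a\<close> of the construction, small at once for the Whitney geometry
  and, by the factor \<open>c_K\<close>, for the smoothness of the kernel.\<close>

definition osc_radius :: "real \<Rightarrow> real" where
 "osc_radius c_K = 1 / (1000 * (c_d\<^sup>2)^8 * c_K)"

definition sparse_ratio :: "real \<Rightarrow> real" where
 "sparse_ratio c_K = 1 / (2 * dbl c_mu (1 / osc_radius c_K))"

text \<open>The density threshold \<tau>. The factor \<open>dbl\<close> is lost between the ball at
  an exit point and the small ball of the child; dividing by 8 stays below \<open>1/4\<close> and
  makes \<tau> less than 1.\<close>

definition small_fraction :: "real \<Rightarrow> real" where
 "small_fraction c_K = 1 / (8 * dbl c_mu (1 / (c_d\<^sup>2 * osc_radius c_K)))"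

text \<open>The relative size \<epsilon> of the exceptional sets, solved from the smallness
  condition of \<open>whitney_step\<close>; it is also at most \<open>1/4\<close>.\<close>

definition small_level :: "real \<Rightarrow> real" where
 "small_level c_K = small_fraction c_K /
   (4 * (dq 5 * dq 3 * dbl c_mu (1 / osc_radius c_K)))"

text \<open>The passage from test functions to the extension doubles the weak type constant.\<close>

definition weak_const :: "real \<Rightarrow> real \<Rightarrow> real" where
 "weak_const c_K p0 = 2 * cz_const p0 (osc_radius c_K)"

text \<open>The stopping height \<open>A\<close>, solved from the condition in
  \<open>bad_set\<close>.\<close>

definition stop_const :: "real \<Rightarrow> real \<Rightarrow> real" where
 "stop_const c_K p0 = max 1 ((weak_const c_K p0 + dq 5) * dbl c_mu (1 / osc_radius c_K) / small_level c_K)"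

definition domination_const :: "real \<Rightarrow> real \<Rightarrow> real" where
 "domination_const c_K p0 = stop_const c_K p0 *
   (1 + (4 * dq 6 + stop_const c_K p0) * dq 4)"

text \<open>The interface of the proof: the bound by cubes and the weighted bound are both deduced
  from this property, without a return to the kernel.\<close>

definition ball_dominated :: "real \<Rightarrow> real \<Rightarrow> (('a \<Rightarrow> 'b::real_normed_vector) \<Rightarrow> 'a \<Rightarrow> 'c::real_normed_vector) \<Rightarrow> bool" where
 "ball_dominated \<eta> C T1 \<longleftrightarrow> (\<forall>f\<in>Lp_space M 1. boundedly_supported M d f \<longrightarrow>
   (\<exists>(J :: (nat \<times> 'a) set) r E. countable J \<and> (\<forall>j\<in>J. snd j \<in> space M \<and> r j > 0 \<and> E j \<in> sets M \<and>
    E j \<subseteq> B (snd j) (r j) \<and> measure M (E j) \<ge> \<eta> * V (snd j) (r j)) \<and> disjoint_family_on E J \<and>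
   (AE s in M. \<exists>F\<subseteq>J. finite F \<and> (\<forall>j\<in>F. s \<in> B (snd j) (r j)) \<and>
    norm (T1 f s) \<le> C * (\<Sum>j\<in>F. avg f (snd j) (r j)))))"

lemma cz_const_pos: "cz_const p a > 0"
 unfolding cz_const_def using dbl_pos[of "5 * c_d\<^sup>2"] dbl_pos[of "3 * c_d\<^sup>2"] dbl_pos[of "4 * c_d"]
 by (intro add_pos_pos add_nonneg_pos mult_pos_pos mult_nonneg_nonneg) auto

lemma domination_const_pos: "domination_const c_K p0 > 0"
proof -
 have "stop_const c_K p0 \<ge> 1" by (simp add: stop_const_def)
 then show ?thesis unfolding domination_const_def
  using dbl_pos[of "6 * c_d\<^sup>2"] dbl_pos[of "4 * c_d\<^sup>2"]
  by (intro mult_pos_pos add_pos_nonneg mult_nonneg_nonneg add_nonneg_nonneg) auto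
qed

lemma sparse_ratio_bounds: "sparse_ratio c_K > 0" "sparse_ratio c_K < 1"
 using dbl_ge_1[of "1 / osc_radius c_K"] by (auto simp: sparse_ratio_def)

section \<open>The extension of a Dini operator\<close>

context
 fixes K :: "'a \<Rightarrow> 'a \<Rightarrow> 'b::banach \<Rightarrow>\<^sub>L 'c::banach" and \<omega> :: "real \<Rightarrow> real" and c_K p0 \<kappa> :: real
  and T :: "('a \<Rightarrow> 'b) \<Rightarrow> ('a \<Rightarrow> 'c)"
 assumes op: "dini_operator M d p0 T K \<omega> c_K" and p0: "p0 \<ge> 1" and \<kappa>: "\<kappa> > 0" and CT: "C_T M p0 T \<omega> \<le> ennreal \<kappa>"
  and ne: "space M \<noteq> {}"
begin

lemma dini: "dini_kernel M d K \<omega> c_K" and c_K: "c_K \<ge> 2"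
 using op by (auto simp: dini_operator_def dini_kernel_def)

lemma osc_radius:
 "osc_radius c_K > 0" "1000 * (c_d\<^sup>2)^8 * osc_radius c_K \<le> 1" "5 * (c_d\<^sup>2)^3 * osc_radius c_K * c_K \<le> 1"
 "4 * c_d\<^sup>2 * c_K * (5 * (c_d\<^sup>2)^3 * osc_radius c_K) \<le> 1" "c_d * (5 * (c_d\<^sup>2)^3 * osc_radius c_K) \<le> 1/2"
proof -
 define q where "q = c_d\<^sup>2"
 have q: "q \<ge> 1" "c_d \<le> q" using cd2 by (auto simp: q_def)
 have q8: "q^8 > 0" "q^3 \<le> q^8" "q^4 \<le> q^8" using q by (auto intro: power_increasing)
 then have q38: "q^3 \<le> 200 * q^8" "q^4 \<le> 50 * q^8" by linarith+
 have a: "osc_radius c_K = 1 / (1000 * q^8 * c_K)" by (simp add: osc_radius_def q_def)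
 have kq: "1000 * q^8 * c_K > 0" using q8 c_K by simp
 show "osc_radius c_K > 0" using kq by (simp add: a)
 show "1000 * (c_d\<^sup>2)^8 * osc_radius c_K \<le> 1" using q8 c_K by (simp add: a q_def[symmetric])
 show "5 * (c_d\<^sup>2)^3 * osc_radius c_K * c_K \<le> 1" using q8(1) q38 c_K by (simp add: a q_def[symmetric])
 have "4 * q * c_K * (5 * q^3 * osc_radius c_K) = 20 * q^4 / (1000 * q^8)"
  using c_K by (simp add: a power_numeral_reduce)
 also have "... \<le> 1" using q8(1) q38 by simp
 finally show "4 * c_d\<^sup>2 * c_K * (5 * (c_d\<^sup>2)^3 * osc_radius c_K) \<le> 1" by (simp only: q_def)
 have "c_d * (5 * q^3 * osc_radius c_K) \<le> q * (5 * q^3 * osc_radius c_K)"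
  using q kq by (intro mult_right_mono) (auto simp: a)
 also have "... = 5 * q^4 / (1000 * q^8 * c_K)" by (simp add: a power_numeral_reduce)
 also have "... \<le> 5 * q^8 / (1000 * q^8 * 2)" using q8 c_K by (intro frac_le mult_left_mono) auto
 also have "... \<le> 1/2" using q8 by simp
 finally show "c_d * (5 * (c_d\<^sup>2)^3 * osc_radius c_K) \<le> 1/2" by (simp only: q_def)
qed

lemma V0_Lp: "g \<in> V0 \<Longrightarrow> g \<in> Lp_space M p0"
 using V0_Lp_integral[of g p0] p0 by (simp add: Lp_space_iff V0_strongly_measurable)

lemma T_meas: "g \<in> Lp_space M p0 \<Longrightarrow> strongly_measurable M (T g)"
 and T_add: "f \<in> Lp_space M p0 \<Longrightarrow> g \<in> Lp_space M p0 \<Longrightarrow> AE s in M. T (\<lambda>x. f x + g x) s = T f s + T g s"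
 and T_scale: "f \<in> Lp_space M p0 \<Longrightarrow> AE s in M. T (\<lambda>x. c *\<^sub>R f x) s = c *\<^sub>R T f s"
 using op by (auto simp: dini_operator_def bounded_linear_operator_def)

lemma dini_le: "dini_norm \<omega> \<le> ennreal \<kappa>"
proof -
 have "dini_norm \<omega> \<le> C_T M p0 T \<omega>" by (simp add: C_T_def)
 then show ?thesis using CT by (rule order_trans)
qed

text \<open>A ball on which \<open>g\<close> vanishes contains the open neighbourhood
  \<open>U s e\<close> of \<open>s\<close>, so \<open>s\<close> is outside the closure of the
  support.\<close>

lemma T_kernel:
 assumes g: "g \<in> V0"
 shows "AE s in M. (\<exists>e>0. \<forall>t\<in>B s e. g t = 0) \<longrightarrow> has_strong_bochner_integral M (\<lambda>t. K s t (g t)) (T g s)"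
proof -
 have "AE s in M. s \<notin> qtopology M d closure_of {t \<in> space M. g t \<noteq> 0} \<longrightarrow>
      has_strong_bochner_integral M (\<lambda>t. blinfun_apply (K s t) (g t)) (T g s)"
  using op V0_Lp[OF g] g unfolding dini_operator_def has_kernel_def V0_def by blast
 then show ?thesis using AE_space
 proof eventually_elim
  fix s assume h: "s \<notin> qtopology M d closure_of {t \<in> space M. g t \<noteq> 0} \<longrightarrow>
      has_strong_bochner_integral M (\<lambda>t. blinfun_apply (K s t) (g t)) (T g s)" and s: "s \<in> space M"
  show "(\<exists>e>0. \<forall>t\<in>B s e. g t = 0) \<longrightarrow> has_strong_bochner_integral M (\<lambda>t. K s t (g t)) (T g s)"
  proof
   assume "\<exists>e>0. \<forall>t\<in>B s e. g t = 0"
   then obtain e where e: "e > 0" "\<forall>t\<in>B s e. g t = 0" by blast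
   have "s \<notin> qtopology M d closure_of {t \<in> space M. g t \<noteq> 0}"
   proof
    assume "s \<in> qtopology M d closure_of {t \<in> space M. g t \<noteq> 0}"
    then obtain y where "y \<in> U s e" "g y \<noteq> 0"
     unfolding in_closure_of using U_open[of s e] U_center[OF s e(1)] by blast
    then show False using e U_subset by blast
   qed
   then show "has_strong_bochner_integral M (\<lambda>t. K s t (g t)) (T g s)" using h by blast
  qed
 qed
qed

abbreviation "W \<equiv> cz_const p0 (osc_radius c_K) * \<kappa>"

lemma W_pos: "W > 0" using cz_const_pos \<kappa> by simp

lemma T_weak:
 assumes g: "g \<in> V0" and l: "l > 0"
 shows "emeasure M (superlevel M (T g) l) \<le> ennreal (W / l) * L1_mass M g"
proof -
 have "emeasure M (superlevel M (T g) l) \<le> ennreal (W / l) * emeasure (nu M g) (space M)"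
  by (rule weak_type_test[OF dini p0 \<kappa> dini_le osc_radius(1-3) T_meas[OF V0_Lp] T_add[OF V0_Lp V0_Lp]
   dini_operator_weak_type[OF op p0 CT less_imp_le[OF \<kappa>] V0_Lp] T_kernel g l])
 then show ?thesis by (simp only: emeasure_nu_space[OF V0_strongly_measurable[OF g]])
qed

lemmas ext_assms = ne W_pos T_meas[OF V0_Lp] T_add[OF V0_Lp V0_Lp] T_weak

abbreviation "T1 \<equiv> T_ext T W"

lemma T1_meas: "f \<in> Lp_space M 1 \<Longrightarrow> strongly_measurable M (T1 f)"
 by (rule T_ext(1)[OF ext_assms])

lemma T1_add: "f \<in> Lp_space M 1 \<Longrightarrow> g \<in> Lp_space M 1 \<Longrightarrow> AE s in M. T1 (\<lambda>x. f x + g x) s = T1 f s + T1 g s"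
 by (rule T_ext_add[OF ext_assms])

lemma T1_weak:
 assumes "f \<in> Lp_space M 1" "l > 0"
 shows "emeasure M (superlevel M (T1 f) l) \<le> ennreal (2 * W / l) * L1_mass M f"
 by (rule T_ext_weak[OF ext_assms assms])

lemma T1_weak_nu:
 assumes f: "f \<in> Lp_space M 1" and l: "l > 0"
 shows "emeasure M (superlevel M (T1 f) l) \<le> ennreal (weak_const c_K p0 * \<kappa> / l) * emeasure (nu M f) (space M)"
proof -
 have "strongly_measurable M f" using f by (simp add: L1_iff)
 moreover have "weak_const c_K p0 * \<kappa> = 2 * W" by (simp add: weak_const_def)
 ultimately show ?thesis using T1_weak[OF f l] by (simp only: emeasure_nu_space)
qed

text \<open>One test function is close to \<open>f\<close> both in the mean and at
  \<open>p0\<close>. The second closeness puts its image near \<open>T f\<close> in measure, and the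
  uniqueness of the extension does the rest.\<close>

lemma T1_eq:
 assumes f1: "f \<in> Lp_space M 1" and f0: "f \<in> Lp_space M p0"
 shows "AE s in M. T1 f s = T f s"
proof -
 have near: "\<exists>g\<in>V0. (L1_dist M f g) \<le> ennreal e \<and>
   emeasure M (superlevel M (\<lambda>s. T g s - T f s) l) \<le> ennreal (1 * e / l)" if el: "e > 0" "l > 0" for e l :: real
 proof -
 have sm: "strongly_measurable M f" using f1 by (simp add: L1_iff)
 obtain G where G: "\<And>n. G n \<in> V0" "\<And>n x. x \<in> space M \<Longrightarrow> norm (G n x) \<le> 2 * norm (f x)"
  "\<And>p. p > 0 \<Longrightarrow> (\<integral>\<^sup>+x. ennreal (norm (f x) powr p) \<partial>M) < \<infinity> \<Longrightarrow> (\<lambda>n. \<integral>\<^sup>+x. ennreal (norm (f x - G n x) powr p) \<partial>M) \<longlonglongrightarrow> 0"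
  by (rule V0_dense[OF ne sm]) (rule that)
 define c where "c = (\<kappa> / l) powr p0"
 have c: "c > 0" using \<kappa> el by (simp add: c_def)
 have "(\<lambda>n. \<integral>\<^sup>+x. enorm (f x - G n x) \<partial>M) \<longlonglongrightarrow> 0"
  using G(3)[of 1] f1 by (simp add: L1_iff)
 then have ev1: "\<forall>\<^sub>F n in sequentially. (L1_dist M f (G n)) < ennreal e"
  using el by (intro order_tendstoD(2)) auto
 have "(\<lambda>n. \<integral>\<^sup>+x. ennreal (norm (f x - G n x) powr p0) \<partial>M) \<longlonglongrightarrow> 0"
  using G(3)[of p0] f0 p0 by (simp add: Lp_space_iff)
 then have ev2: "\<forall>\<^sub>F n in sequentially. (\<integral>\<^sup>+x. ennreal (norm (f x - G n x) powr p0) \<partial>M) < ennreal (e / l / c)"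
  using el c by (intro order_tendstoD(2)) auto
 obtain n where n1: "L1_dist M f (G n) < ennreal e"
  and n2: "(\<integral>\<^sup>+x. ennreal (norm (f x - G n x) powr p0) \<partial>M) < ennreal (e / l / c)"
  using eventually_happens[OF eventually_conj[OF ev1 ev2]] by auto
 note Gn = V0_Lp[OF G(1), of n]
 \<comment> \<open>Additivity and homogeneity are what is given, so the difference is formed as a
   sum with a multiple by -1.\<close>
 have mG: "(\<lambda>x. (-1) *\<^sub>R G n x) \<in> Lp_space M p0" using V0_Lp[OF V0_scaleR[OF G(1)]] .
 have df: "(\<lambda>x. f x + (-1) *\<^sub>R G n x) \<in> Lp_space M p0"
  using n2 strongly_measurable_diff[OF sm V0_strongly_measurable[OF G(1)], of n] less_trans[OF n2 ennreal_less_top]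
  by (simp add: Lp_space_iff)
 have eq: "AE s in M. T (\<lambda>x. f x + (-1) *\<^sub>R G n x) s = (-1) *\<^sub>R (T (G n) s - T f s)"
  using T_add[OF f0 mG] T_scale[OF Gn, of "-1"] by eventually_elim simp
 have "emeasure M {s\<in>space M. norm (T (G n) s - T f s) > l} = emeasure M {s\<in>space M. norm ((-1) *\<^sub>R (T (G n) s - T f s)) > l}"
  by (simp only: norm_scaleR abs_neg_one mult_1)
 also have "... = emeasure M {s\<in>space M. norm (T (\<lambda>x. f x + (-1) *\<^sub>R G n x) s) > l}"
  using eq T_meas[OF df] T_meas[OF f0] T_meas[OF Gn]
  by (intro emeasure_levels_cong[symmetric] strongly_measurable_scaleR strongly_measurable_diff) auto
 also have "... \<le> ennreal c * (\<integral>\<^sup>+x. ennreal (norm (f x - G n x) powr p0) \<partial>M)"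
  using dini_operator_weak_type[OF op p0 CT less_imp_le[OF \<kappa>] df el(2)] by (simp add: c_def)
 also have "... \<le> ennreal c * ennreal (e / l / c)" using n2 by (intro mult_left_mono) auto
 also have "... = ennreal (1 * e / l)" using c el by (subst ennreal_mult[symmetric]) auto
 finally show "\<exists>g\<in>V0. (L1_dist M f g) \<le> ennreal e \<and>
   emeasure M (superlevel M (\<lambda>s. T g s - T f s) l) \<le> ennreal (1 * e / l)"
  using G(1)[of n] n1 by (intro bexI[of _ "G n"]) auto
 qed
 show ?thesis by (rule T_ext_unique[OF ext_assms f1 T_meas[OF f0] zero_less_one near])
qed

lemma T1_extension: "is_L1_extension M p0 T T1"
 unfolding is_L1_extension_def bounded_linear_operator_def
proof (intro conjI ballI allI)
 fix f :: "'a \<Rightarrow> 'b" assume f: "f \<in> Lp_space M 1"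
 show "strongly_measurable M (T1 f)" by (rule T1_meas[OF f])
 show "AE s in M. T1 (\<lambda>x. c *\<^sub>R f x) s = c *\<^sub>R T1 f s" for c
  by (rule T_ext_scaleR[OF ext_assms f T_scale[OF V0_Lp]])
 show "AE s in M. T1 (\<lambda>x. f x + g x) s = T1 f s + T1 g s" if "g \<in> Lp_space M 1" for g
  by (rule T1_add[OF f that])
next
 show "\<exists>Bd. \<forall>f\<in>Lp_space M 1. weak_Lp_norm M 1 (T1 f) \<le> ennreal Bd * Lp_norm M 1 f"
 proof (intro exI ballI)
  fix f :: "'a \<Rightarrow> 'b" assume f: "f \<in> Lp_space M 1"
  show "weak_Lp_norm M 1 (T1 f) \<le> ennreal (2 * W) * Lp_norm M 1 f"
   unfolding Lp_norm_1 using W_pos by (intro weak_L1_normI T1_weak[OF f]) auto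
 qed
qed (use T1_eq in blast)

text \<open>The kernel formula is known for test functions, so the estimate is made for approximants
  and passed to the limit at almost every point. They have at most twice the mass of
  \<open>f\<close>, hence 4 where \<open>kernel_oscillation\<close> has 2.\<close>

lemma T1_oscillation:
 assumes f: "f \<in> Lp_space M 1" and z: "z \<in> space M" and r: "r > 0" and f0: "\<forall>x\<in>B z r. f x = 0"
  and A: "A \<ge> 0" "\<forall>R\<ge>r. measure (nu M f) (B z R) \<le> A * V z R"
 shows "\<exists>N\<in>null_sets M. \<forall>y\<in>B z (5 * (c_d\<^sup>2)^3 * osc_radius c_K * r) - N. \<forall>y'\<in>B z (5 * (c_d\<^sup>2)^3 * osc_radius c_K * r) - N.
     norm (T1 f y - T1 f y') \<le> 4 * dq 6 * \<kappa> * A"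
proof -
 define b where "b = 5 * (c_d\<^sup>2)^3 * osc_radius c_K"
 have b: "b > 0" "4 * c_d\<^sup>2 * c_K * b \<le> 1" "c_d * b \<le> 1/2"
 proof -
  have "c_d > 0" using c_d by simp
  then show "b > 0" using osc_radius(1) by (simp add: b_def)
 qed (use osc_radius in \<open>simp_all only: b_def\<close>)
 obtain G where G: "\<And>n. G n \<in> V0" "\<And>n x. x \<in> space M \<Longrightarrow> norm (G n x) \<le> 2 * norm (f x)"
  and lim: "AE s in M. (\<lambda>n. T (G n) s) \<longlonglongrightarrow> T1 f s"
  by (rule T_ext_approx[OF ext_assms f]; (assumption | rule that))
 have "AE s in M. \<forall>n. (\<exists>e>0. \<forall>t\<in>B s e. G n t = 0) \<longrightarrow> has_strong_bochner_integral M (\<lambda>t. K s t (G n t)) (T (G n) s)"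
  unfolding AE_all_countable using T_kernel[OF G(1)] by blast
 then have "AE s in M. (\<forall>n. (\<exists>e>0. \<forall>t\<in>B s e. G n t = 0) \<longrightarrow> has_strong_bochner_integral M (\<lambda>t. K s t (G n t)) (T (G n) s))
   \<and> (\<lambda>n. T (G n) s) \<longlonglongrightarrow> T1 f s"
  using lim by (rule AE_conjI)
 then obtain N where good: "\<And>s. s \<in> space M - N \<Longrightarrow>
   (\<forall>n. (\<exists>e>0. \<forall>t\<in>B s e. G n t = 0) \<longrightarrow> has_strong_bochner_integral M (\<lambda>t. K s t (G n t)) (T (G n) s))
   \<and> (\<lambda>n. T (G n) s) \<longlonglongrightarrow> T1 f s" and N: "N \<in> null_sets M"
  by (rule AE_E3) (rule that)
 have G0: "G n x = 0" if "x \<in> B z r" for n x using G(2)[of x n] f0 that by (auto simp: mem_B)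
 \<comment> \<open>Since \<open>c_d * b \<le> 1/2\<close>, a ball of radius
   \<open>r / (2 * c_d)\<close> around \<open>y\<close> stays in \<open>B z r\<close>, where the
   approximants vanish.\<close>
 have rep: "has_strong_bochner_integral M (\<lambda>t. K y t (G n t)) (T (G n) y)" if "y \<in> B z (b * r) - N" for y n
 proof -
  have y: "y \<in> space M" "d z y \<le> b * r" using that by (auto simp: mem_B)
  have "c_d * (b * r + r / (2 * c_d)) = c_d * b * r + r / 2" using c_d by (simp add: distrib_left)
  also have "... \<le> 1/2 * r + r / 2" using b r by (intro add_right_mono mult_right_mono) auto
  finally have "B y (r / (2 * c_d)) \<subseteq> B z r" using y z by (intro B_subset) auto
  then have "\<forall>t\<in>B y (r / (2 * c_d)). G n t = 0" using G0 by blast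
  moreover have "r / (2 * c_d) > 0" using r c_d by simp
  ultimately show ?thesis using good[of y] that y by blast
 qed
 have nuG: "measure (nu M (G n)) (B z R) \<le> 2 * A * V z R" if R: "R \<ge> r" for n R
 proof -
  have sm: "strongly_measurable M (G n)" "strongly_measurable M f" using G(1) V0_strongly_measurable f by (auto simp: L1_iff)
  have Bz: "B z R \<in> sets M" using z by simp
  have [measurable]: "(\<lambda>x. norm (f x)) \<in> borel_measurable M" by (rule strongly_measurable_norm[OF sm(2)])
  have "emeasure (nu M (G n)) (B z R) \<le> (\<integral>\<^sup>+x. ennreal 2 * (enorm (f x) * indicator (B z R) x) \<partial>M)"
   unfolding emeasure_nu[OF sm(1) Bz]
  proof (rule nn_integral_mono)
   fix x assume "x \<in> space M"
   then have "enorm (G n x) \<le> ennreal 2 * enorm (f x)"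
    using G(2)[of x n] by (subst ennreal_mult[symmetric]) (auto intro: ennreal_leI)
   then show "enorm (G n x) * indicator (B z R) x \<le> ennreal 2 * (enorm (f x) * indicator (B z R) x)"
    by (simp add: indicator_def)
  qed
  also have "... = ennreal 2 * emeasure (nu M f) (B z R)"
   unfolding emeasure_nu[OF sm(2) Bz] using Bz by (intro nn_integral_cmult) auto
  finally have "ennreal (measure (nu M (G n)) (B z R)) \<le> ennreal (2 * measure (nu M f) (B z R))"
   using finite_measure.emeasure_eq_measure[OF finite_measure_nu[OF f]]
    finite_measure.emeasure_eq_measure[OF finite_measure_nu[OF V0_L1[OF G(1)]]] by (simp add: ennreal_mult)
  then have "measure (nu M (G n)) (B z R) \<le> 2 * measure (nu M f) (B z R)" by simp
  also have "... \<le> 2 * (A * V z R)" using A(2) R by (intro mult_left_mono) auto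
  finally show ?thesis by simp
 qed
 have bound: "norm (T (G n) y - T (G n) y') \<le> 4 * dq 6 * \<kappa> * A"
  if y: "y \<in> B z (b * r) - N" "y' \<in> B z (b * r) - N" for y y' n
 proof -
  have "enorm (T (G n) y - T (G n) y') \<le> (\<integral>\<^sup>+t. enorm (K y t (G n t) - K y' t (G n t)) \<partial>M)"
   using rep y by (intro has_strong_bochner_integral_diff_le) auto
  also have "... \<le> ennreal (2 * dq 6 * (2 * A)) * dini_norm \<omega>"
   using A nuG y b by (intro kernel_oscillation[OF dini V0_L1[OF G(1)] z r G0 _ _ b(1,2)]) auto
  also have "... \<le> ennreal (2 * dq 6 * (2 * A)) * ennreal \<kappa>" using dini_le by (rule mult_left_mono) simp
  also have "... = ennreal (4 * dq 6 * \<kappa> * A)"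
   using A \<kappa> dbl_pos[of "6 * c_d\<^sup>2"] by (subst ennreal_mult[symmetric]) (auto simp: mult_ac)
  finally show ?thesis using A \<kappa> dbl_pos[of "6 * c_d\<^sup>2"] by (subst (asm) ennreal_le_iff) auto
 qed
 show ?thesis
 proof (intro bexI[OF _ N] ballI)
  fix y y' assume y: "y \<in> B z (5 * (c_d\<^sup>2)^3 * osc_radius c_K * r) - N" "y' \<in> B z (5 * (c_d\<^sup>2)^3 * osc_radius c_K * r) - N"
  then have yb: "y \<in> B z (b * r) - N" "y' \<in> B z (b * r) - N" by (simp_all add: b_def)
  then have "(\<lambda>n. norm (T (G n) y - T (G n) y')) \<longlonglongrightarrow> norm (T1 f y - T1 f y')"
   using good[of y] good[of y'] by (intro tendsto_norm tendsto_diff) (auto simp: mem_B)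
  then show "norm (T1 f y - T1 f y') \<le> 4 * dq 6 * \<kappa> * A"
   using bound[OF yb] by (intro LIMSEQ_le_const2) auto
 qed
qed

text \<open>Once the weak type and oscillation bounds are known, what remains is to check that the
  chosen constants meet the smallness conditions of \<open>ball_sparse_domination\<close>.\<close>

lemma T1_ball_dominated: "ball_dominated (sparse_ratio c_K) (domination_const c_K p0 * \<kappa>) T1"
proof -
 have d1: "dq 5 \<ge> 1" "dq 3 \<ge> 1" "dbl c_mu (1 / osc_radius c_K) \<ge> 1"
  "dbl c_mu (1 / (c_d\<^sup>2 * osc_radius c_K)) \<ge> 1" "dq 6 \<ge> 1" by (rule dbl_ge_1)+
 define P where "P = dq 5 * dq 3 * dbl c_mu (1 / osc_radius c_K)"
 have "1 * 1 * 1 \<le> P" unfolding P_def using d1 by (intro mult_mono) auto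
 then have P: "P \<ge> 1" by simp
 have \<tau>: "small_fraction c_K > 0" "small_fraction c_K < 1"
  "small_fraction c_K * dbl c_mu (1 / (c_d\<^sup>2 * osc_radius c_K)) \<le> 1/4"
  using d1(4) by (auto simp: small_fraction_def)
 have lev: "small_level c_K = small_fraction c_K / (4 * P)" by (simp add: small_level_def P_def)
 have \<epsilon>: "small_level c_K > 0" using \<tau> P by (simp add: lev)
 have "small_level c_K \<le> 1 / (4 * 1)" unfolding lev using \<tau> P by (intro frac_le) auto
 then have \<epsilon>2: "small_level c_K \<le> 1/4" by simp
 have "dq 5 * dq 3 / small_fraction c_K * small_level c_K * dbl c_mu (1 / osc_radius c_K)
   = P / small_fraction c_K * small_level c_K" by (simp add: P_def)
 also have "... \<le> 1/2" using \<tau> P by (simp add: lev)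
 finally have \<epsilon>3: "dq 5 * dq 3 / small_fraction c_K * small_level c_K * dbl c_mu (1 / osc_radius c_K) \<le> 1/2" .
 have A: "stop_const c_K p0 \<ge> 1" by (simp add: stop_const_def)
 have "(weak_const c_K p0 + dq 5) * dbl c_mu (1 / osc_radius c_K) / small_level c_K \<le> stop_const c_K p0"
  by (simp add: stop_const_def)
 then have A2: "(weak_const c_K p0 + dq 5) * dbl c_mu (1 / osc_radius c_K) \<le> stop_const c_K p0 * small_level c_K"
  using \<epsilon> by (simp add: pos_divide_le_eq)
 have C1: "weak_const c_K p0 \<ge> 0" using cz_const_pos[of p0 "osc_radius c_K"] by (simp add: weak_const_def)
 have C2: "4 * dq 6 \<ge> 0" using d1 by simp
 show ?thesis
  unfolding ball_dominated_def
 proof (intro ballI impI)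
  fix f :: "'a \<Rightarrow> 'b" assume f: "f \<in> Lp_space M 1" and supp: "boundedly_supported M d f"
  show "\<exists>(J :: (nat \<times> 'a) set) r E. countable J \<and> (\<forall>j\<in>J. snd j \<in> space M \<and> r j > 0 \<and> E j \<in> sets M \<and>
    E j \<subseteq> B (snd j) (r j) \<and> measure M (E j) \<ge> sparse_ratio c_K * V (snd j) (r j)) \<and> disjoint_family_on E J \<and>
   (AE s in M. \<exists>F\<subseteq>J. finite F \<and> (\<forall>j\<in>F. s \<in> B (snd j) (r j)) \<and>
    norm (T1 f s) \<le> domination_const c_K p0 * \<kappa> * (\<Sum>j\<in>F. avg f (snd j) (r j)))"
   apply (rule ball_sparse_domination[of "osc_radius c_K" \<kappa> "weak_const c_K p0" "4 * dq 6" T1 f "small_fraction c_K" "small_level c_K" "stop_const c_K p0", OF osc_radius(1,2) \<kappa> C1 C2 T1_meas T1_add T1_weak_nu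
     T1_oscillation f supp \<tau> \<epsilon> \<epsilon>2 \<epsilon>3 A A2, folded sparse_ratio_def domination_const_def])
   apply (assumption | rule f)+
   subgoal for J r E by (intro exI[of _ J] exI[of _ r] exI[of _ E]) (simp add: domination_const_def)
   done
 qed
qed

end

end

lemma strongly_measurable_density: "strongly_measurable (density M g) f \<longleftrightarrow> strongly_measurable M f"
 by (simp add: strongly_measurable_def simple_function_def)

lemma sum_le_infsum_ennreal:
 fixes g :: "'i \<Rightarrow> ennreal"
 assumes "finite F" "F \<subseteq> A"
 shows "sum g F \<le> infsum g A"
 using assms by (subst nonneg_infsum_complete) (auto intro: SUP_upper)

section \<open>From balls to cubes and to weights\<close>

context homogeneous_type
begin

lemma ball_dominatedE:
 fixes T1 :: "('a \<Rightarrow> 'b::real_normed_vector) \<Rightarrow> 'a \<Rightarrow> 'c::real_normed_vector"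
 assumes dom: "ball_dominated \<eta> C T1" and f: "f \<in> Lp_space M 1" "boundedly_supported M d f"
 obtains J :: "(nat \<times> 'a) set" and r E where "countable J" "\<And>j. j \<in> J \<Longrightarrow> snd j \<in> space M" "\<And>j. j \<in> J \<Longrightarrow> r j > 0"
  "\<And>j. j \<in> J \<Longrightarrow> E j \<in> sets M" "\<And>j. j \<in> J \<Longrightarrow> E j \<subseteq> B (snd j) (r j)"
  "\<And>j. j \<in> J \<Longrightarrow> measure M (E j) \<ge> \<eta> * V (snd j) (r j)" "disjoint_family_on E J"
  "AE s in M. \<exists>F\<subseteq>J. finite F \<and> (\<forall>j\<in>F. s \<in> B (snd j) (r j)) \<and> norm (T1 f s) \<le> C * (\<Sum>j\<in>F. avg f (snd j) (r j))"
proof -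
 from dom[unfolded ball_dominated_def, THEN bspec, OF f(1), THEN mp, OF f(2)]
 show thesis
 proof (elim exE conjE)
  fix J :: "(nat \<times> 'a) set" and r E
  assume J: "countable J" and b: "\<forall>j\<in>J. snd j \<in> space M \<and> r j > 0 \<and> E j \<in> sets M \<and>
    E j \<subseteq> B (snd j) (r j) \<and> measure M (E j) \<ge> \<eta> * V (snd j) (r j)"
   and dis: "disjoint_family_on E J"
   and ae: "AE s in M. \<exists>F\<subseteq>J. finite F \<and> (\<forall>j\<in>F. s \<in> B (snd j) (r j)) \<and> norm (T1 f s) \<le> C * (\<Sum>j\<in>F. avg f (snd j) (r j))"
  show thesis by (rule that[OF J _ _ _ _ _ dis ae]) (use b in simp_all)
 qed
qed

text \<open>Each ball is enlarged to a cube of comparable measure.  The disjoint sets \<open>E j\<close> bound the number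
 of balls that give the same cube.\<close>

lemma sparse_cubes:
 fixes f :: "'a \<Rightarrow> 'b::real_normed_vector" and x :: "'j \<Rightarrow> 'a"
 assumes adj: "adjacent_dyadic_systems M d c0 C0 \<gamma> \<delta> m D" and f: "f \<in> Lp_space M 1"
  and J: "\<And>j. j \<in> J \<Longrightarrow> x j \<in> space M" "\<And>j. j \<in> J \<Longrightarrow> r j > 0"
  and E: "\<And>j. j \<in> J \<Longrightarrow> E j \<in> sets M" "\<And>j. j \<in> J \<Longrightarrow> E j \<subseteq> B (x j) (r j)"
   "\<And>j. j \<in> J \<Longrightarrow> measure M (E j) \<ge> \<eta> * V (x j) (r j)" "disjoint_family_on E J" and \<eta>: "\<eta> > 0" and C: "C \<ge> 0"
  and dom: "AE y in M. \<exists>F\<subseteq>J. finite F \<and> (\<forall>j\<in>F. y \<in> B (x j) (r j)) \<and> h y \<le> C * (\<Sum>j\<in>F. avg f (x j) (r j))"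
 shows "\<exists>\<S>\<subseteq>cubes m D. is_sparse M (\<eta> / dbl c_mu (2 * \<gamma>)) \<S> \<and>
   (AE s in M. ennreal (h s) \<le> ennreal (C * ((dbl c_mu (2 * \<gamma>))\<^sup>2 / \<eta>)) * sparse_operator M \<S> f s)"
proof -
 define \<Lambda> where "\<Lambda> = dbl c_mu (2 * \<gamma>)"
 have \<Lambda>: "\<Lambda> > 0" by (simp add: \<Lambda>_def dbl_pos)
 have \<gamma>: "\<gamma> \<ge> 1" using adj by (simp add: adjacent_dyadic_systems_def)
 have sm: "strongly_measurable M f" using f by (simp add: L1_iff)
 have "D i k \<subseteq> sets M" if "i < m" for i k
  using that adj by (simp add: adjacent_dyadic_systems_def dyadic_system_def)
 then have cs: "Q \<in> sets M" if "Q \<in> cubes m D" for Q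
  using that by (auto simp: cubes_def)
 have "\<forall>j\<in>J. \<exists>Q. Q \<in> cubes m D \<and> B (x j) (r j) \<subseteq> Q \<and> (\<forall>y\<in>Q. \<forall>z\<in>Q. d y z \<le> \<gamma> * r j)"
 proof
  fix j assume j: "j \<in> J"
  have "\<forall>s\<in>space M. \<forall>\<rho>>0. \<exists>Q\<in>cubes m D. B s \<rho> \<subseteq> Q \<and> (\<forall>x\<in>Q. \<forall>y\<in>Q. d x y \<le> \<gamma> * \<rho>)"
   using adj by (simp add: adjacent_dyadic_systems_def)
  from this[rule_format, OF J(1)[OF j] J(2)[OF j]]
  show "\<exists>Q. Q \<in> cubes m D \<and> B (x j) (r j) \<subseteq> Q \<and> (\<forall>y\<in>Q. \<forall>z\<in>Q. d y z \<le> \<gamma> * r j)" by (simp only: Bex_def)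
 qed
 then obtain Q where Q: "\<And>j. j \<in> J \<Longrightarrow> Q j \<in> cubes m D" "\<And>j. j \<in> J \<Longrightarrow> B (x j) (r j) \<subseteq> Q j"
  "\<And>j y z. j \<in> J \<Longrightarrow> y \<in> Q j \<Longrightarrow> z \<in> Q j \<Longrightarrow> d y z \<le> \<gamma> * r j"
  unfolding bchoice_iff by blast
 have Qs: "Q j \<in> sets M" if "j \<in> J" for j using cs Q(1) that by blast
 have QB: "Q j \<subseteq> B (x j) (2 * \<gamma> * r j)" if j: "j \<in> J" for j
 proof
  fix y assume y: "y \<in> Q j"
  \<comment> \<open>The diameter bound is not strict whereas balls are, hence the factor 2 in the
    radius.\<close>
  have "d (x j) y \<le> \<gamma> * r j" using Q(2,3)[OF j] B_center[OF J(1,2)[OF j]] y by blast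
  moreover have "\<gamma> * r j < 2 * \<gamma> * r j" using \<gamma> J(2)[OF j] by simp
  ultimately show "y \<in> B (x j) (2 * \<gamma> * r j)" using y sets.sets_into_space[OF Qs[OF j]] by (auto simp: mem_B)
 qed
 have Qm: "measure M (Q j) \<le> \<Lambda> * V (x j) (r j)" "measure M (Q j) > 0"
  "emeasure M (Q j) = ennreal (measure M (Q j))" if j: "j \<in> J" for j
 proof -
  have "measure M (Q j) \<le> V (x j) (2 * \<gamma> * r j)"
   unfolding V_def using J(1)[OF j] QB[OF j] by (intro measure_mono_B[OF J(1)[OF j] _ order_refl]) auto
  also have "... \<le> \<Lambda> * V (x j) (r j)" unfolding \<Lambda>_def using J j \<gamma> by (intro V_dbl) auto
  finally show "measure M (Q j) \<le> \<Lambda> * V (x j) (r j)" .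
  show "emeasure M (Q j) = ennreal (measure M (Q j))" by (rule emeasure_eq_measure_subset_B[OF J(1)[OF j] QB[OF j]])
  have "V (x j) (r j) \<le> measure M (Q j)"
   unfolding V_def by (rule measure_mono_B[OF J(1)[OF j] Q(2)[OF j] QB[OF j] Qs[OF j]])
  then show "measure M (Q j) > 0" using V_pos[OF J(1,2)[OF j]] by linarith
 qed
 define a where "a q = measure (nu M f) q / measure M q" for q
 have a0: "a q \<ge> 0" for q by (simp add: a_def)
 have average: "average M (\<lambda>x. enorm (f x)) (Q j) = ennreal (a (Q j))" if j: "j \<in> J" for j
 proof -
  have "(\<integral>\<^sup>+x\<in>Q j. enorm (f x) \<partial>M) = ennreal (measure (nu M f) (Q j))"
   using emeasure_nu[OF sm Qs[OF j]] finite_measure.emeasure_eq_measure[OF finite_measure_nu[OF f]] by simp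
  then show ?thesis unfolding average_def a_def Qm(3)[OF j] using Qm(2)[OF j] by (simp add: divide_ennreal)
 qed
 have avg_le: "avg f (x j) (r j) \<le> \<Lambda> * a (Q j)" if j: "j \<in> J" for j
 proof -
  have nu_le: "measure (nu M f) (B (x j) (r j)) \<le> measure (nu M f) (Q j)"
   using Q(2)[OF j] Qs[OF j] finite_measure_nu[OF f] by (intro finite_measure.finite_measure_mono) auto
  have "avg f (x j) (r j) \<le> measure (nu M f) (Q j) / V (x j) (r j)"
   unfolding avg_def using nu_le V_nonneg by (rule divide_right_mono)
  also have "... \<le> measure (nu M f) (Q j) / (measure M (Q j) / \<Lambda>)"
   using Qm(1,2)[OF j] \<Lambda> V_pos[OF J(1,2)[OF j]] by (intro divide_left_mono) (auto simp: field_simps)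
  finally show ?thesis by (simp add: a_def mult.commute)
 qed
 have EQ: "\<eta> / \<Lambda> * measure M (Q j) \<le> measure M (E j)" if j: "j \<in> J" for j
 proof -
  have "\<eta> / \<Lambda> * measure M (Q j) \<le> \<eta> / \<Lambda> * (\<Lambda> * V (x j) (r j))"
   using Qm(1)[OF j] \<eta> \<Lambda> by (intro mult_left_mono) auto
  then show ?thesis using E(3)[OF j] \<Lambda> by simp
 qed
 have Em: "emeasure M (E j) = ennreal (measure M (E j))" if j: "j \<in> J" for j
  by (rule emeasure_eq_measure_subset_B[OF J(1)[OF j] E(2)[OF j]])
 have mult_le: "real (card {j\<in>F. Q j = q}) \<le> \<Lambda> / \<eta>" if F: "finite F" "F \<subseteq> J" and q: "q \<in> Q ` F" for F q
 proof -
  define G where "G = {j\<in>F. Q j = q}"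
  obtain i where i: "i \<in> F" "q = Q i" using q by blast
  have iJ: "i \<in> J" using i F by blast
  have G: "finite G" "G \<subseteq> J" using F by (auto simp: G_def)
  have "ennreal (real (card G) * (\<eta> / \<Lambda> * measure M q)) = (\<Sum>j\<in>G. ennreal (\<eta> / \<Lambda> * measure M q))"
   using \<eta> \<Lambda> by (simp add: ennreal_mult ennreal_of_nat_eq_real_of_nat del: times_divide_eq_left)
  also have "... \<le> (\<Sum>j\<in>G. emeasure M (E j))"
  proof (rule sum_mono)
   fix j assume "j \<in> G"
   then have j: "j \<in> J" "Q j = q" using F by (auto simp: G_def)
   show "ennreal (\<eta> / \<Lambda> * measure M q) \<le> emeasure M (E j)"
    using EQ[OF j(1)] unfolding Em[OF j(1)] j(2) by (rule ennreal_leI)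
  qed
  also have "... = emeasure M (\<Union>j\<in>G. E j)"
   using G E(1) disjoint_family_on_mono[OF G(2) E(4)] by (intro sum_emeasure) auto
  also have "... \<le> emeasure M q"
  proof (rule emeasure_mono)
   show "(\<Union>j\<in>G. E j) \<subseteq> q"
   proof (rule UN_least)
    fix j assume "j \<in> G"
    then have j: "j \<in> J" "Q j = q" using F by (auto simp: G_def)
    show "E j \<subseteq> q" using E(2)[OF j(1)] Q(2)[OF j(1)] j(2) by blast
   qed
  qed (use Qs[OF iJ] i in simp)
  also have "... = ennreal (measure M q)" using Qm(3)[OF iJ] i by simp
  finally have "real (card G) * (\<eta> / \<Lambda> * measure M q) \<le> measure M q" by simp
  then have "(real (card G) * (\<eta> / \<Lambda>)) * measure M q \<le> 1 * measure M q" by (simp add: mult.assoc)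
  then have "real (card G) * (\<eta> / \<Lambda>) \<le> 1" using Qm(2)[OF iJ] i by (simp only: mult_le_cancel_right)
  then show ?thesis using \<eta> \<Lambda> by (simp add: G_def field_simps)
 qed
 have "is_sparse M (\<eta> / \<Lambda>) (Q ` J)"
  unfolding is_sparse_def
 \<comment> \<open>Of all balls giving the same cube one is chosen, and its set serves the
   cube.\<close>
 proof (intro exI[of _ "\<lambda>q. E (inv_into J Q q)"] conjI ballI)
  fix q assume "q \<in> Q ` J"
  then have i: "inv_into J Q q \<in> J" "Q (inv_into J Q q) = q" by (auto simp: inv_into_into f_inv_into_f)
  show "E (inv_into J Q q) \<in> sets M" using E(1) i by blast
  show "E (inv_into J Q q) \<subseteq> q" using E(2)[OF i(1)] Q(2)[OF i(1)] i(2) by blast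
  have "ennreal (\<eta> / \<Lambda> * measure M q) \<le> emeasure M (E (inv_into J Q q))"
   using EQ[OF i(1)] unfolding Em[OF i(1)] i(2) by (rule ennreal_leI)
  then show "ennreal (\<eta> / \<Lambda>) * emeasure M q \<le> emeasure M (E (inv_into J Q q))"
   using Qm(3)[OF i(1)] i(2) \<eta> \<Lambda> by (simp add: ennreal_mult del: times_divide_eq_left)
 next
  show "disjoint_family_on (\<lambda>q. E (inv_into J Q q)) (Q ` J)"
   unfolding disjoint_family_on_def
  proof (intro ballI impI)
   fix q q' assume q: "q \<in> Q ` J" "q' \<in> Q ` J" "q \<noteq> q'"
   then have "inv_into J Q q \<noteq> inv_into J Q q'" by (metis f_inv_into_f)
   then show "E (inv_into J Q q) \<inter> E (inv_into J Q q') = {}"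
    using q by (intro disjoint_family_onD[OF E(4)] inv_into_into)
  qed
 qed
 moreover have "AE s in M. ennreal (h s) \<le> ennreal (C * (\<Lambda>\<^sup>2 / \<eta>)) * sparse_operator M (Q ` J) f s"
  using dom
 proof eventually_elim
  fix s assume "\<exists>F\<subseteq>J. finite F \<and> (\<forall>j\<in>F. s \<in> B (x j) (r j)) \<and> h s \<le> C * (\<Sum>j\<in>F. avg f (x j) (r j))"
  then obtain F where F: "F \<subseteq> J" "finite F" "\<And>j. j \<in> F \<Longrightarrow> s \<in> B (x j) (r j)" "h s \<le> C * (\<Sum>j\<in>F. avg f (x j) (r j))"
   by blast
  \<comment> \<open>One \<Lambda> is the price of averaging over the cube instead of the ball; the
    other, with \<open>1 / \<eta>\<close>, bounds the number of balls per cube.\<close>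
  have "(\<Sum>j\<in>F. avg f (x j) (r j)) \<le> (\<Sum>j\<in>F. \<Lambda> * a (Q j))" using avg_le F(1) by (intro sum_mono) auto
  also have "... = (\<Sum>q\<in>Q ` F. \<Sum>j\<in>{j\<in>F. Q j = q}. \<Lambda> * a (Q j))"
   using F(2) by (intro sum.group[symmetric]) auto
  also have "... = (\<Sum>q\<in>Q ` F. real (card {j\<in>F. Q j = q}) * (\<Lambda> * a q))" by (intro sum.cong) auto
  also have "... \<le> (\<Sum>q\<in>Q ` F. \<Lambda> / \<eta> * (\<Lambda> * a q))"
   using mult_le[OF F(2,1)] \<Lambda> a0 by (intro sum_mono mult_right_mono) auto
  also have "... = \<Lambda>\<^sup>2 / \<eta> * (\<Sum>q\<in>Q ` F. a q)"
   unfolding sum_distrib_left by (intro sum.cong) (auto simp: power2_eq_square)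
  finally have "h s \<le> C * (\<Lambda>\<^sup>2 / \<eta> * (\<Sum>q\<in>Q ` F. a q))" using F(4) C by (meson mult_left_mono order_trans)
  then have "ennreal (h s) \<le> ennreal (C * (\<Lambda>\<^sup>2 / \<eta>) * (\<Sum>q\<in>Q ` F. a q))" by (simp add: ennreal_leI mult.assoc)
  also have "... = ennreal (C * (\<Lambda>\<^sup>2 / \<eta>)) * (\<Sum>q\<in>Q ` F. ennreal (a q))"
   using C \<eta> a0 by (subst ennreal_mult) (auto intro!: sum_nonneg simp: sum_ennreal)
  also have "(\<Sum>q\<in>Q ` F. ennreal (a q)) = (\<Sum>q\<in>Q ` F. average M (\<lambda>x. enorm (f x)) q * indicator q s)"
  proof (rule sum.cong[OF refl])
   fix q assume "q \<in> Q ` F"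
   then obtain j where j: "j \<in> F" "q = Q j" by blast
   then have "s \<in> q" using F Q(2)[of j] by blast
   then show "ennreal (a q) = average M (\<lambda>x. enorm (f x)) q * indicator q s"
    using average[of j] j F(1) by auto
  qed
  also have "... \<le> sparse_operator M (Q ` J) f s"
   unfolding sparse_operator_def using F by (intro sum_le_infsum_ennreal) auto
  finally show "ennreal (h s) \<le> ennreal (C * (\<Lambda>\<^sup>2 / \<eta>)) * sparse_operator M (Q ` J) f s" by (simp add: mult_left_mono)
 qed
 moreover have "Q ` J \<subseteq> cubes m D" using Q(1) by blast
 ultimately show ?thesis unfolding \<Lambda>_def by blast
qed

text \<open>Before \<open>weighted_sparse\<close> applies, \<open>f\<close> must be integrable and
  the dual weight must have finite mass on balls. The first follows by Young's inequality from
  \<open>norm (f x) = (norm (f x) * w x powr (1/p)) * w x powr (- 1/p)\<close>, the second from the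
  finiteness of the \<open>A_p\<close> constant.\<close>

lemma weighted_bound:
 fixes T1 :: "('a \<Rightarrow> 'b::banach) \<Rightarrow> 'a \<Rightarrow> 'c::banach"
 assumes T1: "ball_dominated \<eta> C T1" and \<eta>: "\<eta> > 0" and C: "C \<ge> 0" and p: "p > 1" and Ap: "Ap_weight M d p w"
 shows "weighted_op_norm M d w p T1 \<le> ennreal (C * weighted_const \<eta> p) * enn_powr (Ap_constant M d p w) (max (1 / (p - 1)) 1)"
 unfolding weighted_op_norm_def op_norm_def
proof (rule SUP_least)
 fix f :: "'a \<Rightarrow> 'b"
 assume "f \<in> {f \<in> {f \<in> Lp_space (weighted_measure M w) p. boundedly_supported M d f}. Lp_norm (weighted_measure M w) p f \<le> 1}"
 then have fL: "f \<in> Lp_space (weighted_measure M w) p" and supp: "boundedly_supported M d f"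
  and f1: "Lp_norm (weighted_measure M w) p f \<le> 1" by auto
 define mx where "mx = max (1 / (p - 1)) 1"
 define s where "s x = w x powr (- 1 / (p - 1))" for x
 define q where "q = p / (p - 1)"
 have q: "q > 1" "1/p + 1/q = 1" using p by (simp_all add: q_def field_simps)
 have w[measurable]: "w \<in> borel_measurable M" and w_pos: "\<And>x. x \<in> space M \<Longrightarrow> w x > 0"
  and w_int: "\<And>x r. x \<in> space M \<Longrightarrow> r > 0 \<Longrightarrow> (\<integral>\<^sup>+y\<in>B x r. ennreal (w y) \<partial>M) < \<infinity>"
  using Ap by (auto simp: Ap_weight_def is_weight_def)
 have s[measurable]: "s \<in> borel_measurable M" unfolding s_def by measurable
 have s_pos: "x \<in> space M \<Longrightarrow> s x > 0" for x using w_pos by (force simp: s_def)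
 let ?Wm = "density M (\<lambda>x. ennreal (w x))" and ?Sm = "density M (\<lambda>x. ennreal (s x))"
 have wm: "weighted_measure M w = ?Wm" by (simp add: weighted_measure_def)
 obtain \<Phi> where \<Phi>: "Ap_constant M d p w = ennreal \<Phi>" "\<Phi> \<ge> 0"
  using Ap by (cases "Ap_constant M d p w") (auto simp: Ap_weight_def)
 have ball: "emeasure ?Wm (B x r) < \<infinity> \<and> emeasure ?Sm (B x r) < \<infinity> \<and> measure ?Wm (B x r) > 0 \<and> measure ?Sm (B x r) > 0 \<and>
   measure ?Wm (B x r) / V x r * (measure ?Sm (B x r) / V x r) powr (p - 1) \<le> \<Phi>"
  if x: "x \<in> space M" "r > 0" for x r
 proof -
  have Bs: "B x r \<in> sets M" using x by simp
  have Vp: "V x r > 0" using V_pos x by blast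
  have Bp: "emeasure M (B x r) > 0" using ball_pos x by blast
  have eW: "emeasure ?Wm (B x r) = (\<integral>\<^sup>+y\<in>B x r. ennreal (w y) \<partial>M)" using Bs by (simp add: emeasure_density)
  have eS: "emeasure ?Sm (B x r) = (\<integral>\<^sup>+y\<in>B x r. ennreal (s y) \<partial>M)" using Bs by (simp add: emeasure_density)
  have Wf: "emeasure ?Wm (B x r) < \<infinity>" using w_int[OF x] eW by simp
  have Wp: "emeasure ?Wm (B x r) > 0" by (rule density_pos[OF w w_pos Bs Bp])
  have Sp: "emeasure ?Sm (B x r) > 0" by (rule density_pos[OF s s_pos Bs Bp])
  have We: "emeasure ?Wm (B x r) = ennreal (measure ?Wm (B x r))"
   using Wf by (intro emeasure_eq_ennreal_measure) auto
  have W0: "measure ?Wm (B x r) > 0" using Wp We by simp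
  have aW: "average M (\<lambda>y. ennreal (w y)) (B x r) = ennreal (measure ?Wm (B x r) / V x r)"
   unfolding average_def eW[symmetric] emeasure_B[OF x(1)] using We Vp by (simp add: divide_ennreal)
  have le: "average M (\<lambda>y. ennreal (w y)) (B x r) * enn_powr (average M (\<lambda>y. ennreal (s y)) (B x r)) (p - 1) \<le> ennreal \<Phi>"
   unfolding \<Phi>(1)[symmetric] Ap_constant_def s_def using x by (intro SUP_upper2[of "(x, r)"]) auto
  \<comment> \<open>The average of \<open>w\<close> is positive, so an infinite average of the dual
    weight would make the product infinite.\<close>
  have Sf: "emeasure ?Sm (B x r) < \<infinity>"
  proof (rule ccontr)
   assume "\<not> emeasure ?Sm (B x r) < \<infinity>"
   then have "average M (\<lambda>y. ennreal (s y)) (B x r) = \<infinity>"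
    unfolding average_def eS[symmetric] emeasure_B[OF x(1)] by (simp add: less_top[symmetric] ennreal_top_divide)
   then have "ennreal (measure ?Wm (B x r) / V x r) * \<infinity> \<le> ennreal \<Phi>" using le unfolding aW by (simp add: enn_powr_def)
   then show False using W0 Vp by (simp add: ennreal_mult_top top_unique)
  qed
  have Se: "emeasure ?Sm (B x r) = ennreal (measure ?Sm (B x r))"
   using Sf by (intro emeasure_eq_ennreal_measure) auto
  have aS: "average M (\<lambda>y. ennreal (s y)) (B x r) = ennreal (measure ?Sm (B x r) / V x r)"
   unfolding average_def eS[symmetric] emeasure_B[OF x(1)] using Se Vp by (simp add: divide_ennreal)
  have "ennreal (measure ?Wm (B x r) / V x r * (measure ?Sm (B x r) / V x r) powr (p - 1)) \<le> ennreal \<Phi>"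
   using le Vp unfolding aW aS by (simp add: enn_powr_ennreal ennreal_mult del: times_divide_eq_left)
  then show ?thesis using Wf Sf W0 Sp Se \<Phi>(2) by simp
 qed
 obtain x0 R where x0: "x0 \<in> space M" "R > 0" "{t \<in> space M. f t \<noteq> 0} \<subseteq> B x0 R"
  using supp unfolding boundedly_supported_def by blast
 \<comment> \<open>The ball around the support is one on which the product of averages is
   positive.\<close>
 have "\<Phi> > 0"
 proof -
  have "0 < measure ?Wm (B x0 R) / V x0 R * (measure ?Sm (B x0 R) / V x0 R) powr (p - 1)"
   using ball[OF x0(1,2)] V_pos[OF x0(1,2)] by simp
  also have "... \<le> \<Phi>" using ball[OF x0(1,2)] by simp
  finally show ?thesis .
 qed
 have sm: "strongly_measurable M f" using fL by (simp add: Lp_space_iff wm strongly_measurable_density)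
 have [measurable]: "(\<lambda>x. norm (f x)) \<in> borel_measurable M" by (rule strongly_measurable_norm[OF sm])
 have Bs[measurable]: "B x0 R \<in> sets M" using x0 by simp
 have f_int: "(\<integral>\<^sup>+x. ennreal (norm (f x) powr p) \<partial>?Wm) \<le> 1"
 proof (cases "\<integral>\<^sup>+x. ennreal (norm (f x) powr p) \<partial>?Wm")
  case (real i)
  have "ennreal (i powr (1/p)) \<le> 1" using f1 real unfolding Lp_norm_def wm by (simp add: enn_powr_ennreal)
  then have "i powr (1/p) \<le> 1" by simp
  then have "(i powr (1/p)) powr p \<le> 1 powr p" using p by (intro powr_mono2) auto
  then show ?thesis using real p by (simp add: powr_powr)
 next
  case top
  then show ?thesis using f1 unfolding Lp_norm_def wm by (simp add: enn_powr_def)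
 qed
 have f: "f \<in> Lp_space M 1"
 proof -
  have "L1_mass M f \<le> (\<integral>\<^sup>+x. ennreal (w x) * ennreal (norm (f x) powr p) + ennreal (s x) * indicator (B x0 R) x \<partial>M)"
  proof (rule nn_integral_mono)
   fix x assume x: "x \<in> space M"
   show "enorm (f x) \<le> ennreal (w x) * ennreal (norm (f x) powr p) + ennreal (s x) * indicator (B x0 R) x"
   proof (cases "f x = 0")
    case False
    then have xB: "x \<in> B x0 R" using x x0 by blast
    note wx = w_pos[OF x]
    define u v where "u = norm (f x) * w x powr (1/p)" and "v = w x powr (- 1/p)"
    have "- 1/p * q = - 1 / (p - 1)" using p by (simp add: q_def)
    then have v: "v powr q = s x" by (simp add: v_def powr_powr s_def)
    have u: "u powr p = norm (f x) powr p * w x" using wx p by (simp add: u_def powr_mult powr_powr)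
    have "norm (f x) = u * v" using wx by (simp add: u_def v_def mult.assoc powr_add[symmetric])
    also have "... \<le> u powr p / p + v powr q / q"
     using p q by (intro Youngs_inequality) (auto simp: u_def v_def)
    also have "... \<le> u powr p + v powr q" using p q by (intro add_mono) (auto simp: divide_le_eq mult_le_cancel_left1)
    finally have "norm (f x) \<le> w x * norm (f x) powr p + s x" by (simp add: u v mult.commute)
    then have "enorm (f x) \<le> ennreal (w x * norm (f x) powr p + s x)" by (rule ennreal_leI)
    then show ?thesis using xB wx s_pos[OF x] by (simp add: ennreal_mult)
   qed simp
  qed
  also have "... = (\<integral>\<^sup>+x. ennreal (w x) * ennreal (norm (f x) powr p) \<partial>M) + (\<integral>\<^sup>+x\<in>B x0 R. ennreal (s x) \<partial>M)"
   by (rule nn_integral_add) measurable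
  also have "(\<integral>\<^sup>+x. ennreal (w x) * ennreal (norm (f x) powr p) \<partial>M) = (\<integral>\<^sup>+x. ennreal (norm (f x) powr p) \<partial>?Wm)"
   by (subst nn_integral_density) auto
  also have "(\<integral>\<^sup>+x\<in>B x0 R. ennreal (s x) \<partial>M) = emeasure ?Sm (B x0 R)" by (simp add: emeasure_density)
  also have "(\<integral>\<^sup>+x. ennreal (norm (f x) powr p) \<partial>?Wm) + emeasure ?Sm (B x0 R) < \<infinity>"
   using le_less_trans[OF f_int] ball[OF x0(1,2)] by simp
  finally show ?thesis using sm by (simp add: L1_iff)
 qed
 have se: "s = (\<lambda>x. w x powr (- 1 / (p - 1)))" by (rule ext) (rule s_def)
 obtain J :: "(nat \<times> 'a) set" and r E where J: "countable J" "\<And>j. j \<in> J \<Longrightarrow> snd j \<in> space M" "\<And>j. j \<in> J \<Longrightarrow> r j > 0"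
  and E: "\<And>j. j \<in> J \<Longrightarrow> E j \<in> sets M" "\<And>j. j \<in> J \<Longrightarrow> E j \<subseteq> B (snd j) (r j)"
   "\<And>j. j \<in> J \<Longrightarrow> measure M (E j) \<ge> \<eta> * V (snd j) (r j)" "disjoint_family_on E J"
  and dom: "AE s in M. \<exists>F\<subseteq>J. finite F \<and> (\<forall>j\<in>F. s \<in> B (snd j) (r j)) \<and> norm (T1 f s) \<le> C * (\<Sum>j\<in>F. avg f (snd j) (r j))"
  by (rule ball_dominatedE[OF T1 f supp]) (rule that)
 define Z where "Z = C * (weighted_const \<eta> p * \<Phi> powr mx)"
 have Z: "Z \<ge> 0" using C weighted_const_pos[OF \<eta> p] by (simp add: Z_def)
 have wf: "emeasure ?Wm (B x r) < \<infinity>" and sf: "emeasure ?Sm (B x r) < \<infinity>"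
  and \<Phi>b: "measure ?Wm (B x r) / V x r * (measure ?Sm (B x r) / V x r) powr (p - 1) \<le> \<Phi>"
  if "x \<in> space M" "r > 0" for x r using ball[OF that] by auto
 have "(\<integral>\<^sup>+y. ennreal (norm (T1 f y) powr p) \<partial>?Wm) \<le> ennreal (Z powr p) * (\<integral>\<^sup>+y. ennreal (norm (f y) powr p) \<partial>?Wm)"
  unfolding Z_def mx_def
  by (rule weighted_sparse[OF p q_def w w_pos se wf sf \<open>\<Phi> > 0\<close> \<Phi>b f J E \<eta> norm_ge_zero C dom])
 also have "... \<le> ennreal (Z powr p) * 1" using f_int by (rule mult_left_mono) simp
 finally have "Lp_norm (weighted_measure M w) p (T1 f) \<le> enn_powr (ennreal (Z powr p)) (1/p)"
  unfolding Lp_norm_def wm using p by (intro enn_powr_mono) auto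
 also have "... = ennreal Z" using p Z by (simp add: enn_powr_ennreal powr_powr)
 also have "... = ennreal (C * weighted_const \<eta> p) * enn_powr (Ap_constant M d p w) mx"
  using C weighted_const_pos[OF \<eta> p] \<Phi> by (simp add: Z_def enn_powr_ennreal ennreal_mult mult.assoc)
 finally show "Lp_norm (weighted_measure M w) p (T1 f) \<le> ennreal (C * weighted_const \<eta> p) * enn_powr (Ap_constant M d p w) (max (1 / (p - 1)) 1)"
  by (simp only: mx_def)
qed

text \<open>The construction divides by \<kappa> and starts from a point of the space. If
  \<open>\<kappa> = 0\<close> the operator is null and its extension is zero; on the empty space all
  claims are vacuous.\<close>

lemma extension_ball_dominated:
 fixes T :: "('a \<Rightarrow> 'b::banach) \<Rightarrow> ('a \<Rightarrow> 'c::banach)"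
 assumes op: "dini_operator M d p0 T K \<omega> c_K" and p0: "p0 \<ge> 1" and CT: "C_T M p0 T \<omega> = ennreal \<kappa>" "\<kappa> \<ge> 0"
 shows "\<exists>T1. is_L1_extension M p0 T T1 \<and> ball_dominated (sparse_ratio c_K) (domination_const c_K p0 * \<kappa>) T1"
proof (cases "\<kappa> > 0 \<and> space M \<noteq> {}")
 case True
 then have "\<kappa> > 0" "C_T M p0 T \<omega> \<le> ennreal \<kappa>" "space M \<noteq> {}" using CT by auto
 note h = op p0 this
 show ?thesis
  by (rule exI[where x="T1 c_K p0 \<kappa> T"]) (intro conjI T1_extension[OF h] T1_ball_dominated[OF h])
next
 case False
 have T0: "AE s in M. 0 = T f s" if f: "f \<in> Lp_space M p0" for f
 proof (cases "space M = {}")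
  case ne: False
  then have "\<kappa> = 0" using False CT(2) by auto
  have "strongly_measurable M (T f)" using op f by (simp add: dini_operator_def bounded_linear_operator_def)
  moreover have "emeasure M (superlevel M (T f) l) = 0" if l: "l > 0" for l
   using dini_operator_weak_type[OF op p0 _ CT(2) f l] CT(1) p0 \<open>\<kappa> = 0\<close> by simp
  ultimately have "AE s in M. T f s = 0" by (rule AE_zero_levels)
  then show ?thesis by eventually_elim simp
 qed (auto intro: AE_I2)
 have "strongly_measurable M (\<lambda>x. 0 :: 'c)" by (intro strongly_measurable_simple) simp
 moreover have "weak_Lp_norm M 1 (\<lambda>x. 0 :: 'c) = 0"
  by (auto simp: weak_Lp_norm_def intro!: SUP_eq_const)
 ultimately have "is_L1_extension M p0 T (\<lambda>_ _. 0)"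
  using T0 by (auto simp: is_L1_extension_def bounded_linear_operator_def)
 moreover have "ball_dominated (sparse_ratio c_K) (domination_const c_K p0 * \<kappa>) ((\<lambda>_ _. 0) :: ('a \<Rightarrow> 'b) \<Rightarrow> 'a \<Rightarrow> 'c)"
  unfolding ball_dominated_def by (intro ballI impI exI[of _ "{}"]) (auto simp: disjoint_family_on_def)
 ultimately show ?thesis by blast
qed

end

theorem theorem6p1:
 fixes p0 c_d c_mu c_K c0 C0 \<gamma> \<delta> :: real and m :: nat
 assumes "1 \<le> p0"
 shows "\<exists>C>0. \<exists>C' :: real \<Rightarrow> real. (\<forall>p>1. C' p > 0) \<and>
  (\<forall>(M :: 'a measure) d (T :: ('a \<Rightarrow> 'b::banach) \<Rightarrow> ('a \<Rightarrow> 'c::banach)) K \<omega>.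
    homogeneous_type M d c_d c_mu \<longrightarrow> dini_operator M d p0 T K \<omega> c_K \<longrightarrow>
    (\<exists>T1. is_L1_extension M p0 T T1 \<and>
     (\<forall>D. adjacent_dyadic_systems M d c0 C0 \<gamma> \<delta> m D \<longrightarrow>
       (\<exists>\<eta>. 0 < \<eta> \<and> \<eta> < 1 \<and>
        (\<forall>f \<in> Lp_space M 1. boundedly_supported M d f \<longrightarrow>
          (\<exists>\<S> \<subseteq> cubes m D. is_sparse M \<eta> \<S> \<and>
           (AE s in M. ennreal (norm (T1 f s))
             \<le> ennreal C * C_T M p0 T \<omega> * sparse_operator M \<S> f s))))) \<and>
     (\<forall>p>1. \<forall>w. Ap_weight M d p w \<longrightarrow>
       weighted_op_norm M d w p T1
        \<le> ennreal (C' p) * C_T M p0 T \<omega> *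
         enn_powr (Ap_constant M d p w) (max (1 / (p - 1)) 1))))"
proof -
 \<comment> \<open>The constants are named before a space is given: they are functions of the
   numerical parameters alone, hence the same for all spaces and operators.\<close>
 define \<eta>0 where "\<eta>0 = homogeneous_type.sparse_ratio c_d c_mu c_K"
 define k where "k = homogeneous_type.domination_const c_d c_mu c_K p0"
 define \<Lambda> where "\<Lambda> = dbl c_mu (2 * \<gamma>)"
 \<comment> \<open>Positivity of \<open>k\<close> and \<open>\<eta>0\<close> is known only for an
   actual space, where \<open>c_mu \<ge> 1\<close>; the maximum with 1 makes \<open>C\<close>
   positive in advance.\<close>
 define C where "C = max 1 (k * (\<Lambda>\<^sup>2 / \<eta>0))"
 define C' where "C' p = max 1 (k * homogeneous_type.weighted_const c_d c_mu \<eta>0 p)" for p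
 have pos: "C > 0" "\<forall>p>1. C' p > 0" by (auto simp: C_def C'_def)
 show ?thesis
  apply (intro exI[of _ C] exI[of _ C'] conjI pos allI impI)
  subgoal premises prems for M d T K \<omega>
 proof -
  interpret homogeneous_type M d c_d c_mu by (rule prems)
  note op = prems(2)
  have \<eta>0: "0 < \<eta>0" "\<eta>0 < 1" unfolding \<eta>0_def by (rule sparse_ratio_bounds)+
  have k: "k > 0" unfolding k_def by (rule domination_const_pos)
  have \<Lambda>: "\<Lambda> \<ge> 1" unfolding \<Lambda>_def by (rule dbl_ge_1)
  obtain \<kappa> where \<kappa>: "C_T M p0 T \<omega> = ennreal \<kappa>" "\<kappa> \<ge> 0"
   using C_T_finite[OF op] by (cases "C_T M p0 T \<omega>") auto
  obtain T1 where ext: "is_L1_extension M p0 T T1" and T1: "ball_dominated \<eta>0 (k * \<kappa>) T1"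
   using extension_ball_dominated[OF op assms \<kappa>] unfolding \<eta>0_def k_def by blast
  have sparse: "\<exists>\<S> \<subseteq> cubes m D. is_sparse M (\<eta>0 / \<Lambda>) \<S> \<and>
    (AE s in M. enorm (T1 f s) \<le> ennreal C * C_T M p0 T \<omega> * sparse_operator M \<S> f s)"
   if D: "adjacent_dyadic_systems M d c0 C0 \<gamma> \<delta> m D" and f: "f \<in> Lp_space M 1" "boundedly_supported M d f" for D f
  proof -
   obtain J :: "(nat \<times> 'a) set" and r E where J: "\<And>j. j \<in> J \<Longrightarrow> snd j \<in> space M" "\<And>j. j \<in> J \<Longrightarrow> r j > 0"
    and E: "\<And>j. j \<in> J \<Longrightarrow> E j \<in> sets M" "\<And>j. j \<in> J \<Longrightarrow> E j \<subseteq> B (snd j) (r j)"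
     "\<And>j. j \<in> J \<Longrightarrow> measure M (E j) \<ge> \<eta>0 * V (snd j) (r j)" "disjoint_family_on E J"
    and dom: "AE s in M. \<exists>F\<subseteq>J. finite F \<and> (\<forall>j\<in>F. s \<in> B (snd j) (r j)) \<and> norm (T1 f s) \<le> (k * \<kappa>) * (\<Sum>j\<in>F. avg f (snd j) (r j))"
    by (rule ball_dominatedE[OF T1 f]) (rule that)
   have "k * \<kappa> \<ge> 0" using k \<kappa> by simp
   then obtain \<S> where S: "\<S> \<subseteq> cubes m D" "is_sparse M (\<eta>0 / \<Lambda>) \<S>"
    and le: "AE s in M. enorm (T1 f s) \<le> ennreal ((k * \<kappa>) * (\<Lambda>\<^sup>2 / \<eta>0)) * sparse_operator M \<S> f s"
    using sparse_cubes[OF D f(1) J E \<eta>0(1) _ dom, folded \<Lambda>_def] by blast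
   have "k * \<kappa> * (\<Lambda>\<^sup>2 / \<eta>0) = k * (\<Lambda>\<^sup>2 / \<eta>0) * \<kappa>" by simp
   also have "... \<le> C * \<kappa>" using \<kappa> by (intro mult_right_mono) (auto simp: C_def)
   finally have "ennreal (k * \<kappa> * (\<Lambda>\<^sup>2 / \<eta>0)) \<le> ennreal (C * \<kappa>)" by (rule ennreal_leI)
   also have "... = ennreal C * C_T M p0 T \<omega>" using \<kappa> by (simp add: C_def ennreal_mult)
   finally have c: "ennreal (k * \<kappa> * (\<Lambda>\<^sup>2 / \<eta>0)) \<le> ennreal C * C_T M p0 T \<omega>" .
   have "AE s in M. enorm (T1 f s) \<le> ennreal C * C_T M p0 T \<omega> * sparse_operator M \<S> f s"
    using le
   proof eventually_elim
    fix s assume "enorm (T1 f s) \<le> ennreal ((k * \<kappa>) * (\<Lambda>\<^sup>2 / \<eta>0)) * sparse_operator M \<S> f s"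
    also have "... \<le> ennreal C * C_T M p0 T \<omega> * sparse_operator M \<S> f s" using c by (rule mult_right_mono) simp
    finally show "enorm (T1 f s) \<le> ennreal C * C_T M p0 T \<omega> * sparse_operator M \<S> f s" .
   qed
   then show ?thesis using S by blast
  qed
  have weighted: "weighted_op_norm M d w p T1 \<le> ennreal (C' p) * C_T M p0 T \<omega> *
    enn_powr (Ap_constant M d p w) (max (1 / (p - 1)) 1)" if p: "p > 1" and w: "Ap_weight M d p w" for p w
  proof -
   have "weighted_op_norm M d w p T1 \<le> ennreal (k * \<kappa> * weighted_const \<eta>0 p) * enn_powr (Ap_constant M d p w) (max (1 / (p - 1)) 1)"
    using k \<kappa> by (intro weighted_bound[OF T1 \<eta>0(1) _ p w]) simp
   also have "... \<le> ennreal (C' p) * C_T M p0 T \<omega> * enn_powr (Ap_constant M d p w) (max (1 / (p - 1)) 1)"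
   proof (rule mult_right_mono)
    have "k * \<kappa> * weighted_const \<eta>0 p = k * weighted_const \<eta>0 p * \<kappa>" by simp
    also have "... \<le> C' p * \<kappa>" using \<kappa> by (intro mult_right_mono) (auto simp: C'_def)
    finally have "ennreal (k * \<kappa> * weighted_const \<eta>0 p) \<le> ennreal (C' p * \<kappa>)" by (rule ennreal_leI)
    then show "ennreal (k * \<kappa> * weighted_const \<eta>0 p) \<le> ennreal (C' p) * C_T M p0 T \<omega>"
     using \<kappa> by (simp add: C'_def ennreal_mult)
   qed simp
   finally show ?thesis .
  qed
  have ratio: "0 < \<eta>0 / \<Lambda>" "\<eta>0 / \<Lambda> < 1" using \<eta>0 \<Lambda> by auto
  show ?thesis
   by (intro exI[of _ T1] exI[of _ "\<eta>0 / \<Lambda>"] conjI allI impI ballI ext ratio sparse weighted)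
 qed
  done
qed

end
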